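(* Let scalars $\{\alpha_i\}_{i=1}^\beta\subset\mathbb R$ be given, and let the system data, the functions $g_i(\cdot)=[\phi_i^\top\ \varphi_i^\top\ f_i^\top]^\top$ and matrices $M_i$, $\widehat A_i,\widehat B_i,\widehat C_i,\widehat{\mathfrak B}_i$ ($i\in\mathbb N_\nu$), the matrices $\Gamma_i,\mathfrak H_i,\mathfrak E_i,\mathfrak F_i$ and their Cholesky factors, and the supply rate function $\mathsf s$ with parameters $\widetilde J,J_1,J_2,J_3$ be given as described in the context. Suppose there exist $X,\acute P_1\in\mathbb S^n$, $\acute P_2\in\mathbb R^{n\times dn}$, $\acute P_3\in\mathbb S^{dn}$, $\acute Q_i,\acute R_i\in\mathbb S^n$ ($i\in\mathbb N_\nu$) and $V\in\mathbb R^{p\times n}$ such that $$\begin{bmatrix}\acute P_1&\acute P_2\\ *&\acute P_3\end{bmatrix}+\Big[\mathsf O_n\oplus\big(\mathrm{diag}_{i=1}^\nu\, I_{d_i}\otimes\acute Q_i\big)\Big]\succ0,$$ $$\acute{\mathbf Q}=\mathrm{diag}_{i=1}^\nu\acute Q_i\succ0,\qquad\acute{\mathbf R}=\mathrm{diag}_{i=1}^\nu\acute R_i\succ0,$$ $$\mathrm{Sy}\left(\begin{bmatrix}I_n\\ \mathrm{Col}_{i=1}^\beta\,\alpha_iI_n\\ \mathsf O_{(q+m),n}\end{bmatrix}\big[-X\ \ \acute{\boldsymbol\Pi}\big]\right)+\begin{bmatrix}\mathsf O_n&\acute{\mathbf P}\\ *&\acute{\boldsymbol\Phi}\end{bmatrix}\prec0,$$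 where $$\acute{\mathbf P}=\big[\acute P_1\ \ \mathsf O_{n,\nu n}\ \ \acute P_2\widehat I\ \ \mathsf O_{n,(\mu n+q+m)}\big],$$ $$\acute{\boldsymbol\Pi}=\big[\mathbf A[(I_\beta\otimes X)\oplus I_q]+\mathbf B_1[(I_\beta\otimes V)\oplus\mathsf O_q]\ \ \ \mathsf O_{n,m}\big],$$ $$\acute{\boldsymbol\Sigma}=\mathbf C[(I_\beta\otimes X)\oplus I_q]+\mathbf B_2[(I_\beta\otimes V)\oplus\mathsf O_q],\qquad \acute{\boldsymbol\Phi}=\boldsymbol\Phi(\acute P_2,\acute P_3,\acute{\mathbf Q},\acute{\mathbf R},\acute{\boldsymbol\Sigma}),$$ with $\widehat I$ and the matrix-valued map $\boldsymbol\Phi$ defined in the context. Then $X$ is nonsingular and, with controller gain $K=VX^{-1}$, the closed-loop system (defined in the context) with supply rate $\mathsf s$ is dissipative and the origin of the closed-loop system with $w(t)\equiv\mathbf 0_q$ is globally exponentially stable. Moreover, the total number of scalar unknowns in these conditions is $(0.5d^2+d+\nu+1)n^2+(0.5d+1+\nu+p)n\in\mathcal O(d^2n^2)$.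
   Context: **Notation.** $\mathbb N_\nu=\{1,\dots,\nu\}$; $\mathbb S^n$: real symmetric $n\times n$ matrices; $\mathrm{Sy}(X)=X+X^\top$; $X\oplus Y$ is the block-diagonal matrix with blocks $X,Y$ and $\mathrm{diag}_{i=1}^\nu X_i=X_1\oplus\dots\oplus X_\nu$ (blocks may be rectangular); $\otimes$ is the Kronecker product; $\mathrm{Row}_{i=a}^{b}X_i=[X_a\cdots X_b]$ and $\mathrm{Col}_{i=a}^{b}X_i=[X_a^\top\cdots X_b^\top]^\top$; $*$ denotes a block determined by symmetry; $\mathsf O_{n,m}$ is the $n\times m$ zero matrix, $\mathsf O_n=\mathsf O_{n,n}$, $\mathbf 0_n$ the $n\times1$ zero vector. Matrix products bind tighter than $\otimes$, which binds tighter than $\oplus,\mathrm{diag}$. Empty matrices (zero rows or columns) are allowed, with the usual conventions; blocks of zero size are absent. $L^2(\mathcal X;\cdot)$ is the space of measurable square-integrable functions; $W^{1,2}(\mathcal X;\mathbb R^d)$ is the space of $L^2$ functions with weak derivative in $L^2$ (evaluated pointwise via the continuous representative). **Data.** $n,m,p,q,\nu\in\mathbb N$; $0=r_0<r_1<\dots<r_\nu=r$; $\mathcal J=[-r,0]$; $\mathcal I_i=[-r_i,-r_{i-1}]$; $t_0\in\mathbb R$. Constant matrices $A_i\in\mathbb R^{n\times n}$, $B_i\in\mathbb R^{n\times p}$, $C_i\in\mathbb R^{m\times n}$, $\mathfrak B_i\in\mathbb R^{m\times p}$ ($i=0,\dots,\nu$), $D_1\in\mathbb R^{n\times q}$, $D_2\in\mathbb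 R^{m\times q}$, and kernels $\widetilde A_i\in L^2(\mathcal I_i;\mathbb R^{n\times n})$, $\widetilde B_i\in L^2(\mathcal I_i;\mathbb R^{n\times p})$, $\widetilde C_i\in L^2(\mathcal I_i;\mathbb R^{m\times n})$, $\widetilde{\mathfrak B}_i\in L^2(\mathcal I_i;\mathbb R^{m\times p})$ ($i\in\mathbb N_\nu$). **Kernel decomposition.** For each $i\in\mathbb N_\nu$ let $d_i\in\mathbb N$, $\delta_i,\mu_i\in\mathbb N\cup\{0\}$, $\varkappa_i=d_i+\delta_i$, $\kappa_i=d_i+\delta_i+\mu_i$, and $f_i\in W^{1,2}(\mathcal I_i;\mathbb R^{d_i})$, $\varphi_i\in L^2(\mathcal I_i;\mathbb R^{\delta_i})$, $\phi_i\in L^2(\mathcal I_i;\mathbb R^{\mu_i})$, $h_i=\begin{bmatrix}\varphi_i\\ f_i\end{bmatrix}$, $g_i=\begin{bmatrix}\phi_i\\ h_i\end{bmatrix}$, $M_i\in\mathbb R^{d_i\times\varkappa_i}$ satisfy $\frac{\mathrm d f_i(\tau)}{\mathrm d\tau}=M_ih_i(\tau)$ (weak derivative) and $\int_{\mathcal I_i}g_i(\tau)g_i^\top(\tau)\,\mathrm d\tau\succ0$, and let $\widehat A_i\in\mathbb R^{n\times\kappa_in}$, $\widehat B_i\in\mathbb R^{n\times\kappa_ip}$, $\widehat C_i\in\mathbb R^{m\times\kappa_in}$, $\widehat{\mathfrak B}_i\in\mathbb R^{m\times\kappa_ip}$ satisfy on $\mathcal I_i$: $\widetilde A_i(\tau)=\widehat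 A_i(g_i(\tau)\otimes I_n)$, $\widetilde B_i(\tau)=\widehat B_i(g_i(\tau)\otimes I_p)$, $\widetilde C_i(\tau)=\widehat C_i(g_i(\tau)\otimes I_n)$, $\widetilde{\mathfrak B}_i(\tau)=\widehat{\mathfrak B}_i(g_i(\tau)\otimes I_p)$. Put $\mathfrak F_i=\int_{\mathcal I_i}f_if_i^\top\mathrm d\tau$, $\mathfrak H_i=\int_{\mathcal I_i}h_ih_i^\top\mathrm d\tau$, $\Gamma_i=\int_{\mathcal I_i}\phi_ih_i^\top\mathrm d\tau$, $\varepsilon_i(\tau)=\phi_i(\tau)-\Gamma_i\mathfrak H_i^{-1}h_i(\tau)$, $\mathfrak E_i=\int_{\mathcal I_i}\varepsilon_i\varepsilon_i^\top\mathrm d\tau$; these Gram matrices are positive definite, with lower-triangular Cholesky factorizations $\mathfrak F_i=\mathfrak L_{f_i}\mathfrak L_{f_i}^\top$, $\mathfrak H_i=\mathfrak L_{h_i}\mathfrak L_{h_i}^\top$, $\mathfrak E_i=\mathfrak L_{\varepsilon_i}\mathfrak L_{\varepsilon_i}^\top$. Put $T_i=\begin{bmatrix}\Gamma_i\mathfrak H_i^{-1}\\ I_{\varkappa_i}\end{bmatrix}\mathfrak L_{h_i}$, $\widetilde T_i=\begin{bmatrix}I_{\mu_i}\\ \mathsf O_{\varkappa_i,\mu_i}\end{bmatrix}\mathfrak L_{\varepsilon_i}$. Let $d=\sum_i d_i$, $\varkappa=\sum_i\varkappa_i$, $\mu=\sum_i\mu_i$, $\kappa=\sum_i\kappa_i$,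 $\beta=1+\nu+\kappa$. **Closed-loop system with gain $K\in\mathbb R^{p\times n}$** (obtained from state feedback $u(t)=Kx(t)$): for almost all $t\ge t_0$, $\dot x(t)=D_1w(t)+\sum_{i=0}^\nu(A_i+B_iK)x(t-r_i)+\sum_{i=1}^\nu\int_{\mathcal I_i}[\widetilde A_i(\tau)+\widetilde B_i(\tau)K]x(t+\tau)\mathrm d\tau$, $z(t)=D_2w(t)+\sum_{i=0}^\nu(C_i+\mathfrak B_iK)x(t-r_i)+\sum_{i=1}^\nu\int_{\mathcal I_i}[\widetilde C_i(\tau)+\widetilde{\mathfrak B}_i(\tau)K]x(t+\tau)\mathrm d\tau$, with $x(t_0+\theta)=\psi(\theta)$ for $\theta\in\mathcal J$, $\psi\in C(\mathcal J;\mathbb R^n)$, disturbance $w\in L^2(\mathbb R_{\ge t_0};\mathbb R^q)$; solutions $x(t)\in\mathbb R^n$ are absolutely continuous for $t\ge t_0$ (Carathéodory sense). Equivalently $\dot x(t)=(\mathbf A+\mathbf B_1[(I_\beta\otimes K)\oplus\mathsf O_q])\vartheta(t)$, $z(t)=(\mathbf C+\mathbf B_2[(I_\beta\otimes K)\oplus\mathsf O_q])\vartheta(t)$, where $\mathbf A=[\mathrm{Row}_{i=0}^\nu A_i\ \ \mathrm{Row}_{i=1}^\nu\widehat A_i(T_i\otimes I_n)\ \ \mathrm{Row}_{i=1}^\nu\widehat A_i(\widetilde T_i\otimes I_n)\ \ D_1]$, $\mathbf B_1=[\mathrm{Row}_{i=0}^\nu B_i\ \ \mathrm{Row}_{i=1}^\nu\widehat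 B_i(T_i\otimes I_p)\ \ \mathrm{Row}_{i=1}^\nu\widehat B_i(\widetilde T_i\otimes I_p)\ \ \mathsf O_{n,q}]$, $\mathbf C=[\mathrm{Row}_{i=0}^\nu C_i\ \ \mathrm{Row}_{i=1}^\nu\widehat C_i(T_i\otimes I_n)\ \ \mathrm{Row}_{i=1}^\nu\widehat C_i(\widetilde T_i\otimes I_n)\ \ D_2]$, $\mathbf B_2=[\mathrm{Row}_{i=0}^\nu\mathfrak B_i\ \ \mathrm{Row}_{i=1}^\nu\widehat{\mathfrak B}_i(T_i\otimes I_p)\ \ \mathrm{Row}_{i=1}^\nu\widehat{\mathfrak B}_i(\widetilde T_i\otimes I_p)\ \ \mathsf O_{m,q}]$, $\vartheta(t)=\mathrm{Col}\big(\mathrm{Col}_{i=0}^\nu x(t-r_i),\ \mathrm{Col}_{i=1}^\nu\int_{\mathcal I_i}(\mathfrak L_{h_i}^{-1}h_i(\tau)\otimes I_n)x(t+\tau)\mathrm d\tau,\ \mathrm{Col}_{i=1}^\nu\int_{\mathcal I_i}(\mathfrak L_{\varepsilon_i}^{-1}\varepsilon_i(\tau)\otimes I_n)x(t+\tau)\mathrm d\tau,\ w(t)\big)$. **Supply rate.** $\mathsf s(z,w)=\begin{bmatrix}z\\ w\end{bmatrix}^\top\begin{bmatrix}\widetilde J^\top J_1^{-1}\widetilde J&J_2\\ *&J_3\end{bmatrix}\begin{bmatrix}z\\ w\end{bmatrix}$ with $\widetilde J\in\mathbb R^{m\times m}$, $J_1\in\mathbb S^m$, $J_1^{-1}\prec0$,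 $\widetilde J^\top J_1^{-1}\widetilde J\preceq 0$, $J_2\in\mathbb R^{m\times q}$, $J_3\in\mathbb S^q$. **Auxiliary matrices.** $\widehat I=\big(\mathrm{diag}_{i=1}^\nu \mathfrak L_{f_i}^{-1}[\mathsf O_{d_i,\delta_i}\ \ I_{d_i}]\,\mathfrak L_{h_i}\big)\otimes I_n$; $\Lambda=\mathrm{diag}_{i=1}^\nu (r_i-r_{i-1})I_n$; $\mathbf M=\big[\mathrm{diag}_{i=1}^\nu\mathfrak L_{f_i}^{-1}f_i(-r_{i-1})\ \ \mathbf 0_d\ \ \mathsf O_{d,\varkappa}\big]-\big[\mathbf 0_d\ \ \mathrm{diag}_{i=1}^\nu\mathfrak L_{f_i}^{-1}f_i(-r_i)\ \ \mathrm{diag}_{i=1}^\nu\mathfrak L_{f_i}^{-1}M_i\mathfrak L_{h_i}\big]$. For $P_2\in\mathbb R^{n\times dn}$, $P_3\in\mathbb S^{dn}$, $\mathbf Q=\mathrm{diag}_{i=1}^\nu Q_i$, $\mathbf R=\mathrm{diag}_{i=1}^\nu R_i$ with $Q_i,R_i\in\mathbb S^n$, and $\boldsymbol\Sigma\in\mathbb R^{m\times(\beta n+q)}$, $$\Xi(\mathbf Q,\mathbf R)=\big[(\mathbf Q+\mathbf R\Lambda)\oplus\mathsf O_n\oplus\mathsf O_{\kappa n}\oplus\mathsf O_q\big]-\big[\mathsf O_n\oplus\mathbf Q\oplus(\mathrm{diag}_{i=1}^\nu I_{\varkappa_i}\otimes R_i)\oplus(\mathrm{diag}_{i=1}^\nu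 I_{\mu_i}\otimes R_i)\oplus J_3\big],$$ $$\boldsymbol\Phi(P_2,P_3,\mathbf Q,\mathbf R,\boldsymbol\Sigma)=\mathrm{Sy}\left(\begin{bmatrix}P_2\\ \mathsf O_{\nu n,dn}\\ \widehat I^\top P_3\\ \mathsf O_{(\mu n+q+m),dn}\end{bmatrix}\big[\mathbf M\otimes I_n\ \ \mathsf O_{dn,(\mu n+q+m)}\big]+\begin{bmatrix}\mathsf O_{(\beta n),m}\\ -J_2^\top\\ \widetilde J\end{bmatrix}\big[\boldsymbol\Sigma\ \ \mathsf O_m\big]\right)+[\Xi(\mathbf Q,\mathbf R)\oplus J_1].$$ **Dissipativity.** The closed-loop system with supply rate $\mathsf s$ is dissipative if there is $\mathsf v\in C^1(C(\mathcal J;\mathbb R^n);\mathbb R)$ such that $\frac{\mathrm d}{\mathrm dt}\mathsf v(\mathsf x_t(\cdot))-\mathsf s(z(t),w(t))\le0$ for almost all $t\ge t_0$ along its trajectories, where $\mathsf x_t(\theta)=x(t+\theta)$, $\theta\in\mathcal J$. **Exponential stability** of the origin has its usual meaning for functional differential equations, with initial functions in $C(\mathcal J;\mathbb R^n)$ and the sup norm. *)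

theory Defs
  imports
    "HOL-Analysis.Analysis"
    "Jordan_Normal_Form.VS_Connect"
    "Jordan_Normal_Form.Gauss_Jordan_Elimination"
begin

text \<open>
  The dimensions \<open>n\<close>, \<open>m\<close>, \<open>p\<close>, \<open>q\<close> of the state, the regulated output, the input and the
  disturbance are the cardinalities of finite index types, so trajectories and the coefficients of
  the differential equation live in \<open>real^'n\<close>, \<open>real^'n^'m\<close> and so on.  The block matrices of the
  matrix inequalities have sizes depending on \<open>\<nu>\<close>, \<open>d\<^sub>i\<close>, \<open>\<delta>\<^sub>i\<close>, \<open>\<mu>\<^sub>i\<close> (possibly zero), so they are
  matrices of \<^theory>\<open>Jordan_Normal_Form.Matrix\<close>.  The two representations are identified by the
  library's fixed enumeration of a finite type.
\<close>

unbundle no vec_syntax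
unbundle no inner_syntax
hide_const (open) Finite_Cartesian_Product.mat

definition vec_of :: "real^'a \<Rightarrow> real Matrix.vec" where
  "vec_of x = Matrix.vec CARD('a) (\<lambda>i. vec_nth x (from_nat_into UNIV i))"

definition mat_of :: "real^'c^'r \<Rightarrow> real mat" where
  "mat_of A = Matrix.mat CARD('r) CARD('c)
     (\<lambda>(i, j). vec_nth (vec_nth A (from_nat_into UNIV i)) (from_nat_into UNIV j))"

definition cart_of_mat :: "real mat \<Rightarrow> real^'c^'r" where
  "cart_of_mat A = vec_lambda (\<lambda>i. vec_lambda (\<lambda>j. A $$ (to_nat_on UNIV i, to_nat_on UNIV j)))"


section \<open>Matrices\<close>

definition hcat :: "real mat list \<Rightarrow> real mat" where
  "hcat As = foldr (\<lambda>A B. four_block_mat A B (0\<^sub>m 0 (dim_col A)) (0\<^sub>m 0 (dim_col B))) As (0\<^sub>m 0 0)"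

definition vcat :: "real mat list \<Rightarrow> real mat" where
  "vcat As = foldr (@\<^sub>r) As (0\<^sub>m 0 0)"

definition kron :: "real mat \<Rightarrow> real mat \<Rightarrow> real mat" where
  "kron A B = Matrix.mat (dim_row A * dim_row B) (dim_col A * dim_col B)
     (\<lambda>(i, j). A $$ (i div dim_row B, j div dim_col B) * B $$ (i mod dim_row B, j mod dim_col B))"

definition Sy :: "real mat \<Rightarrow> real mat" where
  "Sy X = X + X\<^sup>T"

definition symmetric_mats :: "nat \<Rightarrow> real mat set" where
  "symmetric_mats k = {A \<in> carrier_mat k k. A\<^sup>T = A}"

definition pos_def :: "real mat \<Rightarrow> bool" where
  "pos_def A \<longleftrightarrow> A \<in> symmetric_mats (dim_row A) \<and>
     (\<forall>v \<in> carrier_vec (dim_row A). v \<noteq> 0\<^sub>v (dim_row A) \<longrightarrow> v \<bullet> (A *\<^sub>v v) > 0)"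

definition neg_def :: "real mat \<Rightarrow> bool" where
  "neg_def A \<longleftrightarrow> pos_def (- A)"

definition neg_semidef :: "real mat \<Rightarrow> bool" where
  "neg_semidef A \<longleftrightarrow> A \<in> symmetric_mats (dim_row A) \<and>
     (\<forall>v \<in> carrier_vec (dim_row A). v \<bullet> (A *\<^sub>v v) \<le> 0)"

definition minv :: "real mat \<Rightarrow> real mat" where
  "minv A = the (mat_inverse A)"

definition cholesky_factor :: "real mat \<Rightarrow> real mat \<Rightarrow> bool" where
  "cholesky_factor A L \<longleftrightarrow> L \<in> carrier_mat (dim_row A) (dim_row A) \<and>
     upper_triangular (L\<^sup>T) \<and> (\<forall>i < dim_row A. L $$ (i, i) > 0) \<and> A = L * L\<^sup>T"

definition cross_gram ::
  "real set \<Rightarrow> nat \<Rightarrow> nat \<Rightarrow> (real \<Rightarrow> real Matrix.vec) \<Rightarrow> (real \<Rightarrow> real Matrix.vec) \<Rightarrow> real mat" where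
  "cross_gram I a b u v = Matrix.mat a b (\<lambda>(k, l). LINT \<tau>:I|lebesgue. (u \<tau> $ k) * (v \<tau> $ l))"


section \<open>Function spaces\<close>

definition L2_on :: "real set \<Rightarrow> (real \<Rightarrow> 'a::euclidean_space) \<Rightarrow> bool" where
  "L2_on I f \<longleftrightarrow> set_borel_measurable lebesgue I f \<and> set_integrable lebesgue I (\<lambda>t. (norm (f t))\<^sup>2)"

text \<open>The test functions are the \<open>C\<^sup>1\<close> functions with compact support in \<open>(a, b)\<close>.\<close>

definition weak_derivative_on :: "real \<Rightarrow> real \<Rightarrow> (real \<Rightarrow> real) \<Rightarrow> (real \<Rightarrow> real) \<Rightarrow> bool" where
  "weak_derivative_on a b f g \<longleftrightarrow>
     (\<forall>\<xi> \<xi>'. (\<forall>t. (\<xi> has_real_derivative \<xi>' t) (at t)) \<and> continuous_on UNIV \<xi>' \<and>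
        (\<exists>c e. a < c \<and> e < b \<and> (\<forall>t. t \<notin> {c..e} \<longrightarrow> \<xi> t = 0)) \<longrightarrow>
        (LINT t:{a..b}|lebesgue. f t * \<xi>' t) = - (LINT t:{a..b}|lebesgue. g t * \<xi> t))"

text \<open>Elements of \<open>W\<^sup>1\<^sup>,\<^sup>2\<close> are represented by their continuous representative.\<close>

definition W12_on :: "real \<Rightarrow> real \<Rightarrow> (real \<Rightarrow> real) \<Rightarrow> bool" where
  "W12_on a b f \<longleftrightarrow> continuous_on {a..b} f \<and> L2_on {a..b} f \<and>
     (\<exists>g. L2_on {a..b} g \<and> weak_derivative_on a b f g)"

definition abs_cont_on :: "real \<Rightarrow> real \<Rightarrow> (real \<Rightarrow> 'a::real_normed_vector) \<Rightarrow> bool" where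
  "abs_cont_on a b x \<longleftrightarrow>
     (\<forall>\<epsilon>>0. \<exists>\<delta>>0. \<forall>\<D> U. \<D> division_of U \<and> U \<subseteq> {a..b} \<and> (\<Sum>k\<in>\<D>. Sup k - Inf k) < \<delta> \<longrightarrow>
        (\<Sum>k\<in>\<D>. norm (x (Sup k) - x (Inf k))) < \<epsilon>)"

text \<open>
  \<open>C([-r, 0]; 'a)\<close>, isometrically realised as the space of those continuous functions on the whole
  line that are constant on \<open>(-\<infinity>, -r]\<close> and on \<open>[0, \<infinity>)\<close>; \<open>segment r x t\<close> is the element
  \<open>\<theta> \<mapsto> x (t + \<theta>)\<close> of this space.
\<close>

definition C_space :: "real \<Rightarrow> (real \<Rightarrow>\<^sub>C 'a::real_normed_vector) set" where
  "C_space r = {\<phi>. apply_bcontfun \<phi> = ext_cont (apply_bcontfun \<phi>) (-r) 0}"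

definition segment :: "real \<Rightarrow> (real \<Rightarrow> 'a::real_normed_vector) \<Rightarrow> real \<Rightarrow> (real \<Rightarrow>\<^sub>C 'a)" where
  "segment r x t = Bcontfun (ext_cont (\<lambda>\<theta>. x (t + \<theta>)) (-r) 0)"

text \<open>
  Functionals on \<open>C([-r, 0]; 'a)\<close> are given by their values on \<open>C_space r\<close>.  A bounded functional on
  this closed subspace extends with the same norm to all bounded continuous functions (compose with
  clamping to \<open>[-r, 0]\<close>), so derivatives may be taken as elements of the full dual, and continuity of
  the derivative in the operator norm is not affected.
\<close>

definition C1_functional :: "real \<Rightarrow> ((real \<Rightarrow>\<^sub>C 'a::real_normed_vector) \<Rightarrow> real) \<Rightarrow> bool" where
  "C1_functional r v \<longleftrightarrow>
     (\<exists>v' :: (real \<Rightarrow>\<^sub>C 'a) \<Rightarrow> ((real \<Rightarrow>\<^sub>C 'a) \<Rightarrow>\<^sub>L real).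
        (\<forall>\<phi> \<in> C_space r. (v has_derivative blinfun_apply (v' \<phi>)) (at \<phi> within C_space r)) \<and>
        continuous_on (C_space r) v')"


section \<open>The delay system\<close>

text \<open>The fields \<open>coE\<close> and \<open>kerE\<close> hold the input-to-output coefficients (Fraktur B).\<close>

record ('n::finite, 'm::finite, 'p::finite, 'q::finite) delay_system =
  num_delays :: nat
  delay :: "nat \<Rightarrow> real"
  coA :: "nat \<Rightarrow> real^'n^'n"
  coB :: "nat \<Rightarrow> real^'p^'n"
  coC :: "nat \<Rightarrow> real^'n^'m"
  coE :: "nat \<Rightarrow> real^'p^'m"
  distD1 :: "real^'q^'n"
  distD2 :: "real^'q^'m"
  kerA :: "nat \<Rightarrow> real \<Rightarrow> real^'n^'n"
  kerB :: "nat \<Rightarrow> real \<Rightarrow> real^'p^'n"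
  kerC :: "nat \<Rightarrow> real \<Rightarrow> real^'n^'m"
  kerE :: "nat \<Rightarrow> real \<Rightarrow> real^'p^'m"

definition max_delay :: "('n::finite, 'm::finite, 'p::finite, 'q::finite) delay_system \<Rightarrow> real" where
  "max_delay S = delay S (num_delays S)"

definition delay_interval ::
  "('n::finite, 'm::finite, 'p::finite, 'q::finite) delay_system \<Rightarrow> nat \<Rightarrow> real set" where
  "delay_interval S i = {- delay S i .. - delay S (i - 1)}"

definition valid_system :: "('n::finite, 'm::finite, 'p::finite, 'q::finite) delay_system \<Rightarrow> bool" where
  "valid_system S \<longleftrightarrow>
     1 \<le> num_delays S \<and> delay S 0 = 0 \<and> (\<forall>i < num_delays S. delay S i < delay S (Suc i)) \<and>
     (\<forall>i \<in> {1..num_delays S}.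
        L2_on (delay_interval S i) (kerA S i) \<and> L2_on (delay_interval S i) (kerB S i) \<and>
        L2_on (delay_interval S i) (kerC S i) \<and> L2_on (delay_interval S i) (kerE S i))"

definition state_trajectory ::
  "('n::finite, 'm::finite, 'p::finite, 'q::finite) delay_system \<Rightarrow> real^'n^'p \<Rightarrow> real \<Rightarrow>
   (real \<Rightarrow> real^'n) \<Rightarrow> (real \<Rightarrow> real^'q) \<Rightarrow> (real \<Rightarrow> real^'n) \<Rightarrow> bool" where
  "state_trajectory S K t0 \<psi> w x \<longleftrightarrow>
     continuous_on {- max_delay S..0} \<psi> \<and> L2_on {t0..} w \<and>
     (\<forall>\<theta> \<in> {- max_delay S..0}. x (t0 + \<theta>) = \<psi> \<theta>) \<and>
     (\<forall>t1 > t0. abs_cont_on t0 t1 x) \<and>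
     (AE t in lebesgue. t \<ge> t0 \<longrightarrow>
        (x has_vector_derivative
           (distD1 S *v w t
            + (\<Sum>i=0..num_delays S. (coA S i + coB S i ** K) *v x (t - delay S i))
            + (\<Sum>i=1..num_delays S. LINT \<tau>:delay_interval S i|lebesgue.
                 (kerA S i \<tau> + kerB S i \<tau> ** K) *v x (t + \<tau>)))) (at t))"

definition output_trajectory ::
  "('n::finite, 'm::finite, 'p::finite, 'q::finite) delay_system \<Rightarrow> real^'n^'p \<Rightarrow> real \<Rightarrow>
   (real \<Rightarrow> real^'q) \<Rightarrow> (real \<Rightarrow> real^'n) \<Rightarrow> (real \<Rightarrow> real^'m) \<Rightarrow> bool" where
  "output_trajectory S K t0 w x z \<longleftrightarrow>
     (AE t in lebesgue. t \<ge> t0 \<longrightarrow>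
        z t = distD2 S *v w t
            + (\<Sum>i=0..num_delays S. (coC S i + coE S i ** K) *v x (t - delay S i))
            + (\<Sum>i=1..num_delays S. LINT \<tau>:delay_interval S i|lebesgue.
                 (kerC S i \<tau> + kerE S i \<tau> ** K) *v x (t + \<tau>)))"


section \<open>Supply rate, dissipativity, exponential stability\<close>

record supply_params =
  Jtilde :: "real mat"
  J1 :: "real mat"
  J2 :: "real mat"
  J3 :: "real mat"

definition valid_supply :: "nat \<Rightarrow> nat \<Rightarrow> supply_params \<Rightarrow> bool" where
  "valid_supply m q J \<longleftrightarrow>
     Jtilde J \<in> carrier_mat m m \<and> J1 J \<in> symmetric_mats m \<and>
     J2 J \<in> carrier_mat m q \<and> J3 J \<in> symmetric_mats q \<and>
     invertible_mat (J1 J) \<and> neg_def (minv (J1 J)) \<and>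
     neg_semidef ((Jtilde J)\<^sup>T * minv (J1 J) * Jtilde J)"

definition supply_rate :: "supply_params \<Rightarrow> real^'m \<Rightarrow> real^'q \<Rightarrow> real" where
  "supply_rate J z w =
     (let \<zeta> = vec_of z @\<^sub>v vec_of w
      in \<zeta> \<bullet> (four_block_mat ((Jtilde J)\<^sup>T * minv (J1 J) * Jtilde J) (J2 J) ((J2 J)\<^sup>T) (J3 J) *\<^sub>v \<zeta>))"

definition dissipative ::
  "('n::finite, 'm::finite, 'p::finite, 'q::finite) delay_system \<Rightarrow> real^'n^'p \<Rightarrow> real \<Rightarrow>
   (real^'m \<Rightarrow> real^'q \<Rightarrow> real) \<Rightarrow> bool" where
  "dissipative S K t0 s \<longleftrightarrow>
     (\<exists>v :: (real \<Rightarrow>\<^sub>C (real^'n)) \<Rightarrow> real. C1_functional (max_delay S) v \<and>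
        (\<forall>\<psi> w x z. state_trajectory S K t0 \<psi> w x \<and> output_trajectory S K t0 w x z \<longrightarrow>
           (AE t in lebesgue. t \<ge> t0 \<longrightarrow>
              (\<exists>D. ((\<lambda>\<sigma>. v (segment (max_delay S) x \<sigma>)) has_real_derivative D) (at t) \<and>
                   D - s (z t) (w t) \<le> 0))))"

definition globally_exponentially_stable ::
  "('n::finite, 'm::finite, 'p::finite, 'q::finite) delay_system \<Rightarrow> real^'n^'p \<Rightarrow> real \<Rightarrow> bool" where
  "globally_exponentially_stable S K t0 \<longleftrightarrow>
     (\<exists>c > 0. \<exists>\<gamma> > 0. \<forall>\<psi> x. state_trajectory S K t0 \<psi> (\<lambda>_. 0) x \<longrightarrow>
        (\<forall>t \<ge> t0. norm (x t) \<le> c * (SUP \<theta>\<in>{- max_delay S..0}. norm (\<psi> \<theta>)) * exp (- \<gamma> * (t - t0))))"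


section \<open>Kernel decomposition\<close>

text \<open>
  \<open>dimf\<close>, \<open>dimvphi\<close>, \<open>dimphi\<close> are \<open>d\<^sub>i\<close>, \<open>\<delta>\<^sub>i\<close>, \<open>\<mu>\<^sub>i\<close>, the dimensions of \<open>f\<^sub>i\<close> (\<open>funf\<close>), of the curly
  \<open>\<phi>\<^sub>i\<close> (\<open>funvphi\<close>) and of the straight \<open>\<phi>\<^sub>i\<close> (\<open>funphi\<close>).
\<close>

record kernel_decomposition =
  dimf :: "nat \<Rightarrow> nat"
  dimvphi :: "nat \<Rightarrow> nat"
  dimphi :: "nat \<Rightarrow> nat"
  funf :: "nat \<Rightarrow> real \<Rightarrow> real Matrix.vec"
  funvphi :: "nat \<Rightarrow> real \<Rightarrow> real Matrix.vec"
  funphi :: "nat \<Rightarrow> real \<Rightarrow> real Matrix.vec"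
  matM :: "nat \<Rightarrow> real mat"
  hatA :: "nat \<Rightarrow> real mat"
  hatB :: "nat \<Rightarrow> real mat"
  hatC :: "nat \<Rightarrow> real mat"
  hatE :: "nat \<Rightarrow> real mat"
  cholF :: "nat \<Rightarrow> real mat"
  cholH :: "nat \<Rightarrow> real mat"
  cholE :: "nat \<Rightarrow> real mat"

definition dimh :: "kernel_decomposition \<Rightarrow> nat \<Rightarrow> nat" where
  "dimh G i = dimf G i + dimvphi G i"

definition dimg :: "kernel_decomposition \<Rightarrow> nat \<Rightarrow> nat" where
  "dimg G i = dimf G i + dimvphi G i + dimphi G i"

definition funh :: "kernel_decomposition \<Rightarrow> nat \<Rightarrow> real \<Rightarrow> real Matrix.vec" where
  "funh G i \<tau> = funvphi G i \<tau> @\<^sub>v funf G i \<tau>"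

definition fung :: "kernel_decomposition \<Rightarrow> nat \<Rightarrow> real \<Rightarrow> real Matrix.vec" where
  "fung G i \<tau> = funphi G i \<tau> @\<^sub>v funh G i \<tau>"

definition gramF ::
  "('n::finite, 'm::finite, 'p::finite, 'q::finite) delay_system \<Rightarrow> kernel_decomposition \<Rightarrow> nat \<Rightarrow> real mat" where
  "gramF S G i = cross_gram (delay_interval S i) (dimf G i) (dimf G i) (funf G i) (funf G i)"

definition gramH ::
  "('n::finite, 'm::finite, 'p::finite, 'q::finite) delay_system \<Rightarrow> kernel_decomposition \<Rightarrow> nat \<Rightarrow> real mat" where
  "gramH S G i = cross_gram (delay_interval S i) (dimh G i) (dimh G i) (funh G i) (funh G i)"

definition Gam ::
  "('n::finite, 'm::finite, 'p::finite, 'q::finite) delay_system \<Rightarrow> kernel_decomposition \<Rightarrow> nat \<Rightarrow> real mat" where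
  "Gam S G i = cross_gram (delay_interval S i) (dimphi G i) (dimh G i) (funphi G i) (funh G i)"

definition epsf ::
  "('n::finite, 'm::finite, 'p::finite, 'q::finite) delay_system \<Rightarrow> kernel_decomposition \<Rightarrow> nat \<Rightarrow>
   real \<Rightarrow> real Matrix.vec" where
  "epsf S G i \<tau> = funphi G i \<tau> - (Gam S G i * minv (gramH S G i)) *\<^sub>v funh G i \<tau>"

definition gramE ::
  "('n::finite, 'm::finite, 'p::finite, 'q::finite) delay_system \<Rightarrow> kernel_decomposition \<Rightarrow> nat \<Rightarrow> real mat" where
  "gramE S G i = cross_gram (delay_interval S i) (dimphi G i) (dimphi G i) (epsf S G i) (epsf S G i)"

text \<open>\<open>K\<close> is the kernel \<open>\<tau> \<mapsto> Khat (g\<^sub>i(\<tau>) \<otimes> I\<^sub>k)\<close>; kernels are elements of \<open>L\<^sup>2\<close>.\<close>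

definition decomposes ::
  "real set \<Rightarrow> nat \<Rightarrow> nat \<Rightarrow> (real \<Rightarrow> real Matrix.vec) \<Rightarrow> real mat \<Rightarrow> (real \<Rightarrow> real^'c^'r) \<Rightarrow> bool" where
  "decomposes I k l g Khat K \<longleftrightarrow> Khat \<in> carrier_mat CARD('r) (l * k) \<and>
     (AE \<tau> in lebesgue. \<tau> \<in> I \<longrightarrow> mat_of (K \<tau>) = Khat * kron (mat_of_cols l [g \<tau>]) (1\<^sub>m k))"

definition valid_decomposition ::
  "('n::finite, 'm::finite, 'p::finite, 'q::finite) delay_system \<Rightarrow> kernel_decomposition \<Rightarrow> bool" where
  "valid_decomposition S G \<longleftrightarrow>
     (\<forall>i \<in> {1..num_delays S}.
        let I = delay_interval S i; a = - delay S i; b = - delay S (i - 1) in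
        1 \<le> dimf G i \<and>
        (\<forall>\<tau>\<in>I. funf G i \<tau> \<in> carrier_vec (dimf G i) \<and> funvphi G i \<tau> \<in> carrier_vec (dimvphi G i) \<and>
             funphi G i \<tau> \<in> carrier_vec (dimphi G i)) \<and>
        (\<forall>k < dimf G i. W12_on a b (\<lambda>\<tau>. funf G i \<tau> $ k)) \<and>
        (\<forall>k < dimvphi G i. L2_on I (\<lambda>\<tau>. funvphi G i \<tau> $ k)) \<and>
        (\<forall>k < dimphi G i. L2_on I (\<lambda>\<tau>. funphi G i \<tau> $ k)) \<and>
        matM G i \<in> carrier_mat (dimf G i) (dimh G i) \<and>
        (\<forall>k < dimf G i. weak_derivative_on a b
           (\<lambda>\<tau>. funf G i \<tau> $ k) (\<lambda>\<tau>. (matM G i *\<^sub>v funh G i \<tau>) $ k)) \<and>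
        pos_def (cross_gram I (dimg G i) (dimg G i) (fung G i) (fung G i)) \<and>
        decomposes I CARD('n) (dimg G i) (fung G i) (hatA G i) (kerA S i) \<and>
        decomposes I CARD('p) (dimg G i) (fung G i) (hatB G i) (kerB S i) \<and>
        decomposes I CARD('n) (dimg G i) (fung G i) (hatC G i) (kerC S i) \<and>
        decomposes I CARD('p) (dimg G i) (fung G i) (hatE G i) (kerE S i) \<and>
        cholesky_factor (gramF S G i) (cholF G i) \<and>
        cholesky_factor (gramH S G i) (cholH G i) \<and>
        cholesky_factor (gramE S G i) (cholE G i))"

definition matT ::
  "('n::finite, 'm::finite, 'p::finite, 'q::finite) delay_system \<Rightarrow> kernel_decomposition \<Rightarrow> nat \<Rightarrow> real mat" where
  "matT S G i = vcat [Gam S G i * minv (gramH S G i), 1\<^sub>m (dimh G i)] * cholH G i"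

definition matTtilde :: "kernel_decomposition \<Rightarrow> nat \<Rightarrow> real mat" where
  "matTtilde G i = vcat [1\<^sub>m (dimphi G i), 0\<^sub>m (dimh G i) (dimphi G i)] * cholE G i"


section \<open>The matrix inequalities\<close>

definition idx0 :: "('n::finite, 'm::finite, 'p::finite, 'q::finite) delay_system \<Rightarrow> nat list" where
  "idx0 S = [0..<Suc (num_delays S)]"

definition idx1 :: "('n::finite, 'm::finite, 'p::finite, 'q::finite) delay_system \<Rightarrow> nat list" where
  "idx1 S = [1..<Suc (num_delays S)]"

definition total_dim :: "('n::finite, 'm::finite, 'p::finite, 'q::finite) delay_system \<Rightarrow> (nat \<Rightarrow> nat) \<Rightarrow> nat" where
  "total_dim S k = (\<Sum>i=1..num_delays S. k i)"

definition beta ::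
  "('n::finite, 'm::finite, 'p::finite, 'q::finite) delay_system \<Rightarrow> kernel_decomposition \<Rightarrow> nat" where
  "beta S G = 1 + num_delays S + total_dim S (dimg G)"

text \<open>The common shape of the block rows \<open>\<^bold>A\<close>, \<open>\<^bold>B\<^sub>1\<close>, \<open>\<^bold>C\<close>, \<open>\<^bold>B\<^sub>2\<close>.\<close>

definition block_row ::
  "('n::finite, 'm::finite, 'p::finite, 'q::finite) delay_system \<Rightarrow> kernel_decomposition \<Rightarrow>
   (nat \<Rightarrow> real^'c^'r) \<Rightarrow> (nat \<Rightarrow> real mat) \<Rightarrow> real mat \<Rightarrow> real mat" where
  "block_row S G co hat last_block =
     hcat (map (\<lambda>i. mat_of (co i)) (idx0 S)
         @ map (\<lambda>i. hat i * kron (matT S G i) (1\<^sub>m CARD('c))) (idx1 S)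
         @ map (\<lambda>i. hat i * kron (matTtilde G i) (1\<^sub>m CARD('c))) (idx1 S)
         @ [last_block])"

definition boldA ::
  "('n::finite, 'm::finite, 'p::finite, 'q::finite) delay_system \<Rightarrow> kernel_decomposition \<Rightarrow> real mat" where
  "boldA S G = block_row S G (coA S) (hatA G) (mat_of (distD1 S))"

definition boldB1 ::
  "('n::finite, 'm::finite, 'p::finite, 'q::finite) delay_system \<Rightarrow> kernel_decomposition \<Rightarrow> real mat" where
  "boldB1 S G = block_row S G (coB S) (hatB G) (0\<^sub>m CARD('n) CARD('q))"

definition boldC ::
  "('n::finite, 'm::finite, 'p::finite, 'q::finite) delay_system \<Rightarrow> kernel_decomposition \<Rightarrow> real mat" where
  "boldC S G = block_row S G (coC S) (hatC G) (mat_of (distD2 S))"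

definition boldB2 ::
  "('n::finite, 'm::finite, 'p::finite, 'q::finite) delay_system \<Rightarrow> kernel_decomposition \<Rightarrow> real mat" where
  "boldB2 S G = block_row S G (coE S) (hatE G) (0\<^sub>m CARD('m) CARD('q))"

definition Ihat ::
  "('n::finite, 'm::finite, 'p::finite, 'q::finite) delay_system \<Rightarrow> kernel_decomposition \<Rightarrow> real mat" where
  "Ihat S G = kron
     (diag_block_mat (map (\<lambda>i. minv (cholF G i) * hcat [0\<^sub>m (dimf G i) (dimvphi G i), 1\<^sub>m (dimf G i)] * cholH G i)
        (idx1 S)))
     (1\<^sub>m CARD('n))"

definition Lam :: "('n::finite, 'm::finite, 'p::finite, 'q::finite) delay_system \<Rightarrow> real mat" where
  "Lam S = diag_block_mat (map (\<lambda>i. (delay S i - delay S (i - 1)) \<cdot>\<^sub>m 1\<^sub>m CARD('n)) (idx1 S))"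

definition boldM ::
  "('n::finite, 'm::finite, 'p::finite, 'q::finite) delay_system \<Rightarrow> kernel_decomposition \<Rightarrow> real mat" where
  "boldM S G =
     (let d = total_dim S (dimf G);
          F = (\<lambda>i \<tau>. minv (cholF G i) * mat_of_cols (dimf G i) [funf G i \<tau>])
      in hcat [diag_block_mat (map (\<lambda>i. F i (- delay S (i - 1))) (idx1 S)),
               0\<^sub>m d 1,
               0\<^sub>m d (total_dim S (dimh G))]
       - hcat [0\<^sub>m d 1,
               diag_block_mat (map (\<lambda>i. F i (- delay S i)) (idx1 S)),
               diag_block_mat (map (\<lambda>i. minv (cholF G i) * matM G i * cholH G i) (idx1 S))])"

definition Xi ::
  "('n::finite, 'm::finite, 'p::finite, 'q::finite) delay_system \<Rightarrow> kernel_decomposition \<Rightarrow> supply_params \<Rightarrow>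
   (nat \<Rightarrow> real mat) \<Rightarrow> (nat \<Rightarrow> real mat) \<Rightarrow> real mat" where
  "Xi S G J Q R =
     (let n = CARD('n); \<kappa> = total_dim S (dimg G);
          boldQ = diag_block_mat (map Q (idx1 S)); boldR = diag_block_mat (map R (idx1 S))
      in diag_block_mat [boldQ + boldR * Lam S, 0\<^sub>m n n, 0\<^sub>m (\<kappa> * n) (\<kappa> * n), 0\<^sub>m CARD('q) CARD('q)]
       - diag_block_mat [0\<^sub>m n n, boldQ,
           diag_block_mat (map (\<lambda>i. kron (1\<^sub>m (dimh G i)) (R i)) (idx1 S)),
           diag_block_mat (map (\<lambda>i. kron (1\<^sub>m (dimphi G i)) (R i)) (idx1 S)),
           J3 J])"

definition Phi ::
  "('n::finite, 'm::finite, 'p::finite, 'q::finite) delay_system \<Rightarrow> kernel_decomposition \<Rightarrow> supply_params \<Rightarrow>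
   real mat \<Rightarrow> real mat \<Rightarrow> (nat \<Rightarrow> real mat) \<Rightarrow> (nat \<Rightarrow> real mat) \<Rightarrow> real mat \<Rightarrow> real mat" where
  "Phi S G J P2 P3 Q R \<Sigma> =
     (let n = CARD('n); m = CARD('m); q = CARD('q);
          d = total_dim S (dimf G); \<mu> = total_dim S (dimphi G)
      in Sy (vcat [P2, 0\<^sub>m (num_delays S * n) (d * n), (Ihat S G)\<^sup>T * P3, 0\<^sub>m (\<mu> * n + q + m) (d * n)]
               * hcat [kron (boldM S G) (1\<^sub>m n), 0\<^sub>m (d * n) (\<mu> * n + q + m)]
             + vcat [0\<^sub>m (beta S G * n) m, - (J2 J)\<^sup>T, Jtilde J] * hcat [\<Sigma>, 0\<^sub>m m m])
         + diag_block_mat [Xi S G J Q R, J1 J])"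

record decision =
  varX :: "real mat"
  varP1 :: "real mat"
  varP2 :: "real mat"
  varP3 :: "real mat"
  varQ :: "nat \<Rightarrow> real mat"
  varR :: "nat \<Rightarrow> real mat"
  varV :: "real mat"

text \<open>
  The real vector space of all \<open>(X, P\<^sub>1, P\<^sub>2, P\<^sub>3, Q\<^sub>1, \<dots>, Q\<^sub>\<nu>, R\<^sub>1, \<dots>, R\<^sub>\<nu>, V)\<close>; its dimension is the number
  of scalar unknowns.  Ring multiplication and unit of the record are irrelevant for modules.
\<close>

definition decision_space :: "nat \<Rightarrow> nat \<Rightarrow> nat \<Rightarrow> nat \<Rightarrow> (real, decision) module" where
  "decision_space n p \<nu> d =
     \<lparr> carrier = {U. varX U \<in> symmetric_mats n \<and> varP1 U \<in> symmetric_mats n \<and>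
                     varP2 U \<in> carrier_mat n (d * n) \<and> varP3 U \<in> symmetric_mats (d * n) \<and>
                     varQ U \<in> (\<Pi>\<^sub>E i\<in>{1..\<nu>}. symmetric_mats n) \<and>
                     varR U \<in> (\<Pi>\<^sub>E i\<in>{1..\<nu>}. symmetric_mats n) \<and>
                     varV U \<in> carrier_mat p n},
       mult = undefined, one = undefined,
       zero = \<lparr> varX = 0\<^sub>m n n, varP1 = 0\<^sub>m n n, varP2 = 0\<^sub>m n (d * n), varP3 = 0\<^sub>m (d * n) (d * n),
                varQ = (\<lambda>i\<in>{1..\<nu>}. 0\<^sub>m n n), varR = (\<lambda>i\<in>{1..\<nu>}. 0\<^sub>m n n), varV = 0\<^sub>m p n \<rparr>,
       add = (\<lambda>U W. \<lparr> varX = varX U + varX W, varP1 = varP1 U + varP1 W, varP2 = varP2 U + varP2 W,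
                varP3 = varP3 U + varP3 W, varQ = (\<lambda>i\<in>{1..\<nu>}. varQ U i + varQ W i),
                varR = (\<lambda>i\<in>{1..\<nu>}. varR U i + varR W i), varV = varV U + varV W \<rparr>),
       smult = (\<lambda>c U. \<lparr> varX = c \<cdot>\<^sub>m varX U, varP1 = c \<cdot>\<^sub>m varP1 U, varP2 = c \<cdot>\<^sub>m varP2 U,
                varP3 = c \<cdot>\<^sub>m varP3 U, varQ = (\<lambda>i\<in>{1..\<nu>}. c \<cdot>\<^sub>m varQ U i),
                varR = (\<lambda>i\<in>{1..\<nu>}. c \<cdot>\<^sub>m varR U i), varV = c \<cdot>\<^sub>m varV U \<rparr>) \<rparr>"

definition num_unknowns :: "nat \<Rightarrow> nat \<Rightarrow> nat \<Rightarrow> nat \<Rightarrow> nat" where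
  "num_unknowns n p \<nu> d = vectorspace.dim class_ring (decision_space n p \<nu> d)"

definition boldPi ::
  "('n::finite, 'm::finite, 'p::finite, 'q::finite) delay_system \<Rightarrow> kernel_decomposition \<Rightarrow> decision \<Rightarrow> real mat" where
  "boldPi S G U =
     hcat [boldA S G * diag_block_mat [kron (1\<^sub>m (beta S G)) (varX U), 1\<^sub>m CARD('q)]
           + boldB1 S G * diag_block_mat [kron (1\<^sub>m (beta S G)) (varV U), 0\<^sub>m CARD('q) CARD('q)],
           0\<^sub>m CARD('n) CARD('m)]"

definition boldSigma ::
  "('n::finite, 'm::finite, 'p::finite, 'q::finite) delay_system \<Rightarrow> kernel_decomposition \<Rightarrow> decision \<Rightarrow> real mat" where
  "boldSigma S G U =
     boldC S G * diag_block_mat [kron (1\<^sub>m (beta S G)) (varX U), 1\<^sub>m CARD('q)]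
     + boldB2 S G * diag_block_mat [kron (1\<^sub>m (beta S G)) (varV U), 0\<^sub>m CARD('q) CARD('q)]"

definition boldP ::
  "('n::finite, 'm::finite, 'p::finite, 'q::finite) delay_system \<Rightarrow> kernel_decomposition \<Rightarrow> decision \<Rightarrow> real mat" where
  "boldP S G U =
     (let n = CARD('n)
      in hcat [varP1 U, 0\<^sub>m n (num_delays S * n), varP2 U * Ihat S G,
               0\<^sub>m n (total_dim S (dimphi G) * n + CARD('q) + CARD('m))])"

definition synthesis_lmi ::
  "('n::finite, 'm::finite, 'p::finite, 'q::finite) delay_system \<Rightarrow> kernel_decomposition \<Rightarrow> supply_params \<Rightarrow>
   (nat \<Rightarrow> real) \<Rightarrow> decision \<Rightarrow> real mat" where
  "synthesis_lmi S G J \<alpha> U =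
     (let n = CARD('n); \<beta> = beta S G
      in Sy (vcat [1\<^sub>m n, vcat (map (\<lambda>i. \<alpha> i \<cdot>\<^sub>m 1\<^sub>m n) [1..<Suc \<beta>]), 0\<^sub>m (CARD('q) + CARD('m)) n]
               * hcat [- varX U, boldPi S G U])
         + four_block_mat (0\<^sub>m n n) (boldP S G U) ((boldP S G U)\<^sup>T)
             (Phi S G J (varP2 U) (varP3 U) (varQ U) (varR U) (boldSigma S G U)))"

definition feasible ::
  "('n::finite, 'm::finite, 'p::finite, 'q::finite) delay_system \<Rightarrow> kernel_decomposition \<Rightarrow> supply_params \<Rightarrow>
   (nat \<Rightarrow> real) \<Rightarrow> decision \<Rightarrow> bool" where
  "feasible S G J \<alpha> U \<longleftrightarrow>
     U \<in> carrier (decision_space CARD('n) CARD('p) (num_delays S) (total_dim S (dimf G))) \<and>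
     pos_def (four_block_mat (varP1 U) (varP2 U) ((varP2 U)\<^sup>T) (varP3 U)
       + diag_block_mat [0\<^sub>m CARD('n) CARD('n),
           diag_block_mat (map (\<lambda>i. kron (1\<^sub>m (dimf G i)) (varQ U i)) (idx1 S))]) \<and>
     pos_def (diag_block_mat (map (varQ U) (idx1 S))) \<and>
     pos_def (diag_block_mat (map (varR U) (idx1 S))) \<and>
     neg_def (synthesis_lmi S G J \<alpha> U)"

end

theory Submission imports Defs begin

text \<open>
  Everything is expressed in the state \<open>y = X\<inverse> x\<close>: then \<open>P\<^sub>1, P\<^sub>2, P\<^sub>3, Q\<^sub>i, R\<^sub>i\<close> themselves are the weights of a
  Lyapunov--Krasovskii functional \<open>v = \<eta>\<^sup>T P \<eta> + \<Sum>\<^sub>i \<integral> y\<^sup>T (Q\<^sub>i + (\<tau> + r\<^sub>i) R\<^sub>i) y\<close>, where \<open>\<eta>\<close> consists of \<open>y(t)\<close> and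
  the coefficients of the segment of \<open>y\<close> with respect to the orthonormalised \<open>f\<^sub>i\<close>; these are differentiable
  in time because \<open>f\<^sub>i' = M\<^sub>i h\<^sub>i\<close> weakly.  The matrix inequality is tested with
  \<open>\<chi> = (X\<inverse> x', \<theta>, - J\<^sub>1\<inverse> \<J> z)\<close>, where \<open>\<theta>\<close> is \<open>\<vartheta>\<close> formed from \<open>y\<close> and \<open>\<J>\<close> is the factor of the supply rate.
  On this vector \<open>[-X \<Pi>]\<close> vanishes, so the slack term drops out, and the last component completes the square in \<open>z\<close>.
  By Bessel's inequality for the orthonormal system given by \<open>h\<^sub>i\<close> and \<open>\<epsilon>\<^sub>i\<close>, \<open>v' - s(z, w) \<le> \<chi>\<^sup>T LMI \<chi> \<le> 0\<close>.
  For \<open>w = 0\<close>, the functional \<open>v + \<rho> \<integral> (\<tau> + r) |y|\<^sup>2\<close> with small \<open>\<rho> > 0\<close> decays exponentially.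
  Nonsingularity of \<open>X\<close> follows from testing with \<open>\<chi> = (u, 0)\<close>, \<open>X u = 0\<close>.
\<close>

subsection \<open>Block vectors and block matrices\<close>

text \<open>The reason for the state \<open>y\<close>: with gain \<open>V X\<inverse>\<close> the
  closed loop acts on \<open>x = X y\<close> as \<open>A X + B V\<close>, so the given inequality
  applies directly and no congruence transformation has to be undone. The weight \<open>P\<close>
  need not be positive; only its sum with the blocks \<open>I \<otimes> Q_i\<close> is. That
  \<open>v\<close> still dominates \<open>|y(t)|^2\<close> comes from a second use of Bessel's
  inequality, for the \<open>f_i\<close> alone, bounding those blocks by the integrals of
  \<open>y^T Q_i y\<close>. Two analytic obstacles shape the rest. The initial function is merely
  continuous, so an integral of \<open>f_i(\<tau>) y(t + \<tau>)\<close> cannot be differentiated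
  through \<open>y\<close>; it is integrated by parts against an antiderivative of \<open>y\<close>,
  the weak derivative falling on \<open>f_i\<close>. And \<open>v'\<close> is known only at almost
  every \<open>t\<close>, so decay needs absolute continuity of \<open>v\<close> along trajectories.
  The term with \<open>\<rho>\<close> is added because the matrix inequality is only asked for a
  margin in \<open>|y(t)|^2\<close>, while \<open>v\<close> is bounded above by
  \<open>|y(t)|^2\<close> plus the integral of \<open>|y|^2\<close> over the window; its derivative
  contributes minus that integral.\<close>

definition vconcat :: "real Matrix.vec list \<Rightarrow> real Matrix.vec" where
  "vconcat vs = foldr (@\<^sub>v) vs (0\<^sub>v 0)"

lemma vconcat_simps [simp]:
  "vconcat [] = 0\<^sub>v 0"
  "vconcat (v # vs) = v @\<^sub>v vconcat vs"
  by (simp_all add: vconcat_def)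

lemma dim_vconcat [simp]: "dim_vec (vconcat vs) = (\<Sum>v\<leftarrow>vs. dim_vec v)"
  by (induction vs) auto

lemma append_zero_vec [simp]: "v @\<^sub>v 0\<^sub>v 0 = v" "0\<^sub>v 0 @\<^sub>v v = v"
  by (auto intro!: eq_vecI)

lemma append_vec_assoc: "(u @\<^sub>v v) @\<^sub>v w = u @\<^sub>v (v @\<^sub>v w)"
  by (rule eq_vecI) auto

lemma vconcat_append: "vconcat (us @ vs) = vconcat us @\<^sub>v vconcat vs"
  by (induction us) (auto simp: append_vec_assoc)

lemma scalar_prod_append':
  fixes a b c d :: "real Matrix.vec"
  assumes "dim_vec a = dim_vec c" "dim_vec b = dim_vec d"
  shows "(a @\<^sub>v b) \<bullet> (c @\<^sub>v d) = a \<bullet> c + b \<bullet> d"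
  by (rule scalar_prod_append[of a "dim_vec a" b "dim_vec b" c d]; rule carrier_vecI; simp only: assms)

lemma scalar_prod_vconcat:
  "map dim_vec us = map dim_vec vs \<Longrightarrow> vconcat us \<bullet> vconcat vs = (\<Sum>(u, v)\<leftarrow>zip us vs. u \<bullet> v)"
proof (induction us arbitrary: vs)
  case (Cons u us)
  then obtain v vs' where "vs = v # vs'" by (cases vs) auto
  moreover from Cons.prems this have "dim_vec (vconcat us) = dim_vec (vconcat vs')" by simp
  ultimately show ?case using Cons by (simp add: scalar_prod_append')
qed (auto simp: scalar_prod_def)

lemma append_vec_add':
  fixes a b c d :: "real Matrix.vec"
  shows "dim_vec a = dim_vec c \<Longrightarrow> dim_vec b = dim_vec d \<Longrightarrow> (a @\<^sub>v b) + (c @\<^sub>v d) = (a + c) @\<^sub>v (b + d)"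
  by (rule eq_vecI) auto

lemma vconcat_minus:
  assumes "\<And>i. i \<in> set is \<Longrightarrow> dim_vec (u i) = dim_vec (v i)"
  shows "vconcat (map u is) - vconcat (map v is) = vconcat (map (\<lambda>i. u i - v i) is)"
  using assms
proof (induction "is")
  case (Cons i "is")
  have "dim_vec (vconcat (map u is)) = dim_vec (vconcat (map v is))"
    using Cons by (auto intro!: arg_cong[where f = sum_list])
  then have "(u i @\<^sub>v vconcat (map u is)) - (v i @\<^sub>v vconcat (map v is))
      = (u i - v i) @\<^sub>v (vconcat (map u is) - vconcat (map v is))"
    using Cons.prems by (intro eq_vecI) auto
  with Cons show ?case by simp
qed auto

lemma mult_mat_vec_index: "l < dim_row A \<Longrightarrow> dim_vec v = dim_col A \<Longrightarrow>
    ((A :: real mat) *\<^sub>v v) $ l = (\<Sum>j<dim_col A. A $$ (l, j) * v $ j)"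
  by (auto simp: scalar_prod_def atLeast0LessThan intro!: sum.cong)

lemma hcat_Nil: "hcat [] = 0\<^sub>m 0 0"
  by (simp add: hcat_def)

lemma hcat_Cons: "hcat (A # As) = four_block_mat A (hcat As) (0\<^sub>m 0 (dim_col A)) (0\<^sub>m 0 (dim_col (hcat As)))"
  by (simp add: hcat_def)

lemma dim_hcat: "dim_col (hcat As) = (\<Sum>A\<leftarrow>As. dim_col A)" "As \<noteq> [] \<Longrightarrow> dim_row (hcat As) = dim_row (hd As)"
  by (induction As) (auto simp: hcat_Nil hcat_Cons)

text \<open>Stated entrywise so that the sum over the blocks is a \<open>sum_list\<close> of reals;
  vectors of all dimensions together have no common zero to sum from.\<close>

lemma hcat_mult_vec:
  assumes "As \<noteq> []" "\<And>A. A \<in> set As \<Longrightarrow> dim_row A = r" "map dim_col As = map dim_vec vs"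
  shows "hcat As *\<^sub>v vconcat vs = Matrix.vec r (\<lambda>l. \<Sum>(A, v)\<leftarrow>zip As vs. (A *\<^sub>v v) $ l)"
  using assms
proof (induction As arbitrary: vs)
  case (Cons A As)
  then obtain v us where vs: "vs = v # us" by (cases vs) auto
  have dA: "dim_row A = r" "dim_vec v = dim_col A" and dd: "dim_vec (vconcat us) = dim_col (hcat As)"
    using Cons.prems vs by (auto simp: dim_hcat)
  show ?case
  proof (cases "As = []")
    case True
    then have "us = []" using Cons.prems vs by auto
    then show ?thesis using True vs dA
      by (auto intro!: eq_vecI simp: hcat_Cons hcat_Nil scalar_prod_def intro!: sum.cong)
  next
    case False
    have IH: "hcat As *\<^sub>v vconcat us = Matrix.vec r (\<lambda>l. \<Sum>(A, v)\<leftarrow>zip As us. (A *\<^sub>v v) $ l)"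
      using Cons False vs by auto
    have dr: "dim_row (hcat As) = r" using False Cons.prems by (auto simp: dim_hcat)
    have "hcat (A # As) *\<^sub>v (v @\<^sub>v vconcat us) = (A *\<^sub>v v + hcat As *\<^sub>v vconcat us) @\<^sub>v
      (0\<^sub>m 0 (dim_col A) *\<^sub>v v + 0\<^sub>m 0 (dim_col (hcat As)) *\<^sub>v vconcat us)"
      unfolding hcat_Cons
      by (rule four_block_mat_mult_vec[of _ r "dim_col A" _ "dim_col (hcat As)" _ 0])
        (use dA dd dr in \<open>auto intro!: carrier_matI carrier_vecI\<close>)
    also have "\<dots> = A *\<^sub>v v + hcat As *\<^sub>v vconcat us" by (rule eq_vecI) auto
    finally show ?thesis using dA by (auto simp: vs IH intro!: eq_vecI)
  qed
qed auto

lemma vcat_Nil: "vcat [] = 0\<^sub>m 0 0"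
  by (simp add: vcat_def)

lemma vcat_Cons: "vcat (A # As) = A @\<^sub>r vcat As"
  by (simp add: vcat_def)

lemma dim_vcat: "dim_row (vcat As) = (\<Sum>A\<leftarrow>As. dim_row A)" "As \<noteq> [] \<Longrightarrow> dim_col (vcat As) = dim_col (hd As)"
  by (induction As) (auto simp: vcat_Nil vcat_Cons append_rows_def)

lemma vcat_mult_vec:
  assumes "As \<noteq> []" "\<And>A. A \<in> set As \<Longrightarrow> dim_col A = dim_vec u"
  shows "vcat As *\<^sub>v u = vconcat (map (\<lambda>A. A *\<^sub>v u) As)"
  using assms
proof (induction As)
  case (Cons A As)
  show ?case
  proof (cases "As = []")
    case True
    then show ?thesis using Cons.prems
      by (auto intro!: eq_vecI sum.cong simp: vcat_Cons vcat_Nil append_rows_def scalar_prod_def)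
  next
    case False
    then have "dim_col (vcat As) = dim_vec u" using Cons.prems by (auto simp: dim_vcat)
    then have "(A @\<^sub>r vcat As) *\<^sub>v u = A *\<^sub>v u @\<^sub>v vcat As *\<^sub>v u"
      by (intro mat_mult_append[of _ "dim_row A" "dim_vec u" _ "dim_row (vcat As)"])
        (use Cons.prems in \<open>auto intro!: carrier_matI carrier_vecI\<close>)
    with Cons False show ?thesis by (simp add: vcat_Cons)
  qed
qed auto

lemma four_block_diag_mult_vec:
  assumes "dim_vec a = dim_col A" "dim_vec b = dim_col B"
  shows "four_block_mat A (0\<^sub>m (dim_row A) (dim_col B)) (0\<^sub>m (dim_row B) (dim_col A)) (B :: real mat) *\<^sub>v (a @\<^sub>v b)
      = A *\<^sub>v a @\<^sub>v B *\<^sub>v b"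
proof -
  have "four_block_mat A (0\<^sub>m (dim_row A) (dim_col B)) (0\<^sub>m (dim_row B) (dim_col A)) B *\<^sub>v (a @\<^sub>v b)
      = (A *\<^sub>v a + 0\<^sub>m (dim_row A) (dim_col B) *\<^sub>v b) @\<^sub>v (0\<^sub>m (dim_row B) (dim_col A) *\<^sub>v a + B *\<^sub>v b)"
    by (rule four_block_mat_mult_vec[of _ "dim_row A" "dim_col A" _ "dim_col B" _ "dim_row B"])
      (use assms in \<open>auto intro!: carrier_matI carrier_vecI\<close>)
  also have "\<dots> = A *\<^sub>v a @\<^sub>v B *\<^sub>v b" using assms by (intro eq_vecI) (auto simp: scalar_prod_def)
  finally show ?thesis .
qed

lemma dim_diag_block_mat':
  "dim_row (diag_block_mat As) = (\<Sum>A\<leftarrow>As. dim_row A)" "dim_col (diag_block_mat As) = (\<Sum>A\<leftarrow>As. dim_col A)"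
  by (simp_all add: dim_diag_block_mat)

lemma diag_mult_vec:
  assumes "map dim_col As = map dim_vec vs"
  shows "diag_block_mat As *\<^sub>v vconcat vs = vconcat (map (\<lambda>(A, v). A *\<^sub>v v) (zip As vs))"
  using assms
proof (induction As arbitrary: vs)
  case (Cons A As)
  then obtain v us where vs: "vs = v # us" by (cases vs) auto
  have "dim_vec (vconcat us) = dim_col (diag_block_mat As)"
    using Cons.prems vs by (auto simp: dim_diag_block_mat')
  then show ?case using Cons vs four_block_diag_mult_vec[of v A "vconcat us" "diag_block_mat As"]
    by (simp add: Let_def)
qed (auto intro!: eq_vecI)

lemma diag_mult_vec_map:
  assumes "\<And>i. i \<in> set is \<Longrightarrow> dim_col (A i) = dim_vec (v i)"
  shows "diag_block_mat (map A is) *\<^sub>v vconcat (map v is) = vconcat (map (\<lambda>i. A i *\<^sub>v v i) is)"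
  using assms by (subst diag_mult_vec) (auto simp: zip_map_map zip_same_conv_map comp_def)

lemma scalar_prod_vconcat_map:
  assumes "\<And>i. i \<in> set is \<Longrightarrow> dim_vec (u i) = dim_vec (v i)"
  shows "vconcat (map u is) \<bullet> vconcat (map v is) = (\<Sum>i\<leftarrow>is. u i \<bullet> v i)"
  using assms by (subst scalar_prod_vconcat) (auto simp: zip_map_map zip_same_conv_map comp_def)

subsection \<open>Vectors of equally sized blocks and Kronecker products\<close>

text \<open>A \<open>k\<close> by \<open>n\<close> array read row by row. The first index is the
  outer one, as for the left factor of \<open>kron\<close>, so Kronecker products act on the two
  indices separately.\<close>

definition blk :: "nat \<Rightarrow> nat \<Rightarrow> (nat \<Rightarrow> nat \<Rightarrow> real) \<Rightarrow> real Matrix.vec" where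
  "blk k n c = Matrix.vec (k * n) (\<lambda>i. c (i div n) (i mod n))"

lemma dim_blk [simp]: "dim_vec (blk k n c) = k * n"
  by (simp add: blk_def)

text \<open>The range below \<open>k * n\<close> is cut into \<open>k\<close> consecutive stretches
  of length \<open>n\<close>, on each of which the quotient is constant.\<close>

lemma sum_div_mod:
  fixes f :: "nat \<Rightarrow> nat \<Rightarrow> real"
  shows "(\<Sum>i<k * n. f (i div n) (i mod n)) = (\<Sum>j<k. \<Sum>l<n. f j l)"
proof -
  have "(\<Sum>i<k * n. f (i div n) (i mod n)) = (\<Sum>j<k. \<Sum>i\<in>{j*n..<j*n+n}. f (i div n) (i mod n))"
    by (rule sum.nat_group[symmetric])
  also have "\<dots> = (\<Sum>j<k. \<Sum>l<n. f j l)"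
  proof (rule sum.cong[OF refl])
    fix j
    have "(\<Sum>i\<in>{j*n..<j*n+n}. f (i div n) (i mod n)) = (\<Sum>l<n. f ((j*n+l) div n) ((j*n+l) mod n))"
      by (rule sum.reindex_bij_witness[of _ "\<lambda>l. j*n+l" "\<lambda>i. i - j*n"]) auto
    also have "\<dots> = (\<Sum>l<n. f j l)"
      by (rule sum.cong) auto
    finally show "(\<Sum>i\<in>{j*n..<j*n+n}. f (i div n) (i mod n)) = (\<Sum>l<n. f j l)" .
  qed
  finally show ?thesis .
qed

lemma scalar_prod_blk: "blk k n c \<bullet> blk k n d = (\<Sum>j<k. \<Sum>l<n. c j l * d j l)"
proof -
  have "blk k n c \<bullet> blk k n d = (\<Sum>i<k*n. c (i div n) (i mod n) * d (i div n) (i mod n))"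
    by (auto simp: scalar_prod_def blk_def atLeast0LessThan intro!: sum.cong)
  then show ?thesis by (simp add: sum_div_mod[of "\<lambda>j l. c j l * d j l"])
qed

lemma div_mod_less: "i < k * n \<Longrightarrow> i div n < k \<and> i mod n < (n::nat)"
  by (metis less_mult_imp_div_less mod_less_divisor mult_0_right not_less_zero gr0I)

lemma blk_cong: "(\<And>j l. j < k \<Longrightarrow> l < n \<Longrightarrow> c j l = d j l) \<Longrightarrow> blk k n c = blk k n d"
  unfolding blk_def by (intro eq_vecI) (auto simp: div_mod_less)

lemma blk_add: "blk k n c + blk k n d = blk k n (\<lambda>j l. c j l + d j l)"
  by (rule eq_vecI) (auto simp: blk_def)

lemma kron_dim [simp]: "dim_row (kron A B) = dim_row A * dim_row B" "dim_col (kron A B) = dim_col A * dim_col B"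
  by (simp_all add: kron_def)

lemma kron_mult_blk:
  "kron A B *\<^sub>v blk (dim_col A) (dim_col B) c = blk (dim_row A) (dim_row B)
     (\<lambda>r s. \<Sum>j<dim_col A. \<Sum>l<dim_col B. A $$ (r, j) * B $$ (s, l) * c j l)"
proof (rule eq_vecI)
  fix i assume "i < dim_vec (blk (dim_row A) (dim_row B) (\<lambda>r s. \<Sum>j<dim_col A. \<Sum>l<dim_col B. A $$ (r, j) * B $$ (s, l) * c j l))"
  then have i: "i < dim_row A * dim_row B" by simp
  have "(kron A B *\<^sub>v blk (dim_col A) (dim_col B) c) $ i = (\<Sum>j<dim_col A * dim_col B. 
     A $$ (i div dim_row B, j div dim_col B) * B $$ (i mod dim_row B, j mod dim_col B) * c (j div dim_col B) (j mod dim_col B))"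
    using i by (subst mult_mat_vec_index) (auto simp: kron_def blk_def)
  then show "(kron A B *\<^sub>v blk (dim_col A) (dim_col B) c) $ i
     = blk (dim_row A) (dim_row B) (\<lambda>r s. \<Sum>j<dim_col A. \<Sum>l<dim_col B. A $$ (r, j) * B $$ (s, l) * c j l) $ i"
    using i by (simp add: blk_def sum_div_mod[of "\<lambda>j l. A $$ (i div dim_row B, j) * B $$ (i mod dim_row B, l) * c j l"])
qed simp

text \<open>An identity on the right leaves the inner index alone, so the product is
  \<open>A\<close> applied to each of the \<open>n\<close> slices of the array.\<close>

lemma kron_one_right:
  assumes "dim_col A = k"
  shows "kron A (1\<^sub>m n) *\<^sub>v blk k n c = blk (dim_row A) n (\<lambda>r l. (A *\<^sub>v Matrix.vec k (\<lambda>j. c j l)) $ r)"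
proof -
  have "kron A (1\<^sub>m n) *\<^sub>v blk k n c = blk (dim_row A) n (\<lambda>r s. \<Sum>j<k. \<Sum>l<n. A $$ (r, j) * 1\<^sub>m n $$ (s, l) * c j l)"
    using kron_mult_blk[of A "1\<^sub>m n" c] assms by simp
  also have "\<dots> = blk (dim_row A) n (\<lambda>r l. (A *\<^sub>v Matrix.vec k (\<lambda>j. c j l)) $ r)"
  proof (rule blk_cong)
    fix r s assume "r < dim_row A" "s < n"
    then have "(\<Sum>l<n. A $$ (r, j) * 1\<^sub>m n $$ (s, l) * c j l) = A $$ (r, j) * c j s" for j
      by (subst sum.remove[of _ s]) (auto intro!: sum.neutral)
    then show "(\<Sum>j<k. \<Sum>l<n. A $$ (r, j) * 1\<^sub>m n $$ (s, l) * c j l) = (A *\<^sub>v Matrix.vec k (\<lambda>j. c j s)) $ r"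
      using \<open>r < _\<close> assms by (simp add: mult_mat_vec_index del: index_mult_mat_vec)
  qed
  finally show ?thesis .
qed

text \<open>An identity on the left leaves the outer index alone, so the product is \<open>B\<close>
  applied to each of the \<open>k\<close> rows of the array.\<close>

lemma kron_one_left:
  assumes "dim_col B = n"
  shows "kron (1\<^sub>m k) B *\<^sub>v blk k n c = blk k (dim_row B) (\<lambda>j s. (B *\<^sub>v Matrix.vec n (c j)) $ s)"
proof -
  have "kron (1\<^sub>m k) B *\<^sub>v blk k n c = blk k (dim_row B) (\<lambda>r s. \<Sum>j<k. \<Sum>l<n. 1\<^sub>m k $$ (r, j) * B $$ (s, l) * c j l)"
    using kron_mult_blk[of "1\<^sub>m k" B c] assms by simp
  also have "\<dots> = blk k (dim_row B) (\<lambda>j s. (B *\<^sub>v Matrix.vec n (c j)) $ s)"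
  proof (rule blk_cong)
    fix r s assume "r < k" "s < dim_row B"
    then have "(\<Sum>j<k. \<Sum>l<n. 1\<^sub>m k $$ (r, j) * B $$ (s, l) * c j l) = (\<Sum>l<n. B $$ (s, l) * c r l)"
      by (subst sum.remove[of _ r]) (auto intro!: sum.neutral)
    then show "(\<Sum>j<k. \<Sum>l<n. 1\<^sub>m k $$ (r, j) * B $$ (s, l) * c j l) = (B *\<^sub>v Matrix.vec n (c r)) $ s"
      using \<open>s < _\<close> assms by (simp add: mult_mat_vec_index del: index_mult_mat_vec)
  qed
  finally show ?thesis .
qed

lemma blk_append:
  "blk (k1 + k2) n c = blk k1 n c @\<^sub>v blk k2 n (\<lambda>j l. c (k1 + j) l)"
proof (rule eq_vecI)
  fix i assume "i < dim_vec (blk k1 n c @\<^sub>v blk k2 n (\<lambda>j l. c (k1 + j) l))"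
  then have i: "i < k1 * n + k2 * n" by simp
  show "blk (k1 + k2) n c $ i = (blk k1 n c @\<^sub>v blk k2 n (\<lambda>j l. c (k1 + j) l)) $ i"
  proof (cases "i < k1 * n")
    case True
    then show ?thesis using i by (auto simp: blk_def algebra_simps)
  next
    case False
    then obtain k where k: "i = k1 * n + k" using le_Suc_ex not_less by blast
    have "0 < n" using i by (auto intro: Nat.gr0I)
    then show ?thesis using i False k by (auto simp: blk_def algebra_simps)
  qed
qed (simp add: algebra_simps)

text \<open>Needed because matrices such as \<open>boldM S G\<close> act on the coefficients of all
  families at once, slice by slice, whereas the vectors of the inequality list one block per
  family.\<close>

lemma blk_vconcat:
  assumes "\<And>i l. i \<in> set is \<Longrightarrow> dim_vec (C i l) = k i"
  shows "blk (\<Sum>i\<leftarrow>is. k i) n (\<lambda>j l. vconcat (map (\<lambda>i. C i l) is) $ j)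
       = vconcat (map (\<lambda>i. blk (k i) n (\<lambda>j l. C i l $ j)) is)"
  using assms
proof (induction "is")
  case (Cons a "is")
  have d: "dim_vec (vconcat (map (\<lambda>i. C i l) is)) = (\<Sum>i\<leftarrow>is. k i)" for l
    using Cons.prems by (auto intro!: arg_cong[where f = sum_list])
  have "blk (k a) n (\<lambda>j l. vconcat (map (\<lambda>i. C i l) (a # is)) $ j) = blk (k a) n (\<lambda>j l. C a l $ j)"
    using Cons.prems by (intro blk_cong) auto
  moreover have "blk (\<Sum>i\<leftarrow>is. k i) n (\<lambda>j l. vconcat (map (\<lambda>i. C i l) (a # is)) $ (k a + j))
     = blk (\<Sum>i\<leftarrow>is. k i) n (\<lambda>j l. vconcat (map (\<lambda>i. C i l) is) $ j)"
    using Cons.prems d by (intro blk_cong) auto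
  ultimately show ?case using Cons by (simp add: blk_append del: vconcat_simps) simp
qed (auto simp: blk_def)

lemma blk_1: "blk (Suc 0) n c = Matrix.vec n (c 0)"
  by (rule eq_vecI) (auto simp: blk_def)

subsection \<open>Definite matrices and inverses\<close>

text \<open>\<open>minv\<close> takes the result of an inversion procedure that may fail.
  Invertibility makes \<open>A\<close> a unit of the matrix ring, and this excludes failure.\<close>

lemma minv_works:
  assumes "A \<in> carrier_mat n n" "invertible_mat A"
  shows "minv A \<in> carrier_mat n n" "A * minv A = 1\<^sub>m n" "minv A * A = 1\<^sub>m n"
proof -
  obtain B where B: "inverts_mat A B" "inverts_mat B A"
    using assms unfolding invertible_mat_def by blast
  have "dim_row B = n" "dim_col B = n"
    using B assms unfolding inverts_mat_def
    by (metis carrier_matD index_mult_mat(2,3) index_one_mat(2,3))+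
  then have "A \<in> Units (ring_mat TYPE(real) n ())"
    using assms B unfolding inverts_mat_def Units_def ring_mat_def by (auto intro!: bexI[of _ B])
  then obtain C where C: "mat_inverse A = Some C"
    using mat_inverse(1)[OF assms(1), where b = "()"] by (cases "mat_inverse A") auto
  then show "minv A \<in> carrier_mat n n" "A * minv A = 1\<^sub>m n" "minv A * A = 1\<^sub>m n"
    using mat_inverse(2)[OF assms(1) C] unfolding minv_def by auto
qed

lemma invertible_mat_of_det:
  assumes "A \<in> carrier_mat n n" "Determinant.det A \<noteq> (0::real)"
  shows "invertible_mat A"
  using det_non_zero_imp_unit[OF assms, of "()"] assms(1)
  unfolding Units_def ring_mat_def invertible_mat_def inverts_mat_def square_mat.simps
  by auto

text \<open>The determinant of a triangular matrix is the product of its diagonal entries, all of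
  which are positive here.\<close>

lemma cholesky_invertible:
  assumes "cholesky_factor A L"
  shows "L \<in> carrier_mat (dim_row A) (dim_row A)" "invertible_mat L" "A = L * L\<^sup>T"
proof -
  define n where "n = dim_row A"
  have L: "L \<in> carrier_mat n n" and up: "upper_triangular (L\<^sup>T)"
    and pos: "\<And>i. i < n \<Longrightarrow> L $$ (i, i) > 0" and "A = L * L\<^sup>T"
    using assms unfolding cholesky_factor_def n_def by blast+
  then show "L \<in> carrier_mat (dim_row A) (dim_row A)" "A = L * L\<^sup>T" by (simp_all only: n_def)
  have "Determinant.det L = Determinant.det (L\<^sup>T)" using det_transpose[OF L] by simp
  also have "\<dots> = prod_list (diag_mat (L\<^sup>T))"
    by (rule det_upper_triangular[OF up, of n]) (use L in simp)
  also have "\<dots> \<noteq> 0"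
    using pos L by (fastforce simp: prod_list_zero_iff diag_mat_def)
  finally show "invertible_mat L" by (rule invertible_mat_of_det[OF L])
qed

lemma mult_mat_vec_zero: "(A :: real mat) \<in> carrier_mat m k \<Longrightarrow> A *\<^sub>v 0\<^sub>v k = 0\<^sub>v m"
  by (rule eq_vecI) auto

lemma pos_def_pos: "pos_def A \<Longrightarrow> A \<in> carrier_mat k k \<Longrightarrow> v \<in> carrier_vec k \<Longrightarrow> v \<noteq> 0\<^sub>v k \<Longrightarrow> v \<bullet> (A *\<^sub>v v) > 0"
  by (auto simp: pos_def_def)

lemma pos_def_nonneg:
  assumes "pos_def A" "A \<in> carrier_mat k k" "v \<in> carrier_vec k"
  shows "v \<bullet> (A *\<^sub>v v) \<ge> 0"
proof (cases "v = 0\<^sub>v k")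
  case True
  then show ?thesis using assms by (auto simp: scalar_prod_def)
next
  case False
  then show ?thesis using pos_def_pos[OF assms] by simp
qed

lemma pos_def_invertible:
  assumes "pos_def A" "A \<in> carrier_mat k k"
  shows "invertible_mat A"
proof (rule invertible_mat_of_det[OF assms(2)])
  show "Determinant.det A \<noteq> 0"
  proof
    assume "Determinant.det A = 0"
    then obtain v where v: "v \<in> carrier_vec k" "v \<noteq> 0\<^sub>v k" "A *\<^sub>v v = 0\<^sub>v k"
      using det_0_iff_vec_prod_zero_field[OF assms(2)] by blast
    then show False using pos_def_pos[OF assms v(1,2)] by simp
  qed
qed

lemma symmetric_form:
  assumes "(A :: real mat)\<^sup>T = A" "A \<in> carrier_mat k k" "u \<in> carrier_vec k" "v \<in> carrier_vec k"
  shows "u \<bullet> (A *\<^sub>v v) = v \<bullet> (A *\<^sub>v u)"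
  using transpose_vec_mult_scalar[OF assms(2) assms(4,3)] assms
  by (metis comm_scalar_prod mult_mat_vec_carrier)

text \<open>Cauchy--Schwarz in the inner product of \<open>A\<close>, applied to \<open>v\<close> and \<open>A\<inverse> e\<^sub>l\<close>.\<close>

lemma pos_def_coord_bound:
  assumes pd: "pos_def A" and A: "A \<in> carrier_mat k k" and l: "l < k"
  shows "\<exists>C>0. \<forall>v\<in>carrier_vec k. (v $ l)\<^sup>2 \<le> C * (v \<bullet> (A *\<^sub>v v))"
proof -
  have sym: "A\<^sup>T = A" using pd by (auto simp: pos_def_def symmetric_mats_def)
  note inv = minv_works[OF A pos_def_invertible[OF pd A]]
  define u where "u = minv A *\<^sub>v unit_vec k l"
  have u: "u \<in> carrier_vec k" unfolding u_def using inv by auto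
  have Au: "A *\<^sub>v u = unit_vec k l"
    unfolding u_def by (subst assoc_mult_mat_vec[symmetric, OF A inv(1)]) (use inv in auto)
  define C where "C = u \<bullet> (A *\<^sub>v u)"
  have "u \<noteq> 0\<^sub>v k"
  proof
    assume "u = 0\<^sub>v k"
    then have "unit_vec k l = (0\<^sub>v k :: real Matrix.vec)"
      using Au A by (metis mult_mat_vec_zero)
    then show False using l by (metis index_unit_vec(1) index_zero_vec(1) zero_neq_one)
  qed
  then have C: "C > 0" unfolding C_def using pos_def_pos[OF pd A u] by simp
  have "(v $ l)\<^sup>2 \<le> C * (v \<bullet> (A *\<^sub>v v))" if v: "v \<in> carrier_vec k" for v
  proof -
    define s where "s = v $ l / C"
    have vl: "v \<bullet> (A *\<^sub>v u) = v $ l" unfolding Au using v l by simp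
    have ul: "u \<bullet> (A *\<^sub>v v) = v $ l" using symmetric_form[OF sym A u v] vl by simp
    have "0 \<le> (v - s \<cdot>\<^sub>v u) \<bullet> (A *\<^sub>v (v - s \<cdot>\<^sub>v u))"
      using u v by (intro pos_def_nonneg[OF pd A]) auto
    also have "A *\<^sub>v (v - s \<cdot>\<^sub>v u) = A *\<^sub>v v - s \<cdot>\<^sub>v (A *\<^sub>v u)"
      using u v A by (simp add: mult_minus_distrib_mat_vec mult_mat_vec)
    also have "(v - s \<cdot>\<^sub>v u) \<bullet> (A *\<^sub>v v - s \<cdot>\<^sub>v (A *\<^sub>v u))
       = v \<bullet> (A *\<^sub>v v) - s * (v \<bullet> (A *\<^sub>v u)) - s * (u \<bullet> (A *\<^sub>v v)) + s * s * (u \<bullet> (A *\<^sub>v u))"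
    proof -
      have c: "A *\<^sub>v v \<in> carrier_vec k" "A *\<^sub>v u \<in> carrier_vec k" using A u v by auto
      show ?thesis using c u v
        by (simp add: scalar_prod_minus_distrib[of _ k] minus_scalar_prod_distrib[of _ k] algebra_simps)
    qed
    also have "\<dots> = v \<bullet> (A *\<^sub>v v) - 2 * s * (v $ l) + s * s * C"
      by (simp add: vl ul C_def)
    also have "\<dots> = v \<bullet> (A *\<^sub>v v) - (v $ l)\<^sup>2 / C"
      using C by (simp add: s_def power2_eq_square field_simps)
    finally show ?thesis using C by (simp add: field_simps)
  qed
  then show ?thesis using C by blast
qed

lemma Sy_form:
  assumes "A \<in> carrier_mat k k" "v \<in> carrier_vec k"
  shows "v \<bullet> (Sy A *\<^sub>v v) = 2 * (v \<bullet> (A *\<^sub>v v))"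
proof -
  have "Sy A *\<^sub>v v = A *\<^sub>v v + A\<^sup>T *\<^sub>v v" unfolding Sy_def
    using assms by (intro add_mult_distrib_mat_vec[of _ k k]) auto
  moreover have "v \<bullet> (A\<^sup>T *\<^sub>v v) = v \<bullet> (A *\<^sub>v v)"
    using transpose_vec_mult_scalar[OF assms(1,2,2)] assms
    by (metis comm_scalar_prod mult_mat_vec_carrier transpose_carrier_mat)
  ultimately show ?thesis using assms by (simp add: scalar_prod_add_distrib[of _ k])
qed

lemma scalar_prod_self_pos:
  assumes "(v :: real Matrix.vec) \<in> carrier_vec n" "v \<noteq> 0\<^sub>v n"
  shows "v \<bullet> v > 0"
proof -
  obtain i where i: "i < n" "v $ i \<noteq> 0" using assms by (metis carrier_vecD eq_vecI index_zero_vec)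
  then have "0 < (\<Sum>j\<in>{0..<n}. v $ j * v $ j)"
    by (intro sum_pos2[of _ i]) (auto simp: zero_less_mult_iff)
  then show ?thesis using assms by (simp add: scalar_prod_def)
qed

text \<open>The whole matrix is tested on the vector that equals \<open>v\<close> in block
  \<open>i\<close> and vanishes in the other blocks; every other term of the form is then
  zero.\<close>

lemma pos_def_diag_block:
  assumes "pos_def (diag_block_mat (map Q is))" "\<And>i. i \<in> set is \<Longrightarrow> Q i \<in> carrier_mat n n"
    "i \<in> set is" "distinct is" "(Q i)\<^sup>T = Q i"
  shows "pos_def (Q i)"
proof -
  have "v \<bullet> (Q i *\<^sub>v v) > 0" if v: "v \<in> carrier_vec n" "v \<noteq> 0\<^sub>v n" for v
  proof -
    define w where "w j = (if j = i then v else 0\<^sub>v n)" for j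
    let ?D = "diag_block_mat (map Q is)"
    have wc: "w j \<in> carrier_vec n" for j using v by (simp add: w_def)
    have dw: "dim_vec (vconcat (map w is)) = dim_row ?D" "dim_row ?D = dim_col ?D"
      using assms(2) wc
      by (auto simp: dim_diag_block_mat' comp_def carrier_matD(1,2)[of _ n n] carrier_vecD[of _ n]
          intro!: arg_cong[where f = sum_list])
    \<comment> \<open>The self-product is a convenient certificate that the padded vector is
      nonzero.\<close>
    have "vconcat (map w is) \<bullet> vconcat (map w is) = (\<Sum>j\<leftarrow>is. w j \<bullet> w j)"
      by (rule scalar_prod_vconcat_map) auto
    also have "\<dots> = (\<Sum>j\<in>set is. w j \<bullet> w j)" using assms(4) by (simp add: sum_list_distinct_conv_sum_set)
    also have "\<dots> = v \<bullet> v" using assms(3) by (subst sum.remove[of _ i]) (auto simp: w_def intro!: sum.neutral)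
    also have "\<dots> \<noteq> 0" using scalar_prod_self_pos[OF v] by simp
    finally have "vconcat (map w is) \<noteq> 0\<^sub>v (dim_row ?D)"
      by (metis scalar_prod_left_zero carrier_vec_dim_vec dw(1))
    then have "0 < vconcat (map w is) \<bullet> (?D *\<^sub>v vconcat (map w is))"
      using assms(1) dw unfolding pos_def_def by (auto intro!: carrier_vecI)
    also have "?D *\<^sub>v vconcat (map w is) = vconcat (map (\<lambda>j. Q j *\<^sub>v w j) is)"
      by (rule diag_mult_vec_map) (simp add: carrier_matD(2)[OF assms(2)] carrier_vecD[OF wc])
    also have "vconcat (map w is) \<bullet> \<dots> = (\<Sum>j\<leftarrow>is. w j \<bullet> (Q j *\<^sub>v w j))"
      by (rule scalar_prod_vconcat_map) (simp add: carrier_matD(1)[OF assms(2)] carrier_vecD[OF wc])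
    also have "\<dots> = (\<Sum>j\<in>set is. w j \<bullet> (Q j *\<^sub>v w j))" using assms(4) by (simp add: sum_list_distinct_conv_sum_set)
    also have "\<dots> = v \<bullet> (Q i *\<^sub>v v)" using assms(3)
      by (subst sum.remove[of _ i]) (auto simp: w_def mult_mat_vec_zero[OF assms(2)] intro!: sum.neutral)
    finally show ?thesis .
  qed
  then show ?thesis using assms(2,3,5) unfolding pos_def_def symmetric_mats_def
    by (metis (mono_tags, lifting) carrier_matD(1) mem_Collect_eq)
qed

subsection \<open>Absolutely continuous functions\<close>

lemma abs_cont_onD:
  assumes "abs_cont_on a b f" "0 < \<epsilon>"
  obtains \<delta> where "0 < \<delta>" "\<And>\<D> U. \<D> division_of U \<Longrightarrow> U \<subseteq> {a..b} \<Longrightarrow> (\<Sum>k\<in>\<D>. Sup k - Inf k) < \<delta> \<Longrightarrow>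
        (\<Sum>k\<in>\<D>. norm (f (Sup k) - f (Inf k))) < \<epsilon>"
  using assms unfolding abs_cont_on_def by meson

lemma division_of_real_interval:
  assumes "\<D> division_of U" "k \<in> \<D>" "U \<subseteq> {a..b::real}"
  obtains u v where "k = {u..v}" "u \<le> v" "Inf k = u" "Sup k = v" "a \<le> u" "v \<le> b"
proof -
  obtain u v where k: "k = {u..v}" "k \<noteq> {}" "k \<subseteq> U"
    using division_ofD(2,3,4)[OF assms(1,2)] by (metis box_real(2))
  then have "u \<le> v" by simp
  then show ?thesis using that[of u v] k assms(3) by (auto simp: subset_iff)
qed

text \<open>The common source of the closure properties below: scalar multiples, bounded linear
  images and functions agreeing on the interval all have increments controlled in this way.\<close>

lemma abs_cont_on_dominated:
  assumes "abs_cont_on a b f" and "C \<ge> 0"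
    and "\<And>u v. a \<le> u \<Longrightarrow> u \<le> v \<Longrightarrow> v \<le> b \<Longrightarrow> norm (g v - g u) \<le> C * (norm (f v - f u))"
  shows "abs_cont_on a b g"
  unfolding abs_cont_on_def
proof (intro allI impI)
  fix \<epsilon> :: real assume "0 < \<epsilon>"
  \<comment> \<open>Dividing by \<open>C + 1\<close> rather than \<open>C\<close> covers the case
    \<open>C = 0\<close>.\<close>
  then have e: "0 < \<epsilon> / (C + 1)" using assms(2) by simp
  obtain \<delta> where \<delta>: "0 < \<delta>" "\<And>\<D> U. \<D> division_of U \<Longrightarrow> U \<subseteq> {a..b} \<Longrightarrow> (\<Sum>k\<in>\<D>. Sup k - Inf k) < \<delta> \<Longrightarrow>
        (\<Sum>k\<in>\<D>. norm (f (Sup k) - f (Inf k))) < \<epsilon> / (C + 1)"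
    using abs_cont_onD[OF assms(1) e] by blast
  show "\<exists>\<delta>>0. \<forall>\<D> U. \<D> division_of U \<and> U \<subseteq> {a..b} \<and> (\<Sum>k\<in>\<D>. Sup k - Inf k) < \<delta> \<longrightarrow>
        (\<Sum>k\<in>\<D>. norm (g (Sup k) - g (Inf k))) < \<epsilon>"
  proof (intro exI[of _ \<delta>] conjI allI impI \<delta>(1))
    fix \<D> U assume D: "\<D> division_of U \<and> U \<subseteq> {a..b} \<and> (\<Sum>k\<in>\<D>. Sup k - Inf k) < \<delta>"
    have "(\<Sum>k\<in>\<D>. norm (g (Sup k) - g (Inf k))) \<le> (\<Sum>k\<in>\<D>. C * norm (f (Sup k) - f (Inf k)))"
    proof (rule sum_mono)
      fix k assume k: "k \<in> \<D>"
      obtain u v where "k = {u..v}" "u \<le> v" "Inf k = u" "Sup k = v" "a \<le> u" "v \<le> b"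
        by (rule division_of_real_interval[OF conjunct1[OF D] k conjunct1[OF conjunct2[OF D]]])
      then show "norm (g (Sup k) - g (Inf k)) \<le> C * norm (f (Sup k) - f (Inf k))"
        using assms(3) by metis
    qed
    also have "\<dots> = C * (\<Sum>k\<in>\<D>. norm (f (Sup k) - f (Inf k)))" by (simp add: sum_distrib_left)
    also have "\<dots> \<le> C * (\<epsilon> / (C + 1))"
      using \<delta>(2)[of \<D> U] D assms(2) by (intro mult_left_mono) auto
    also have "\<dots> < \<epsilon>" using \<open>0 < \<epsilon>\<close> assms(2) by (simp add: field_simps)
    finally show "(\<Sum>k\<in>\<D>. norm (g (Sup k) - g (Inf k))) < \<epsilon>" .
  qed
qed

lemma abs_cont_on_add_dominated:
  assumes "abs_cont_on a b f" "abs_cont_on a b g"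
    and "\<And>u v. a \<le> u \<Longrightarrow> u \<le> v \<Longrightarrow> v \<le> b \<Longrightarrow>
      norm (h v - h u) \<le> norm (f v - f u) + norm (g v - g u)"
  shows "abs_cont_on a b h"
  unfolding abs_cont_on_def
proof (intro allI impI)
  fix \<epsilon> :: real assume "0 < \<epsilon>"
  then have e: "0 < \<epsilon> / 2" by simp
  obtain \<delta>1 where \<delta>1: "0 < \<delta>1" "\<And>\<D> U. \<D> division_of U \<Longrightarrow> U \<subseteq> {a..b} \<Longrightarrow> (\<Sum>k\<in>\<D>. Sup k - Inf k) < \<delta>1 \<Longrightarrow>
        (\<Sum>k\<in>\<D>. norm (f (Sup k) - f (Inf k))) < \<epsilon> / 2"
    using abs_cont_onD[OF assms(1) e] by blast
  obtain \<delta>2 where \<delta>2: "0 < \<delta>2" "\<And>\<D> U. \<D> division_of U \<Longrightarrow> U \<subseteq> {a..b} \<Longrightarrow> (\<Sum>k\<in>\<D>. Sup k - Inf k) < \<delta>2 \<Longrightarrow>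
        (\<Sum>k\<in>\<D>. norm (g (Sup k) - g (Inf k))) < \<epsilon> / 2"
    using abs_cont_onD[OF assms(2) e] by blast
  show "\<exists>\<delta>>0. \<forall>\<D> U. \<D> division_of U \<and> U \<subseteq> {a..b} \<and> (\<Sum>k\<in>\<D>. Sup k - Inf k) < \<delta> \<longrightarrow>
        (\<Sum>k\<in>\<D>. norm (h (Sup k) - h (Inf k))) < \<epsilon>"
  proof (intro exI[of _ "min \<delta>1 \<delta>2"] conjI allI impI)
    show "0 < min \<delta>1 \<delta>2" using \<delta>1(1) \<delta>2(1) by simp
    fix \<D> U assume D: "\<D> division_of U \<and> U \<subseteq> {a..b} \<and> (\<Sum>k\<in>\<D>. Sup k - Inf k) < min \<delta>1 \<delta>2"
    have "(\<Sum>k\<in>\<D>. norm (h (Sup k) - h (Inf k)))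
        \<le> (\<Sum>k\<in>\<D>. norm (f (Sup k) - f (Inf k)) + norm (g (Sup k) - g (Inf k)))"
    proof (rule sum_mono)
      fix k assume k: "k \<in> \<D>"
      obtain u v where "k = {u..v}" "u \<le> v" "Inf k = u" "Sup k = v" "a \<le> u" "v \<le> b"
        by (rule division_of_real_interval[OF conjunct1[OF D] k conjunct1[OF conjunct2[OF D]]])
      then show "norm (h (Sup k) - h (Inf k)) \<le> norm (f (Sup k) - f (Inf k)) + norm (g (Sup k) - g (Inf k))"
        using assms(3) by metis
    qed
    also have "\<dots> < \<epsilon>"
      using \<delta>1(2)[of \<D> U] \<delta>2(2)[of \<D> U] D by (auto simp: sum.distrib)
    finally show "(\<Sum>k\<in>\<D>. norm (h (Sup k) - h (Inf k))) < \<epsilon>" .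
  qed
qed

text \<open>Compared with the identity function. The absolute value of \<open>C\<close> enters
  because no sign of \<open>C\<close> is assumed.\<close>

lemma abs_cont_on_lipschitz:
  assumes "\<And>u v. a \<le> u \<Longrightarrow> u \<le> v \<Longrightarrow> v \<le> b \<Longrightarrow> norm (f v - f u) \<le> C * (v - u)"
  shows "abs_cont_on a b f"
proof (rule abs_cont_on_dominated[of a b "\<lambda>t. t" "\<bar>C\<bar>"])
  show "abs_cont_on a b (\<lambda>t::real. t)"
    unfolding abs_cont_on_def
  proof (intro allI impI, rule exI, intro conjI allI impI, assumption)
    fix \<epsilon> :: real and \<D> U assume "0 < \<epsilon>"
      and D: "\<D> division_of U \<and> U \<subseteq> {a..b} \<and> (\<Sum>k\<in>\<D>. Sup k - Inf k) < \<epsilon>"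
    have "norm (Sup k - Inf k) = Sup k - Inf k" if k: "k \<in> \<D>" for k
    proof -
      obtain u v where "u \<le> v" "Inf k = u" "Sup k = v"
        by (rule division_of_real_interval[OF conjunct1[OF D] k conjunct1[OF conjunct2[OF D]]])
      then show ?thesis by simp
    qed
    then show "(\<Sum>k\<in>\<D>. norm (Sup k - Inf k)) < \<epsilon>" using D by simp
  qed
  fix u v assume uv: "a \<le> u" "u \<le> v" "v \<le> b"
  have "C * (v - u) \<le> \<bar>C\<bar> * (v - u)" using uv by (intro mult_right_mono) auto
  then show "norm (f v - f u) \<le> \<bar>C\<bar> * norm (v - u)" using assms[OF uv] uv by simp
qed auto

lemma abs_cont_on_continuous:
  assumes "abs_cont_on a b f"
  shows "continuous_on {a..b} f"
proof (rule continuous_onI)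
  fix t \<epsilon> :: real assume t: "t \<in> {a..b}" and "0 < \<epsilon>"
  then obtain \<delta> where \<delta>: "0 < \<delta>" "\<And>\<D> U. \<D> division_of U \<Longrightarrow> U \<subseteq> {a..b} \<Longrightarrow> (\<Sum>k\<in>\<D>. Sup k - Inf k) < \<delta> \<Longrightarrow>
        (\<Sum>k\<in>\<D>. norm (f (Sup k) - f (Inf k))) < \<epsilon>"
    using abs_cont_onD[OF assms] by blast
  \<comment> \<open>Absolute continuity is used for a division consisting of a single
    interval.\<close>
  have *: "norm (f v - f u) < \<epsilon>" if "a \<le> u" "u \<le> v" "v \<le> b" "v - u < \<delta>" for u v
    using \<delta>(2)[of "{{u..v}}" "{u..v}"] that division_of_self[of u v] by simp
  show "\<exists>d>0. \<forall>s\<in>{a..b}. dist s t < d \<longrightarrow> dist (f s) (f t) \<le> \<epsilon>"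
  proof (intro exI[of _ \<delta>] conjI ballI impI \<delta>(1))
    fix s assume s: "s \<in> {a..b}" "dist s t < \<delta>"
    show "dist (f s) (f t) \<le> \<epsilon>"
      using *[of s t] *[of t s] s t by (cases "s \<le> t") (auto simp: dist_norm norm_minus_commute)
  qed
qed

lemma abs_cont_on_cmult:
  fixes f :: "real \<Rightarrow> real"
  assumes "abs_cont_on a b f"
  shows "abs_cont_on a b (\<lambda>t. c * f t)"
  by (rule abs_cont_on_dominated[OF assms, of "\<bar>c\<bar>"]) (simp_all add: abs_mult right_diff_distrib[symmetric])

text \<open>On the compact interval both factors are bounded, so an increment of the product is at
  most a fixed combination of the increments of the factors.\<close>

lemma abs_cont_on_mult:
  fixes f g :: "real \<Rightarrow> real"
  assumes "abs_cont_on a b f" "abs_cont_on a b g"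
  shows "abs_cont_on a b (\<lambda>t. f t * g t)"
proof -
  have "bounded (f ` {a..b})" "bounded (g ` {a..b})"
    using assms by (auto intro!: compact_imp_bounded compact_continuous_image abs_cont_on_continuous)
  then obtain B1 B2 where B: "0 < B1" "0 < B2" "\<And>t. t \<in> {a..b} \<Longrightarrow> \<bar>f t\<bar> \<le> B1" "\<And>t. t \<in> {a..b} \<Longrightarrow> \<bar>g t\<bar> \<le> B2"
    unfolding bounded_pos by auto
  have "abs_cont_on a b (\<lambda>t. B2 * f t)" "abs_cont_on a b (\<lambda>t. B1 * g t)"
    by (intro abs_cont_on_cmult assms)+
  then show ?thesis
  proof (rule abs_cont_on_add_dominated)
    fix u v assume uv: "a \<le> u" "u \<le> v" "v \<le> b"
    have "f v * g v - f u * g u = g u * (f v - f u) + f v * (g v - g u)" by (simp add: algebra_simps)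
    then have "\<bar>f v * g v - f u * g u\<bar> \<le> \<bar>g u\<bar> * \<bar>f v - f u\<bar> + \<bar>f v\<bar> * \<bar>g v - g u\<bar>"
      by (metis abs_mult abs_triangle_ineq)
    also have "\<dots> \<le> B2 * \<bar>f v - f u\<bar> + B1 * \<bar>g v - g u\<bar>"
      using uv B(3)[of v] B(4)[of u] by (intro add_mono mult_right_mono) auto
    finally show "norm (f v * g v - f u * g u) \<le> norm (B2 * f v - B2 * f u) + norm (B1 * g v - B1 * g u)"
      using B(1,2) by (simp add: abs_mult right_diff_distrib[symmetric])
  qed
qed

lemma abs_cont_on_add:
  assumes "abs_cont_on a b f" "abs_cont_on a b g"
  shows "abs_cont_on a b (\<lambda>t. f t + g t)"
  by (rule abs_cont_on_add_dominated[OF assms]) (metis add_diff_add norm_triangle_ineq)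

lemma abs_cont_on_const: "abs_cont_on a b (\<lambda>t. c)"
  by (rule abs_cont_on_lipschitz[of _ _ _ 0]) simp

lemma abs_cont_on_sum:
  assumes "\<And>i. i \<in> A \<Longrightarrow> abs_cont_on a b (f i)"
  shows "abs_cont_on a b (\<lambda>t. \<Sum>i\<in>A. f i t)"
  using assms
  by (induction A rule: infinite_finite_induct) (auto intro: abs_cont_on_const abs_cont_on_add)

lemma abs_cont_on_bounded_linear:
  assumes "abs_cont_on a b f" "bounded_linear L"
  shows "abs_cont_on a b (\<lambda>t. L (f t))"
proof -
  interpret bounded_linear L by fact
  obtain K where "0 \<le> K" "\<And>x. norm (L x) \<le> norm x * K" using nonneg_bounded by blast
  then show ?thesis
    by (intro abs_cont_on_dominated[OF assms(1), of K]) (auto simp: diff[symmetric] mult.commute)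
qed

text \<open>
  Tags in the exceptional null set are confined to an open set of small measure, where absolute
  continuity controls the increments; all other tags carry a nonpositive derivative.
\<close>

lemma abs_cont_on_nonincreasing:
  fixes F :: "real \<Rightarrow> real"
  assumes ac: "abs_cont_on a b F" and ab: "a \<le> b"
    and ae: "AE t in lebesgue. a < t \<and> t < b \<longrightarrow> (\<exists>D\<le>0. (F has_real_derivative D) (at t))"
  shows "F b \<le> F a"
proof (rule field_le_epsilon)
  fix \<epsilon>' :: real assume e': "0 < \<epsilon>'"
  \<comment> \<open>The good tags contribute at most \<open>\<epsilon> (b - a)\<close> and the
    exceptional ones at most \<open>\<epsilon>\<close>, which together make
    \<open>\<epsilon>'\<close>.\<close>
  define \<epsilon> where "\<epsilon> = \<epsilon>' / (b - a + 1)"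
  have e: "0 < \<epsilon>" using e' ab by (simp add: \<epsilon>_def)
  define good where "good t \<longleftrightarrow> (\<exists>D\<le>0. (F has_real_derivative D) (at t))" for t
  have "\<exists>N\<in>null_sets lebesgue. \<forall>t. t \<notin> N \<longrightarrow> a < t \<and> t < b \<longrightarrow> good t"
    by (rule AE_E3[OF ae[folded good_def]]) (simp, blast)
  then obtain N where N: "\<And>t. t \<notin> N \<Longrightarrow> a < t \<and> t < b \<longrightarrow> good t" "N \<in> null_sets lebesgue"
    by blast
  \<comment> \<open>The end points join the exceptional set because the derivative is only given in
    the open interval.\<close>
  define N' where "N' = N \<union> {a, b}"
  have N': "N' \<in> null_sets lebesgue"
    using N(2) unfolding N'_def by (auto intro!: null_sets.Un simp: null_sets_completionI finite_imp_null_set_lborel)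
  obtain \<delta> where \<delta>: "0 < \<delta>" "\<And>\<D> U. \<D> division_of U \<Longrightarrow> U \<subseteq> {a..b} \<Longrightarrow> (\<Sum>k\<in>\<D>. Sup k - Inf k) < \<delta> \<Longrightarrow>
        (\<Sum>k\<in>\<D>. norm (F (Sup k) - F (Inf k))) < \<epsilon>"
    using abs_cont_onD[OF ac e] by blast
  obtain W where W: "open W" "N' \<subseteq> W" "W - N' \<in> lmeasurable" "emeasure lebesgue (W - N') < ennreal \<delta>"
    using sets_lebesgue_outer_open[OF null_setsD2[OF N'] \<delta>(1)] by metis
  have "emeasure lebesgue W = emeasure lebesgue (W - N')"
    by (metis N' W(1) borel_open emeasure_Diff_null_set sets_completionI_sets sets_lborel)
  then have We: "emeasure lebesgue W < ennreal \<delta>" using W(4) by simp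
  then have Wl: "W \<in> lmeasurable"
    using W(1) by (intro fmeasurableI) (auto intro: less_trans simp: ennreal_less_top)
  then have Wm: "W \<in> lmeasurable" "measure lebesgue W < \<delta>"
    using We by (auto simp: emeasure_eq_measure2 ennreal_less_iff simp del: emeasure_completion)
  have "\<exists>e>0. ball t e \<subseteq> W" if "t \<in> N'" for t using W that by (meson openE subsetD)
  then obtain r1 where r1: "\<And>t. t \<in> N' \<Longrightarrow> 0 < r1 t \<and> ball t (r1 t) \<subseteq> W" by metis
  have "\<exists>e>0. \<forall>u v. u \<le> t \<and> t \<le> v \<and> u \<in> ball t e \<and> v \<in> ball t e \<longrightarrow> F v - F u \<le> \<epsilon> * (v - u)" if g: "good t" for t
  proof -
    obtain D where D: "D \<le> 0" "(F has_real_derivative D) (at t)" using g unfolding good_def by blast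
    then obtain d where d: "0 < d" "\<And>y. norm (y - t) < d \<Longrightarrow> norm (F y - F t - D * (y - t)) \<le> \<epsilon> * norm (y - t)"
      using e unfolding has_field_derivative_def has_derivative_at_alt by (metis)
    show ?thesis
    proof (intro exI[of _ d] conjI allI impI d(1))
      fix u v assume uv: "u \<le> t \<and> t \<le> v \<and> u \<in> ball t d \<and> v \<in> ball t d"
      have "F v - F t \<le> D * (v - t) + \<epsilon> * (v - t)" using d(2)[of v] uv by (auto simp: dist_norm)
      moreover have "F t - F u \<le> D * (t - u) + \<epsilon> * (t - u)"
        using d(2)[of u] uv by (auto simp: dist_norm algebra_simps)
      moreover have "D * (v - t) \<le> 0" "D * (t - u) \<le> 0" using D(1) uv by (auto simp: mult_nonpos_nonneg)
      ultimately show "F v - F u \<le> \<epsilon> * (v - u)" by (simp add: algebra_simps)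
    qed
  qed
  then obtain r2 where r2: "\<And>t. good t \<Longrightarrow> 0 < r2 t"
    "\<And>t u v. good t \<Longrightarrow> u \<le> t \<Longrightarrow> t \<le> v \<Longrightarrow> u \<in> ball t (r2 t) \<Longrightarrow> v \<in> ball t (r2 t) \<Longrightarrow> F v - F u \<le> \<epsilon> * (v - u)"
    by metis
  \<comment> \<open>The last branch only makes the gauge total: a tag in \<open>{a..b}\<close>
    outside \<open>N'\<close> is always good.\<close>
  define \<gamma> where "\<gamma> t = (if t \<in> N' then ball t (r1 t) else if good t then ball t (r2 t) else ball t 1)" for t
  have "gauge \<gamma>" unfolding gauge_def \<gamma>_def using r1 r2(1) by auto
  then obtain p where p: "p tagged_division_of {a..b}" "\<gamma> fine p"
    using fine_division_exists_real by blast
  have p_dest: "\<exists>u v. k = {u..v} \<and> u \<le> t \<and> t \<le> v \<and> a \<le> u \<and> v \<le> b \<and> Inf k = u \<and> Sup k = v \<and> k \<subseteq> \<gamma> t" if k: "(t, k) \<in> p" for t k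
  proof -
    have "t \<in> k" "k \<subseteq> {a..b}" "\<exists>u v. k = cbox u v" using tagged_division_ofD(2,3,4)[OF p(1) k] by auto
    then obtain u v where "k = {u..v}" "t \<in> {u..v}" "{u..v} \<subseteq> {a..b}" by auto
    moreover have "k \<subseteq> \<gamma> t" using p(2) k by (auto simp: fine_def)
    ultimately show ?thesis by auto
  qed
  have fin: "finite p" using p(1) by blast
  define p1 where "p1 = {(t, k) \<in> p. t \<in> N'}"
  define p2 where "p2 = {(t, k) \<in> p. t \<notin> N'}"
  have pp: "p = p1 \<union> p2" "p1 \<inter> p2 = {}" "finite p1" "finite p2"
    using fin unfolding p1_def p2_def by (auto intro: finite_subset[OF _ fin])
  have "F b - F a = (\<Sum>(t, k)\<in>p. F (Sup k) - F (Inf k))"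
    using additive_tagged_division_1[OF ab p(1), of F] by simp
  also have "\<dots> = (\<Sum>(t, k)\<in>p1. F (Sup k) - F (Inf k)) + (\<Sum>(t, k)\<in>p2. F (Sup k) - F (Inf k))"
    by (simp add: pp sum.union_disjoint)
  also have "(\<Sum>(t, k)\<in>p2. F (Sup k) - F (Inf k)) \<le> (\<Sum>(t, k)\<in>p2. \<epsilon> * (Sup k - Inf k))"
  proof (rule sum_mono, clarify)
    fix t k assume tk: "(t, k) \<in> p2"
    then have tp: "(t, k) \<in> p" "t \<notin> N'" by (auto simp: p2_def)
    obtain u v where uv: "k = {u..v}" "u \<le> t" "t \<le> v" "a \<le> u" "v \<le> b" "Inf k = u" "Sup k = v" "k \<subseteq> \<gamma> t"
      using p_dest[OF tp(1)] by blast
    then have "good t" using N(1)[of t] tp(2) unfolding N'_def by fastforce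
    moreover then have "u \<in> ball t (r2 t)" "v \<in> ball t (r2 t)"
      using uv tp(2) by (auto simp: \<gamma>_def subset_iff)
    ultimately show "F (Sup k) - F (Inf k) \<le> \<epsilon> * (Sup k - Inf k)" using r2(2) uv by metis
  qed
  also have "\<dots> \<le> (\<Sum>(t, k)\<in>p. \<epsilon> * (Sup k - Inf k))"
  proof (rule sum_mono2[OF fin])
    fix x assume "x \<in> p - p2"
    then show "0 \<le> (case x of (t, k) \<Rightarrow> \<epsilon> * (Sup k - Inf k))" using p_dest[of "fst x" "snd x"] e by (cases x) auto
  qed (auto simp: pp)
  also have "\<dots> = \<epsilon> * (b - a)"
    using additive_tagged_division_1[OF ab p(1), of "\<lambda>t. t"]
    by (simp add: case_prod_unfold sum_distrib_left[symmetric])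
  also have "(\<Sum>(t, k)\<in>p1. F (Sup k) - F (Inf k)) \<le> \<epsilon>"
  proof -
    have tpd: "p1 tagged_partial_division_of {a..b}"
      using p(1) pp(1) by (metis Un_upper1 tagged_division_of_def tagged_partial_division_subset)
    note td = tagged_partial_division_of_Union_self[OF tpd]
    note dv = partial_division_of_tagged_division[OF tpd]
    have "\<Union> (snd ` p1) \<subseteq> W"
    proof (clarsimp)
      fix t k s assume tk: "(t, k) \<in> p1" and s: "s \<in> k"
      then have "t \<in> N'" "k \<subseteq> \<gamma> t" using p_dest[of t k] by (auto simp: p1_def)
      then show "s \<in> W" using r1[of t] s by (auto simp: \<gamma>_def)
    qed
    then have "measure lebesgue (\<Union> (snd ` p1)) \<le> measure lebesgue W"
      by (intro measure_mono_fmeasurable Wm(1)) (use dv in \<open>auto dest: lmeasurable_division\<close>)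
    then have "(\<Sum>k\<in>snd ` p1. measure lebesgue k) < \<delta>"
      using content_division[OF dv] Wm(2) by simp
    moreover have mk: "measure lebesgue k = Sup k - Inf k" if k: "k \<in> snd ` p1" for k
    proof -
      obtain t where "(t, k) \<in> p" using k by (auto simp: p1_def)
      from p_dest[OF this] obtain u v where "k = {u..v}" "u \<le> v" by auto
      then show ?thesis by simp
    qed
    moreover have "\<Union> (snd ` p1) \<subseteq> {a..b}" using tagged_partial_division_ofD(3)[OF tpd] by fastforce
    ultimately have "(\<Sum>k\<in>snd ` p1. norm (F (Sup k) - F (Inf k))) < \<epsilon>"
      using \<delta>(2)[OF dv] by simp
    moreover have "(\<Sum>(t, k)\<in>p1. F (Sup k) - F (Inf k)) = (\<Sum>k\<in>snd ` p1. F (Sup k) - F (Inf k))"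
    proof -
      \<comment> \<open>Several tags may carry the same degenerate interval, so the sum over tags
        passes to a sum over intervals only because degenerate intervals have increment zero.
        Setting \<open>d\<close> to zero on the empty set makes this hold for every
        \<open>cbox\<close> with empty interior.\<close>
      define d where "d k = (if k = {} then 0 else F (Sup k) - F (Inf k))" for k
      have ne: "k \<noteq> {}" if "(t, k) \<in> p1" for t k using p_dest[of t k] that by (auto simp: p1_def)
      have "(\<Sum>(t, k)\<in>p1. F (Sup k) - F (Inf k)) = (\<Sum>(t, k)\<in>p1. d k)"
        by (intro sum.cong) (auto simp: d_def dest: ne)
      also have "\<dots> = sum d (snd ` p1)"
      proof (rule sum.over_tagged_division_lemma[OF td])
        fix u v :: real assume "box u v = {}"
        then show "d (cbox u v) = 0" by (cases "u = v") (auto simp: d_def)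
      qed
      also have "\<dots> = (\<Sum>k\<in>snd ` p1. F (Sup k) - F (Inf k))"
        by (intro sum.cong) (auto simp: d_def dest: ne)
      finally show ?thesis .
    qed
    moreover have "(\<Sum>k\<in>snd ` p1. F (Sup k) - F (Inf k)) \<le> (\<Sum>k\<in>snd ` p1. norm (F (Sup k) - F (Inf k)))"
      by (rule sum_mono) simp
    ultimately show ?thesis by simp
  qed
  finally have "F b - F a \<le> \<epsilon> * (b - a + 1)" by (simp add: algebra_simps)
  then show "F b \<le> F a + \<epsilon>'" using ab by (simp add: \<epsilon>_def)
qed

subsection \<open>Square-integrable functions\<close>

definition ip :: "real set \<Rightarrow> (real \<Rightarrow> real) \<Rightarrow> (real \<Rightarrow> real) \<Rightarrow> real" where
  "ip I f g = (LINT t:I|lebesgue. f t * g t)"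

lemma ip_commute: "ip I f g = ip I g f"
  by (simp add: ip_def mult.commute)

lemma L2_on_mult:
  fixes f g :: "real \<Rightarrow> real"
  assumes "L2_on I f" "L2_on I g"
  shows "set_integrable lebesgue I (\<lambda>t. f t * g t)"
proof (rule set_integrable_bound)
  show "set_integrable lebesgue I (\<lambda>t. (norm (f t))\<^sup>2 + (norm (g t))\<^sup>2)"
    using assms by (intro set_integral_add) (auto simp: L2_on_def)
  have "set_borel_measurable lebesgue I f" "set_borel_measurable lebesgue I g"
    using assms by (auto simp: L2_on_def)
  then have "(\<lambda>x. (indicat_real I x *\<^sub>R f x) * (indicat_real I x *\<^sub>R g x)) \<in> borel_measurable lebesgue"
    unfolding set_borel_measurable_def by measurable
  moreover have "(\<lambda>x. (indicat_real I x *\<^sub>R f x) * (indicat_real I x *\<^sub>R g x)) = (\<lambda>x. indicat_real I x *\<^sub>R (f x * g x))"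
    by (auto simp: indicator_def)
  ultimately show "set_borel_measurable lebesgue I (\<lambda>t. f t * g t)" by (simp add: set_borel_measurable_def)
  have "\<bar>x * y\<bar> \<le> x\<^sup>2 + y\<^sup>2" for x y :: real
    using sum_squares_bound[of "\<bar>x\<bar>" "\<bar>y\<bar>"] mult_nonneg_nonneg[of "\<bar>x\<bar>" "\<bar>y\<bar>"]
    by (simp add: abs_mult del: mult_nonneg_nonneg)
  then show "AE x in lebesgue. x \<in> I \<longrightarrow> norm (f x * g x) \<le> norm ((norm (f x))\<^sup>2 + (norm (g x))\<^sup>2)"
    by (auto simp: abs_mult)
qed

lemma L2_on_add:
  fixes f g :: "real \<Rightarrow> real"
  assumes "L2_on I f" "L2_on I g"
  shows "L2_on I (\<lambda>t. f t + g t)"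
  unfolding L2_on_def
proof
  have m: "set_borel_measurable lebesgue I f" "set_borel_measurable lebesgue I g"
    using assms by (auto simp: L2_on_def)
  then show "set_borel_measurable lebesgue I (\<lambda>t. f t + g t)"
    unfolding set_borel_measurable_def scaleR_add_right by (rule borel_measurable_add)
  have "set_integrable lebesgue I (\<lambda>t. f t * f t + g t * g t + (f t * g t + f t * g t))"
    by (intro set_integral_add L2_on_mult assms)
  moreover have "(\<lambda>t. f t * f t + g t * g t + (f t * g t + f t * g t)) = (\<lambda>t. (norm (f t + g t))\<^sup>2)"
    by (auto simp: power2_eq_square algebra_simps)
  ultimately show "set_integrable lebesgue I (\<lambda>t. (norm (f t + g t))\<^sup>2)" by simp
qed

lemma L2_on_cmult:
  fixes f :: "real \<Rightarrow> real"
  assumes "L2_on I f"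
  shows "L2_on I (\<lambda>t. c * f t)"
proof -
  have "set_borel_measurable lebesgue I f" using assms by (auto simp: L2_on_def)
  then have "(\<lambda>x. c * (indicat_real I x *\<^sub>R f x)) \<in> borel_measurable lebesgue"
    unfolding set_borel_measurable_def by measurable
  then have "set_borel_measurable lebesgue I (\<lambda>t. c * f t)"
    by (simp add: set_borel_measurable_def mult.left_commute)
  moreover have "set_integrable lebesgue I (\<lambda>t. c\<^sup>2 * (norm (f t))\<^sup>2)"
    using assms by (auto simp: L2_on_def)
  ultimately show ?thesis by (simp add: L2_on_def power_mult_distrib)
qed

lemma L2_on_zero: "L2_on I (\<lambda>t. 0 :: real)"
  by (simp add: L2_on_def set_borel_measurable_def set_integrable_def)

lemma L2_on_sum:
  fixes f :: "'i \<Rightarrow> real \<Rightarrow> real"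
  shows "(\<And>i. i \<in> A \<Longrightarrow> L2_on I (f i)) \<Longrightarrow> L2_on I (\<lambda>t. \<Sum>i\<in>A. f i t)"
  by (induction A rule: infinite_finite_induct) (auto intro: L2_on_zero L2_on_add)

lemma L2_on_diff:
  fixes f g :: "real \<Rightarrow> real"
  shows "L2_on I f \<Longrightarrow> L2_on I g \<Longrightarrow> L2_on I (\<lambda>t. f t - g t)"
  using L2_on_add[of I f "\<lambda>t. (-1) * g t"] L2_on_cmult[of I g "-1"] by simp

lemma L2_on_cong:
  fixes f g :: "real \<Rightarrow> real"
  assumes "L2_on I f" "\<And>t. t \<in> I \<Longrightarrow> f t = g t"
  shows "L2_on I g"
proof -
  have "(\<lambda>x. indicat_real I x *\<^sub>R g x) = (\<lambda>x. indicat_real I x *\<^sub>R f x)"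
    "(\<lambda>x. indicat_real I x *\<^sub>R (norm (g x))\<^sup>2) = (\<lambda>x. indicat_real I x *\<^sub>R (norm (f x))\<^sup>2)"
    using assms(2) by (auto simp: indicator_def)
  then show ?thesis using assms(1)
    by (simp only: L2_on_def set_borel_measurable_def set_integrable_def)
qed

lemma L2_on_continuous:
  fixes f :: "real \<Rightarrow> real"
  assumes "continuous_on {a..b} f"
  shows "L2_on {a..b} f"
proof -
  have "set_integrable lebesgue {a..b} f" by (rule absolutely_integrable_continuous_real[OF assms])
  then have "set_borel_measurable lebesgue {a..b} f"
    by (simp add: set_integrable_def set_borel_measurable_def borel_measurable_integrable)
  moreover have "set_integrable lebesgue {a..b} (\<lambda>t. (norm (f t))\<^sup>2)"
    by (intro absolutely_integrable_continuous_real continuous_intros assms)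
  ultimately show ?thesis by (simp add: L2_on_def)
qed

lemma ip_cong: "(\<And>t. t \<in> I \<Longrightarrow> f t * g t = f' t * g' t) \<Longrightarrow> ip I f g = ip I f' g'"
  unfolding ip_def set_lebesgue_integral_def by (intro Bochner_Integration.integral_cong) (auto simp: indicator_def)

lemma ip_add_left: "L2_on I f \<Longrightarrow> L2_on I g \<Longrightarrow> L2_on I h \<Longrightarrow> ip I (\<lambda>t. f t + g t) h = ip I f h + ip I g h"
  by (simp add: ip_def distrib_right L2_on_mult)

lemma ip_cmult_left: "ip I (\<lambda>t. c * f t) h = c * ip I f h"
  by (simp add: ip_def mult.assoc)

lemma ip_sum_left: "(\<And>i. i \<in> A \<Longrightarrow> L2_on I (f i)) \<Longrightarrow> L2_on I h \<Longrightarrow> ip I (\<lambda>t. \<Sum>i\<in>A. f i t) h = (\<Sum>i\<in>A. ip I (f i) h)"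
proof (induction A rule: infinite_finite_induct)
  case (insert x F)
  then show ?case by (simp add: ip_add_left L2_on_sum)
qed (auto simp: ip_def set_lebesgue_integral_def)

lemma ip_diff_left: "L2_on I f \<Longrightarrow> L2_on I g \<Longrightarrow> L2_on I h \<Longrightarrow> ip I (\<lambda>t. f t - g t) h = ip I f h - ip I g h"
  using ip_add_left[of I f "\<lambda>t. (-1) * g t" h] L2_on_cmult[of I g "-1"] ip_cmult_left[of I "-1" g h] by simp

lemma set_integrable_sum_real:
  fixes f :: "'i \<Rightarrow> real \<Rightarrow> real"
  shows "(\<And>i. i \<in> A \<Longrightarrow> set_integrable M I (f i)) \<Longrightarrow> set_integrable M I (\<lambda>t. \<Sum>i\<in>A. f i t)"
proof (induction A rule: infinite_finite_induct)
  case (insert i A)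
  then show ?case by (simp add: set_integral_add)
qed (auto simp: set_integrable_def)

lemma set_integral_sum_real:
  fixes f :: "'i \<Rightarrow> real \<Rightarrow> real"
  shows "(\<And>i. i \<in> A \<Longrightarrow> set_integrable M I (f i)) \<Longrightarrow>
    (LINT t:I|M. \<Sum>i\<in>A. f i t) = (\<Sum>i\<in>A. LINT t:I|M. f i t)"
proof (induction A rule: infinite_finite_induct)
  case (insert i A)
  then show ?case by (simp add: set_integral_add set_integrable_sum_real)
qed (auto simp: set_lebesgue_integral_def)

text \<open>The form of \<open>R\<close> is integrated at the residual \<open>z\<close> of the
  orthogonal projection of \<open>y\<close> onto the span of the \<open>e k\<close>. Orthonormality
  collapses the cross terms, and the integral is nonnegative because its integrand is.\<close>

lemma bessel:
  fixes R :: "nat \<Rightarrow> nat \<Rightarrow> real" and K :: nat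
  assumes L2e: "\<And>k. k < K \<Longrightarrow> L2_on I (e k)" and L2y: "\<And>l. l < n \<Longrightarrow> L2_on I (y l)"
    and orth: "\<And>j k. j < K \<Longrightarrow> k < K \<Longrightarrow> ip I (e j) (e k) = (if j = k then 1 else 0)"
    and psd: "\<And>u. 0 \<le> (\<Sum>l<n. \<Sum>m<n. R l m * u l * u m)"
  shows "(\<Sum>k<K. \<Sum>l<n. \<Sum>m<n. R l m * ip I (e k) (y l) * ip I (e k) (y m))
       \<le> (\<Sum>l<n. \<Sum>m<n. R l m * ip I (y l) (y m))"
proof -
  define c where "c k l = ip I (e k) (y l)" for k l
  define P where "P l t = (\<Sum>k<K. c k l * e k t)" for l t
  have L2P: "L2_on I (P l)" for l unfolding P_def by (intro L2_on_sum L2_on_cmult L2e) auto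
  have eP: "ip I (e k) (P m) = c k m" if "k < K" for k m
  proof -
    have "ip I (e k) (P m) = ip I (P m) (e k)" by (rule ip_commute)
    also have "\<dots> = (\<Sum>j<K. c j m * ip I (e j) (e k))"
      unfolding P_def using that L2e by (subst ip_sum_left) (auto intro: L2_on_cmult simp: ip_cmult_left)
    also have "\<dots> = (\<Sum>j<K. if j = k then c k m else 0)" using that orth by (intro sum.cong) auto
    also have "\<dots> = c k m" using that by (subst sum.delta) auto
    finally show ?thesis .
  qed
  have Pf: "ip I (P l) f = (\<Sum>k<K. c k l * ip I (e k) f)" if "L2_on I f" for l f
    unfolding P_def using that L2e by (subst ip_sum_left) (auto intro: L2_on_cmult simp: ip_cmult_left)
  define z where "z l t = y l t - P l t" for l t
  have L2z: "l < n \<Longrightarrow> L2_on I (z l)" for l unfolding z_def by (intro L2_on_diff L2y L2P)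
  have zz: "ip I (z l) (z m) = ip I (y l) (y m) - (\<Sum>k<K. c k l * c k m)" if "l < n" "m < n" for l m
  proof -
    have "ip I (z l) (z m) = ip I (y l) (z m) - ip I (P l) (z m)"
      unfolding z_def[of l] using that by (intro ip_diff_left L2y L2P L2z)
    also have "ip I (P l) (z m) = ip I (z m) (P l)" by (rule ip_commute)
    also have "\<dots> = ip I (y m) (P l) - ip I (P m) (P l)"
      unfolding z_def[of m] using that by (intro ip_diff_left L2y L2P)
    also have "ip I (y m) (P l) = ip I (P m) (P l)"
      using that L2y L2P by (subst ip_commute) (simp add: Pf eP c_def mult.commute)
    also have "ip I (y l) (z m) = ip I (z m) (y l)" by (rule ip_commute)
    also have "\<dots> = ip I (y m) (y l) - ip I (P m) (y l)"
      unfolding z_def[of m] using that by (intro ip_diff_left L2y L2P)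
    also have "ip I (P m) (y l) = (\<Sum>k<K. c k l * c k m)"
      using that L2y by (simp add: Pf c_def[symmetric] mult.commute)
    finally show ?thesis by (simp add: ip_commute)
  qed
  have int: "set_integrable lebesgue I (\<lambda>t. R l m * z l t * z m t)" if "l < n" "m < n" for l m
    using L2_on_mult[OF L2_on_cmult[OF L2z[OF that(1)], of "R l m"] L2z[OF that(2)]] by simp
  have "0 \<le> (LINT t:I|lebesgue. (\<Sum>l<n. \<Sum>m<n. R l m * z l t * z m t))"
    unfolding set_lebesgue_integral_def
    by (intro Bochner_Integration.integral_nonneg) (auto simp: indicator_def intro!: psd)
  also have "\<dots> = (\<Sum>l<n. \<Sum>m<n. (LINT t:I|lebesgue. R l m * z l t * z m t))"
  proof -
    have i1: "set_integrable lebesgue I (\<lambda>t. \<Sum>m<n. R l m * z l t * z m t)" if "l < n" for l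
      by (rule set_integrable_sum_real) (use int that in auto)
    show ?thesis
      by (subst set_integral_sum_real) (auto intro!: sum.cong set_integral_sum_real i1 int)
  qed
  also have "\<dots> = (\<Sum>l<n. \<Sum>m<n. R l m * ip I (z l) (z m))"
    by (simp add: ip_def mult.assoc)
  also have "\<dots> = (\<Sum>l<n. \<Sum>m<n. R l m * (ip I (y l) (y m) - (\<Sum>k<K. c k l * c k m)))"
    by (intro sum.cong) (auto simp: zz)
  also have "\<dots> = (\<Sum>l<n. \<Sum>m<n. R l m * ip I (y l) (y m)) - (\<Sum>l<n. \<Sum>m<n. \<Sum>k<K. R l m * c k l * c k m)"
    by (simp add: sum_subtractf right_diff_distrib sum_distrib_left mult.assoc)
  also have "(\<Sum>l<n. \<Sum>m<n. \<Sum>k<K. R l m * c k l * c k m) = (\<Sum>k<K. \<Sum>l<n. \<Sum>m<n. R l m * c k l * c k m)"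
    by (subst sum.swap, subst (2) sum.swap) (rule refl)
  finally show ?thesis by (simp add: c_def)
qed

subsection \<open>Weak derivatives and integration by parts\<close>

text \<open>Building block of an explicit cut-off function. At the origin the difference quotient is
  at most \<open>|h|\<close> in modulus.\<close>

lemma DERIV_pos_part_square:
  "((\<lambda>x::real. (max 0 x)\<^sup>2) has_real_derivative 2 * max 0 x) (at x)"
proof -
  consider "x < 0" | "x = 0" | "x > 0" by linarith
  then show ?thesis
  proof cases
    case 1
    have "((\<lambda>x::real. 0) has_real_derivative 0) (at x)" by simp
    then have "((\<lambda>x::real. (max 0 x)\<^sup>2) has_real_derivative 0) (at x)"
      by (rule DERIV_cong_ev[THEN iffD1, rotated -1, OF _ refl _ refl])
        (use 1 in \<open>auto intro!: eventually_mono[OF eventually_nhds_in_open[of "{..<0}" x]]\<close>)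
    then show ?thesis using 1 by simp
  next
    case 3
    have "((\<lambda>x::real. x\<^sup>2) has_real_derivative 2 * x) (at x)" by (auto intro!: derivative_eq_intros)
    then have "((\<lambda>x::real. (max 0 x)\<^sup>2) has_real_derivative 2 * x) (at x)"
      by (rule DERIV_cong_ev[THEN iffD1, rotated -1, OF _ refl _ refl])
        (use 3 in \<open>auto intro!: eventually_mono[OF eventually_nhds_in_open[of "{0<..}" x]]\<close>)
    then show ?thesis using 3 by simp
  next
    case 2
    have "((\<lambda>h::real. (max 0 h)\<^sup>2 / h) \<longlongrightarrow> 0) (at 0)"
    proof (rule Lim_null_comparison)
      show "\<forall>\<^sub>F h in at (0::real). norm ((max 0 h)\<^sup>2 / h) \<le> \<bar>h\<bar>"
        by (intro always_eventually) (auto simp: max_def power2_eq_square)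
      show "((\<lambda>h::real. \<bar>h\<bar>) \<longlongrightarrow> 0) (at 0)" by (auto intro!: tendsto_eq_intros)
    qed
    then show ?thesis using 2 by (simp add: DERIV_def)
  qed
qed

text \<open>A quadratic spline that rises from 0 at 0 to 1 at 1. It is \<open>C\<^sup>1\<close>,
  which is exactly the smoothness asked of test functions.\<close>

definition smooth_step :: "real \<Rightarrow> real" where
  "smooth_step x = 2 * ((max 0 x)\<^sup>2 - 2 * (max 0 (x - 1/2))\<^sup>2 + (max 0 (x - 1))\<^sup>2)"

text \<open>The hat of height 2 over \<open>[0, 1]\<close>, hence of unit integral; it is the
  derivative of \<open>smooth_step\<close>.\<close>

definition tent :: "real \<Rightarrow> real" where
  "tent x = 4 * (max 0 x - 2 * max 0 (x - 1/2) + max 0 (x - 1))"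

lemma DERIV_smooth_step: "(smooth_step has_real_derivative tent x) (at x)"
proof -
  have *: "((\<lambda>x::real. (max 0 (x - c))\<^sup>2) has_real_derivative 2 * max 0 (x - c)) (at x)" for c
  proof -
    have "((\<lambda>x. x - c) has_real_derivative 1) (at x)" by (auto intro!: derivative_eq_intros)
    from DERIV_chain2[OF DERIV_pos_part_square this] show ?thesis by simp
  qed
  show ?thesis unfolding smooth_step_def[abs_def] tent_def
    by (rule derivative_eq_intros *[of 0, simplified] *[of "1/2"] *[of 1] refl)+ simp
qed

lemma tent_nonneg: "0 \<le> tent x"
  by (auto simp: tent_def max_def)

lemma tent_outside: "x \<le> 0 \<or> 1 \<le> x \<Longrightarrow> tent x = 0"
  by (auto simp: tent_def max_def)

lemma continuous_on_tent [continuous_intros]: "continuous_on A f \<Longrightarrow> continuous_on A (\<lambda>x. tent (f x))"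
  unfolding tent_def by (intro continuous_intros)

lemma smooth_step_0: "x \<le> 0 \<Longrightarrow> smooth_step x = 0"
  by (simp add: smooth_step_def)

lemma smooth_step_1: "1 \<le> x \<Longrightarrow> smooth_step x = 1"
  by (simp add: smooth_step_def max_def) (auto simp: power2_eq_square field_simps)

lemma smooth_step_mono: "x \<le> y \<Longrightarrow> smooth_step x \<le> smooth_step y"
  by (rule DERIV_nonneg_imp_nondecreasing[of x y smooth_step]) (use DERIV_smooth_step tent_nonneg in blast)+

lemma smooth_step_bounds: "0 \<le> smooth_step x" "smooth_step x \<le> 1"
  using smooth_step_mono[of "min x 0" x] smooth_step_mono[of x "max x 1"] smooth_step_0[of "min x 0"] smooth_step_1[of "max x 1"]
  by auto

lemma set_integral_real_eq_integral:
  fixes f :: "real \<Rightarrow> real"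
  shows "set_integrable lebesgue I f \<Longrightarrow> (LINT t:I|lebesgue. f t) = integral I f"
  by (rule set_lebesgue_integral_eq_integral(2))

lemma set_integrable_mult_continuous:
  fixes f g :: "real \<Rightarrow> real"
  assumes "continuous_on {a..b} f" "set_integrable lebesgue {a..b} g"
  shows "set_integrable lebesgue {a..b} (\<lambda>t. g t * f t)"
proof -
  have "set_integrable lebesgue {a..b} (\<lambda>t. f t * g t)"
  proof (rule absolutely_integrable_bounded_measurable_product_real)
    show "f \<in> borel_measurable (lebesgue_on {a..b})"
      using assms(1) by (intro continuous_imp_measurable_on_sets_lebesgue) auto
    show "bounded (f ` {a..b})"
      using assms(1) by (intro compact_imp_bounded compact_continuous_image) auto
  qed (use assms in auto)
  then show ?thesis by (simp add: mult.commute)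
qed

text \<open>The kernel puts unit mass within distance \<open>c k\<close> of \<open>p\<close>, where
  \<open>h\<close> differs little from \<open>h p\<close>. Continuity of \<open>h\<close> is
  relative to \<open>{a..b}\<close>, so \<open>p\<close> may be an end point, which is the case
  used.\<close>

lemma approximate_identity:
  fixes h :: "real \<Rightarrow> real" and c :: "nat \<Rightarrow> real"
  assumes ab: "a < b" and h: "continuous_on {a..b} h" and p: "p \<in> {a..b}"
    and rho: "\<And>k. continuous_on {a..b} (\<rho> k)" "\<And>k t. 0 \<le> \<rho> k t"
      "\<And>k t. t \<in> {a..b} \<Longrightarrow> c k < \<bar>t - p\<bar> \<Longrightarrow> \<rho> k t = 0" and c: "c \<longlonglongrightarrow> 0"
    and one: "\<forall>\<^sub>F k in sequentially. (LINT t:{a..b}|lebesgue. \<rho> k t) = 1"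
  shows "(\<lambda>k. LINT t:{a..b}|lebesgue. \<rho> k t * h t) \<longlonglongrightarrow> h p"
proof (rule tendstoI)
  fix \<epsilon> :: real assume e: "0 < \<epsilon>"
  obtain d where d: "0 < d" "\<And>t. t \<in> {a..b} \<Longrightarrow> \<bar>t - p\<bar> < d \<Longrightarrow> \<bar>h t - h p\<bar> < \<epsilon> / 2"
    using h p e unfolding continuous_on_iff dist_real_def by (metis half_gt_zero)
  have "\<forall>\<^sub>F k in sequentially. \<bar>c k\<bar> < d" using tendstoD[OF c d(1)] by simp
  with one show "\<forall>\<^sub>F k in sequentially. dist (LINT t:{a..b}|lebesgue. \<rho> k t * h t) (h p) < \<epsilon>"
  proof eventually_elim
    case (elim k)
    have ir: "set_integrable lebesgue {a..b} (\<rho> k)" by (intro absolutely_integrable_continuous_real rho)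
    have irh: "set_integrable lebesgue {a..b} (\<lambda>t. \<rho> k t * h t)"
      by (rule set_integrable_mult_continuous[OF h ir])
    have ihp: "set_integrable lebesgue {a..b} (\<lambda>t. \<rho> k t * h p)" using ir by simp
    have "(LINT t:{a..b}|lebesgue. \<rho> k t * h t) - h p = (LINT t:{a..b}|lebesgue. \<rho> k t * h t) - (LINT t:{a..b}|lebesgue. \<rho> k t * h p)"
      using elim(1) by simp
    also have "\<dots> = (LINT t:{a..b}|lebesgue. \<rho> k t * h t - \<rho> k t * h p)"
      using irh ihp by (rule set_integral_diff(2)[symmetric])
    also have "\<bar>\<dots>\<bar> \<le> (LINT t:{a..b}|lebesgue. \<rho> k t * (\<epsilon> / 2))"
    proof -
      have le: "\<bar>\<rho> k t * h t - \<rho> k t * h p\<bar> \<le> \<rho> k t * (\<epsilon> / 2)" if t: "t \<in> {a..b}" for t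
      proof (cases "c k < \<bar>t - p\<bar>")
        case True
        then show ?thesis using rho(3)[OF t] by simp
      next
        case False
        then have "\<bar>h t - h p\<bar> \<le> \<epsilon> / 2" using d(2)[OF t] elim(2) by force
        then have "\<rho> k t * \<bar>h t - h p\<bar> \<le> \<rho> k t * (\<epsilon> / 2)" by (intro mult_left_mono rho)
        moreover have "\<bar>\<rho> k t * h t - \<rho> k t * h p\<bar> = \<rho> k t * \<bar>h t - h p\<bar>"
          using rho(2)[of k t] by (simp add: right_diff_distrib[symmetric] abs_mult)
        ultimately show ?thesis by simp
      qed
      have i1: "set_integrable lebesgue {a..b} (\<lambda>t. \<rho> k t * h t - \<rho> k t * h p)"
        using irh ihp by (rule set_integral_diff(1))
      have "\<bar>LINT t:{a..b}|lebesgue. \<rho> k t * h t - \<rho> k t * h p\<bar> \<le> (LINT t:{a..b}|lebesgue. \<bar>\<rho> k t * h t - \<rho> k t * h p\<bar>)"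
        using set_integral_norm_bound[OF i1] by simp
      also have "\<dots> \<le> (LINT t:{a..b}|lebesgue. \<rho> k t * (\<epsilon> / 2))"
        by (intro set_integral_mono le set_integrable_abs[OF i1]) (use ir in auto)
      finally show ?thesis .
    qed
    also have "\<dots> = \<epsilon> / 2" using elim(1) by simp
    finally show ?case using e by (simp add: dist_real_def)
  qed
qed

text \<open>
  The test functions in the definition of the weak derivative vanish near the end points; the
  boundary terms arise from cutting off \<open>Y\<close> with steps whose derivatives are approximate
  identities at \<open>a\<close> and \<open>b\<close>.
\<close>

lemma weak_derivative_by_parts:
  assumes ab: "a < b" and f: "continuous_on {a..b} f" and g: "set_integrable lebesgue {a..b} g"
    and weak: "weak_derivative_on a b f g"
    and Y: "\<And>t. (Y has_real_derivative Y' t) (at t)" and Y': "continuous_on UNIV Y'"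
  shows "(LINT t:{a..b}|lebesgue. f t * Y' t) = f b * Y b - f a * Y a - (LINT t:{a..b}|lebesgue. g t * Y t)"
proof -
  have cY: "continuous_on A Y" for A
    by (rule continuous_on_subset[OF _ subset_UNIV], rule DERIV_continuous_on) (rule Y)
  have cY'[continuous_intros]: "continuous_on A Y'" for A by (rule continuous_on_subset[OF Y' subset_UNIV])
  obtain k0 :: nat where k0: "4 / (b - a) < real k0" using reals_Archimedean2 by blast
  \<comment> \<open>The offset \<open>k0\<close> makes \<open>4 < K k * (b - a)\<close> true for
    every \<open>k\<close>, so that the two transition zones of the cut-off never overlap.\<close>
  define K where "K k = real (k0 + k + 1)" for k
  have K: "0 < K k" "4 < K k * (b - a)" for k
  proof -
    show "0 < K k" by (simp add: K_def)
    have "4 / (b - a) < K k" using k0 by (simp add: K_def)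
    then show "4 < K k * (b - a)" using ab by (simp add: field_simps)
  qed
  \<comment> \<open>This rises on \<open>[a + 1/K, a + 2/K]\<close> and falls on
    \<open>[b - 2/K, b - 1/K]\<close>. Margins of width \<open>1/K\<close> remain at both ends, so
    that \<open>Y\<close> times it is an admissible test function.\<close>
  define \<chi> where "\<chi> k t = smooth_step ((t - a) * K k - 1) - smooth_step ((t - b) * K k + 2)" for k t
  define \<rho>a where "\<rho>a k t = K k * tent ((t - a) * K k - 1)" for k t
  define \<rho>b where "\<rho>b k t = K k * tent ((t - b) * K k + 2)" for k t
  have D1: "((\<lambda>t. smooth_step ((t - c) * K k + e)) has_real_derivative K k * tent ((t - c) * K k + e)) (at t)" for c e k t
  proof -
    have "((\<lambda>t. (t - c) * K k + e) has_real_derivative K k) (at t)" by (auto intro!: derivative_eq_intros)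
    from DERIV_chain2[OF DERIV_smooth_step this] show ?thesis by (simp add: mult.commute)
  qed
  have D\<chi>: "(\<chi> k has_real_derivative \<rho>a k t - \<rho>b k t) (at t)" for k t
    unfolding \<chi>_def[abs_def] \<rho>a_def \<rho>b_def
    using DERIV_diff[OF D1[of a k "-1" t] D1[of b k 2 t]] by simp
  have c\<rho>[continuous_intros]: "continuous_on A (\<rho>a k)" "continuous_on A (\<rho>b k)" for A k
    unfolding \<rho>a_def \<rho>b_def by (intro continuous_intros)+
  have c\<chi>[continuous_intros]: "continuous_on A (\<chi> k)" for A k
    by (rule continuous_on_subset[OF _ subset_UNIV], rule DERIV_continuous_on) (rule D\<chi>)
  have \<chi>0: "\<chi> k t = 0" if "t \<notin> {a + 1 / K k .. b - 1 / K k}" for k t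
  proof (cases "t < a + 1 / K k")
    case True
    then have 1: "(t - a) * K k - 1 \<le> 0" using K(1)[of k] by (simp add: field_simps)
    have "(t - b) * K k + 2 = ((t - a) * K k - 1) + 3 - K k * (b - a)" by (simp add: algebra_simps)
    then have "(t - b) * K k + 2 \<le> 0" using 1 K(2)[of k] by linarith
    then show ?thesis using 1 by (simp add: \<chi>_def smooth_step_0)
  next
    case False
    then have "b - 1 / K k < t" using that by auto
    then have 1: "1 \<le> (t - b) * K k + 2" using K(1)[of k] by (simp add: field_simps)
    have "(t - a) * K k - 1 = ((t - b) * K k + 2) - 3 + K k * (b - a)" by (simp add: algebra_simps)
    then have "1 \<le> (t - a) * K k - 1" using 1 K(2)[of k] by linarith
    then show ?thesis using 1 by (simp add: \<chi>_def smooth_step_1)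
  qed
  have \<chi>b: "\<bar>\<chi> k t\<bar> \<le> 1" for k t
    using smooth_step_bounds[of "(t - a) * K k - 1"] smooth_step_bounds[of "(t - b) * K k + 2"] by (simp add: \<chi>_def)
  have Kinf: "filterlim K at_top sequentially"
    by (rule filterlim_at_top_mono[OF filterlim_real_sequentially]) (simp add: K_def)
  have \<chi>lim: "(\<lambda>k. \<chi> k t) \<longlonglongrightarrow> 1" if t: "a < t" "t < b" for t
  proof (rule tendsto_eventually)
    have "\<forall>\<^sub>F k in sequentially. K k \<ge> 2 / (t - a) \<and> K k \<ge> 2 / (b - t)"
      using Kinf by (auto simp: filterlim_at_top eventually_conj)
    then show "\<forall>\<^sub>F k in sequentially. \<chi> k t = 1"
    proof eventually_elim
      case (elim k)
      then have "1 \<le> (t - a) * K k - 1" "(t - b) * K k + 2 \<le> 0"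
        using t by (auto simp: field_simps)
      then show ?case by (simp add: \<chi>_def smooth_step_0 smooth_step_1)
    qed
  qed
  have weak_k: "(LINT t:{a..b}|lebesgue. f t * (Y' t * \<chi> k t + (\<rho>a k t - \<rho>b k t) * Y t)) = - (LINT t:{a..b}|lebesgue. g t * (Y t * \<chi> k t))" for k
  proof -
    have 1: "\<forall>t. ((\<lambda>t. Y t * \<chi> k t) has_real_derivative (Y' t * \<chi> k t + (\<rho>a k t - \<rho>b k t) * Y t)) (at t)"
      using DERIV_mult'[OF Y D\<chi>] by (simp add: algebra_simps)
    have 2: "continuous_on UNIV (\<lambda>t. Y' t * \<chi> k t + (\<rho>a k t - \<rho>b k t) * Y t)"
      by (intro continuous_intros cY)
    have 3: "\<exists>c e. a < c \<and> e < b \<and> (\<forall>t. t \<notin> {c..e} \<longrightarrow> Y t * \<chi> k t = 0)"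
      using K(1)[of k] \<chi>0[of _ k] by (intro exI[of _ "a + 1 / K k"] exI[of _ "b - 1 / K k"]) auto
    show ?thesis by (rule weak[unfolded weak_derivative_on_def, THEN spec, THEN spec, THEN mp, OF conjI[OF 1 conjI[OF 2 3]]])
  qed
  \<comment> \<open>The product rule for \<open>Y\<close> times the cut-off: the derivative of the
    cut-off yields the two kernels at \<open>a\<close> and \<open>b\<close>, and the remaining terms
    still carry the cut-off itself.\<close>
  have split_k: "(LINT t:{a..b}|lebesgue. \<rho>a k t * (f t * Y t)) - (LINT t:{a..b}|lebesgue. \<rho>b k t * (f t * Y t))
      + (LINT t:{a..b}|lebesgue. f t * Y' t * \<chi> k t) + (LINT t:{a..b}|lebesgue. g t * Y t * \<chi> k t) = 0" for k
  proof -
    have i: "set_integrable lebesgue {a..b} (\<lambda>t. \<rho>a k t * (f t * Y t))"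
      "set_integrable lebesgue {a..b} (\<lambda>t. \<rho>b k t * (f t * Y t))"
      "set_integrable lebesgue {a..b} (\<lambda>t. f t * Y' t * \<chi> k t)"
      by (intro absolutely_integrable_continuous_real continuous_intros f cY)+
    have "(LINT t:{a..b}|lebesgue. f t * (Y' t * \<chi> k t + (\<rho>a k t - \<rho>b k t) * Y t))
       = (LINT t:{a..b}|lebesgue. \<rho>a k t * (f t * Y t) - \<rho>b k t * (f t * Y t) + f t * Y' t * \<chi> k t)"
      by (intro arg_cong[where f = "set_lebesgue_integral lebesgue {a..b}"]) (auto simp: algebra_simps)
    then show ?thesis
      using weak_k[of k] i by (simp add: set_integral_add(2) set_integral_diff mult.assoc)
  qed
  have cfY: "continuous_on {a..b} (\<lambda>t. f t * Y t)" by (intro continuous_intros f cY)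
  have K0: "(\<lambda>k. 2 / K k) \<longlonglongrightarrow> 0" by (intro tendsto_divide_0[OF tendsto_const] filterlim_at_top_imp_at_infinity Kinf)
  have one: "(LINT t:{a..b}|lebesgue. K k * tent ((t - c) * K k + e)) = smooth_step ((b - c) * K k + e) - smooth_step ((a - c) * K k + e)" for k c e
  proof -
    have "((\<lambda>t. K k * tent ((t - c) * K k + e)) has_integral (smooth_step ((b - c) * K k + e) - smooth_step ((a - c) * K k + e))) {a..b}"
      using ab D1[of c k e] by (intro fundamental_theorem_of_calculus)
        (auto simp: has_real_derivative_iff_has_vector_derivative[symmetric] intro: has_field_derivative_at_within)
    moreover have "set_integrable lebesgue {a..b} (\<lambda>t. K k * tent ((t - c) * K k + e))"
      by (intro absolutely_integrable_continuous_real continuous_intros)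
    ultimately show ?thesis by (metis set_integral_real_eq_integral integral_unique)
  qed
  have lima: "(\<lambda>k. LINT t:{a..b}|lebesgue. \<rho>a k t * (f t * Y t)) \<longlonglongrightarrow> f a * Y a"
  proof (rule approximate_identity[OF ab cfY, of a, OF _ _ _ _ K0])
    show "0 \<le> \<rho>a k t" for k t using K(1)[of k] tent_nonneg by (simp add: \<rho>a_def)
    show "\<rho>a k t = 0" if "t \<in> {a..b}" "2 / K k < \<bar>t - a\<bar>" for k t
      using that K(1)[of k] by (simp add: \<rho>a_def tent_outside field_simps)
    have "(LINT t:{a..b}|lebesgue. \<rho>a k t) = 1" for k
      unfolding \<rho>a_def using one[of k a "-1"] K(2)[of k] by (simp add: smooth_step_0 smooth_step_1 mult.commute)
    then show "\<forall>\<^sub>F k in sequentially. (LINT t:{a..b}|lebesgue. \<rho>a k t) = 1" by simp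
  qed (use ab in \<open>auto intro!: continuous_intros\<close>)
  have limb: "(\<lambda>k. LINT t:{a..b}|lebesgue. \<rho>b k t * (f t * Y t)) \<longlonglongrightarrow> f b * Y b"
  proof (rule approximate_identity[OF ab cfY, of b, OF _ _ _ _ K0])
    show "0 \<le> \<rho>b k t" for k t using K(1)[of k] tent_nonneg by (simp add: \<rho>b_def)
    show "\<rho>b k t = 0" if "t \<in> {a..b}" "2 / K k < \<bar>t - b\<bar>" for k t
      using that K(1)[of k] by (simp add: \<rho>b_def tent_outside field_simps)
    have "(LINT t:{a..b}|lebesgue. \<rho>b k t) = 1" for k
      unfolding \<rho>b_def using one[of k b 2] K(2)[of k] by (simp add: smooth_step_0 smooth_step_1 algebra_simps)
    then show "\<forall>\<^sub>F k in sequentially. (LINT t:{a..b}|lebesgue. \<rho>b k t) = 1" by simp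
  qed (use ab in \<open>auto intro!: continuous_intros\<close>)
  \<comment> \<open>The cut-off is bounded by 1 and tends to 1 off the two end points, so it
    disappears by dominated convergence.\<close>
  have dom: "(\<lambda>k. LINT t:{a..b}|lebesgue. u t * \<chi> k t) \<longlonglongrightarrow> (LINT t:{a..b}|lebesgue. u t)"
    if u: "set_integrable lebesgue {a..b} u" for u
  proof -
    have nab: "AE t in lebesgue. t \<noteq> a \<and> t \<noteq> b"
      using AE_completion[OF AE_lborel_singleton[of a]] AE_completion[OF AE_lborel_singleton[of b]] by eventually_elim auto
    have "(\<lambda>k. LINT t|lebesgue. indicat_real {a..b} t *\<^sub>R (u t * \<chi> k t)) \<longlonglongrightarrow> (LINT t|lebesgue. indicat_real {a..b} t *\<^sub>R u t)"
    proof (rule integral_dominated_convergence)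
      show "(\<lambda>t. indicat_real {a..b} t *\<^sub>R u t) \<in> borel_measurable lebesgue"
        using u unfolding set_integrable_def by (rule borel_measurable_integrable)
      show "(\<lambda>t. indicat_real {a..b} t *\<^sub>R (u t * \<chi> k t)) \<in> borel_measurable lebesgue" for k
        using set_integrable_mult_continuous[OF c\<chi> u, of k] unfolding set_integrable_def by (rule borel_measurable_integrable)
      show "integrable lebesgue (\<lambda>t. norm (indicat_real {a..b} t *\<^sub>R u t))"
        using u unfolding set_integrable_def by (rule integrable_norm)
      show "AE t in lebesgue. (\<lambda>k. indicat_real {a..b} t *\<^sub>R (u t * \<chi> k t)) \<longlonglongrightarrow> indicat_real {a..b} t *\<^sub>R u t"
        using nab
      proof eventually_elim
        case (elim t)
        show ?case
        proof (cases "a < t \<and> t < b")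
          case True
          then show ?thesis using tendsto_mult[OF tendsto_const \<chi>lim[of t], of "u t"] by (auto simp: indicator_def)
        qed (use elim in \<open>auto simp: indicator_def\<close>)
      qed
      show "AE t in lebesgue. norm (indicat_real {a..b} t *\<^sub>R (u t * \<chi> k t)) \<le> norm (indicat_real {a..b} t *\<^sub>R u t)" for k
        by (intro AE_I2) (auto simp: abs_mult indicator_def \<chi>b intro!: mult_left_le)
    qed
    then show ?thesis by (simp add: set_lebesgue_integral_def)
  qed
  have i1: "set_integrable lebesgue {a..b} (\<lambda>t. f t * Y' t)"
    by (intro absolutely_integrable_continuous_real continuous_intros f)
  have i2: "set_integrable lebesgue {a..b} (\<lambda>t. g t * Y t)" by (rule set_integrable_mult_continuous[OF cY g])
  have "(\<lambda>k. 0) \<longlonglongrightarrow> f a * Y a - f b * Y b + (LINT t:{a..b}|lebesgue. f t * Y' t) + (LINT t:{a..b}|lebesgue. g t * Y t)"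
    using tendsto_add[OF tendsto_add[OF tendsto_diff[OF lima limb] dom[OF i1]] dom[OF i2]] by (simp add: split_k)
  then have "0 = f a * Y a - f b * Y b + (LINT t:{a..b}|lebesgue. f t * Y' t) + (LINT t:{a..b}|lebesgue. g t * Y t)"
    by (rule LIMSEQ_unique[OF tendsto_const])
  then show ?thesis by simp
qed

text \<open>Classical integration by parts without boundary terms. It lets the weights affine in
  \<open>\<tau>\<close> be treated by the same result on moving integrals as the kernel
  functions.\<close>

lemma weak_derivative_C1:
  assumes ab: "a < b" and f: "\<And>t. (f has_real_derivative f' t) (at t)" and f': "continuous_on UNIV f'"
  shows "weak_derivative_on a b f f'"
  unfolding weak_derivative_on_def
proof (intro allI impI, elim conjE exE)
  fix \<xi> \<xi>' :: "real \<Rightarrow> real" and c e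
  assume \<xi>: "\<forall>t. (\<xi> has_real_derivative \<xi>' t) (at t)" "continuous_on UNIV \<xi>'"
    and ce: "a < c" "e < b" "\<forall>t. t \<notin> {c..e} \<longrightarrow> \<xi> t = 0"
  have c: "continuous_on A f" "continuous_on A \<xi>" for A
    by (rule continuous_on_subset[OF _ subset_UNIV], rule DERIV_continuous_on, use f \<xi> in blast)+
  have c': "continuous_on A f'" "continuous_on A \<xi>'" for A
    using f' \<xi>(2) by (auto intro: continuous_on_subset)
  have i: "set_integrable lebesgue {a..b} (\<lambda>t. f t * \<xi>' t)" "set_integrable lebesgue {a..b} (\<lambda>t. f' t * \<xi> t)"
    by (intro absolutely_integrable_continuous_real continuous_intros c c')+
  have "((\<lambda>t. f t * \<xi>' t + f' t * \<xi> t) has_integral (f b * \<xi> b - f a * \<xi> a)) {a..b}"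
    using ab DERIV_mult'[OF f \<xi>(1)[rule_format]] by (intro fundamental_theorem_of_calculus)
      (auto simp: has_real_derivative_iff_has_vector_derivative[symmetric] intro: has_field_derivative_at_within)
  moreover have "\<xi> a = 0" "\<xi> b = 0" using ce by auto
  moreover have "(LINT t:{a..b}|lebesgue. f t * \<xi>' t + f' t * \<xi> t) = integral {a..b} (\<lambda>t. f t * \<xi>' t + f' t * \<xi> t)"
    using i by (intro set_integral_real_eq_integral set_integral_add)
  ultimately have "(LINT t:{a..b}|lebesgue. f t * \<xi>' t + f' t * \<xi> t) = 0"
    by (simp add: integral_unique)
  then show "(LINT t:{a..b}|lebesgue. f t * \<xi>' t) = - (LINT t:{a..b}|lebesgue. f' t * \<xi> t)"
    using i by (simp add: set_integral_add(2))
qed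

text \<open>Since \<open>y\<close> is only continuous, the time derivative cannot fall on it.
  Integrating by parts against an antiderivative \<open>Y\<close> leaves the time variable inside
  \<open>Y\<close> only, which is continuously differentiable.\<close>

lemma DERIV_moving_integral:
  fixes y :: "real \<Rightarrow> real"
  assumes ab: "a < b" and f: "continuous_on {a..b} f" and g: "set_integrable lebesgue {a..b} g"
    and weak: "weak_derivative_on a b f g"
    and y: "continuous_on UNIV y" "\<And>t. \<bar>y t\<bar> \<le> B"
  shows "((\<lambda>t. LINT \<tau>:{a..b}|lebesgue. f \<tau> * y (t + \<tau>)) has_real_derivative
     f b * y (t + b) - f a * y (t + a) - (LINT \<tau>:{a..b}|lebesgue. g \<tau> * y (t + \<tau>))) (at t)"
proof -
  have "\<exists>Y. \<forall>x::real. - \<infinity> < ereal x \<longrightarrow> ereal x < \<infinity> \<longrightarrow> (Y has_vector_derivative y x) (at x)"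
    by (rule einterval_antiderivative) (use y(1) in \<open>auto simp: continuous_on_eq_continuous_at\<close>)
  then obtain Y where Y: "\<And>x. (Y has_real_derivative y x) (at x)"
    by (auto simp: has_real_derivative_iff_has_vector_derivative)
  have cY: "continuous_on A Y" for A
    by (rule continuous_on_subset[OF _ subset_UNIV], rule DERIV_continuous_on) (rule Y)
  have Yt: "((\<lambda>\<tau>. Y (s + \<tau>)) has_real_derivative y (s + \<tau>)) (at \<tau>)" for s \<tau>
  proof -
    have "((\<lambda>\<tau>. s + \<tau>) has_real_derivative 1) (at \<tau>)" by (auto intro!: derivative_eq_intros)
    from DERIV_chain2[OF Y this] show ?thesis by simp
  qed
  have Yt': "((\<lambda>s. Y (s + \<tau>)) has_real_derivative y (s + \<tau>)) (at s)" for s \<tau>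
  proof -
    have "((\<lambda>s. s + \<tau>) has_real_derivative 1) (at s)" by (auto intro!: derivative_eq_intros)
    from DERIV_chain2[OF Y this] show ?thesis by simp
  qed
  have G: "(LINT \<tau>:{a..b}|lebesgue. f \<tau> * y (s + \<tau>)) = f b * Y (s + b) - f a * Y (s + a) - (LINT \<tau>:{a..b}|lebesgue. g \<tau> * Y (s + \<tau>))" for s
    by (rule weak_derivative_by_parts[OF ab f g weak Yt])
      (auto intro!: continuous_on_compose2[OF y(1)] continuous_intros)
  \<comment> \<open>This bound dominates the difference quotients of \<open>Y\<close> uniformly, so
    the limit may be taken under the integral with \<open>g\<close>.\<close>
  have lip: "\<bar>Y u - Y v\<bar> \<le> B * \<bar>u - v\<bar>" for u v
    using field_differentiable_bound[of UNIV Y y B u v] Y y(2) by (auto intro: has_field_derivative_at_within)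
  have cYs: "continuous_on A (\<lambda>\<tau>. Y (s + \<tau>))" for s A
    by (rule continuous_on_compose2[OF cY]) (auto intro!: continuous_intros)
  have igY: "set_integrable lebesgue {a..b} (\<lambda>\<tau>. g \<tau> * Y (s + \<tau>))" for s
    by (rule set_integrable_mult_continuous[OF cYs g])
  have "((\<lambda>s. LINT \<tau>:{a..b}|lebesgue. g \<tau> * Y (s + \<tau>)) has_real_derivative (LINT \<tau>:{a..b}|lebesgue. g \<tau> * y (t + \<tau>))) (at t)"
    unfolding has_field_derivative_iff tendsto_at_iff_sequentially
  proof (intro allI impI)
    fix X assume X: "\<forall>i. X i \<in> UNIV - {t}" "X \<longlonglongrightarrow> t"
    have eq: "((\<lambda>s. ((LINT \<tau>:{a..b}|lebesgue. g \<tau> * Y (s + \<tau>)) - (LINT \<tau>:{a..b}|lebesgue. g \<tau> * Y (t + \<tau>))) / (s - t)) \<circ> X) i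
       = (LINT \<tau>|lebesgue. indicat_real {a..b} \<tau> *\<^sub>R (g \<tau> * ((Y (X i + \<tau>) - Y (t + \<tau>)) / (X i - t))))" for i
    proof -
      have "((LINT \<tau>:{a..b}|lebesgue. g \<tau> * Y (X i + \<tau>)) - (LINT \<tau>:{a..b}|lebesgue. g \<tau> * Y (t + \<tau>))) / (X i - t)
        = (LINT \<tau>:{a..b}|lebesgue. (g \<tau> * Y (X i + \<tau>) - g \<tau> * Y (t + \<tau>)) / (X i - t))"
        using igY by (simp add: set_integral_diff)
      then show ?thesis by (simp add: set_lebesgue_integral_def right_diff_distrib diff_divide_distrib)
    qed
    have "(\<lambda>i. LINT \<tau>|lebesgue. indicat_real {a..b} \<tau> *\<^sub>R (g \<tau> * ((Y (X i + \<tau>) - Y (t + \<tau>)) / (X i - t))))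
        \<longlonglongrightarrow> (LINT \<tau>|lebesgue. indicat_real {a..b} \<tau> *\<^sub>R (g \<tau> * y (t + \<tau>)))"
    proof (rule integral_dominated_convergence)
      have cys: "continuous_on A (\<lambda>\<tau>. y (t + \<tau>))" for A
        by (rule continuous_on_compose2[OF y(1)]) (auto intro!: continuous_intros)
      show "(\<lambda>\<tau>. indicat_real {a..b} \<tau> *\<^sub>R (g \<tau> * y (t + \<tau>))) \<in> borel_measurable lebesgue"
        using set_integrable_mult_continuous[OF cys g] unfolding set_integrable_def by (rule borel_measurable_integrable)
      have cq: "continuous_on A (\<lambda>\<tau>. (Y (X i + \<tau>) - Y (t + \<tau>)) / (X i - t))" for i A
        using X(1) by (intro continuous_intros cYs) auto
      show "(\<lambda>\<tau>. indicat_real {a..b} \<tau> *\<^sub>R (g \<tau> * ((Y (X i + \<tau>) - Y (t + \<tau>)) / (X i - t)))) \<in> borel_measurable lebesgue" for i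
        using set_integrable_mult_continuous[OF cq g] unfolding set_integrable_def by (rule borel_measurable_integrable)
      show "integrable lebesgue (\<lambda>\<tau>. B * norm (indicat_real {a..b} \<tau> *\<^sub>R g \<tau>))"
        using g unfolding set_integrable_def by (intro integrable_mult_right integrable_norm)
      show "AE \<tau> in lebesgue. (\<lambda>i. indicat_real {a..b} \<tau> *\<^sub>R (g \<tau> * ((Y (X i + \<tau>) - Y (t + \<tau>)) / (X i - t)))) \<longlonglongrightarrow> indicat_real {a..b} \<tau> *\<^sub>R (g \<tau> * y (t + \<tau>))"
      proof (intro AE_I2 tendsto_intros)
        fix \<tau>
        show "(\<lambda>i. (Y (X i + \<tau>) - Y (t + \<tau>)) / (X i - t)) \<longlonglongrightarrow> y (t + \<tau>)"
          using Yt'[of \<tau> t] X unfolding has_field_derivative_iff tendsto_at_iff_sequentially by (auto simp: comp_def)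
      qed
      show "AE \<tau> in lebesgue. norm (indicat_real {a..b} \<tau> *\<^sub>R (g \<tau> * ((Y (X i + \<tau>) - Y (t + \<tau>)) / (X i - t)))) \<le> B * norm (indicat_real {a..b} \<tau> *\<^sub>R g \<tau>)" for i
      proof (intro AE_I2)
        fix \<tau>
        have "\<bar>Y (X i + \<tau>) - Y (t + \<tau>)\<bar> / \<bar>X i - t\<bar> \<le> B" using lip[of "X i + \<tau>" "t + \<tau>"] X(1) by (simp add: field_simps)
        then have "\<bar>g \<tau>\<bar> * (\<bar>Y (X i + \<tau>) - Y (t + \<tau>)\<bar> / \<bar>X i - t\<bar>) \<le> \<bar>g \<tau>\<bar> * B" by (intro mult_left_mono) auto
        then show "norm (indicat_real {a..b} \<tau> *\<^sub>R (g \<tau> * ((Y (X i + \<tau>) - Y (t + \<tau>)) / (X i - t)))) \<le> B * norm (indicat_real {a..b} \<tau> *\<^sub>R g \<tau>)"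
          by (auto simp: indicator_def abs_mult mult.commute)
      qed
    qed
    then show "((\<lambda>s. ((LINT \<tau>:{a..b}|lebesgue. g \<tau> * Y (s + \<tau>)) - (LINT \<tau>:{a..b}|lebesgue. g \<tau> * Y (t + \<tau>))) / (s - t)) \<circ> X)
      \<longlonglongrightarrow> (LINT \<tau>:{a..b}|lebesgue. g \<tau> * y (t + \<tau>))"
      unfolding eq[abs_def, folded fun_eq_iff] by (simp add: set_lebesgue_integral_def comp_def eq[unfolded comp_def])
  qed
  then show ?thesis unfolding G
    by (intro DERIV_diff DERIV_cmult Yt')
qed

subsection \<open>The number of unknowns\<close>

text \<open>Positions in the lower triangle, row index first; they are the free entries of a
  symmetric matrix.\<close>

definition tri :: "nat \<Rightarrow> (nat \<times> nat) set" where
  "tri k = (SIGMA j:{..<k}. {..j})"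

definition symm :: "nat \<Rightarrow> (nat \<times> nat \<Rightarrow> real) \<Rightarrow> real mat" where
  "symm k f = Matrix.mat k k (\<lambda>(i, j). f (max i j, min i j))"

lemma symm_dims [simp]: "dim_row (symm k f) = k" "dim_col (symm k f) = k"
  by (simp_all add: symm_def)

lemma symm_symmetric: "symm k f \<in> symmetric_mats k"
  by (auto simp: symm_def symmetric_mats_def max.commute min.commute intro!: eq_matI)

lemma symm_index: "(j, i) \<in> tri k \<Longrightarrow> symm k f $$ (j, i) = f (j, i)"
  by (auto simp: tri_def symm_def max_def min_def)

lemma symm_surj:
  assumes "A \<in> symmetric_mats k" "\<And>x. x \<in> tri k \<Longrightarrow> f x = A $$ x"
  shows "symm k f = A"
proof (rule eq_matI)
  fix i j assume ij: "i < dim_row A" "j < dim_col A"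
  have k: "A \<in> carrier_mat k k" "A\<^sup>T = A" using assms(1) by (auto simp: symmetric_mats_def)
  have "A $$ (i, j) = A $$ (j, i)" using k ij by (metis carrier_matD index_transpose_mat(1))
  then show "symm k f $$ (i, j) = A $$ (i, j)"
    using k ij assms(2)[of "(max i j, min i j)"] by (auto simp: symm_def tri_def max_def min_def split: if_splits)
qed (use assms(1) in \<open>auto simp: symmetric_mats_def\<close>)

lemma card_tri: "real (card (tri k)) = real k * (real k + 1) / 2"
proof -
  have "card (tri k) = (\<Sum>j<k. Suc j)" by (simp add: tri_def card_SigmaI)
  moreover have "real (\<Sum>j<k. Suc j) = real k * (real k + 1) / 2"
    by (induction k) (auto simp: field_simps)
  ultimately show ?thesis by simp
qed

text \<open>The tag \<open>t\<close> selects the unknown: 0, 1, 2, 3, 4 stand for \<open>X\<close>,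
  \<open>P1\<close>, \<open>P2\<close>, \<open>P3\<close>, \<open>V\<close>, then
  \<open>4 + i\<close> for \<open>Q i\<close> and \<open>4 + \<nu> + i\<close> for
  \<open>R i\<close>, with \<open>i\<close> running from 1 to \<open>\<nu>\<close>. Symmetric
  unknowns contribute a triangle, the others a full rectangle.\<close>

definition coords :: "nat \<Rightarrow> nat \<Rightarrow> nat \<Rightarrow> nat \<Rightarrow> (nat \<times> nat \<times> nat) set" where
  "coords n p \<nu> d = (SIGMA t:{..<5 + 2 * \<nu>}. if t = 2 then {..<n} \<times> {..<d * n} else if t = 3 then tri (d * n)
     else if t = 4 then {..<p} \<times> {..<n} else tri n)"

definition decode :: "nat \<Rightarrow> nat \<Rightarrow> nat \<Rightarrow> nat \<Rightarrow> (nat \<times> nat \<times> nat \<Rightarrow> real) \<Rightarrow> decision" where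
  "decode n p \<nu> d c = \<lparr> varX = symm n (\<lambda>x. c (0, x)), varP1 = symm n (\<lambda>x. c (1, x)),
     varP2 = Matrix.mat n (d * n) (\<lambda>x. c (2, x)), varP3 = symm (d * n) (\<lambda>x. c (3, x)),
     varQ = (\<lambda>i\<in>{1..\<nu>}. symm n (\<lambda>x. c (4 + i, x))), varR = (\<lambda>i\<in>{1..\<nu>}. symm n (\<lambda>x. c (4 + \<nu> + i, x))),
     varV = Matrix.mat p n (\<lambda>x. c (4, x)) \<rparr>"

lemma finite_tri [simp]: "finite (tri k)"
  by (simp add: tri_def)

lemma finite_coords [simp]: "finite (coords n p \<nu> d)"
  by (auto simp: coords_def)

lemma card_coords:
  "real (card (coords n p \<nu> d)) = (0.5 * (real d)\<^sup>2 + real d + real \<nu> + 1) * (real n)\<^sup>2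
     + (0.5 * real d + 1 + real \<nu> + real p) * real n"
proof -
  let ?J = "\<lambda>t::nat. if t = 2 then {..<n} \<times> {..<d * n} else if t = 3 then tri (d * n)
     else if t = 4 then {..<p} \<times> {..<n} else tri n"
  have "card (coords n p \<nu> d) = (\<Sum>t<5 + 2 * \<nu>. card (?J t))"
    unfolding coords_def by (subst card_SigmaI) auto
  also have "\<dots> = (\<Sum>t<5. card (?J t)) + (\<Sum>t=5..<5 + 2 * \<nu>. card (?J t))"
    by (subst sum.atLeastLessThan_concat[symmetric, of 0 5 "5 + 2 * \<nu>", unfolded atLeast0LessThan]) auto
  also have "(\<Sum>t=5..<5 + 2 * \<nu>. card (?J t)) = (\<Sum>t=5..<5 + 2 * \<nu>. card (tri n))"
    by (intro sum.cong) auto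
  finally have "card (coords n p \<nu> d) = 2 * card (tri n) + n * (d * n) + card (tri (d * n)) + p * n + 2 * \<nu> * card (tri n)"
    by (simp add: eval_nat_numeral)
  then have "real (card (coords n p \<nu> d)) = 2 * real (card (tri n)) + n * (d * n) + real (card (tri (d * n))) + p * n + 2 * \<nu> * real (card (tri n))"
    by simp
  then show ?thesis unfolding card_tri by (simp add: field_simps power2_eq_square)
qed

lemma decode_carrier: "decode n p \<nu> d c \<in> carrier (decision_space n p \<nu> d)"
  by (auto simp: decode_def decision_space_def symm_symmetric)

lemma decode_inj:
  assumes "decode n p \<nu> d c = decode n p \<nu> d c'" "x \<in> coords n p \<nu> d"
  shows "c x = c' x"
proof -
  obtain t i j where x: "x = (t, i, j)" by (cases x)
  have eqs: "symm n (\<lambda>x. c (0, x)) = symm n (\<lambda>x. c' (0, x))" "symm n (\<lambda>x. c (1, x)) = symm n (\<lambda>x. c' (1, x))"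
    "Matrix.mat n (d * n) (\<lambda>x. c (2, x)) = Matrix.mat n (d * n) (\<lambda>x. c' (2, x))"
    "symm (d * n) (\<lambda>x. c (3, x)) = symm (d * n) (\<lambda>x. c' (3, x))"
    "Matrix.mat p n (\<lambda>x. c (4, x)) = Matrix.mat p n (\<lambda>x. c' (4, x))"
    and Q: "(\<lambda>i\<in>{1..\<nu>}. symm n (\<lambda>x. c (4 + i, x))) = (\<lambda>i\<in>{1..\<nu>}. symm n (\<lambda>x. c' (4 + i, x)))"
    and R: "(\<lambda>i\<in>{1..\<nu>}. symm n (\<lambda>x. c (4 + \<nu> + i, x))) = (\<lambda>i\<in>{1..\<nu>}. symm n (\<lambda>x. c' (4 + \<nu> + i, x)))"
    using assms(1) by (simp_all only: decode_def decision.ext_inject)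
  have Q': "symm n (\<lambda>x. c (4 + i, x)) = symm n (\<lambda>x. c' (4 + i, x))" if "i \<in> {1..\<nu>}" for i
    using fun_cong[OF Q, of i] that by simp
  have R': "symm n (\<lambda>x. c (4 + \<nu> + i, x)) = symm n (\<lambda>x. c' (4 + \<nu> + i, x))" if "i \<in> {1..\<nu>}" for i
    using fun_cong[OF R, of i] that by simp
  consider "t = 0" | "t = 1" | "t = 2" | "t = 3" | "t = 4" | "5 \<le> t" "t \<le> 4 + \<nu>" | "5 + \<nu> \<le> t" "t < 5 + 2 * \<nu>"
    using assms(2) x unfolding coords_def by fastforce
  then show ?thesis
  proof cases
    case 1
    then have "(i, j) \<in> tri n" using assms(2) x by (auto simp: coords_def)
    then show ?thesis using arg_cong[OF eqs(1), of "\<lambda>A. A $$ (i, j)"] by (simp add: symm_index x 1)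
  next
    case 2
    then have "(i, j) \<in> tri n" using assms(2) x by (auto simp: coords_def)
    then show ?thesis using arg_cong[OF eqs(2), of "\<lambda>A. A $$ (i, j)"] by (simp add: symm_index x 2)
  next
    case 3
    then have "i < n" "j < d * n" using assms(2) x by (auto simp: coords_def)
    then show ?thesis using arg_cong[OF eqs(3), of "\<lambda>A. A $$ (i, j)"] by (simp add: x 3)
  next
    case 4
    then have "(i, j) \<in> tri (d * n)" using assms(2) x by (auto simp: coords_def)
    then show ?thesis using arg_cong[OF eqs(4), of "\<lambda>A. A $$ (i, j)"] by (simp add: symm_index x 4)
  next
    case 5
    then have "i < p" "j < n" using assms(2) x by (auto simp: coords_def)
    then show ?thesis using arg_cong[OF eqs(5), of "\<lambda>A. A $$ (i, j)"] by (simp add: x 5)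
  next
    case 6
    then have "(i, j) \<in> tri n" using assms(2) x by (auto simp: coords_def)
    moreover have "t - 4 \<in> {1..\<nu>}" using 6 by auto
    ultimately show ?thesis using arg_cong[OF Q'[of "t - 4"], of "\<lambda>A. A $$ (i, j)"] 6 by (simp add: symm_index x)
  next
    case 7
    then have "(i, j) \<in> tri n" using assms(2) x by (auto simp: coords_def)
    moreover have "t - 4 - \<nu> \<in> {1..\<nu>}" using 7 by auto
    ultimately show ?thesis using arg_cong[OF R'[of "t - 4 - \<nu>"], of "\<lambda>A. A $$ (i, j)"] 7 by (simp add: symm_index x)
  qed
qed

lemma decode_cong:
  assumes "\<And>x. x \<in> coords n p \<nu> d \<Longrightarrow> c x = c' x"
  shows "decode n p \<nu> d c = decode n p \<nu> d c'"
proof -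
  have s: "symm k f = symm k g" if "\<And>x. x \<in> tri k \<Longrightarrow> f x = g x" for k f g
    using that by (auto simp: symm_def tri_def max_def min_def intro!: eq_matI)
  show ?thesis unfolding decode_def
    by (auto intro!: s eq_matI restrict_ext assms simp: coords_def)
qed

lemma decode_surj:
  assumes U: "U \<in> carrier (decision_space n p \<nu> d)"
    and c: "\<And>t x. (t, x) \<in> coords n p \<nu> d \<Longrightarrow> c (t, x) = (if t = 0 then varX U else if t = 1 then varP1 U
      else if t = 2 then varP2 U else if t = 3 then varP3 U else if t = 4 then varV U
      else if t \<le> 4 + \<nu> then varQ U (t - 4) else varR U (t - 4 - \<nu>)) $$ x"
  shows "decode n p \<nu> d c = U"
proof -
  have u: "varX U \<in> symmetric_mats n" "varP1 U \<in> symmetric_mats n" "varP2 U \<in> carrier_mat n (d * n)"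
    "varP3 U \<in> symmetric_mats (d * n)" "varV U \<in> carrier_mat p n"
    and Q: "varQ U \<in> (\<Pi>\<^sub>E i\<in>{1..\<nu>}. symmetric_mats n)" and R: "varR U \<in> (\<Pi>\<^sub>E i\<in>{1..\<nu>}. symmetric_mats n)"
    using U by (simp_all add: decision_space_def)
  have "symm n (\<lambda>x. c (0, x)) = varX U" using u by (intro symm_surj) (auto simp: c coords_def)
  moreover have "symm n (\<lambda>x. c (1, x)) = varP1 U" using u by (intro symm_surj) (auto simp: c coords_def)
  moreover have "Matrix.mat n (d * n) (\<lambda>x. c (2, x)) = varP2 U"
    using u by (intro eq_matI) (auto simp: c coords_def)
  moreover have "symm (d * n) (\<lambda>x. c (3, x)) = varP3 U" using u by (intro symm_surj) (auto simp: c coords_def)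
  moreover have "Matrix.mat p n (\<lambda>x. c (4, x)) = varV U"
    using u by (intro eq_matI) (auto simp: c coords_def)
  moreover have "(\<lambda>i\<in>{1..\<nu>}. symm n (\<lambda>x. c (4 + i, x))) = varQ U"
  proof (rule PiE_ext[OF _ Q])
    have s: "symm n (\<lambda>x. c (4 + i, x)) = varQ U i" if i: "i \<in> {1..\<nu>}" for i
      using Q i by (intro symm_surj) (auto simp: c coords_def)
    then show "(\<lambda>i\<in>{1..\<nu>}. symm n (\<lambda>x. c (4 + i, x))) i = varQ U i" if "i \<in> {1..\<nu>}" for i
      using that by simp
  qed (simp add: symm_symmetric)
  moreover have "(\<lambda>i\<in>{1..\<nu>}. symm n (\<lambda>x. c (4 + \<nu> + i, x))) = varR U"
  proof (rule PiE_ext[OF _ R])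
    have s: "symm n (\<lambda>x. c (4 + \<nu> + i, x)) = varR U i" if i: "i \<in> {1..\<nu>}" for i
      using R i by (intro symm_surj) (auto simp: c coords_def)
    then show "(\<lambda>i\<in>{1..\<nu>}. symm n (\<lambda>x. c (4 + \<nu> + i, x))) i = varR U i" if "i \<in> {1..\<nu>}" for i
      using that by simp
  qed (simp add: symm_symmetric)
  ultimately show ?thesis unfolding decode_def by simp
qed

lemma decode_linear:
  "decode n p \<nu> d (\<lambda>x. c x + c' x) = decode n p \<nu> d c \<oplus>\<^bsub>decision_space n p \<nu> d\<^esub> decode n p \<nu> d c'"
  "decode n p \<nu> d (\<lambda>x. r * c x) = r \<odot>\<^bsub>decision_space n p \<nu> d\<^esub> decode n p \<nu> d c"
  by (auto simp: decode_def decision_space_def symm_def intro!: restrict_ext eq_matI)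

lemma decode_ex:
  assumes "U \<in> carrier (decision_space n p \<nu> d)"
  shows "\<exists>c. U = decode n p \<nu> d c"
proof -
  define c where "c = (\<lambda>(t, x). (if t = 0 then varX U else if t = 1 then varP1 U
      else if t = 2 then varP2 U else if t = 3 then varP3 U else if t = 4 then varV U
      else if t \<le> 4 + \<nu> then varQ U (t - 4) else varR U (t - 4 - \<nu>)) $$ x)"
  have "decode n p \<nu> d c = U" by (rule decode_surj[OF assms]) (simp add: c_def)
  then show ?thesis by metis
qed

lemma decode_zero: "decode n p \<nu> d (\<lambda>_. 0) = \<zero>\<^bsub>decision_space n p \<nu> d\<^esub>"
  by (auto simp: decode_def decision_space_def symm_def intro!: restrict_ext eq_matI)

text \<open>The vector space laws are those of functions on the coordinates, transported by \<^const>\<open>decode\<close>.\<close>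

lemma vectorspace_decision_space: "vectorspace class_ring (decision_space n p \<nu> d)"
proof -
  let ?V = "decision_space n p \<nu> d" and ?D = "decode n p \<nu> d"
  note lin = decode_linear[symmetric] decode_zero[symmetric]
  have "abelian_group ?V"
  proof (rule abelian_groupI)
    fix U assume "U \<in> carrier ?V"
    then obtain c where c: "U = ?D c" using decode_ex by blast
    have "?D (\<lambda>x. - c x) \<oplus>\<^bsub>?V\<^esub> U = \<zero>\<^bsub>?V\<^esub>" unfolding c lin by simp
    then show "\<exists>W\<in>carrier ?V. W \<oplus>\<^bsub>?V\<^esub> U = \<zero>\<^bsub>?V\<^esub>" using decode_carrier by blast
    show "\<zero>\<^bsub>?V\<^esub> \<oplus>\<^bsub>?V\<^esub> U = U" unfolding c lin by simp
    fix W assume "W \<in> carrier ?V"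
    then obtain c' where c': "W = ?D c'" using decode_ex by blast
    show "U \<oplus>\<^bsub>?V\<^esub> W \<in> carrier ?V" unfolding c c' lin by (rule decode_carrier)
    show "U \<oplus>\<^bsub>?V\<^esub> W = W \<oplus>\<^bsub>?V\<^esub> U" unfolding c c' lin by (simp add: add.commute)
    fix Z assume "Z \<in> carrier ?V"
    then obtain c'' where c'': "Z = ?D c''" using decode_ex by blast
    show "U \<oplus>\<^bsub>?V\<^esub> W \<oplus>\<^bsub>?V\<^esub> Z = U \<oplus>\<^bsub>?V\<^esub> (W \<oplus>\<^bsub>?V\<^esub> Z)" unfolding c c' c'' lin by (simp add: add.assoc)
  qed (unfold lin, rule decode_carrier)
  moreover have "cring (class_ring :: real ring)" by (rule module.axioms(1)[OF vec_module])
  moreover have "field (class_ring :: real ring)" by (rule class_field)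
  ultimately show ?thesis
    unfolding vectorspace_def
  proof (intro conjI module.intro module_axioms.intro)
    fix a b :: real and U W
    assume "U \<in> carrier ?V"
    then obtain c where c: "U = ?D c" using decode_ex by blast
    show "a \<odot>\<^bsub>?V\<^esub> U \<in> carrier ?V" unfolding c lin by (rule decode_carrier)
    show "(a \<oplus>\<^bsub>class_ring\<^esub> b) \<odot>\<^bsub>?V\<^esub> U = a \<odot>\<^bsub>?V\<^esub> U \<oplus>\<^bsub>?V\<^esub> b \<odot>\<^bsub>?V\<^esub> U"
      unfolding c lin class_ring_simps by (simp add: distrib_right)
    show "(a \<otimes>\<^bsub>class_ring\<^esub> b) \<odot>\<^bsub>?V\<^esub> U = a \<odot>\<^bsub>?V\<^esub> (b \<odot>\<^bsub>?V\<^esub> U)"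
      unfolding c lin class_ring_simps by (simp add: mult.assoc)
    show "\<one>\<^bsub>class_ring\<^esub> \<odot>\<^bsub>?V\<^esub> U = U" unfolding c lin class_ring_simps by simp
    assume "W \<in> carrier ?V"
    then obtain c' where c': "W = ?D c'" using decode_ex by blast
    show "a \<odot>\<^bsub>?V\<^esub> (U \<oplus>\<^bsub>?V\<^esub> W) = a \<odot>\<^bsub>?V\<^esub> U \<oplus>\<^bsub>?V\<^esub> a \<odot>\<^bsub>?V\<^esub> W"
      unfolding c c' lin by (simp add: distrib_left)
  qed
qed

text \<open>A numbering of the coordinates turns \<open>decode\<close> into a linear bijection from
  the vectors of length \<open>N\<close>, and such maps preserve dimension.\<close>

lemma num_unknowns_eq: "num_unknowns n p \<nu> d = card (coords n p \<nu> d)"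
proof -
  let ?V = "decision_space n p \<nu> d"
  define N where "N = card (coords n p \<nu> d)"
  obtain e where e: "bij_betw e (coords n p \<nu> d) {0..<N}"
    using ex_bij_betw_finite_nat[OF finite_coords] N_def by blast
  have eN: "x \<in> coords n p \<nu> d \<Longrightarrow> e x < N" for x using bij_betwE[OF e] by auto
  \<comment> \<open>The value off \<open>coords\<close> is immaterial to \<open>decode\<close>; the
    constant 0 keeps the coordinate function linear in \<open>v\<close>.\<close>
  define T where "T v = decode n p \<nu> d (\<lambda>x. if x \<in> coords n p \<nu> d then v $ e x else 0)" for v :: "real Matrix.vec"
  let ?W = "module_vec TYPE(real) N"
  have W: "carrier ?W = carrier_vec N" "v \<oplus>\<^bsub>?W\<^esub> w = v + w" "r \<odot>\<^bsub>?W\<^esub> v = r \<cdot>\<^sub>v v" for v w r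
    by (simp_all add: module_vec_simps)
  have mV: "module class_ring ?V" using vectorspace_decision_space by (simp add: vectorspace_def)
  have c: "T v \<in> carrier ?V" for v unfolding T_def by (rule decode_carrier)
  have add: "T (v \<oplus>\<^bsub>?W\<^esub> w) = T v \<oplus>\<^bsub>?V\<^esub> T w" if vw: "v \<in> carrier ?W" "w \<in> carrier ?W" for v w
  proof -
    have "(\<lambda>x. if x \<in> coords n p \<nu> d then (v + w) $ e x else 0)
        = (\<lambda>x. (if x \<in> coords n p \<nu> d then v $ e x else 0) + (if x \<in> coords n p \<nu> d then w $ e x else 0))"
      using vw eN by (auto simp: W(1) fun_eq_iff)
    then show ?thesis unfolding T_def W(2) by (simp only: decode_linear(1))
  qed
  have smult: "T (r \<odot>\<^bsub>?W\<^esub> v) = r \<odot>\<^bsub>?V\<^esub> T v" if v: "v \<in> carrier ?W" for r v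
  proof -
    have "(\<lambda>x. if x \<in> coords n p \<nu> d then (r \<cdot>\<^sub>v v) $ e x else 0)
        = (\<lambda>x. r * (if x \<in> coords n p \<nu> d then v $ e x else 0))"
      using v eN by (auto simp: W(1) fun_eq_iff)
    then show ?thesis unfolding T_def W(3) by (simp only: decode_linear(2))
  qed
  have lin: "linear_map class_ring ?W ?V T"
    unfolding linear_map_def mod_hom_def mod_hom_axioms_def module_hom_def
    using c add smult by (intro conjI CollectI vectorspace_decision_space vec_vs vec_module mV) blast+
  have inj: "inj_on T (carrier (module_vec TYPE(real) N))"
  proof (rule inj_onI)
    fix v w :: "real Matrix.vec"
    assume vw: "v \<in> carrier (module_vec TYPE(real) N)" "w \<in> carrier (module_vec TYPE(real) N)" "T v = T w"
    show "v = w"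
    proof (rule eq_vecI)
      fix i assume "i < dim_vec w"
      then have "i \<in> {0..<N}" using vw by (auto simp: W(1))
      then obtain x where x: "x \<in> coords n p \<nu> d" "e x = i" using e by (metis bij_betw_iff_bijections)
      show "v $ i = w $ i" using decode_inj[OF vw(3)[unfolded T_def] x(1)] x by simp
    qed (use vw in \<open>auto simp: module_vec_simps\<close>)
  qed
  have surj: "T ` carrier (module_vec TYPE(real) N) = carrier ?V"
  proof (intro equalityI subsetI)
    fix U assume U: "U \<in> carrier ?V"
    obtain c where c: "U = decode n p \<nu> d c" using decode_ex[OF U] by blast
    define v where "v = Matrix.vec N (\<lambda>i. c (inv_into (coords n p \<nu> d) e i))"
    have "v $ e x = c x" if "x \<in> coords n p \<nu> d" for x
      using that eN[OF that] bij_betw_inv_into_left[OF e that] by (simp add: v_def)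
    then have "T v = U" unfolding T_def c by (intro decode_cong) simp
    moreover have "v \<in> carrier (module_vec TYPE(real) N)" by (simp add: v_def W(1))
    ultimately show "U \<in> T ` carrier (module_vec TYPE(real) N)" by blast
  qed (auto intro: decode_carrier simp: T_def)
  have "vectorspace.dim class_ring ?W = vectorspace.dim class_ring ?V"
    by (rule linear_map.dim_eq[OF lin vec_space.fin_dim inj surj])
  then show ?thesis by (simp add: vec_space.dim_is_n num_unknowns_def N_def)
qed

text \<open>For \<open>d\<close> and \<open>n\<close> at least 1, every power of \<open>d\<close> is
  at most \<open>d^2\<close> and every \<open>n\<close> at most \<open>n^2\<close>. The constant is
  the sum \<open>(2.5 + \<nu>) + (1.5 + \<nu> + p)\<close> of the coefficients of the count.\<close>

lemma num_unknowns_bigo: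
  "(\<lambda>(d, n). real (num_unknowns n p \<nu> d)) \<in> O[principal ({1..} \<times> {1..})](\<lambda>(d, n). (real d)\<^sup>2 * (real n)\<^sup>2)"
proof (rule bigoI[where c = "4 + 2 * real \<nu> + real p"])
  show "\<forall>\<^sub>F x in principal ({1..} \<times> {1..}). norm (case x of (d, n) \<Rightarrow> real (num_unknowns n p \<nu> d))
      \<le> (4 + 2 * real \<nu> + real p) * norm (case x of (d, n) \<Rightarrow> (real d)\<^sup>2 * (real n)\<^sup>2)"
    unfolding eventually_principal
  proof
    fix x assume "x \<in> {1::nat..} \<times> {1::nat..}"
    then obtain d n :: nat where x: "x = (d, n)" and "1 \<le> d" "1 \<le> n" by auto
    then have d: "1 \<le> real d" and n: "1 \<le> real n" by auto
    define D where "D = (real d)\<^sup>2"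
    define M where "M = (real n)\<^sup>2"
    have 1: "real d \<le> D" "1 \<le> D" "real n \<le> M" "0 \<le> M"
      using d n self_le_power[of "real d" 2] self_le_power[of "real n" 2] by (auto simp: D_def M_def)
    have "(0.5 * D + real d + real \<nu> + 1) * M \<le> (0.5 * D + D + real \<nu> * D + D) * M"
      using 1 mult_left_mono[of 1 D "real \<nu>"] by (intro mult_right_mono) auto
    moreover have "(0.5 * real d + 1 + real \<nu> + real p) * real n \<le> (0.5 * D + D + real \<nu> * D + real p * D) * M"
      using 1 n mult_left_mono[of 1 D "real \<nu>"] mult_left_mono[of 1 D "real p"] by (intro mult_mono) auto
    ultimately have "real (num_unknowns n p \<nu> d) \<le> (4 + 2 * real \<nu> + real p) * (D * M)"
      unfolding num_unknowns_eq card_coords by (simp add: D_def[symmetric] M_def[symmetric] algebra_simps)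
    then show "norm (case x of (d, n) \<Rightarrow> real (num_unknowns n p \<nu> d))
      \<le> (4 + 2 * real \<nu> + real p) * norm (case x of (d, n) \<Rightarrow> (real d)\<^sup>2 * (real n)\<^sup>2)"
      by (simp add: x D_def M_def)
  qed
qed

subsection \<open>Stacked block vectors\<close>

lemma hcat_single: "hcat [A] = A"
  by (rule eq_matI) (auto simp: hcat_Cons hcat_Nil)

lemma vcat_single: "vcat [A] = A"
  by (rule eq_matI) (auto simp: vcat_Cons vcat_Nil append_rows_def)

lemma hcat_Cons_mult_vec:
  assumes "dim_vec v = dim_col A" "dim_vec u = dim_col (hcat (B # Bs))" "dim_row B = dim_row A"
  shows "hcat (A # B # Bs) *\<^sub>v (v @\<^sub>v u) = A *\<^sub>v v + hcat (B # Bs) *\<^sub>v u"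
proof -
  have dr: "dim_row (hcat (B # Bs)) = dim_row A" using assms by (simp add: dim_hcat)
  have "hcat (A # B # Bs) *\<^sub>v (v @\<^sub>v u) = (A *\<^sub>v v + hcat (B # Bs) *\<^sub>v u) @\<^sub>v
      (0\<^sub>m 0 (dim_col A) *\<^sub>v v + 0\<^sub>m 0 (dim_col (hcat (B # Bs))) *\<^sub>v u)"
    unfolding hcat_Cons[of A "B # Bs"]
    by (rule four_block_mat_mult_vec[of _ "dim_row A" "dim_col A" _ "dim_col (hcat (B # Bs))" _ 0])
      (use assms dr in \<open>auto intro!: carrier_matI carrier_vecI\<close>)
  also have "\<dots> = A *\<^sub>v v + hcat (B # Bs) *\<^sub>v u" by (rule eq_vecI) auto
  finally show ?thesis .
qed

lemma vcat_Cons_form: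
  assumes "dim_vec u = dim_row A" "dim_vec v = dim_row (vcat (B # Bs))" "dim_vec x = dim_col A" "dim_col B = dim_col A"
  shows "(u @\<^sub>v v) \<bullet> (vcat (A # B # Bs) *\<^sub>v x) = u \<bullet> (A *\<^sub>v x) + v \<bullet> (vcat (B # Bs) *\<^sub>v x)"
proof -
  have "(A @\<^sub>r vcat (B # Bs)) *\<^sub>v x = A *\<^sub>v x @\<^sub>v vcat (B # Bs) *\<^sub>v x"
    by (rule mat_mult_append[of _ "dim_row A" "dim_col A" _ "dim_row (vcat (B # Bs))"])
      (use assms in \<open>auto intro!: carrier_matI carrier_vecI simp: dim_vcat\<close>)
  then show ?thesis unfolding vcat_Cons[of A "B # Bs"]
    by (simp add: scalar_prod_append' assms del: vcat_Cons)
qed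

lemma zero_mat_mult_vec: "(0\<^sub>m r c :: real mat) *\<^sub>v v = 0\<^sub>v r" if "dim_vec v = c"
  using that by (intro eq_vecI) auto

lemma add_zero_right_vec: "dim_vec v = r \<Longrightarrow> v + 0\<^sub>v r = (v :: real Matrix.vec)"
  by (intro eq_vecI) auto

lemma scalar_prod_zero_right: "v \<bullet> 0\<^sub>v r = (0 :: real)"
  by (simp add: scalar_prod_def)

text \<open>\<open>c i l\<close> is meant as the coefficient vector of the \<open>l\<close>-th state
  component with respect to the \<open>i\<close>-th family of functions; within a block the order is
  that of a Kronecker product with identity on the right.\<close>

definition stack :: "nat \<Rightarrow> (nat \<Rightarrow> nat) \<Rightarrow> (nat \<Rightarrow> nat \<Rightarrow> real Matrix.vec) \<Rightarrow> nat list \<Rightarrow> real Matrix.vec" where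
  "stack n k c is = vconcat (map (\<lambda>i. blk (k i) n (\<lambda>j l. c i l $ j)) is)"

lemma dim_stack [simp]: "dim_vec (stack n k c is) = (\<Sum>i\<leftarrow>is. k i) * n"
  by (simp add: stack_def comp_def sum_list_mult_const)

lemma stack_eq_blk:
  assumes "\<And>i l. i \<in> set is \<Longrightarrow> dim_vec (c i l) = k i"
  shows "stack n k c is = blk (\<Sum>i\<leftarrow>is. k i) n (\<lambda>j l. vconcat (map (\<lambda>i. c i l) is) $ j)"
  unfolding stack_def by (rule blk_vconcat[symmetric]) (use assms in auto)

lemma vec_index_self: "dim_vec v = r \<Longrightarrow> Matrix.vec r (\<lambda>j. v $ j) = v"
  by (intro eq_vecI) auto

lemma kron_one_right_blk:
  assumes "dim_col M = K" "\<And>l. dim_vec (V l) = K"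
  shows "kron M (1\<^sub>m n) *\<^sub>v blk K n (\<lambda>j l. V l $ j) = blk (dim_row M) n (\<lambda>r l. (M *\<^sub>v V l) $ r)"
  using kron_one_right[OF assms(1), of n "\<lambda>j l. V l $ j"] by (simp add: vec_index_self assms(2))

text \<open>Both structures decouple: the identity factor separates the components \<open>l\<close>
  and the block diagonal separates the families \<open>i\<close>.\<close>

lemma kron_diag_stack:
  assumes "\<And>i l. i \<in> set is \<Longrightarrow> dim_vec (c i l) = dim_col (B i)"
  shows "kron (diag_block_mat (map B is)) (1\<^sub>m n) *\<^sub>v stack n (\<lambda>i. dim_col (B i)) c is
    = stack n (\<lambda>i. dim_row (B i)) (\<lambda>i l. B i *\<^sub>v c i l) is"
proof -
  let ?K = "\<Sum>i\<leftarrow>is. dim_col (B i)"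
  have "stack n (\<lambda>i. dim_col (B i)) c is = blk ?K n (\<lambda>j l. vconcat (map (\<lambda>i. c i l) is) $ j)"
    by (rule stack_eq_blk) (rule assms)
  moreover have "kron (diag_block_mat (map B is)) (1\<^sub>m n) *\<^sub>v blk ?K n (\<lambda>j l. vconcat (map (\<lambda>i. c i l) is) $ j)
     = blk (dim_row (diag_block_mat (map B is))) n (\<lambda>r l. (diag_block_mat (map B is) *\<^sub>v vconcat (map (\<lambda>i. c i l) is)) $ r)"
    using assms by (intro kron_one_right_blk) (auto simp: dim_diag_block_mat' comp_def intro!: arg_cong[where f = sum_list])
  moreover have "diag_block_mat (map B is) *\<^sub>v vconcat (map (\<lambda>i. c i l) is) = vconcat (map (\<lambda>i. B i *\<^sub>v c i l) is)" for l
    using assms by (intro diag_mult_vec_map) simp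
  ultimately show ?thesis
    by (simp add: stack_eq_blk dim_diag_block_mat' comp_def)
qed

text \<open>Groups of blocks of common width \<open>n\<close> but of different origin. The factor
  \<open>I \<otimes> X\<close> of the closed-loop rows only sees the total number of blocks, across
  the borders between delayed states and coefficients.\<close>

definition blks :: "nat \<Rightarrow> (nat \<times> (nat \<Rightarrow> nat \<Rightarrow> real)) list \<Rightarrow> real Matrix.vec" where
  "blks n bs = vconcat (map (\<lambda>(k, c). blk k n c) bs)"

lemma blks_eq_blk: "\<exists>c. blks n bs = blk (\<Sum>b\<leftarrow>bs. fst b) n c"
proof (induction bs)
  case (Cons b bs)
  obtain k c where b: "b = (k, c)" by (cases b)
  obtain c' where c': "blks n bs = blk (\<Sum>b\<leftarrow>bs. fst b) n c'" using Cons by blast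
  have "blks n (b # bs) = blk k n c @\<^sub>v blk (\<Sum>b\<leftarrow>bs. fst b) n c'" by (simp add: blks_def b c'[unfolded blks_def])
  also have "\<dots> = blk (k + (\<Sum>b\<leftarrow>bs. fst b)) n (\<lambda>j l. if j < k then c j l else c' (j - k) l)"
    unfolding blk_append by (intro arg_cong2[where f = "(@\<^sub>v)"] blk_cong) auto
  finally show ?case by (auto simp: b)
qed (auto simp: blks_def intro!: exI eq_vecI)

lemma kron_one_left_blks:
  assumes "dim_col B = n"
  shows "kron (1\<^sub>m (\<Sum>b\<leftarrow>bs. fst b)) B *\<^sub>v blks n bs
    = blks (dim_row B) (map (\<lambda>(k, c). (k, \<lambda>j s. (B *\<^sub>v Matrix.vec n (c j)) $ s)) bs)"
proof (induction bs)
  case (Cons b bs)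
  obtain k c where b: "b = (k, c)" by (cases b)
  let ?K = "\<Sum>b\<leftarrow>bs. fst b"
  obtain c' where c': "blks n bs = blk ?K n c'" using blks_eq_blk by blast
  let ?c = "\<lambda>j l. if j < k then c j l else c' (j - k) l"
  have 1: "blks n (b # bs) = blk k n c @\<^sub>v blk ?K n c'" by (simp add: blks_def b c'[unfolded blks_def])
  also have "\<dots> = blk (k + ?K) n ?c"
    unfolding blk_append by (intro arg_cong2[where f = "(@\<^sub>v)"] blk_cong) auto
  finally have "kron (1\<^sub>m (\<Sum>b\<leftarrow>b # bs. fst b)) B *\<^sub>v blks n (b # bs)
     = blk (k + ?K) (dim_row B) (\<lambda>j s. (B *\<^sub>v Matrix.vec n (?c j)) $ s)"
    using kron_one_left[OF assms, of "k + ?K" ?c] by (simp add: b)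
  also have "\<dots> = blk k (dim_row B) (\<lambda>j s. (B *\<^sub>v Matrix.vec n (c j)) $ s) @\<^sub>v blk ?K (dim_row B) (\<lambda>j s. (B *\<^sub>v Matrix.vec n (c' j)) $ s)"
    unfolding blk_append by (intro arg_cong2[where f = "(@\<^sub>v)"] blk_cong) auto
  also have "blk ?K (dim_row B) (\<lambda>j s. (B *\<^sub>v Matrix.vec n (c' j)) $ s) = kron (1\<^sub>m ?K) B *\<^sub>v blks n bs"
    unfolding c' by (rule kron_one_left[OF assms, symmetric])
  finally show ?case unfolding Cons.IH by (simp add: blks_def b)
qed (auto simp: blks_def intro!: eq_vecI)

lemma quad_blk_one_left:
  assumes "B \<in> carrier_mat n n"
  shows "blk k n c \<bullet> (kron (1\<^sub>m k) B *\<^sub>v blk k n c) = (\<Sum>j<k. Matrix.vec n (c j) \<bullet> (B *\<^sub>v Matrix.vec n (c j)))"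
proof -
  have "kron (1\<^sub>m k) B *\<^sub>v blk k n c = blk k n (\<lambda>j s. (B *\<^sub>v Matrix.vec n (c j)) $ s)"
    using kron_one_left[of B n k c] assms by simp
  then show ?thesis using assms
    by (simp add: scalar_prod_blk) (auto simp: scalar_prod_def atLeast0LessThan intro!: sum.cong)
qed

lemma mult_smult_one_mat_vec: "dim_vec v = n \<Longrightarrow> (c \<cdot>\<^sub>m 1\<^sub>m n) *\<^sub>v v = c \<cdot>\<^sub>v (v :: real Matrix.vec)"
proof (intro eq_vecI)
  fix i assume v: "dim_vec v = n" and "i < dim_vec (c \<cdot>\<^sub>v v)"
  then have i: "i < n" by simp
  have "((c \<cdot>\<^sub>m 1\<^sub>m n) *\<^sub>v v) $ i = (\<Sum>j<n. (c \<cdot>\<^sub>m 1\<^sub>m n) $$ (i, j) * v $ j)"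
    using i v by (subst mult_mat_vec_index) auto
  also have "\<dots> = c * v $ i" using i by (subst sum.remove[of _ i]) (auto intro!: sum.neutral)
  finally show "((c \<cdot>\<^sub>m 1\<^sub>m n) *\<^sub>v v) $ i = (c \<cdot>\<^sub>v v) $ i" using i v by simp
qed simp

text \<open>The delayed states are read in two ways: as those at indices \<open>0\<close> to
  \<open>\<nu> - 1\<close> followed by the last, and as the undelayed one followed by those at
  \<open>1\<close> to \<open>\<nu>\<close>. The differences in \<open>boldM\<close> and
  \<open>Xi\<close> pair the two readings.\<close>

lemma upt_shift: "[0..<Suc k] = map (\<lambda>i. i - 1) [1..<Suc k] @ [k]" "[0..<Suc k] = 0 # [1..<Suc k]"
proof -
  have "map (\<lambda>i. i - 1) [1..<Suc k] = map (\<lambda>i. i - 1) (map Suc [0..<k])" by (simp only: map_Suc_upt One_nat_def)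
  then show "[0..<Suc k] = map (\<lambda>i. i - 1) [1..<Suc k] @ [k]" by (simp add: comp_def)
  show "[0..<Suc k] = 0 # [1..<Suc k]" by (simp add: upt_conv_Cons)
qed

lemma sum_list_idx1: "(\<Sum>i\<leftarrow>idx1 S. f i) = (\<Sum>i=1..num_delays S. f i)" for f :: "nat \<Rightarrow> 'b::comm_monoid_add"
  by (simp only: idx1_def interv_sum_list_conv_sum_set_nat set_upt atLeastLessThanSuc_atLeastAtMost)

lemma sum_list_idx0: "(\<Sum>i\<leftarrow>idx0 S. f i) = (\<Sum>i=0..num_delays S. f i)" for f :: "nat \<Rightarrow> 'b::comm_monoid_add"
  by (simp only: idx0_def interv_sum_list_conv_sum_set_nat set_upt atLeastLessThanSuc_atLeastAtMost)

lemma set_idx1: "set (idx1 S) = {1..num_delays S}"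
  unfolding idx1_def by auto

lemma total_dim_idx1: "total_dim S k = (\<Sum>i\<leftarrow>idx1 S. k i)"
  by (simp add: total_dim_def sum_list_idx1)

section \<open>Consequences of a valid kernel decomposition\<close>

locale delay_kernels =
  fixes S :: "('n::finite, 'm::finite, 'p::finite, 'q::finite) delay_system"
    and G :: kernel_decomposition
  assumes valid_S: "valid_system S" and valid_G: "valid_decomposition S G"
begin

lemma decomposition_facts:
  assumes "i \<in> {1..num_delays S}"
  defines "I \<equiv> delay_interval S i"
  shows "\<And>\<tau>. \<tau> \<in> I \<Longrightarrow> dim_vec (funf G i \<tau>) = dimf G i" "\<And>\<tau>. \<tau> \<in> I \<Longrightarrow> dim_vec (funvphi G i \<tau>) = dimvphi G i"
    "\<And>\<tau>. \<tau> \<in> I \<Longrightarrow> dim_vec (funphi G i \<tau>) = dimphi G i"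
    "\<And>k. k < dimf G i \<Longrightarrow> W12_on (- delay S i) (- delay S (i - 1)) (\<lambda>\<tau>. funf G i \<tau> $ k)"
    "\<And>k. k < dimvphi G i \<Longrightarrow> L2_on I (\<lambda>\<tau>. funvphi G i \<tau> $ k)"
    "\<And>k. k < dimphi G i \<Longrightarrow> L2_on I (\<lambda>\<tau>. funphi G i \<tau> $ k)"
    "matM G i \<in> carrier_mat (dimf G i) (dimh G i)"
    "\<And>k. k < dimf G i \<Longrightarrow> weak_derivative_on (- delay S i) (- delay S (i - 1))
           (\<lambda>\<tau>. funf G i \<tau> $ k) (\<lambda>\<tau>. (matM G i *\<^sub>v funh G i \<tau>) $ k)"
    "decomposes I CARD('n) (dimg G i) (fung G i) (hatA G i) (kerA S i)"
    "decomposes I CARD('p) (dimg G i) (fung G i) (hatB G i) (kerB S i)"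
    "decomposes I CARD('n) (dimg G i) (fung G i) (hatC G i) (kerC S i)"
    "decomposes I CARD('p) (dimg G i) (fung G i) (hatE G i) (kerE S i)"
    "cholesky_factor (gramF S G i) (cholF G i)"
    "cholesky_factor (gramH S G i) (cholH G i)"
    "cholesky_factor (gramE S G i) (cholE G i)"
proof -
  have "let I = delay_interval S i; a = - delay S i; b = - delay S (i - 1) in
        1 \<le> dimf G i \<and>
        (\<forall>\<tau>\<in>I. funf G i \<tau> \<in> carrier_vec (dimf G i) \<and> funvphi G i \<tau> \<in> carrier_vec (dimvphi G i) \<and>
             funphi G i \<tau> \<in> carrier_vec (dimphi G i)) \<and>
        (\<forall>k < dimf G i. W12_on a b (\<lambda>\<tau>. funf G i \<tau> $ k)) \<and>
        (\<forall>k < dimvphi G i. L2_on I (\<lambda>\<tau>. funvphi G i \<tau> $ k)) \<and>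
        (\<forall>k < dimphi G i. L2_on I (\<lambda>\<tau>. funphi G i \<tau> $ k)) \<and>
        matM G i \<in> carrier_mat (dimf G i) (dimh G i) \<and>
        (\<forall>k < dimf G i. weak_derivative_on a b
           (\<lambda>\<tau>. funf G i \<tau> $ k) (\<lambda>\<tau>. (matM G i *\<^sub>v funh G i \<tau>) $ k)) \<and>
        pos_def (cross_gram I (dimg G i) (dimg G i) (fung G i) (fung G i)) \<and>
        decomposes I CARD('n) (dimg G i) (fung G i) (hatA G i) (kerA S i) \<and>
        decomposes I CARD('p) (dimg G i) (fung G i) (hatB G i) (kerB S i) \<and>
        decomposes I CARD('n) (dimg G i) (fung G i) (hatC G i) (kerC S i) \<and>
        decomposes I CARD('p) (dimg G i) (fung G i) (hatE G i) (kerE S i) \<and>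
        cholesky_factor (gramF S G i) (cholF G i) \<and>
        cholesky_factor (gramH S G i) (cholH G i) \<and>
        cholesky_factor (gramE S G i) (cholE G i)"
    using bspec[OF valid_G[unfolded valid_decomposition_def] assms(1)] .
  note facts = this[unfolded Let_def, folded I_def]
  show "\<And>\<tau>. \<tau> \<in> I \<Longrightarrow> dim_vec (funf G i \<tau>) = dimf G i" "\<And>\<tau>. \<tau> \<in> I \<Longrightarrow> dim_vec (funvphi G i \<tau>) = dimvphi G i"
    "\<And>\<tau>. \<tau> \<in> I \<Longrightarrow> dim_vec (funphi G i \<tau>) = dimphi G i" using facts carrier_vecD by blast+
  show "\<And>k. k < dimf G i \<Longrightarrow> W12_on (- delay S i) (- delay S (i - 1)) (\<lambda>\<tau>. funf G i \<tau> $ k)"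
    "\<And>k. k < dimvphi G i \<Longrightarrow> L2_on I (\<lambda>\<tau>. funvphi G i \<tau> $ k)"
    "\<And>k. k < dimphi G i \<Longrightarrow> L2_on I (\<lambda>\<tau>. funphi G i \<tau> $ k)"
    "matM G i \<in> carrier_mat (dimf G i) (dimh G i)"
    "\<And>k. k < dimf G i \<Longrightarrow> weak_derivative_on (- delay S i) (- delay S (i - 1))
           (\<lambda>\<tau>. funf G i \<tau> $ k) (\<lambda>\<tau>. (matM G i *\<^sub>v funh G i \<tau>) $ k)"
    "decomposes I CARD('n) (dimg G i) (fung G i) (hatA G i) (kerA S i)"
    "decomposes I CARD('p) (dimg G i) (fung G i) (hatB G i) (kerB S i)"
    "decomposes I CARD('n) (dimg G i) (fung G i) (hatC G i) (kerC S i)"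
    "decomposes I CARD('p) (dimg G i) (fung G i) (hatE G i) (kerE S i)"
    "cholesky_factor (gramF S G i) (cholF G i)"
    "cholesky_factor (gramH S G i) (cholH G i)"
    "cholesky_factor (gramE S G i) (cholE G i)"
    using facts by blast+
qed

lemma delay_mono: "i \<le> j \<Longrightarrow> j \<le> num_delays S \<Longrightarrow> delay S i \<le> delay S j"
proof (induction j rule: dec_induct)
  case (step j)
  have "delay S j < delay S (Suc j)" using valid_S step.prems by (auto simp: valid_system_def)
  then show ?case using step by simp
qed simp

lemma delay_bounds:
  assumes "i \<in> {1..num_delays S}"
  shows "delay S (i - 1) < delay S i" "0 \<le> delay S (i - 1)" "delay S i \<le> max_delay S"
proof -
  have "\<forall>i < num_delays S. delay S i < delay S (Suc i)" "delay S 0 = 0" using valid_S by (auto simp: valid_system_def)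
  then show "delay S (i - 1) < delay S i" "0 \<le> delay S (i - 1)" "delay S i \<le> max_delay S"
    using assms delay_mono[of 0 "i - 1"] delay_mono[of i "num_delays S"]
    by (cases i; auto simp: max_delay_def)+
qed

lemma cholesky_facts:
  assumes i: "i \<in> {1..num_delays S}"
  shows "minv (cholF G i) \<in> carrier_mat (dimf G i) (dimf G i)" "cholF G i \<in> carrier_mat (dimf G i) (dimf G i)"
    "minv (cholH G i) \<in> carrier_mat (dimh G i) (dimh G i)" "cholH G i \<in> carrier_mat (dimh G i) (dimh G i)"
    "minv (cholE G i) \<in> carrier_mat (dimphi G i) (dimphi G i)" "cholE G i \<in> carrier_mat (dimphi G i) (dimphi G i)"
    "minv (cholF G i) * cholF G i = 1\<^sub>m (dimf G i)" "cholF G i * minv (cholF G i) = 1\<^sub>m (dimf G i)"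
    "minv (cholH G i) * cholH G i = 1\<^sub>m (dimh G i)" "cholH G i * minv (cholH G i) = 1\<^sub>m (dimh G i)"
    "minv (cholE G i) * cholE G i = 1\<^sub>m (dimphi G i)" "cholE G i * minv (cholE G i) = 1\<^sub>m (dimphi G i)"
    "gramF S G i = cholF G i * (cholF G i)\<^sup>T" "gramH S G i = cholH G i * (cholH G i)\<^sup>T" "gramE S G i = cholE G i * (cholE G i)\<^sup>T"
proof -
  note ch = decomposition_facts(13-15)[OF i]
  have d: "dim_row (gramF S G i) = dimf G i" "dim_row (gramH S G i) = dimh G i" "dim_row (gramE S G i) = dimphi G i"
    by (simp_all add: gramF_def gramH_def gramE_def cross_gram_def)
  note F = cholesky_invertible[OF ch(1), unfolded d] and H = cholesky_invertible[OF ch(2), unfolded d]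
    and E = cholesky_invertible[OF ch(3), unfolded d]
  show "minv (cholF G i) \<in> carrier_mat (dimf G i) (dimf G i)" "cholF G i \<in> carrier_mat (dimf G i) (dimf G i)"
    "minv (cholH G i) \<in> carrier_mat (dimh G i) (dimh G i)" "cholH G i \<in> carrier_mat (dimh G i) (dimh G i)"
    "minv (cholE G i) \<in> carrier_mat (dimphi G i) (dimphi G i)" "cholE G i \<in> carrier_mat (dimphi G i) (dimphi G i)"
    "minv (cholF G i) * cholF G i = 1\<^sub>m (dimf G i)" "cholF G i * minv (cholF G i) = 1\<^sub>m (dimf G i)"
    "minv (cholH G i) * cholH G i = 1\<^sub>m (dimh G i)" "cholH G i * minv (cholH G i) = 1\<^sub>m (dimh G i)"
    "minv (cholE G i) * cholE G i = 1\<^sub>m (dimphi G i)" "cholE G i * minv (cholE G i) = 1\<^sub>m (dimphi G i)"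
    "gramF S G i = cholF G i * (cholF G i)\<^sup>T" "gramH S G i = cholH G i * (cholH G i)\<^sup>T" "gramE S G i = cholE G i * (cholE G i)\<^sup>T"
    using F H E minv_works by blast+
qed

end

lemma stack_cong:
  assumes "\<And>i. i \<in> set is \<Longrightarrow> k i = k' i" "\<And>i l. i \<in> set is \<Longrightarrow> c i l = c' i l"
  shows "stack n k c is = stack n k' c' is"
  unfolding stack_def using assms by (auto intro!: arg_cong[where f = vconcat])

lemma stack_append_eq_blk:
  assumes "\<And>i l. i \<in> set is \<Longrightarrow> dim_vec (c i l) = k i" "\<And>i l. i \<in> set js \<Longrightarrow> dim_vec (c' i l) = k' i"
  shows "stack n k c is @\<^sub>v stack n k' c' js = blk ((\<Sum>i\<leftarrow>is. k i) + (\<Sum>i\<leftarrow>js. k' i)) n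
    (\<lambda>j l. (vconcat (map (\<lambda>i. c i l) is) @\<^sub>v vconcat (map (\<lambda>i. c' i l) js)) $ j)"
proof -
  have d: "(\<Sum>i\<leftarrow>is. dim_vec (c i l)) = (\<Sum>i\<leftarrow>is. k i)" "(\<Sum>i\<leftarrow>js. dim_vec (c' i l)) = (\<Sum>i\<leftarrow>js. k' i)" for l
    using assms by (auto intro!: arg_cong[where f = sum_list])
  have s: "stack n k c is = blk (\<Sum>i\<leftarrow>is. k i) n (\<lambda>j l. vconcat (map (\<lambda>i. c i l) is) $ j)"
    "stack n k' c' js = blk (\<Sum>i\<leftarrow>js. k' i) n (\<lambda>j l. vconcat (map (\<lambda>i. c' i l) js) $ j)"
    by (rule stack_eq_blk, rule assms, assumption)+
  show ?thesis
    unfolding blk_append s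
    by (intro arg_cong2[where f = "(@\<^sub>v)"] blk_cong) (auto simp: d comp_def)
qed

lemma vconcat_add:
  assumes "\<And>i. i \<in> set is \<Longrightarrow> dim_vec (u i) = dim_vec (v i)"
  shows "vconcat (map u is) + vconcat (map v is) = vconcat (map (\<lambda>i. u i + v i) is)"
  using assms
proof (induction "is")
  case (Cons i "is")
  have "dim_vec (vconcat (map u is)) = dim_vec (vconcat (map v is))"
    using Cons by (auto intro!: arg_cong[where f = sum_list])
  then show ?case using Cons by (simp add: append_vec_add')
qed auto

lemma map_idx0:
  "map f (idx0 S) = map (\<lambda>i. f (i - 1)) (idx1 S) @ [f (num_delays S)]" "map f (idx0 S) = f 0 # map f (idx1 S)"
  unfolding idx0_def idx1_def
  by (subst upt_shift(1), simp del: upt_Suc, subst upt_shift(2), simp del: upt_Suc)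

lemma stack_eq_vconcat_vec: "stack n (\<lambda>_. Suc 0) c is = vconcat (map (\<lambda>i. Matrix.vec n (\<lambda>l. c i l $ 0)) is)"
  by (simp add: stack_def blk_1)

lemma hcat_mult_vec_2:
  assumes "dim_vec a = dim_col A" "dim_vec b = dim_col B" "dim_row B = dim_row A"
  shows "hcat [A, B] *\<^sub>v (a @\<^sub>v b) = A *\<^sub>v a + B *\<^sub>v b"
  using hcat_Cons_mult_vec[of a A b B "[]"] assms by (simp add: hcat_single)

lemma hcat_mult_vec_3:
  assumes "dim_vec a = dim_col A" "dim_vec b = dim_col B" "dim_vec c = dim_col C"
    "dim_row B = dim_row A" "dim_row C = dim_row A"
  shows "hcat [A, B, C] *\<^sub>v (a @\<^sub>v b @\<^sub>v c) = A *\<^sub>v a + (B *\<^sub>v b + C *\<^sub>v c)"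
  using hcat_Cons_mult_vec[of a A "b @\<^sub>v c" B "[C]"] hcat_mult_vec_2[of b B c C] assms by (simp add: dim_hcat)

lemma hcat_mult_vec_4:
  assumes "dim_vec a = dim_col A" "dim_vec b = dim_col B" "dim_vec c = dim_col C" "dim_vec d = dim_col D"
    "dim_row B = dim_row A" "dim_row C = dim_row A" "dim_row D = dim_row A"
  shows "hcat [A, B, C, D] *\<^sub>v (a @\<^sub>v b @\<^sub>v c @\<^sub>v d) = A *\<^sub>v a + (B *\<^sub>v b + (C *\<^sub>v c + D *\<^sub>v d))"
  using hcat_Cons_mult_vec[of a A "b @\<^sub>v c @\<^sub>v d" B "[C, D]"] hcat_mult_vec_3[of b B c C d D] assms by (simp add: dim_hcat)

lemma zero_mult_add:
  fixes v u :: "real Matrix.vec"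
  shows "dim_vec u = c \<Longrightarrow> dim_vec v = r \<Longrightarrow> 0\<^sub>m r c *\<^sub>v u + v = v"
    "dim_vec u = c \<Longrightarrow> dim_vec v = r \<Longrightarrow> v + 0\<^sub>m r c *\<^sub>v u = v"
  by (auto simp: zero_mat_mult_vec intro!: eq_vecI)

lemma diag_cons_quad:
  fixes a b :: "real Matrix.vec"
  assumes "dim_row A = dim_vec a" "dim_col A = dim_vec a"
    "dim_row (diag_block_mat As) = dim_vec b" "dim_col (diag_block_mat As) = dim_vec b"
  shows "(a @\<^sub>v b) \<bullet> (diag_block_mat (A # As) *\<^sub>v (a @\<^sub>v b)) = a \<bullet> (A *\<^sub>v a) + b \<bullet> (diag_block_mat As *\<^sub>v b)"
  using four_block_diag_mult_vec[of a A b "diag_block_mat As"] assms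
  by (simp add: Let_def scalar_prod_append')

lemma diag_single: "diag_block_mat [A] = A"
  by (rule eq_matI) (auto simp: Let_def)

lemma quad_diag_4:
  fixes a b c d :: "real Matrix.vec"
  assumes "dim_row A = dim_vec a" "dim_col A = dim_vec a" "dim_row B = dim_vec b" "dim_col B = dim_vec b"
    "dim_row C = dim_vec c" "dim_col C = dim_vec c" "dim_row D = dim_vec d" "dim_col D = dim_vec d"
  shows "(a @\<^sub>v b @\<^sub>v c @\<^sub>v d) \<bullet> (diag_block_mat [A, B, C, D] *\<^sub>v (a @\<^sub>v b @\<^sub>v c @\<^sub>v d))
    = a \<bullet> (A *\<^sub>v a) + (b \<bullet> (B *\<^sub>v b) + (c \<bullet> (C *\<^sub>v c) + d \<bullet> (D *\<^sub>v d)))"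
proof -
  note dims = dim_diag_block_mat' list.map sum_list.Cons sum_list.Nil index_append_vec assms add_0_right
  have 1: "(a @\<^sub>v b @\<^sub>v c @\<^sub>v d) \<bullet> (diag_block_mat [A, B, C, D] *\<^sub>v (a @\<^sub>v b @\<^sub>v c @\<^sub>v d))
    = a \<bullet> (A *\<^sub>v a) + (b @\<^sub>v c @\<^sub>v d) \<bullet> (diag_block_mat [B, C, D] *\<^sub>v (b @\<^sub>v c @\<^sub>v d))"
    by (rule diag_cons_quad) (simp_all only: dims)
  have 2: "(b @\<^sub>v c @\<^sub>v d) \<bullet> (diag_block_mat [B, C, D] *\<^sub>v (b @\<^sub>v c @\<^sub>v d))
    = b \<bullet> (B *\<^sub>v b) + (c @\<^sub>v d) \<bullet> (diag_block_mat [C, D] *\<^sub>v (c @\<^sub>v d))"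
    by (rule diag_cons_quad) (simp_all only: dims)
  have 3: "(c @\<^sub>v d) \<bullet> (diag_block_mat [C, D] *\<^sub>v (c @\<^sub>v d)) = c \<bullet> (C *\<^sub>v c) + d \<bullet> (diag_block_mat [D] *\<^sub>v d)"
    by (rule diag_cons_quad) (simp_all only: dims)
  show ?thesis unfolding 1 2 3 diag_single ..
qed

lemma quad_diag_5:
  fixes a b c d e :: "real Matrix.vec"
  assumes "dim_row A = dim_vec a" "dim_col A = dim_vec a" "dim_row B = dim_vec b" "dim_col B = dim_vec b"
    "dim_row C = dim_vec c" "dim_col C = dim_vec c" "dim_row D = dim_vec d" "dim_col D = dim_vec d"
    "dim_row E = dim_vec e" "dim_col E = dim_vec e"
  shows "(a @\<^sub>v b @\<^sub>v c @\<^sub>v d @\<^sub>v e) \<bullet> (diag_block_mat [A, B, C, D, E] *\<^sub>v (a @\<^sub>v b @\<^sub>v c @\<^sub>v d @\<^sub>v e))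
    = a \<bullet> (A *\<^sub>v a) + (b \<bullet> (B *\<^sub>v b) + (c \<bullet> (C *\<^sub>v c) + (d \<bullet> (D *\<^sub>v d) + e \<bullet> (E *\<^sub>v e))))"
proof -
  have "(a @\<^sub>v b @\<^sub>v c @\<^sub>v d @\<^sub>v e) \<bullet> (diag_block_mat [A, B, C, D, E] *\<^sub>v (a @\<^sub>v b @\<^sub>v c @\<^sub>v d @\<^sub>v e))
    = a \<bullet> (A *\<^sub>v a) + (b @\<^sub>v c @\<^sub>v d @\<^sub>v e) \<bullet> (diag_block_mat [B, C, D, E] *\<^sub>v (b @\<^sub>v c @\<^sub>v d @\<^sub>v e))"
    by (rule diag_cons_quad) (simp_all only: dim_diag_block_mat' list.map sum_list.Cons sum_list.Nil index_append_vec assms add_0_right)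
  then show ?thesis unfolding quad_diag_4[of B b C c D d E e, OF assms(3-10)] .
qed

lemma diag_carrier_4:
  assumes "A \<in> carrier_mat a a" "B \<in> carrier_mat b b" "C \<in> carrier_mat c c" "D \<in> carrier_mat d d"
  shows "diag_block_mat [A, B, C, D] \<in> carrier_mat (a + b + c + d) (a + b + c + d)"
  using assms by (intro carrier_matI) (simp_all add: dim_diag_block_mat')

lemma diag_carrier_5:
  assumes "A \<in> carrier_mat a a" "B \<in> carrier_mat b b" "C \<in> carrier_mat c c" "D \<in> carrier_mat d d" "E \<in> carrier_mat e e"
  shows "diag_block_mat [A, B, C, D, E] \<in> carrier_mat (a + b + c + d + e) (a + b + c + d + e)"
  using assms by (intro carrier_matI) (simp_all add: dim_diag_block_mat')

lemma quad_zero_mat: "dim_vec v = k \<Longrightarrow> v \<bullet> (0\<^sub>m k k *\<^sub>v v) = (0 :: real)"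
  by (simp add: zero_mat_mult_vec scalar_prod_zero_right)

section \<open>The matrix inequality as a quadratic form on the test vector\<close>

locale synthesis = delay_kernels S G
  for S :: "('n::finite, 'm::finite, 'p::finite, 'q::finite) delay_system" and G +
  fixes J :: supply_params and \<alpha> :: "nat \<Rightarrow> real" and U :: decision
  assumes valid_J: "valid_supply CARD('m) CARD('q) J" and feas: "feasible S G J \<alpha> U"
begin

lemma decision_facts:
  "varX U \<in> symmetric_mats CARD('n)" "varP1 U \<in> symmetric_mats CARD('n)" "varP2 U \<in> carrier_mat CARD('n) (total_dim S (dimf G) * CARD('n))"
  "varP3 U \<in> symmetric_mats (total_dim S (dimf G) * CARD('n))" "varV U \<in> carrier_mat CARD('p) CARD('n)"
  "\<And>i. i \<in> {1..num_delays S} \<Longrightarrow> varQ U i \<in> symmetric_mats CARD('n)"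
  "\<And>i. i \<in> {1..num_delays S} \<Longrightarrow> varR U i \<in> symmetric_mats CARD('n)"
  using feas by (auto simp: feasible_def decision_space_def)

lemma decision_carriers:
  "varX U \<in> carrier_mat CARD('n) CARD('n)" "varP1 U \<in> carrier_mat CARD('n) CARD('n)" "varP3 U \<in> carrier_mat (total_dim S (dimf G) * CARD('n)) (total_dim S (dimf G) * CARD('n))"
  "\<And>i. i \<in> {1..num_delays S} \<Longrightarrow> varQ U i \<in> carrier_mat CARD('n) CARD('n)"
  "\<And>i. i \<in> {1..num_delays S} \<Longrightarrow> varR U i \<in> carrier_mat CARD('n) CARD('n)"
  using decision_facts by (auto simp: symmetric_mats_def)

lemma supply_facts:
  "Jtilde J \<in> carrier_mat CARD('m) CARD('m)" "J1 J \<in> symmetric_mats CARD('m)" "J1 J \<in> carrier_mat CARD('m) CARD('m)"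
  "J2 J \<in> carrier_mat CARD('m) CARD('q)" "J3 J \<in> symmetric_mats CARD('q)" "J3 J \<in> carrier_mat CARD('q) CARD('q)"
  "invertible_mat (J1 J)" "neg_semidef ((Jtilde J)\<^sup>T * minv (J1 J) * Jtilde J)"
  using valid_J by (auto simp: valid_supply_def symmetric_mats_def)

text \<open>The block of \<open>Ihat\<close> belonging to family \<open>i\<close>. It takes
  coefficients in the normalised \<open>h_i\<close> to coefficients in the normalised
  \<open>f_i\<close>.\<close>

definition embed_f :: "nat \<Rightarrow> real mat" where
  "embed_f i = minv (cholF G i) * hcat [0\<^sub>m (dimf G i) (dimvphi G i), 1\<^sub>m (dimf G i)] * cholH G i"

definition F_col :: "nat \<Rightarrow> real \<Rightarrow> real mat" where
  "F_col i \<tau> = minv (cholF G i) * mat_of_cols (dimf G i) [funf G i \<tau>]"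

definition M_col :: "nat \<Rightarrow> real mat" where
  "M_col i = minv (cholF G i) * matM G i * cholH G i"

lemma local_dims:
  assumes "i \<in> {1..num_delays S}"
  shows "dim_row (embed_f i) = dimf G i" "dim_col (embed_f i) = dimh G i"
    "dim_row (F_col i \<tau>) = dimf G i" "dim_col (F_col i \<tau>) = 1"
    "dim_row (M_col i) = dimf G i" "dim_col (M_col i) = dimh G i"
  using cholesky_facts(1,4)[OF assms] decomposition_facts(7)[OF assms]
  by (auto simp: embed_f_def F_col_def M_col_def dim_hcat dimh_def)

lemma Ihat_eq: "Ihat S G = kron (diag_block_mat (map embed_f (idx1 S))) (1\<^sub>m CARD('n))"
  by (simp add: Ihat_def embed_f_def[abs_def])

lemma Ihat_dims: "dim_row (Ihat S G) = total_dim S (dimf G) * CARD('n)" "dim_col (Ihat S G) = total_dim S (dimh G) * CARD('n)"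
  using local_dims unfolding Ihat_eq total_dim_idx1
  by (auto simp: dim_diag_block_mat' comp_def set_idx1 intro!: arg_cong[where f = sum_list])

lemma Ihat_carrier: "Ihat S G \<in> carrier_mat (total_dim S (dimf G) * CARD('n)) (total_dim S (dimh G) * CARD('n))"
  using Ihat_dims by (intro carrier_matI) auto

lemma Ihat_mult_stack:
  assumes "\<And>i l. i \<in> {1..num_delays S} \<Longrightarrow> dim_vec (ch i l) = dimh G i"
  shows "Ihat S G *\<^sub>v stack CARD('n) (dimh G) ch (idx1 S) = stack CARD('n) (dimf G) (\<lambda>i l. embed_f i *\<^sub>v ch i l) (idx1 S)"
proof -
  have "stack CARD('n) (dimh G) ch (idx1 S) = stack CARD('n) (\<lambda>i. dim_col (embed_f i)) ch (idx1 S)"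
    by (rule stack_cong) (simp_all add: local_dims set_idx1)
  then have "Ihat S G *\<^sub>v stack CARD('n) (dimh G) ch (idx1 S) = stack CARD('n) (\<lambda>i. dim_row (embed_f i)) (\<lambda>i l. embed_f i *\<^sub>v ch i l) (idx1 S)"
    unfolding Ihat_eq by (simp only:) (rule kron_diag_stack, simp add: assms local_dims set_idx1)
  then show ?thesis using stack_cong[of "idx1 S" "\<lambda>i. dim_row (embed_f i)" "dimf G"]
    by (simp add: local_dims set_idx1)
qed

lemma boldM_eq:
  "boldM S G = hcat [diag_block_mat (map (\<lambda>i. F_col i (- delay S (i - 1))) (idx1 S)), 0\<^sub>m (total_dim S (dimf G)) 1,
       0\<^sub>m (total_dim S (dimf G)) (total_dim S (dimh G))]
     - hcat [0\<^sub>m (total_dim S (dimf G)) 1, diag_block_mat (map (\<lambda>i. F_col i (- delay S i)) (idx1 S)),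
       diag_block_mat (map M_col (idx1 S))]"
  by (simp add: boldM_def Let_def F_col_def M_col_def[abs_def])

lemma diag_dims:
  "dim_row (diag_block_mat (map (\<lambda>i. F_col i (\<tau> i)) (idx1 S))) = total_dim S (dimf G)"
  "dim_col (diag_block_mat (map (\<lambda>i. F_col i (\<tau> i)) (idx1 S))) = num_delays S"
  "dim_row (diag_block_mat (map M_col (idx1 S))) = total_dim S (dimf G)"
  "dim_col (diag_block_mat (map M_col (idx1 S))) = total_dim S (dimh G)"
  by (auto simp: dim_diag_block_mat' comp_def sum_list_idx1 local_dims total_dim_def)

lemma boldM_dims: "dim_row (boldM S G) = total_dim S (dimf G)" "dim_col (boldM S G) = 1 + num_delays S + total_dim S (dimh G)"
  unfolding boldM_eq by (simp_all add: dim_hcat diag_dims)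

text \<open>The diagonal blocks of the two summands of \<open>boldM\<close> are offset by one
  column, so the stacked delayed states are regrouped for each: at the newer end of every interval
  for the first, at the older end for the second.\<close>

lemma boldM_mult:
  assumes ch: "\<And>i. i \<in> {1..num_delays S} \<Longrightarrow> dim_vec (ch i) = dimh G i"
  shows "boldM S G *\<^sub>v (vconcat (map (\<lambda>i. Matrix.vec 1 (\<lambda>_. y i)) (idx0 S)) @\<^sub>v vconcat (map ch (idx1 S)))
    = vconcat (map (\<lambda>i. F_col i (- delay S (i - 1)) *\<^sub>v Matrix.vec 1 (\<lambda>_. y (i - 1))
        - (F_col i (- delay S i) *\<^sub>v Matrix.vec 1 (\<lambda>_. y i) + M_col i *\<^sub>v ch i)) (idx1 S))"
proof -
  let ?y = "\<lambda>i. Matrix.vec 1 (\<lambda>_. y i)" and ?h = "vconcat (map ch (idx1 S))" and ?d = "total_dim S (dimf G)"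
  let ?V = "vconcat (map ?y (idx0 S)) @\<^sub>v ?h"
  let ?F0 = "\<lambda>i. F_col i (- delay S (i - 1))" and ?F1 = "\<lambda>i. F_col i (- delay S i)"
  let ?D0 = "diag_block_mat (map ?F0 (idx1 S))" and ?D1 = "diag_block_mat (map ?F1 (idx1 S))" and ?DM = "diag_block_mat (map M_col (idx1 S))"
  let ?A = "hcat [?D0, 0\<^sub>m ?d 1, 0\<^sub>m ?d (total_dim S (dimh G))]" and ?B = "hcat [0\<^sub>m ?d 1, ?D1, ?DM]"
  have dh: "(\<Sum>i = Suc 0..num_delays S. dim_vec (ch i)) = total_dim S (dimh G)" by (simp add: total_dim_def ch)
  have V1: "?V = vconcat (map (\<lambda>i. ?y (i - 1)) (idx1 S)) @\<^sub>v (?y (num_delays S) @\<^sub>v ?h)"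
    by (simp add: map_idx0(1) vconcat_append append_vec_assoc)
  have V2: "?V = ?y 0 @\<^sub>v (vconcat (map ?y (idx1 S)) @\<^sub>v ?h)"
    by (simp add: map_idx0(2) append_vec_assoc)
  have dA: "?A \<in> carrier_mat ?d (dim_vec ?V)" "?B \<in> carrier_mat ?d (dim_vec ?V)"
    by (intro carrier_matI; simp add: dim_hcat diag_dims comp_def sum_list_idx1 sum_list_idx0 total_dim_def ch)+
  have dims: "dim_vec ?h = total_dim S (dimh G)" "dim_vec (vconcat (map (\<lambda>i. ?y (f i)) (idx1 S))) = num_delays S"
    "dim_row ?D0 = ?d" "dim_col ?D0 = num_delays S" "dim_row ?D1 = ?d" "dim_col ?D1 = num_delays S"
    "dim_row ?DM = ?d" "dim_col ?DM = total_dim S (dimh G)" "dim_vec (?y k) = 1" for f k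
    by (simp_all only: dim_vconcat map_map comp_def sum_list_idx1 dh dim_vec diag_dims) (simp_all add: dh)
  have "?A *\<^sub>v ?V = ?D0 *\<^sub>v vconcat (map (\<lambda>i. ?y (i - 1)) (idx1 S)) + (0\<^sub>m ?d 1 *\<^sub>v ?y (num_delays S) + 0\<^sub>m ?d (total_dim S (dimh G)) *\<^sub>v ?h)"
    unfolding V1 by (rule hcat_mult_vec_3) (simp_all only: dims index_zero_mat)
  also have "\<dots> = ?D0 *\<^sub>v vconcat (map (\<lambda>i. ?y (i - 1)) (idx1 S))"
    by (simp only: zero_mult_add dims index_zero_mat dim_mult_mat_vec)
  finally have A: "?A *\<^sub>v ?V = ?D0 *\<^sub>v vconcat (map (\<lambda>i. ?y (i - 1)) (idx1 S))" .
  have "?B *\<^sub>v ?V = 0\<^sub>m ?d 1 *\<^sub>v ?y 0 + (?D1 *\<^sub>v vconcat (map ?y (idx1 S)) + ?DM *\<^sub>v ?h)"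
    unfolding V2 by (rule hcat_mult_vec_3) (simp_all only: dims index_zero_mat)
  also have "\<dots> = ?D1 *\<^sub>v vconcat (map ?y (idx1 S)) + ?DM *\<^sub>v ?h"
    by (simp only: zero_mult_add dims index_zero_mat dim_mult_mat_vec index_add_vec)
  finally have B: "?B *\<^sub>v ?V = ?D1 *\<^sub>v vconcat (map ?y (idx1 S)) + ?DM *\<^sub>v ?h" .
  have D0: "?D0 *\<^sub>v vconcat (map (\<lambda>i. ?y (i - 1)) (idx1 S)) = vconcat (map (\<lambda>i. ?F0 i *\<^sub>v ?y (i - 1)) (idx1 S))"
    by (rule diag_mult_vec_map) (simp add: set_idx1 local_dims)
  have D1: "?D1 *\<^sub>v vconcat (map ?y (idx1 S)) = vconcat (map (\<lambda>i. ?F1 i *\<^sub>v ?y i) (idx1 S))"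
    by (rule diag_mult_vec_map) (simp add: set_idx1 local_dims)
  have DM: "?DM *\<^sub>v ?h = vconcat (map (\<lambda>i. M_col i *\<^sub>v ch i) (idx1 S))"
    by (rule diag_mult_vec_map) (simp add: set_idx1 local_dims ch)
  have "boldM S G *\<^sub>v ?V = ?A *\<^sub>v ?V - ?B *\<^sub>v ?V"
    unfolding boldM_eq by (rule minus_mult_distrib_mat_vec[OF dA carrier_vec_dim_vec])
  then show ?thesis unfolding A B D0 D1 DM
    by (simp only:, subst vconcat_add, simp add: set_idx1 local_dims)
      (rule vconcat_minus, simp add: set_idx1 local_dims)
qed

text \<open>The delayed states and the coefficients are parameters, so that the algebra of the
  inequality is done without reference to a trajectory and also covers the zero vector.\<close>

definition theta where
  "theta yd ch ce w = vconcat (map (\<lambda>i. Matrix.vec CARD('n) (yd i)) (idx0 S)) @\<^sub>v stack CARD('n) (dimh G) ch (idx1 S)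
     @\<^sub>v stack CARD('n) (dimphi G) ce (idx1 S) @\<^sub>v w"

definition zeta where
  "zeta ch = stack CARD('n) (dimf G) (\<lambda>i l. embed_f i *\<^sub>v ch i l) (idx1 S)"

text \<open>Boundary terms at both ends of each interval minus the \<open>M_i\<close> term: this is
  what integrating \<open>f_i\<close> against a moving function by parts produces, hence the time
  derivative of \<open>zeta\<close> along trajectories.\<close>

definition zeta_dot where
  "zeta_dot yd ch = stack CARD('n) (dimf G) (\<lambda>i l. F_col i (- delay S (i - 1)) *\<^sub>v Matrix.vec 1 (\<lambda>_. yd (i - 1) l)
        - (F_col i (- delay S i) *\<^sub>v Matrix.vec 1 (\<lambda>_. yd i l) + M_col i *\<^sub>v ch i l)) (idx1 S)"

lemma zeta_dims: "dim_vec (zeta ch) = total_dim S (dimf G) * CARD('n)" "dim_vec (zeta_dot yd ch) = total_dim S (dimf G) * CARD('n)"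
  by (simp_all add: zeta_def zeta_dot_def total_dim_idx1)

lemma kron_boldM_mult:
  assumes ch: "\<And>i l. i \<in> {1..num_delays S} \<Longrightarrow> dim_vec (ch i l) = dimh G i"
  shows "kron (boldM S G) (1\<^sub>m CARD('n)) *\<^sub>v (vconcat (map (\<lambda>i. Matrix.vec CARD('n) (yd i)) (idx0 S)) @\<^sub>v stack CARD('n) (dimh G) ch (idx1 S))
    = zeta_dot yd ch"
proof -
  let ?y = "\<lambda>i l. Matrix.vec 1 (\<lambda>_. yd i l)"
  let ?V = "\<lambda>l. vconcat (map (\<lambda>i. ?y i l) (idx0 S)) @\<^sub>v vconcat (map (\<lambda>i. ch i l) (idx1 S))"
  have Y: "vconcat (map (\<lambda>i. Matrix.vec CARD('n) (yd i)) (idx0 S)) = stack CARD('n) (\<lambda>_. Suc 0) ?y (idx0 S)"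
    by (simp add: stack_eq_vconcat_vec)
  have K: "(\<Sum>i\<leftarrow>idx0 S. Suc 0) + (\<Sum>i\<leftarrow>idx1 S. dimh G i) = dim_col (boldM S G)"
    by (simp only: sum_list_idx0 sum_list_idx1 boldM_dims total_dim_def) simp
  have 1: "stack CARD('n) (\<lambda>_. Suc 0) ?y (idx0 S) @\<^sub>v stack CARD('n) (dimh G) ch (idx1 S)
      = blk (dim_col (boldM S G)) CARD('n) (\<lambda>j l. ?V l $ j)"
    unfolding K[symmetric] by (rule stack_append_eq_blk) (simp_all add: ch set_idx1)
  have dV: "dim_vec (?V l) = dim_col (boldM S G)" for l
    unfolding K[symmetric] by (auto simp: comp_def ch set_idx1 intro!: arg_cong[where f = sum_list])
  have 2: "kron (boldM S G) (1\<^sub>m CARD('n)) *\<^sub>v blk (dim_col (boldM S G)) CARD('n) (\<lambda>j l. ?V l $ j)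
     = blk (dim_row (boldM S G)) CARD('n) (\<lambda>r l. (boldM S G *\<^sub>v ?V l) $ r)"
    by (rule kron_one_right_blk[OF refl dV])
  have 3: "boldM S G *\<^sub>v ?V l = vconcat (map (\<lambda>i. F_col i (- delay S (i - 1)) *\<^sub>v ?y (i - 1) l
        - (F_col i (- delay S i) *\<^sub>v ?y i l + M_col i *\<^sub>v ch i l)) (idx1 S))" for l
    by (rule boldM_mult) (rule ch)
  show ?thesis
    unfolding Y 1 2 3 zeta_dot_def boldM_dims(1) total_dim_idx1
    by (rule stack_eq_blk[symmetric]) (simp add: set_idx1 local_dims)
qed

text \<open>The two block diagonals in \<open>Xi\<close> partition the vector differently; these are
  the matching readings.\<close>

lemma theta_splits:
  "theta yd ch ce w = Matrix.vec CARD('n) (yd 0) @\<^sub>v vconcat (map (\<lambda>i. Matrix.vec CARD('n) (yd i)) (idx1 S))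
     @\<^sub>v stack CARD('n) (dimh G) ch (idx1 S) @\<^sub>v stack CARD('n) (dimphi G) ce (idx1 S) @\<^sub>v w"
  "theta yd ch ce w = vconcat (map (\<lambda>i. Matrix.vec CARD('n) (yd (i - 1))) (idx1 S)) @\<^sub>v Matrix.vec CARD('n) (yd (num_delays S))
     @\<^sub>v (stack CARD('n) (dimh G) ch (idx1 S) @\<^sub>v stack CARD('n) (dimphi G) ce (idx1 S)) @\<^sub>v w"
  by (simp only: theta_def map_idx0(2) vconcat_simps append_vec_assoc)
    (simp only: theta_def map_idx0(1) vconcat_append vconcat_simps append_zero_vec append_vec_assoc)

lemma dim_parts:
  "dim_vec (vconcat (map (\<lambda>i. Matrix.vec CARD('n) (y i)) (idx1 S))) = num_delays S * CARD('n)"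
  "dim_vec (vconcat (map (\<lambda>i. Matrix.vec CARD('n) (y i)) (idx0 S))) = Suc (num_delays S) * CARD('n)"
  "dim_vec (stack CARD('n) (dimh G) ch (idx1 S)) = total_dim S (dimh G) * CARD('n)"
  "dim_vec (stack CARD('n) (dimphi G) ce (idx1 S)) = total_dim S (dimphi G) * CARD('n)"
  by (simp_all add: comp_def sum_list_idx1 sum_list_idx0 total_dim_def)

lemma total_dimg: "total_dim S (dimg G) = total_dim S (dimh G) + total_dim S (dimphi G)"
  by (simp add: total_dim_def dimg_def dimh_def sum.distrib)

lemma dim_theta: "dim_vec w = CARD('q) \<Longrightarrow> dim_vec (theta yd ch ce w) = beta S G * CARD('n) + CARD('q)"
  by (simp add: theta_def dim_parts beta_def total_dimg algebra_simps del: dim_stack dim_vconcat)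

lemma boldP_dims: "dim_row (boldP S G U) = CARD('n)" "dim_col (boldP S G U) = beta S G * CARD('n) + CARD('q) + CARD('m)"
  using decision_carriers decision_facts(3) Ihat_dims
  by (auto simp: boldP_def Let_def dim_hcat beta_def total_dimg algebra_simps)

lemma boldP_mult:
  assumes ch: "\<And>i l. i \<in> {1..num_delays S} \<Longrightarrow> dim_vec (ch i l) = dimh G i"
    and w: "dim_vec w = CARD('q)" and s: "dim_vec s = CARD('m)"
  shows "boldP S G U *\<^sub>v (theta yd ch ce w @\<^sub>v s) = varP1 U *\<^sub>v Matrix.vec CARD('n) (yd 0) + varP2 U *\<^sub>v zeta ch"
proof -
  let ?Y = "vconcat (map (\<lambda>i. Matrix.vec CARD('n) (yd i)) (idx1 S))"
  let ?H = "stack CARD('n) (dimh G) ch (idx1 S)" and ?E = "stack CARD('n) (dimphi G) ce (idx1 S)"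
  note P1 = carrier_matD[OF decision_carriers(2)] and P2 = carrier_matD[OF decision_facts(3)]
  have "boldP S G U *\<^sub>v (theta yd ch ce w @\<^sub>v s) = varP1 U *\<^sub>v Matrix.vec CARD('n) (yd 0)
     + (0\<^sub>m CARD('n) (num_delays S * CARD('n)) *\<^sub>v ?Y + ((varP2 U * Ihat S G) *\<^sub>v ?H
       + 0\<^sub>m CARD('n) (total_dim S (dimphi G) * CARD('n) + CARD('q) + CARD('m)) *\<^sub>v (?E @\<^sub>v w @\<^sub>v s)))"
    unfolding boldP_def Let_def theta_splits(1) append_vec_assoc
    by (rule hcat_mult_vec_4) (simp_all only: dim_parts P1 P2 w s index_mult_mat Ihat_dims index_append_vec dim_vec index_zero_mat add.assoc)
  also have "\<dots> = varP1 U *\<^sub>v Matrix.vec CARD('n) (yd 0) + (varP2 U * Ihat S G) *\<^sub>v ?H"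
    by (simp only: zero_mult_add dim_parts P1 P2 w s dim_mult_mat_vec index_mult_mat index_append_vec index_add_vec add.assoc)
  also have "(varP2 U * Ihat S G) *\<^sub>v ?H = varP2 U *\<^sub>v zeta ch"
  proof -
    have "zeta ch = Ihat S G *\<^sub>v ?H" by (simp only: zeta_def Ihat_mult_stack ch)
    then show ?thesis
      by (simp only:) (rule assoc_mult_mat_vec[OF decision_facts(3) Ihat_carrier], rule carrier_vecI, rule dim_parts)
  qed
  finally show ?thesis .
qed

text \<open>The time derivative of the integral part of the functional, with each integral of
  \<open>y^T R_i y\<close> replaced by its Bessel lower bound in the coefficients, minus the form of
  \<open>J3\<close> in the disturbance.\<close>

definition Xi_form where
  "Xi_form yd ch ce w = (\<Sum>i\<leftarrow>idx1 S. Matrix.vec CARD('n) (yd (i - 1)) \<bullet> (varQ U i *\<^sub>v Matrix.vec CARD('n) (yd (i - 1)))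
        + (delay S i - delay S (i - 1)) * (Matrix.vec CARD('n) (yd (i - 1)) \<bullet> (varR U i *\<^sub>v Matrix.vec CARD('n) (yd (i - 1))))
        - Matrix.vec CARD('n) (yd i) \<bullet> (varQ U i *\<^sub>v Matrix.vec CARD('n) (yd i))
        - (\<Sum>k<dimh G i. Matrix.vec CARD('n) (\<lambda>l. ch i l $ k) \<bullet> (varR U i *\<^sub>v Matrix.vec CARD('n) (\<lambda>l. ch i l $ k)))
        - (\<Sum>k<dimphi G i. Matrix.vec CARD('n) (\<lambda>l. ce i l $ k) \<bullet> (varR U i *\<^sub>v Matrix.vec CARD('n) (\<lambda>l. ce i l $ k))))
     - w \<bullet> (J3 J *\<^sub>v w)"

lemma QR_dims:
  assumes "i \<in> {1..num_delays S}"
  shows "dim_row (varQ U i) = CARD('n)" "dim_col (varQ U i) = CARD('n)" "dim_row (varR U i) = CARD('n)" "dim_col (varR U i) = CARD('n)"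
  using decision_carriers(4,5)[OF assms] by auto

lemma scalar_prod_stack_kron:
  assumes "\<And>i. i \<in> {1..num_delays S} \<Longrightarrow> R i \<in> carrier_mat CARD('n) CARD('n)"
  shows "stack CARD('n) k c (idx1 S) \<bullet> (diag_block_mat (map (\<lambda>i. kron (1\<^sub>m (k i)) (R i)) (idx1 S)) *\<^sub>v stack CARD('n) k c (idx1 S))
    = (\<Sum>i\<leftarrow>idx1 S. \<Sum>j<k i. Matrix.vec CARD('n) (\<lambda>l. c i l $ j) \<bullet> (R i *\<^sub>v Matrix.vec CARD('n) (\<lambda>l. c i l $ j)))"
proof -
  let ?b = "\<lambda>i. blk (k i) CARD('n) (\<lambda>j l. c i l $ j)"
  have Rd: "dim_row (R i) = CARD('n)" "dim_col (R i) = CARD('n)" if "i \<in> {1..num_delays S}" for i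
    using assms[OF that] by auto
  have 1: "diag_block_mat (map (\<lambda>i. kron (1\<^sub>m (k i)) (R i)) (idx1 S)) *\<^sub>v stack CARD('n) k c (idx1 S)
     = vconcat (map (\<lambda>i. kron (1\<^sub>m (k i)) (R i) *\<^sub>v ?b i) (idx1 S))"
    unfolding stack_def by (rule diag_mult_vec_map) (simp add: set_idx1 Rd)
  have "stack CARD('n) k c (idx1 S) \<bullet> vconcat (map (\<lambda>i. kron (1\<^sub>m (k i)) (R i) *\<^sub>v ?b i) (idx1 S)) = (\<Sum>i\<leftarrow>idx1 S. ?b i \<bullet> (kron (1\<^sub>m (k i)) (R i) *\<^sub>v ?b i))"
    unfolding stack_def by (rule scalar_prod_vconcat_map) (simp add: set_idx1 Rd)
  also have "\<dots> = (\<Sum>i\<leftarrow>idx1 S. \<Sum>j<k i. Matrix.vec CARD('n) (\<lambda>l. c i l $ j) \<bullet> (R i *\<^sub>v Matrix.vec CARD('n) (\<lambda>l. c i l $ j)))"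
  proof (rule arg_cong[where f = sum_list], rule map_cong[OF refl])
    fix i assume "i \<in> set (idx1 S)"
    then have "R i \<in> carrier_mat CARD('n) CARD('n)" using assms by (simp add: set_idx1)
    then show "?b i \<bullet> (kron (1\<^sub>m (k i)) (R i) *\<^sub>v ?b i)
        = (\<Sum>j<k i. Matrix.vec CARD('n) (\<lambda>l. c i l $ j) \<bullet> (R i *\<^sub>v Matrix.vec CARD('n) (\<lambda>l. c i l $ j)))"
      by (rule quad_blk_one_left)
  qed
  finally show ?thesis unfolding 1 .
qed

lemma diag_sum_dims:
  assumes "\<And>i. i \<in> {1..num_delays S} \<Longrightarrow> A i \<in> carrier_mat CARD('n) CARD('n)"
  shows "diag_block_mat (map A (idx1 S)) \<in> carrier_mat (num_delays S * CARD('n)) (num_delays S * CARD('n))"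
proof -
  have "dim_row (A i) = CARD('n)" "dim_col (A i) = CARD('n)" if "i \<in> {1..num_delays S}" for i
    using assms[OF that] by auto
  then show ?thesis by (intro carrier_matI) (simp_all add: dim_diag_block_mat' comp_def sum_list_idx1)
qed

lemma Xi_quadratic:
  assumes w: "dim_vec w = CARD('q)"
  shows "theta yd ch ce w \<bullet> (Xi S G J (varQ U) (varR U) *\<^sub>v theta yd ch ce w) = Xi_form yd ch ce w"
    and "Xi S G J (varQ U) (varR U) \<in> carrier_mat (beta S G * CARD('n) + CARD('q)) (beta S G * CARD('n) + CARD('q))"
proof -
  let ?n = "CARD('n)" and ?k = "total_dim S (dimg G)" and ?t = "theta yd ch ce w"
  let ?Q = "diag_block_mat (map (varQ U) (idx1 S))" and ?R = "diag_block_mat (map (varR U) (idx1 S))"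
  let ?Y = "\<lambda>i. Matrix.vec ?n (yd i)"
  let ?Yp = "vconcat (map (\<lambda>i. ?Y (i - 1)) (idx1 S))" and ?Yc = "vconcat (map ?Y (idx1 S))"
  let ?H = "stack ?n (dimh G) ch (idx1 S)" and ?E = "stack ?n (dimphi G) ce (idx1 S)"
  let ?DH = "diag_block_mat (map (\<lambda>i. kron (1\<^sub>m (dimh G i)) (varR U i)) (idx1 S))"
  let ?DE = "diag_block_mat (map (\<lambda>i. kron (1\<^sub>m (dimphi G i)) (varR U i)) (idx1 S))"
  let ?A = "diag_block_mat [?Q + ?R * Lam S, 0\<^sub>m ?n ?n, 0\<^sub>m (?k * ?n) (?k * ?n), 0\<^sub>m CARD('q) CARD('q)]"
  let ?B = "diag_block_mat [0\<^sub>m ?n ?n, ?Q, ?DH, ?DE, J3 J]"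
  have Qc: "?Q \<in> carrier_mat (num_delays S * ?n) (num_delays S * ?n)" and Rc: "?R \<in> carrier_mat (num_delays S * ?n) (num_delays S * ?n)"
    by (rule diag_sum_dims, rule decision_carriers, assumption)+
  have Lc: "Lam S \<in> carrier_mat (num_delays S * ?n) (num_delays S * ?n)"
    unfolding Lam_def by (rule diag_sum_dims) simp
  have DHd: "dim_row ?DH = total_dim S (dimh G) * ?n" "dim_col ?DH = total_dim S (dimh G) * ?n"
    "dim_row ?DE = total_dim S (dimphi G) * ?n" "dim_col ?DE = total_dim S (dimphi G) * ?n"
    by (auto simp: dim_diag_block_mat' comp_def sum_list_idx1 QR_dims total_dim_def sum_distrib_right)
  note J3d = carrier_matD[OF supply_facts(6)]
  have Mc: "?Q + ?R * Lam S \<in> carrier_mat (num_delays S * ?n) (num_delays S * ?n)"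
    using Qc Rc Lc by (intro add_carrier_mat mult_carrier_mat)
  have be: "num_delays S * ?n + ?n + ?k * ?n + CARD('q) = beta S G * ?n + CARD('q)"
    "?n + num_delays S * ?n + total_dim S (dimh G) * ?n + total_dim S (dimphi G) * ?n + CARD('q) = beta S G * ?n + CARD('q)"
    by (simp_all add: beta_def total_dimg algebra_simps)
  have Ac: "?A \<in> carrier_mat (beta S G * ?n + CARD('q)) (beta S G * ?n + CARD('q))"
    unfolding be(1)[symmetric] by (intro diag_carrier_4 Mc zero_carrier_mat)
  have Bc: "?B \<in> carrier_mat (beta S G * ?n + CARD('q)) (beta S G * ?n + CARD('q))"
    unfolding be(2)[symmetric] using DHd by (intro diag_carrier_5 Qc zero_carrier_mat supply_facts(6) carrier_matI)
  have Xi: "Xi S G J (varQ U) (varR U) = ?A - ?B" by (simp add: Xi_def Let_def)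
  show "Xi S G J (varQ U) (varR U) \<in> carrier_mat (beta S G * ?n + CARD('q)) (beta S G * ?n + CARD('q))"
    unfolding Xi by (rule minus_carrier_mat[OF Bc])
  have tc: "?t \<in> carrier_vec (beta S G * ?n + CARD('q))" by (rule carrier_vecI) (rule dim_theta[OF w])
  have dYp: "dim_vec ?Yp = num_delays S * ?n" by (rule dim_parts)
  have "?t \<bullet> (?A *\<^sub>v ?t) = ?Yp \<bullet> ((?Q + ?R * Lam S) *\<^sub>v ?Yp) + (?Y (num_delays S) \<bullet> (0\<^sub>m ?n ?n *\<^sub>v ?Y (num_delays S))
      + ((?H @\<^sub>v ?E) \<bullet> (0\<^sub>m (?k * ?n) (?k * ?n) *\<^sub>v (?H @\<^sub>v ?E)) + w \<bullet> (0\<^sub>m CARD('q) CARD('q) *\<^sub>v w)))"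
    unfolding theta_splits(2)
    by (rule quad_diag_4) (simp_all only: carrier_matD[OF Mc] dYp index_zero_mat dim_vec w index_append_vec dim_parts total_dimg distrib_right)
  also have "\<dots> = ?Yp \<bullet> ((?Q + ?R * Lam S) *\<^sub>v ?Yp)"
    by (simp only: quad_zero_mat dim_vec w index_append_vec dim_parts total_dimg distrib_right add_0_right)
  also have "(?Q + ?R * Lam S) *\<^sub>v ?Yp = ?Q *\<^sub>v ?Yp + ?R *\<^sub>v (Lam S *\<^sub>v ?Yp)"
  proof -
    have Yc: "?Yp \<in> carrier_vec (num_delays S * ?n)" by (rule carrier_vecI) (rule dim_parts)
    show ?thesis
      using add_mult_distrib_mat_vec[OF Qc mult_carrier_mat[OF Rc Lc] Yc] assoc_mult_mat_vec[OF Rc Lc Yc] by simp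
  qed
  also have "Lam S *\<^sub>v ?Yp = vconcat (map (\<lambda>i. (delay S i - delay S (i - 1)) \<cdot>\<^sub>v ?Y (i - 1)) (idx1 S))"
    unfolding Lam_def by (subst diag_mult_vec_map) (simp_all add: mult_smult_one_mat_vec)
  also have "?R *\<^sub>v \<dots> = vconcat (map (\<lambda>i. varR U i *\<^sub>v ((delay S i - delay S (i - 1)) \<cdot>\<^sub>v ?Y (i - 1))) (idx1 S))"
    by (rule diag_mult_vec_map) (simp add: QR_dims set_idx1)
  also have "?Q *\<^sub>v ?Yp = vconcat (map (\<lambda>i. varQ U i *\<^sub>v ?Y (i - 1)) (idx1 S))"
    by (rule diag_mult_vec_map) (simp add: QR_dims set_idx1)
  also have "\<dots> + vconcat (map (\<lambda>i. varR U i *\<^sub>v ((delay S i - delay S (i - 1)) \<cdot>\<^sub>v ?Y (i - 1))) (idx1 S))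
      = vconcat (map (\<lambda>i. varQ U i *\<^sub>v ?Y (i - 1) + varR U i *\<^sub>v ((delay S i - delay S (i - 1)) \<cdot>\<^sub>v ?Y (i - 1))) (idx1 S))"
    by (rule vconcat_add) (simp add: QR_dims set_idx1)
  also have "?Yp \<bullet> \<dots> = (\<Sum>i\<leftarrow>idx1 S. ?Y (i - 1) \<bullet> (varQ U i *\<^sub>v ?Y (i - 1) + varR U i *\<^sub>v ((delay S i - delay S (i - 1)) \<cdot>\<^sub>v ?Y (i - 1))))"
    by (rule scalar_prod_vconcat_map) (simp add: QR_dims set_idx1)
  also have "\<dots> = (\<Sum>i\<leftarrow>idx1 S. ?Y (i - 1) \<bullet> (varQ U i *\<^sub>v ?Y (i - 1)) + (delay S i - delay S (i - 1)) * (?Y (i - 1) \<bullet> (varR U i *\<^sub>v ?Y (i - 1))))"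
  proof (intro arg_cong[where f = sum_list] map_cong refl)
    fix i assume "i \<in> set (idx1 S)"
    then have c: "varQ U i \<in> carrier_mat ?n ?n" "varR U i \<in> carrier_mat ?n ?n" using decision_carriers(4,5) by (auto simp: set_idx1)
    show "?Y (i - 1) \<bullet> (varQ U i *\<^sub>v ?Y (i - 1) + varR U i *\<^sub>v ((delay S i - delay S (i - 1)) \<cdot>\<^sub>v ?Y (i - 1)))
      = ?Y (i - 1) \<bullet> (varQ U i *\<^sub>v ?Y (i - 1)) + (delay S i - delay S (i - 1)) * (?Y (i - 1) \<bullet> (varR U i *\<^sub>v ?Y (i - 1)))"
      using c by (simp add: mult_mat_vec[OF c(2)] scalar_prod_add_distrib[of _ ?n])
  qed
  finally have qA: "?t \<bullet> (?A *\<^sub>v ?t) = (\<Sum>i\<leftarrow>idx1 S. ?Y (i - 1) \<bullet> (varQ U i *\<^sub>v ?Y (i - 1)) + (delay S i - delay S (i - 1)) * (?Y (i - 1) \<bullet> (varR U i *\<^sub>v ?Y (i - 1))))" .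
  have "?t \<bullet> (?B *\<^sub>v ?t) = ?Y 0 \<bullet> (0\<^sub>m ?n ?n *\<^sub>v ?Y 0) + (?Yc \<bullet> (?Q *\<^sub>v ?Yc) + (?H \<bullet> (?DH *\<^sub>v ?H) + (?E \<bullet> (?DE *\<^sub>v ?E) + w \<bullet> (J3 J *\<^sub>v w))))"
    unfolding theta_splits(1)
    by (rule quad_diag_5) (simp_all only: carrier_matD[OF Qc] index_zero_mat dim_vec w dim_parts DHd J3d)
  also have "\<dots> = ?Yc \<bullet> (?Q *\<^sub>v ?Yc) + ?H \<bullet> (?DH *\<^sub>v ?H) + ?E \<bullet> (?DE *\<^sub>v ?E) + w \<bullet> (J3 J *\<^sub>v w)"
    by (simp only: quad_zero_mat dim_vec add_0_left add.assoc)
  also have "?Yc \<bullet> (?Q *\<^sub>v ?Yc) = (\<Sum>i\<leftarrow>idx1 S. ?Y i \<bullet> (varQ U i *\<^sub>v ?Y i))"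
    by (subst diag_mult_vec_map) (auto intro!: scalar_prod_vconcat_map simp: QR_dims set_idx1)
  also have "?H \<bullet> (?DH *\<^sub>v ?H) = (\<Sum>i\<leftarrow>idx1 S. \<Sum>k<dimh G i. Matrix.vec ?n (\<lambda>l. ch i l $ k) \<bullet> (varR U i *\<^sub>v Matrix.vec ?n (\<lambda>l. ch i l $ k)))"
    by (rule scalar_prod_stack_kron) (rule decision_carriers)
  also have "?E \<bullet> (?DE *\<^sub>v ?E) = (\<Sum>i\<leftarrow>idx1 S. \<Sum>k<dimphi G i. Matrix.vec ?n (\<lambda>l. ce i l $ k) \<bullet> (varR U i *\<^sub>v Matrix.vec ?n (\<lambda>l. ce i l $ k)))"
    by (rule scalar_prod_stack_kron) (rule decision_carriers)
  finally have qB: "?t \<bullet> (?B *\<^sub>v ?t) = (\<Sum>i\<leftarrow>idx1 S. ?Y i \<bullet> (varQ U i *\<^sub>v ?Y i))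
    + (\<Sum>i\<leftarrow>idx1 S. \<Sum>k<dimh G i. Matrix.vec ?n (\<lambda>l. ch i l $ k) \<bullet> (varR U i *\<^sub>v Matrix.vec ?n (\<lambda>l. ch i l $ k)))
    + (\<Sum>i\<leftarrow>idx1 S. \<Sum>k<dimphi G i. Matrix.vec ?n (\<lambda>l. ce i l $ k) \<bullet> (varR U i *\<^sub>v Matrix.vec ?n (\<lambda>l. ce i l $ k)))
    + w \<bullet> (J3 J *\<^sub>v w)" .
  have "Xi S G J (varQ U) (varR U) *\<^sub>v ?t = ?A *\<^sub>v ?t - ?B *\<^sub>v ?t"
    unfolding Xi by (rule minus_mult_distrib_mat_vec[OF Ac Bc tc])
  then have "?t \<bullet> (Xi S G J (varQ U) (varR U) *\<^sub>v ?t) = ?t \<bullet> (?A *\<^sub>v ?t) - ?t \<bullet> (?B *\<^sub>v ?t)"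
    using tc mult_mat_vec_carrier[OF Ac tc] mult_mat_vec_carrier[OF Bc tc]
    by (simp only: scalar_prod_minus_distrib)
  then show "?t \<bullet> (Xi S G J (varQ U) (varR U) *\<^sub>v ?t) = Xi_form yd ch ce w"
    unfolding qA qB Xi_form_def by (simp add: sum_list_idx1 sum.distrib sum_subtractf)
qed

end

lemma vcat_form_3:
  assumes "dim_vec a = dim_row A" "dim_vec b = dim_row B" "dim_vec c = dim_row C" "dim_vec x = dim_col A"
    "dim_col B = dim_col A" "dim_col C = dim_col A"
  shows "(a @\<^sub>v b @\<^sub>v c) \<bullet> (vcat [A, B, C] *\<^sub>v x) = a \<bullet> (A *\<^sub>v x) + (b \<bullet> (B *\<^sub>v x) + c \<bullet> (C *\<^sub>v x))"
proof -
  have 1: "(a @\<^sub>v b @\<^sub>v c) \<bullet> (vcat [A, B, C] *\<^sub>v x) = a \<bullet> (A *\<^sub>v x) + (b @\<^sub>v c) \<bullet> (vcat [B, C] *\<^sub>v x)"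
    by (rule vcat_Cons_form) (simp_all add: assms dim_vcat)
  have 2: "(b @\<^sub>v c) \<bullet> (vcat [B, C] *\<^sub>v x) = b \<bullet> (B *\<^sub>v x) + c \<bullet> (vcat [C] *\<^sub>v x)"
    by (rule vcat_Cons_form) (simp_all add: assms dim_vcat)
  show ?thesis unfolding 1 2 vcat_single ..
qed

lemma vcat_form_4:
  assumes "dim_vec a = dim_row A" "dim_vec b = dim_row B" "dim_vec c = dim_row C" "dim_vec d = dim_row D" "dim_vec x = dim_col A"
    "dim_col B = dim_col A" "dim_col C = dim_col A" "dim_col D = dim_col A"
  shows "(a @\<^sub>v b @\<^sub>v c @\<^sub>v d) \<bullet> (vcat [A, B, C, D] *\<^sub>v x)
    = a \<bullet> (A *\<^sub>v x) + (b \<bullet> (B *\<^sub>v x) + (c \<bullet> (C *\<^sub>v x) + d \<bullet> (D *\<^sub>v x)))"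
proof -
  have 1: "(a @\<^sub>v b @\<^sub>v c @\<^sub>v d) \<bullet> (vcat [A, B, C, D] *\<^sub>v x) = a \<bullet> (A *\<^sub>v x) + (b @\<^sub>v c @\<^sub>v d) \<bullet> (vcat [B, C, D] *\<^sub>v x)"
    by (rule vcat_Cons_form) (simp_all add: assms dim_vcat)
  have 2: "(b @\<^sub>v c @\<^sub>v d) \<bullet> (vcat [B, C, D] *\<^sub>v x) = b \<bullet> (B *\<^sub>v x) + (c \<bullet> (C *\<^sub>v x) + d \<bullet> (D *\<^sub>v x))"
    by (rule vcat_form_3) (simp_all add: assms)
  show ?thesis unfolding 1 2 ..
qed

lemma transpose_form:
  assumes "(A :: real mat) \<in> carrier_mat r c" "u \<in> carrier_vec c" "v \<in> carrier_vec r"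
  shows "u \<bullet> (A\<^sup>T *\<^sub>v v) = v \<bullet> (A *\<^sub>v u)"
  using transpose_vec_mult_scalar[OF assms] assms
  by (metis comm_scalar_prod mult_mat_vec_carrier transpose_carrier_mat)

lemma transpose_form_left:
  assumes "(A :: real mat) \<in> carrier_mat r c" "u \<in> carrier_vec c" "v \<in> carrier_vec r"
  shows "u \<bullet> (A\<^sup>T *\<^sub>v v) = (A *\<^sub>v u) \<bullet> v"
  using transpose_form[OF assms] assms by (metis comm_scalar_prod mult_mat_vec_carrier)

context synthesis
begin

text \<open>Each product under \<open>Sy\<close> is a column of blocks times a row of blocks. The
  rows send the vector to \<open>zeta_dot\<close> and to the output \<open>z\<close>; pairing the
  columns with the vector then yields the \<open>P\<close> terms and the supply terms.\<close>

lemma Phi_quadratic: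
  assumes ch: "\<And>i l. i \<in> {1..num_delays S} \<Longrightarrow> dim_vec (ch i l) = dimh G i"
    and w: "dim_vec w = CARD('q)" and s: "dim_vec s = CARD('m)"
    and Sg: "\<Sigma> \<in> carrier_mat CARD('m) (beta S G * CARD('n) + CARD('q))" and z: "z = \<Sigma> *\<^sub>v theta yd ch ce w"
  defines "\<Phi> \<equiv> Phi S G J (varP2 U) (varP3 U) (varQ U) (varR U) \<Sigma>"
  shows "(theta yd ch ce w @\<^sub>v s) \<bullet> (\<Phi> *\<^sub>v (theta yd ch ce w @\<^sub>v s))
      = 2 * (Matrix.vec CARD('n) (yd 0) \<bullet> (varP2 U *\<^sub>v zeta_dot yd ch) + zeta ch \<bullet> (varP3 U *\<^sub>v zeta_dot yd ch))
      + 2 * (w \<bullet> ((- (J2 J)\<^sup>T) *\<^sub>v z) + s \<bullet> (Jtilde J *\<^sub>v z)) + (Xi_form yd ch ce w + s \<bullet> (J1 J *\<^sub>v s))" (is ?form)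
    and "\<Phi> \<in> carrier_mat (beta S G * CARD('n) + CARD('q) + CARD('m)) (beta S G * CARD('n) + CARD('q) + CARD('m))" (is ?carrier)
proof -
  let ?n = "CARD('n)" and ?m = "CARD('m)" and ?q = "CARD('q)"
  let ?d = "total_dim S (dimf G)" and ?mu = "total_dim S (dimphi G)"
  let ?D = "beta S G * ?n + ?q + ?m" and ?t = "theta yd ch ce w"
  let ?Yb = "vconcat (map (\<lambda>i. Matrix.vec ?n (yd i)) (idx0 S))" and ?Yc = "vconcat (map (\<lambda>i. Matrix.vec ?n (yd i)) (idx1 S))"
  let ?H = "stack ?n (dimh G) ch (idx1 S)" and ?E = "stack ?n (dimphi G) ce (idx1 S)"
  let ?r = "?mu * ?n + ?q + ?m"
  let ?Lp = "vcat [varP2 U, 0\<^sub>m (num_delays S * ?n) (?d * ?n), (Ihat S G)\<^sup>T * varP3 U, 0\<^sub>m ?r (?d * ?n)]"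
  let ?Rp = "hcat [kron (boldM S G) (1\<^sub>m ?n), 0\<^sub>m (?d * ?n) ?r]"
  let ?Lj = "vcat [0\<^sub>m (beta S G * ?n) ?m, - (J2 J)\<^sup>T, Jtilde J]"
  let ?Rj = "hcat [\<Sigma>, 0\<^sub>m ?m ?m]"
  note cd = carrier_matD[OF decision_facts(3)] carrier_matD[OF decision_carriers(3)] carrier_matD[OF supply_facts(1)]
    carrier_matD[OF supply_facts(3)] carrier_matD[OF supply_facts(4)] carrier_matD[OF Sg] Ihat_dims boldM_dims
  have D: "?n + (num_delays S * ?n + (total_dim S (dimh G) * ?n + ?r)) = ?D"
    "(1 + num_delays S + total_dim S (dimh G)) * ?n + ?r = ?D" "beta S G * ?n + (?q + ?m) = ?D"
    by (simp_all add: beta_def total_dimg algebra_simps)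
  have Lp: "?Lp \<in> carrier_mat ?D (?d * ?n)"
    by (intro carrier_matI) (simp_all add: dim_vcat cd D)
  have Rp: "?Rp \<in> carrier_mat (?d * ?n) ?D"
    unfolding D(2)[symmetric] by (intro carrier_matI) (simp_all add: dim_hcat cd)
  have Lj: "?Lj \<in> carrier_mat ?D ?m"
    by (intro carrier_matI) (simp_all add: dim_vcat cd D)
  have Rj: "?Rj \<in> carrier_mat ?m ?D"
    by (intro carrier_matI) (simp_all add: dim_hcat cd)
  have Mc: "?Lp * ?Rp + ?Lj * ?Rj \<in> carrier_mat ?D ?D"
    by (rule add_carrier_mat[OF mult_carrier_mat[OF Lj Rj]])
  have Sc: "Sy (?Lp * ?Rp + ?Lj * ?Rj) \<in> carrier_mat ?D ?D"
    unfolding Sy_def using Mc by (intro add_carrier_mat) simp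
  have Xc: "Xi S G J (varQ U) (varR U) \<in> carrier_mat (beta S G * ?n + ?q) (beta S G * ?n + ?q)"
    by (rule Xi_quadratic(2)[OF w])
  have Dc: "diag_block_mat [Xi S G J (varQ U) (varR U), J1 J] \<in> carrier_mat ?D ?D"
    by (intro carrier_matI) (simp_all add: dim_diag_block_mat' carrier_matD[OF Xc] cd)
  have Phi: "\<Phi> = Sy (?Lp * ?Rp + ?Lj * ?Rj) + diag_block_mat [Xi S G J (varQ U) (varR U), J1 J]"
    by (simp only: \<Phi>_def Phi_def Let_def)
  show ?carrier unfolding Phi by (rule add_carrier_mat[OF Dc])
  have tc: "?t @\<^sub>v s \<in> carrier_vec ?D"
    by (rule carrier_vecI) (simp only: index_append_vec dim_theta[OF w] s)
  have t1: "?t @\<^sub>v s = (?Yb @\<^sub>v ?H) @\<^sub>v (?E @\<^sub>v w @\<^sub>v s)" by (simp only: theta_def append_vec_assoc)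
  have t2: "?t @\<^sub>v s = Matrix.vec ?n (yd 0) @\<^sub>v ?Yc @\<^sub>v ?H @\<^sub>v (?E @\<^sub>v w @\<^sub>v s)" by (simp only: theta_splits(1) append_vec_assoc)
  have t3: "?t @\<^sub>v s = (?Yb @\<^sub>v ?H @\<^sub>v ?E) @\<^sub>v w @\<^sub>v s" by (simp only: theta_def append_vec_assoc)
  have "?Rp *\<^sub>v (?t @\<^sub>v s) = kron (boldM S G) (1\<^sub>m ?n) *\<^sub>v (?Yb @\<^sub>v ?H) + 0\<^sub>m (?d * ?n) ?r *\<^sub>v (?E @\<^sub>v w @\<^sub>v s)"
    unfolding t1 by (rule hcat_mult_vec_2)
      (simp_all add: dim_parts cd w s algebra_simps del: dim_stack dim_vconcat)
  also have "\<dots> = kron (boldM S G) (1\<^sub>m ?n) *\<^sub>v (?Yb @\<^sub>v ?H)"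
    by (rule zero_mult_add) (simp_all add: dim_parts cd w s del: dim_stack dim_vconcat)
  also have "\<dots> = zeta_dot yd ch" by (rule kron_boldM_mult) (rule ch)
  finally have Rpt: "?Rp *\<^sub>v (?t @\<^sub>v s) = zeta_dot yd ch" .
  have "?Rj *\<^sub>v (?t @\<^sub>v s) = \<Sigma> *\<^sub>v ?t + 0\<^sub>m ?m ?m *\<^sub>v s"
    by (rule hcat_mult_vec_2) (simp_all only: dim_theta[OF w] cd s index_zero_mat)
  also have "\<dots> = z" unfolding z by (rule zero_mult_add) (simp_all only: cd s dim_mult_mat_vec)
  finally have Rjt: "?Rj *\<^sub>v (?t @\<^sub>v s) = z" .
  have zd: "dim_vec z = ?m" by (simp add: z cd)
  have Hc: "?H \<in> carrier_vec (total_dim S (dimh G) * ?n)" by (rule carrier_vecI) (rule dim_parts)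
  have zdc: "zeta_dot yd ch \<in> carrier_vec (?d * ?n)" by (rule carrier_vecI) (rule zeta_dims)
  have "(?t @\<^sub>v s) \<bullet> (?Lp *\<^sub>v zeta_dot yd ch) = Matrix.vec ?n (yd 0) \<bullet> (varP2 U *\<^sub>v zeta_dot yd ch)
     + (?Yc \<bullet> (0\<^sub>m (num_delays S * ?n) (?d * ?n) *\<^sub>v zeta_dot yd ch) + (?H \<bullet> (((Ihat S G)\<^sup>T * varP3 U) *\<^sub>v zeta_dot yd ch)
       + (?E @\<^sub>v w @\<^sub>v s) \<bullet> (0\<^sub>m ?r (?d * ?n) *\<^sub>v zeta_dot yd ch)))"
    unfolding t2 by (rule vcat_form_4) (simp_all add: dim_parts cd w s zeta_dims del: dim_stack dim_vconcat)
  also have "\<dots> = Matrix.vec ?n (yd 0) \<bullet> (varP2 U *\<^sub>v zeta_dot yd ch) + ?H \<bullet> (((Ihat S G)\<^sup>T * varP3 U) *\<^sub>v zeta_dot yd ch)"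
    by (simp only: zero_mat_mult_vec zeta_dims scalar_prod_zero_right add_0_left add_0_right)
  also have "((Ihat S G)\<^sup>T * varP3 U) *\<^sub>v zeta_dot yd ch = (Ihat S G)\<^sup>T *\<^sub>v (varP3 U *\<^sub>v zeta_dot yd ch)"
    by (rule assoc_mult_mat_vec[OF _ decision_carriers(3) zdc]) (use Ihat_carrier in simp)
  \<comment> \<open>Moving the transpose to the other factor turns the stacked coefficients into
    \<open>zeta\<close>.\<close>
  also have "?H \<bullet> ((Ihat S G)\<^sup>T *\<^sub>v (varP3 U *\<^sub>v zeta_dot yd ch)) = (Ihat S G *\<^sub>v ?H) \<bullet> (varP3 U *\<^sub>v zeta_dot yd ch)"
    by (rule transpose_form_left[OF Ihat_carrier Hc]) (rule mult_mat_vec_carrier[OF decision_carriers(3) zdc])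
  also have "Ihat S G *\<^sub>v ?H = zeta ch" unfolding zeta_def by (rule Ihat_mult_stack) (rule ch)
  finally have qp: "(?t @\<^sub>v s) \<bullet> (?Lp *\<^sub>v zeta_dot yd ch)
     = Matrix.vec ?n (yd 0) \<bullet> (varP2 U *\<^sub>v zeta_dot yd ch) + zeta ch \<bullet> (varP3 U *\<^sub>v zeta_dot yd ch)" .
  have "(?t @\<^sub>v s) \<bullet> (?Lj *\<^sub>v z) = (?Yb @\<^sub>v ?H @\<^sub>v ?E) \<bullet> (0\<^sub>m (beta S G * ?n) ?m *\<^sub>v z) + (w \<bullet> ((- (J2 J)\<^sup>T) *\<^sub>v z) + s \<bullet> (Jtilde J *\<^sub>v z))"
    unfolding t3 by (rule vcat_form_3)
      (simp_all add: dim_parts cd w s zd beta_def total_dimg algebra_simps del: dim_stack dim_vconcat)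
  then have qj: "(?t @\<^sub>v s) \<bullet> (?Lj *\<^sub>v z) = w \<bullet> ((- (J2 J)\<^sup>T) *\<^sub>v z) + s \<bullet> (Jtilde J *\<^sub>v z)"
    by (simp only: zero_mat_mult_vec zd scalar_prod_zero_right add_0_left)
  have zc: "z \<in> carrier_vec ?m" by (rule carrier_vecI) (rule zd)
  have "(?Lp * ?Rp + ?Lj * ?Rj) *\<^sub>v (?t @\<^sub>v s) = (?Lp * ?Rp) *\<^sub>v (?t @\<^sub>v s) + (?Lj * ?Rj) *\<^sub>v (?t @\<^sub>v s)"
    by (rule add_mult_distrib_mat_vec[OF mult_carrier_mat[OF Lp Rp] mult_carrier_mat[OF Lj Rj] tc])
  also have "(?Lp * ?Rp) *\<^sub>v (?t @\<^sub>v s) = ?Lp *\<^sub>v zeta_dot yd ch"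
    unfolding assoc_mult_mat_vec[OF Lp Rp tc] Rpt ..
  also have "(?Lj * ?Rj) *\<^sub>v (?t @\<^sub>v s) = ?Lj *\<^sub>v z"
    unfolding assoc_mult_mat_vec[OF Lj Rj tc] Rjt ..
  finally have "(?t @\<^sub>v s) \<bullet> ((?Lp * ?Rp + ?Lj * ?Rj) *\<^sub>v (?t @\<^sub>v s)) = (?t @\<^sub>v s) \<bullet> (?Lp *\<^sub>v zeta_dot yd ch) + (?t @\<^sub>v s) \<bullet> (?Lj *\<^sub>v z)"
    by (simp only: scalar_prod_add_distrib[OF tc mult_mat_vec_carrier[OF Lp zdc] mult_mat_vec_carrier[OF Lj zc]])
  then have qS: "(?t @\<^sub>v s) \<bullet> (Sy (?Lp * ?Rp + ?Lj * ?Rj) *\<^sub>v (?t @\<^sub>v s)) = 2 * (((Matrix.vec ?n (yd 0) \<bullet> (varP2 U *\<^sub>v zeta_dot yd ch)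
     + zeta ch \<bullet> (varP3 U *\<^sub>v zeta_dot yd ch))) + (w \<bullet> ((- (J2 J)\<^sup>T) *\<^sub>v z) + s \<bullet> (Jtilde J *\<^sub>v z)))"
    unfolding Sy_form[OF Mc tc] qp qj by simp
  have qD: "(?t @\<^sub>v s) \<bullet> (diag_block_mat [Xi S G J (varQ U) (varR U), J1 J] *\<^sub>v (?t @\<^sub>v s)) = Xi_form yd ch ce w + s \<bullet> (J1 J *\<^sub>v s)"
    by (subst diag_cons_quad) (simp_all only: diag_single carrier_matD[OF Xc] dim_theta[OF w] cd s Xi_quadratic(1)[OF w])
  have "\<Phi> *\<^sub>v (?t @\<^sub>v s) = Sy (?Lp * ?Rp + ?Lj * ?Rj) *\<^sub>v (?t @\<^sub>v s) + diag_block_mat [Xi S G J (varQ U) (varR U), J1 J] *\<^sub>v (?t @\<^sub>v s)"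
    unfolding Phi by (rule add_mult_distrib_mat_vec[OF Sc Dc tc])
  then show ?form
    by (simp only: scalar_prod_add_distrib[OF tc mult_mat_vec_carrier[OF Sc tc] mult_mat_vec_carrier[OF Dc tc]] qS qD) simp
qed

lemma block_row_dims:
  "dim_row (block_row S G (co :: nat \<Rightarrow> real^'c^'r) hat lastb) = CARD('r)"
  "dim_col lastb = CARD('q) \<Longrightarrow> dim_col (block_row S G (co :: nat \<Rightarrow> real^'c^'r) hat lastb) = beta S G * CARD('c) + CARD('q)"
proof -
  have T: "dim_col (matT S G i) = dimh G i" "dim_col (matTtilde G i) = dimphi G i" if "i \<in> {1..num_delays S}" for i
    using cholesky_facts(4,6)[OF that] by (simp_all add: matT_def matTtilde_def)
  show "dim_row (block_row S G (co :: nat \<Rightarrow> real^'c^'r) hat lastb) = CARD('r)"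
    by (simp add: block_row_def dim_hcat map_idx0(2) mat_of_def)
  assume "dim_col lastb = CARD('q)"
  then show "dim_col (block_row S G (co :: nat \<Rightarrow> real^'c^'r) hat lastb) = beta S G * CARD('c) + CARD('q)"
    by (simp add: block_row_def dim_hcat comp_def mat_of_def sum_list_idx0 sum_list_idx1 T beta_def total_dimg)
      (simp add: total_dim_def sum_distrib_right distrib_right)
qed

lemma boldSigma_carrier: "boldSigma S G U \<in> carrier_mat CARD('m) (beta S G * CARD('n) + CARD('q))"
  using decision_facts(5)
  by (intro carrier_matI) (simp_all add: boldSigma_def boldB2_def block_row_dims dim_diag_block_mat')

lemma boldPi_carrier: "boldPi S G U \<in> carrier_mat CARD('n) (beta S G * CARD('n) + CARD('q) + CARD('m))"
  using decision_facts(5)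
  by (intro carrier_matI) (simp_all add: boldPi_def boldB1_def block_row_dims dim_diag_block_mat' dim_hcat)

text \<open>The first component \<open>u\<close> is constrained only through \<open>Pi\<close>. The
  identity therefore serves both for a trajectory, where \<open>X u\<close> is the time derivative
  of \<open>x\<close>, and for a kernel vector of \<open>X\<close> with all other entries
  zero.\<close>

lemma lmi_quadratic:
  assumes ch: "\<And>i l. i \<in> {1..num_delays S} \<Longrightarrow> dim_vec (ch i l) = dimh G i"
    and u: "dim_vec u = CARD('n)" and w: "dim_vec w = CARD('q)" and s: "dim_vec s = CARD('m)"
    and z: "z = boldSigma S G U *\<^sub>v theta yd ch ce w"
    and Pi: "boldPi S G U *\<^sub>v (theta yd ch ce w @\<^sub>v s) = varX U *\<^sub>v u"
  defines "\<chi> \<equiv> u @\<^sub>v (theta yd ch ce w @\<^sub>v s)"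
  shows "\<chi> \<bullet> (synthesis_lmi S G J \<alpha> U *\<^sub>v \<chi>)
      = 2 * (u \<bullet> (varP1 U *\<^sub>v Matrix.vec CARD('n) (yd 0) + varP2 U *\<^sub>v zeta ch))
      + 2 * (Matrix.vec CARD('n) (yd 0) \<bullet> (varP2 U *\<^sub>v zeta_dot yd ch) + zeta ch \<bullet> (varP3 U *\<^sub>v zeta_dot yd ch))
      + 2 * (w \<bullet> ((- (J2 J)\<^sup>T) *\<^sub>v z) + s \<bullet> (Jtilde J *\<^sub>v z)) + (Xi_form yd ch ce w + s \<bullet> (J1 J *\<^sub>v s))" (is ?form)
    and "synthesis_lmi S G J \<alpha> U \<in> carrier_mat (CARD('n) + (beta S G * CARD('n) + CARD('q) + CARD('m)))
       (CARD('n) + (beta S G * CARD('n) + CARD('q) + CARD('m)))" (is ?carrier)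
    and "\<chi> \<in> carrier_vec (CARD('n) + (beta S G * CARD('n) + CARD('q) + CARD('m)))" (is ?dim)
proof -
  let ?n = "CARD('n)" and ?m = "CARD('m)" and ?q = "CARD('q)"
  let ?D = "beta S G * ?n + ?q + ?m" and ?ts = "theta yd ch ce w @\<^sub>v s"
  let ?L = "vcat [1\<^sub>m ?n, vcat (map (\<lambda>i. \<alpha> i \<cdot>\<^sub>m 1\<^sub>m ?n) [1..<Suc (beta S G)]), 0\<^sub>m (?q + ?m) ?n]"
  let ?H = "hcat [- varX U, boldPi S G U]"
  let ?P = "boldP S G U" and ?Phi = "Phi S G J (varP2 U) (varP3 U) (varQ U) (varR U) (boldSigma S G U)"
  let ?F = "four_block_mat (0\<^sub>m ?n ?n) ?P (?P\<^sup>T) ?Phi"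
  have L: "?L \<in> carrier_mat (?n + ?D) ?n"
    by (intro carrier_matI) (simp_all add: dim_vcat comp_def sum_list_triv)
  have H: "?H \<in> carrier_mat ?n (?n + ?D)"
    using boldPi_carrier decision_carriers(1) by (intro carrier_matI) (simp_all add: dim_hcat)
  have P: "?P \<in> carrier_mat ?n ?D" using boldP_dims by (intro carrier_matI) auto
  note Phi = Phi_quadratic[where \<Sigma> = "boldSigma S G U" and yd = yd and ce = ce, OF ch w s boldSigma_carrier z]
  have F: "?F \<in> carrier_mat (?n + ?D) (?n + ?D)"
    by (rule four_block_carrier_mat[OF zero_carrier_mat Phi(2)])
  have LH: "?L * ?H \<in> carrier_mat (?n + ?D) (?n + ?D)" by (rule mult_carrier_mat[OF L H])
  have S: "Sy (?L * ?H) \<in> carrier_mat (?n + ?D) (?n + ?D)"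
    unfolding Sy_def using LH by (intro add_carrier_mat) simp
  have lmi: "synthesis_lmi S G J \<alpha> U = Sy (?L * ?H) + ?F" by (simp only: synthesis_lmi_def Let_def)
  show ?carrier unfolding lmi by (rule add_carrier_mat[OF F])
  have uc: "u \<in> carrier_vec ?n" by (rule carrier_vecI) (rule u)
  have tc: "?ts \<in> carrier_vec ?D" by (rule carrier_vecI) (simp only: index_append_vec dim_theta[OF w] s)
  show chi: ?dim unfolding \<chi>_def by (rule append_carrier_vec[OF uc tc])
  have "?H *\<^sub>v \<chi> = (- varX U) *\<^sub>v u + boldPi S G U *\<^sub>v ?ts"
    unfolding \<chi>_def using boldPi_carrier decision_carriers(1) tc u
    by (intro hcat_mult_vec_2) (simp_all add: carrier_vecD del: index_append_vec)
  also have "\<dots> = 0\<^sub>v ?n"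
    unfolding Pi using decision_carriers(1) uc by (intro eq_vecI) (auto simp: uminus_scalar_prod)
  finally have Hc: "?H *\<^sub>v \<chi> = 0\<^sub>v ?n" .
  have "\<chi> \<bullet> (Sy (?L * ?H) *\<^sub>v \<chi>) = 0"
    unfolding Sy_form[OF LH chi] assoc_mult_mat_vec[OF L H chi] Hc mult_mat_vec_zero[OF L] scalar_prod_zero_right by simp
  moreover have "\<chi> \<bullet> (?F *\<^sub>v \<chi>) = 2 * (u \<bullet> (?P *\<^sub>v ?ts)) + ?ts \<bullet> (?Phi *\<^sub>v ?ts)"
  proof -
    have c: "?P *\<^sub>v ?ts \<in> carrier_vec ?n" "?P\<^sup>T *\<^sub>v u \<in> carrier_vec ?D" "?Phi *\<^sub>v ?ts \<in> carrier_vec ?D"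
      using P tc uc Phi(2) by (auto intro!: mult_mat_vec_carrier)
    have "?F *\<^sub>v \<chi> = (0\<^sub>m ?n ?n *\<^sub>v u + ?P *\<^sub>v ?ts) @\<^sub>v (?P\<^sup>T *\<^sub>v u + ?Phi *\<^sub>v ?ts)"
      unfolding \<chi>_def by (rule four_block_mat_mult_vec[OF zero_carrier_mat P _ Phi(2) uc tc]) (use P in simp)
    also have "0\<^sub>m ?n ?n *\<^sub>v u + ?P *\<^sub>v ?ts = ?P *\<^sub>v ?ts" by (rule zero_mult_add) (simp_all only: u dim_mult_mat_vec boldP_dims)
    finally have "\<chi> \<bullet> (?F *\<^sub>v \<chi>) = u \<bullet> (?P *\<^sub>v ?ts) + ?ts \<bullet> (?P\<^sup>T *\<^sub>v u + ?Phi *\<^sub>v ?ts)"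
      unfolding \<chi>_def using scalar_prod_append[OF uc tc c(1)] c by (simp del: scalar_prod_append)
    also have "?ts \<bullet> (?P\<^sup>T *\<^sub>v u + ?Phi *\<^sub>v ?ts) = ?ts \<bullet> (?P\<^sup>T *\<^sub>v u) + ?ts \<bullet> (?Phi *\<^sub>v ?ts)"
      by (rule scalar_prod_add_distrib[OF tc c(2,3)])
    also have "?ts \<bullet> (?P\<^sup>T *\<^sub>v u) = u \<bullet> (?P *\<^sub>v ?ts)" by (rule transpose_form[OF P tc uc])
    finally show ?thesis by simp
  qed
  moreover have "\<chi> \<bullet> (synthesis_lmi S G J \<alpha> U *\<^sub>v \<chi>) = \<chi> \<bullet> (Sy (?L * ?H) *\<^sub>v \<chi>) + \<chi> \<bullet> (?F *\<^sub>v \<chi>)"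
    unfolding lmi add_mult_distrib_mat_vec[OF S F chi]
    by (rule scalar_prod_add_distrib[OF chi mult_mat_vec_carrier[OF S chi] mult_mat_vec_carrier[OF F chi]])
  moreover have "?P *\<^sub>v ?ts = varP1 U *\<^sub>v Matrix.vec ?n (yd 0) + varP2 U *\<^sub>v zeta ch"
    by (rule boldP_mult[OF ch w s])
  ultimately show ?form using Phi(1) by simp
qed

text \<open>Uniform in \<open>B\<close> and \<open>Lq\<close>: with \<open>X\<close> and the
  identity it evaluates the rows \<open>boldA\<close> and \<open>boldC\<close>, with
  \<open>V\<close> and zero the rows \<open>boldB1\<close> and \<open>boldB2\<close>.\<close>

lemma block_row_mult:
  fixes co :: "nat \<Rightarrow> real^'c^'r"
  assumes hat: "\<And>i. i \<in> {1..num_delays S} \<Longrightarrow> hat i \<in> carrier_mat CARD('r) (dimg G i * CARD('c))"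
    and B: "B \<in> carrier_mat CARD('c) CARD('n)" and Lq: "Lq \<in> carrier_mat CARD('q) CARD('q)"
    and lastb: "lastb \<in> carrier_mat CARD('r) CARD('q)" and w: "dim_vec w = CARD('q)" and l: "l < CARD('r)"
  shows "((block_row S G co hat lastb * diag_block_mat [kron (1\<^sub>m (beta S G)) B, Lq]) *\<^sub>v theta yd ch ce w) $ l
    = (\<Sum>i=0..num_delays S. (mat_of (co i) *\<^sub>v (B *\<^sub>v Matrix.vec CARD('n) (yd i))) $ l)
    + (\<Sum>i=1..num_delays S. (hat i *\<^sub>v
        (kron (matT S G i) (1\<^sub>m CARD('c)) *\<^sub>v blk (dimh G i) CARD('c) (\<lambda>j s. (B *\<^sub>v Matrix.vec CARD('n) (\<lambda>l. ch i l $ j)) $ s)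
       + kron (matTtilde G i) (1\<^sub>m CARD('c)) *\<^sub>v blk (dimphi G i) CARD('c) (\<lambda>j s. (B *\<^sub>v Matrix.vec CARD('n) (\<lambda>l. ce i l $ j)) $ s))) $ l)
    + (lastb *\<^sub>v (Lq *\<^sub>v w)) $ l"
proof -
  let ?n = "CARD('n)" and ?c = "CARD('c)"
  let ?bs = "map (\<lambda>i. (1::nat, \<lambda>_::nat. yd i)) (idx0 S) @ map (\<lambda>i. (dimh G i, \<lambda>j l. ch i l $ j)) (idx1 S)
    @ map (\<lambda>i. (dimphi G i, \<lambda>j l. ce i l $ j)) (idx1 S)"
  let ?xd = "\<lambda>i. B *\<^sub>v Matrix.vec ?n (yd i)"
  let ?hB = "\<lambda>i. blk (dimh G i) ?c (\<lambda>j s. (B *\<^sub>v Matrix.vec ?n (\<lambda>l. ch i l $ j)) $ s)"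
  let ?eB = "\<lambda>i. blk (dimphi G i) ?c (\<lambda>j s. (B *\<^sub>v Matrix.vec ?n (\<lambda>l. ce i l $ j)) $ s)"
  let ?D = "diag_block_mat [kron (1\<^sub>m (beta S G)) B, Lq]"
  have tb: "theta yd ch ce w = blks ?n ?bs @\<^sub>v w"
    by (simp add: theta_def blks_def stack_def vconcat_append append_vec_assoc comp_def blk_1)
  have be: "beta S G = (\<Sum>b\<leftarrow>?bs. fst b)"
    by (simp add: comp_def sum_list_idx0 sum_list_idx1 beta_def total_dimg) (simp add: total_dim_def)
  have db: "dim_vec (blks ?n ?bs) = beta S G * ?n"
    unfolding be by (simp add: blks_def comp_def sum_list_idx0 sum_list_idx1 sum_distrib_right distrib_right)
  have Dt: "?D *\<^sub>v theta yd ch ce w = vconcat (map ?xd (idx0 S) @ map ?hB (idx1 S) @ map ?eB (idx1 S) @ [Lq *\<^sub>v w])"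
  proof -
    have "map dim_col [kron (1\<^sub>m (beta S G)) B, Lq] = map dim_vec [blks ?n ?bs, w]"
      using carrier_matD(2)[OF B] carrier_matD(2)[OF Lq] by (simp only: list.map kron_dim index_one_mat db w)
    from diag_mult_vec[OF this] have "?D *\<^sub>v theta yd ch ce w = kron (1\<^sub>m (beta S G)) B *\<^sub>v blks ?n ?bs @\<^sub>v Lq *\<^sub>v w"
      by (simp only: tb vconcat_simps append_zero_vec list.map zip_Cons_Cons zip_Nil prod.case)
    also have "kron (1\<^sub>m (beta S G)) B *\<^sub>v blks ?n ?bs = blks ?c (map (\<lambda>(k, c). (k, \<lambda>j s. (B *\<^sub>v Matrix.vec ?n (c j)) $ s)) ?bs)"
      using kron_one_left_blks[of B ?n ?bs] B unfolding be by simp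
    also have "blks ?c (map (\<lambda>(k, c). (k, \<lambda>j s. (B *\<^sub>v Matrix.vec ?n (c j)) $ s)) ?bs)
       = vconcat (map ?xd (idx0 S) @ map ?hB (idx1 S) @ map ?eB (idx1 S))"
      using B by (simp add: blks_def comp_def blk_1 vec_index_self)
    finally show ?thesis by (simp only: vconcat_append vconcat_simps append_vec_assoc append_zero_vec)
  qed
  have T: "dim_col (matT S G i) = dimh G i" "dim_col (matTtilde G i) = dimphi G i"
    "dim_row (matT S G i) = dimg G i" "dim_row (matTtilde G i) = dimg G i" if "i \<in> {1..num_delays S}" for i
    using cholesky_facts(4,6)[OF that] by (simp_all add: matT_def matTtilde_def dim_vcat dimg_def dimh_def Gam_def cross_gram_def)
  have hd: "dim_row (hat i) = CARD('r)" "dim_col (hat i) = dimg G i * ?c" if "i \<in> {1..num_delays S}" for i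
    using hat[OF that] by auto
  let ?As = "map (\<lambda>i. mat_of (co i)) (idx0 S) @ map (\<lambda>i. hat i * kron (matT S G i) (1\<^sub>m ?c)) (idx1 S)
         @ map (\<lambda>i. hat i * kron (matTtilde G i) (1\<^sub>m ?c)) (idx1 S) @ [lastb]"
  let ?vs = "map ?xd (idx0 S) @ map ?hB (idx1 S) @ map ?eB (idx1 S) @ [Lq *\<^sub>v w]"
  have "block_row S G co hat lastb *\<^sub>v vconcat ?vs
     = Matrix.vec CARD('r) (\<lambda>l. \<Sum>(A, v)\<leftarrow>zip ?As ?vs. (A *\<^sub>v v) $ l)"
    unfolding block_row_def
    by (rule hcat_mult_vec) (use B Lq lastb in \<open>auto simp: mat_of_def set_idx1 hd T\<close>)
  then have "(block_row S G co hat lastb *\<^sub>v vconcat ?vs) $ l = (\<Sum>(A, v)\<leftarrow>zip ?As ?vs. (A *\<^sub>v v) $ l)"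
    using l by simp
  also have "\<dots> = (\<Sum>i\<leftarrow>idx0 S. (mat_of (co i) *\<^sub>v ?xd i) $ l) + ((\<Sum>i\<leftarrow>idx1 S. ((hat i * kron (matT S G i) (1\<^sub>m ?c)) *\<^sub>v ?hB i) $ l)
      + ((\<Sum>i\<leftarrow>idx1 S. ((hat i * kron (matTtilde G i) (1\<^sub>m ?c)) *\<^sub>v ?eB i) $ l) + (lastb *\<^sub>v (Lq *\<^sub>v w)) $ l))"
    by (simp add: zip_append zip_map_map zip_same_conv_map comp_def del: index_mult_mat_vec)
  also have "\<dots> = (\<Sum>i=0..num_delays S. (mat_of (co i) *\<^sub>v ?xd i) $ l)
      + (\<Sum>i=1..num_delays S. ((hat i * kron (matT S G i) (1\<^sub>m ?c)) *\<^sub>v ?hB i) $ l + ((hat i * kron (matTtilde G i) (1\<^sub>m ?c)) *\<^sub>v ?eB i) $ l)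
      + (lastb *\<^sub>v (Lq *\<^sub>v w)) $ l"
    by (simp only: sum_list_idx0 sum_list_idx1 sum.distrib add.assoc)
  also have "(\<Sum>i=1..num_delays S. ((hat i * kron (matT S G i) (1\<^sub>m ?c)) *\<^sub>v ?hB i) $ l + ((hat i * kron (matTtilde G i) (1\<^sub>m ?c)) *\<^sub>v ?eB i) $ l)
     = (\<Sum>i=1..num_delays S. (hat i *\<^sub>v (kron (matT S G i) (1\<^sub>m ?c) *\<^sub>v ?hB i + kron (matTtilde G i) (1\<^sub>m ?c) *\<^sub>v ?eB i)) $ l)"
  proof (rule sum.cong[OF refl])
    fix i assume i: "i \<in> {1..num_delays S}"
    have k: "kron (matT S G i) (1\<^sub>m ?c) \<in> carrier_mat (dimg G i * ?c) (dimh G i * ?c)"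
      "kron (matTtilde G i) (1\<^sub>m ?c) \<in> carrier_mat (dimg G i * ?c) (dimphi G i * ?c)"
      using T[OF i] by (intro carrier_matI; simp)+
    have v: "?hB i \<in> carrier_vec (dimh G i * ?c)" "?eB i \<in> carrier_vec (dimphi G i * ?c)" by (rule carrier_vecI, simp)+
    have "hat i *\<^sub>v (kron (matT S G i) (1\<^sub>m ?c) *\<^sub>v ?hB i + kron (matTtilde G i) (1\<^sub>m ?c) *\<^sub>v ?eB i)
       = hat i *\<^sub>v (kron (matT S G i) (1\<^sub>m ?c) *\<^sub>v ?hB i) + hat i *\<^sub>v (kron (matTtilde G i) (1\<^sub>m ?c) *\<^sub>v ?eB i)"
      by (rule mult_add_distrib_mat_vec[OF hat[OF i] mult_mat_vec_carrier[OF k(1) v(1)] mult_mat_vec_carrier[OF k(2) v(2)]])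
    then show "((hat i * kron (matT S G i) (1\<^sub>m ?c)) *\<^sub>v ?hB i) $ l + ((hat i * kron (matTtilde G i) (1\<^sub>m ?c)) *\<^sub>v ?eB i) $ l
       = (hat i *\<^sub>v (kron (matT S G i) (1\<^sub>m ?c) *\<^sub>v ?hB i + kron (matTtilde G i) (1\<^sub>m ?c) *\<^sub>v ?eB i)) $ l"
      using l hd[OF i] unfolding assoc_mult_mat_vec[OF hat[OF i] k(1) v(1)] assoc_mult_mat_vec[OF hat[OF i] k(2) v(2)]
      by (simp del: index_mult_mat_vec)
  qed
  also have "block_row S G co hat lastb *\<^sub>v vconcat ?vs = (block_row S G co hat lastb * ?D) *\<^sub>v theta yd ch ce w"
  proof -
    have r: "block_row S G co hat lastb \<in> carrier_mat CARD('r) (beta S G * ?c + CARD('q))"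
      using lastb by (intro carrier_matI block_row_dims) auto
    have D: "?D \<in> carrier_mat (beta S G * ?c + CARD('q)) (beta S G * ?n + CARD('q))"
      using B Lq by (intro carrier_matI) (simp_all add: dim_diag_block_mat')
    have t: "theta yd ch ce w \<in> carrier_vec (beta S G * ?n + CARD('q))" by (rule carrier_vecI) (rule dim_theta[OF w])
    show ?thesis unfolding assoc_mult_mat_vec[OF r D t] Dt ..
  qed
  finally show ?thesis .
qed

end

subsection \<open>Cartesian vectors as lists of coordinates\<close>

lemma bij_from_nat_into: "bij_betw (from_nat_into (UNIV :: 'a::finite set)) {..<CARD('a)} UNIV"
  using bij_betw_from_nat_into_finite[of "UNIV :: 'a set"] by simp

lemma sum_UNIV_from_nat_into: "(\<Sum>j\<in>UNIV. f j) = (\<Sum>j<CARD('a). f (from_nat_into UNIV j))" for f :: "'a::finite \<Rightarrow> real"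
  by (rule sum.reindex_bij_betw[OF bij_from_nat_into, symmetric])

lemma dim_vec_of [simp]: "dim_vec (vec_of (x :: real^'a)) = CARD('a)"
  by (simp add: vec_of_def)

lemma vec_of_index: "j < CARD('a) \<Longrightarrow> vec_of (x :: real^'a) $ j = vec_nth x (from_nat_into UNIV j)"
  by (simp add: vec_of_def)

lemma vec_of_carrier: "vec_of (x :: real^'a) \<in> carrier_vec CARD('a)"
  by (simp add: carrier_vecI)

lemma mat_of_carrier: "mat_of (A :: real^'c^'r) \<in> carrier_mat CARD('r) CARD('c)"
  by (simp add: mat_of_def)

lemma vec_of_mult: "vec_of (A *v x) = mat_of (A :: real^'c^'r) *\<^sub>v vec_of x"
proof (rule eq_vecI)
  fix i assume "i < dim_vec (mat_of A *\<^sub>v vec_of x)"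
  then have i: "i < CARD('r)" by (simp add: mat_of_def)
  have "vec_of (A *v x) $ i = (\<Sum>j<CARD('c). vec_nth (vec_nth A (from_nat_into UNIV i)) (from_nat_into UNIV j) * vec_nth x (from_nat_into UNIV j))"
    using i by (simp add: vec_of_index matrix_vector_mult_def sum_UNIV_from_nat_into)
  also have "\<dots> = (mat_of A *\<^sub>v vec_of x) $ i"
    using i by (subst mult_mat_vec_index) (auto simp: mat_of_def vec_of_index)
  finally show "vec_of (A *v x) $ i = (mat_of A *\<^sub>v vec_of x) $ i" .
qed (simp add: mat_of_def)

lemma vec_of_add: "vec_of (x + y) = vec_of x + vec_of (y :: real^'a)"
  by (intro eq_vecI) (auto simp: vec_of_index)

lemma vec_of_sum_index: "j < CARD('a) \<Longrightarrow> vec_of (\<Sum>i\<in>A. f i) $ j = (\<Sum>i\<in>A. vec_of (f i :: real^'a) $ j)"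
  by (simp add: vec_of_index)

lemma ex_from_nat_into: "\<exists>j<CARD('a). from_nat_into UNIV j = (k :: 'a::finite)"
proof -
  have "k \<in> from_nat_into UNIV ` {..<CARD('a)}"
    using bij_from_nat_into[where ?'a = 'a] by (simp add: bij_betw_def)
  then show ?thesis by auto
qed

lemma bounded_linear_vec_of: "j < CARD('a) \<Longrightarrow> bounded_linear (\<lambda>x :: real^'a. vec_of x $ j)"
  by (simp add: vec_of_index bounded_linear_vec_nth)

lemma to_nat_on_from_nat_into_UNIV:
  assumes "i < CARD('a)"
  shows "to_nat_on UNIV (from_nat_into (UNIV :: 'a::finite set) i) = i"
  using to_nat_on_finite[of "UNIV :: 'a set"] assms
  by (intro to_nat_on_from_nat_into) (simp_all add: bij_betw_def)

lemma mat_of_cart_of_mat: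
  assumes "A \<in> carrier_mat CARD('r) CARD('c)"
  shows "mat_of (cart_of_mat A :: real^'c^'r) = A"
  using assms by (intro eq_matI) (auto simp: mat_of_def cart_of_mat_def to_nat_on_from_nat_into_UNIV)

lemma set_integrable_vec:
  assumes "\<And>j. j < CARD('a) \<Longrightarrow> set_integrable lebesgue I (\<lambda>\<tau>. vec_of (\<Phi> \<tau> :: real^'a) $ j)"
  shows "set_integrable lebesgue I \<Phi>" "\<And>j. j < CARD('a) \<Longrightarrow> vec_of (LINT \<tau>:I|lebesgue. \<Phi> \<tau>) $ j = (LINT \<tau>:I|lebesgue. vec_of (\<Phi> \<tau>) $ j)"
proof -
  show int: "set_integrable lebesgue I \<Phi>"
  proof (rule absolutely_integrable_componentwise)
    fix b :: "real^'a" assume "b \<in> Basis"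
    then obtain k where b: "b = axis k 1" by (auto simp: Basis_vec_def)
    obtain j where j: "j < CARD('a)" "from_nat_into UNIV j = k"
      using ex_from_nat_into by blast
    show "set_integrable lebesgue I (\<lambda>x. inner (\<Phi> x) b)"
      using assms[OF j(1)] j by (simp add: b inner_axis vec_of_index)
  qed
  show "vec_of (LINT \<tau>:I|lebesgue. \<Phi> \<tau>) $ j = (LINT \<tau>:I|lebesgue. vec_of (\<Phi> \<tau>) $ j)" if "j < CARD('a)" for j
    using integral_bounded_linear[OF bounded_linear_vec_of[OF that], of lebesgue "\<lambda>\<tau>. indicat_real I \<tau> *\<^sub>R \<Phi> \<tau>"] int that
    by (simp add: set_lebesgue_integral_def set_integrable_def vec_of_index)
qed

lemma sum_lessThan_add: "(\<Sum>k<a + b. f k) = (\<Sum>k<a. f k) + (\<Sum>k<b. f (a + k :: nat) :: real)"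
  by (induction b) (simp_all add: add.assoc)

subsection \<open>Coefficients with respect to a family of functions\<close>

definition L2_family :: "real set \<Rightarrow> nat \<Rightarrow> (real \<Rightarrow> real Matrix.vec) \<Rightarrow> bool" where
  "L2_family I k F \<longleftrightarrow> (\<forall>\<tau>\<in>I. dim_vec (F \<tau>) = k) \<and> (\<forall>j<k. L2_on I (\<lambda>\<tau>. F \<tau> $ j))"

definition cvec :: "real set \<Rightarrow> nat \<Rightarrow> (real \<Rightarrow> real Matrix.vec) \<Rightarrow> (real \<Rightarrow> real) \<Rightarrow> real Matrix.vec" where
  "cvec I k F y = Matrix.vec k (\<lambda>j. ip I (\<lambda>\<tau>. F \<tau> $ j) y)"

lemma dim_cvec [simp]: "dim_vec (cvec I k F y) = k"
  by (simp add: cvec_def)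

lemma cvec_carrier: "cvec I k F y \<in> carrier_vec k"
  by (simp add: carrier_vecI)

lemma ip_cong': "(\<And>t. t \<in> I \<Longrightarrow> f t = f' t) \<Longrightarrow> (\<And>t. t \<in> I \<Longrightarrow> g t = g' t) \<Longrightarrow> ip I f g = ip I f' g'"
  by (rule ip_cong) simp

lemma L2_family_mult:
  assumes "L2_family I k F" "A \<in> carrier_mat r k"
  shows "L2_family I r (\<lambda>\<tau>. A *\<^sub>v F \<tau>)"
  unfolding L2_family_def
proof (intro conjI ballI allI impI)
  fix i assume i: "i < r"
  have "L2_on I (\<lambda>\<tau>. \<Sum>j<k. A $$ (i, j) * F \<tau> $ j)"
    using assms(1) by (intro L2_on_sum L2_on_cmult) (auto simp: L2_family_def)
  then show "L2_on I (\<lambda>\<tau>. (A *\<^sub>v F \<tau>) $ i)"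
    by (rule L2_on_cong) (use assms i in \<open>auto simp: mult_mat_vec_index L2_family_def simp del: index_mult_mat_vec\<close>)
qed (use assms in auto)

lemma ip_mult_left:
  assumes "L2_family I k F" "A \<in> carrier_mat r k" "L2_on I y" "i < r"
  shows "ip I (\<lambda>\<tau>. (A *\<^sub>v F \<tau>) $ i) y = (\<Sum>j<k. A $$ (i, j) * ip I (\<lambda>\<tau>. F \<tau> $ j) y)"
proof -
  have "ip I (\<lambda>\<tau>. (A *\<^sub>v F \<tau>) $ i) y = ip I (\<lambda>\<tau>. \<Sum>j<k. A $$ (i, j) * F \<tau> $ j) y"
    by (rule ip_cong') (use assms in \<open>auto simp: mult_mat_vec_index L2_family_def simp del: index_mult_mat_vec\<close>)
  also have "\<dots> = (\<Sum>j<k. ip I (\<lambda>\<tau>. A $$ (i, j) * F \<tau> $ j) y)"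
    using assms by (intro ip_sum_left L2_on_cmult) (auto simp: L2_family_def)
  finally show ?thesis by (simp add: ip_cmult_left)
qed

lemma cvec_mult:
  assumes "L2_family I k F" "A \<in> carrier_mat r k" "L2_on I y"
  shows "cvec I r (\<lambda>\<tau>. A *\<^sub>v F \<tau>) y = A *\<^sub>v cvec I k F y"
proof (rule eq_vecI)
  fix i assume "i < dim_vec (A *\<^sub>v cvec I k F y)"
  then have i: "i < r" using assms(2) by simp
  have "(A *\<^sub>v cvec I k F y) $ i = (\<Sum>j<k. A $$ (i, j) * cvec I k F y $ j)"
    using mult_mat_vec_index[of i A "cvec I k F y"] i assms(2) by (simp del: index_mult_mat_vec)
  then show "cvec I r (\<lambda>\<tau>. A *\<^sub>v F \<tau>) y $ i = (A *\<^sub>v cvec I k F y) $ i"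
    using i ip_mult_left[OF assms i] by (simp add: cvec_def del: index_mult_mat_vec)
qed (use assms in simp)

lemma cvec_sum_right:
  assumes "L2_family I k F" "\<And>l. l \<in> A \<Longrightarrow> L2_on I (y l)" "j < k"
  shows "cvec I k F (\<lambda>\<tau>. \<Sum>l\<in>A. c l * y l \<tau>) $ j = (\<Sum>l\<in>A. c l * cvec I k F (y l) $ j)"
proof -
  have "ip I (\<lambda>\<tau>. F \<tau> $ j) (\<lambda>\<tau>. \<Sum>l\<in>A. c l * y l \<tau>) = ip I (\<lambda>\<tau>. \<Sum>l\<in>A. c l * y l \<tau>) (\<lambda>\<tau>. F \<tau> $ j)"
    by (rule ip_commute)
  also have "\<dots> = (\<Sum>l\<in>A. ip I (\<lambda>\<tau>. c l * y l \<tau>) (\<lambda>\<tau>. F \<tau> $ j))"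
    using assms by (intro ip_sum_left L2_on_cmult) (auto simp: L2_family_def)
  also have "\<dots> = (\<Sum>l\<in>A. c l * ip I (\<lambda>\<tau>. F \<tau> $ j) (y l))" by (simp add: ip_cmult_left ip_commute)
  finally show ?thesis using assms(3) by (simp add: cvec_def)
qed

lemma cross_gram_index: "k < a \<Longrightarrow> l < b \<Longrightarrow> cross_gram I a b u v $$ (k, l) = ip I (\<lambda>\<tau>. u \<tau> $ k) (\<lambda>\<tau>. v \<tau> $ l)"
  by (simp add: cross_gram_def ip_def)

lemma cross_gram_carrier: "cross_gram I a b u v \<in> carrier_mat a b"
  by (simp add: cross_gram_def)

lemma cross_gram_transpose: "(cross_gram I a b u v)\<^sup>T = cross_gram I b a v u"
  by (rule eq_matI) (auto simp: cross_gram_index ip_commute cross_gram_def mult.commute)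

lemma cross_gram_mult_left:
  assumes "L2_family I a u" "A \<in> carrier_mat r a" "L2_family I b v"
  shows "cross_gram I r b (\<lambda>\<tau>. A *\<^sub>v u \<tau>) v = A * cross_gram I a b u v"
proof (rule eq_matI)
  fix i l assume "i < dim_row (A * cross_gram I a b u v)" "l < dim_col (A * cross_gram I a b u v)"
  then have i: "i < r" "l < b" using assms(2) by (auto simp: cross_gram_def)
  have "(A * cross_gram I a b u v) $$ (i, l) = (\<Sum>j<a. A $$ (i, j) * cross_gram I a b u v $$ (j, l))"
    using i assms(2) by (auto simp: scalar_prod_def atLeast0LessThan cross_gram_def intro!: sum.cong)
  also have "\<dots> = (\<Sum>j<a. A $$ (i, j) * ip I (\<lambda>\<tau>. u \<tau> $ j) (\<lambda>\<tau>. v \<tau> $ l))"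
    using i by (simp add: cross_gram_index)
  also have "\<dots> = ip I (\<lambda>\<tau>. (A *\<^sub>v u \<tau>) $ i) (\<lambda>\<tau>. v \<tau> $ l)"
    using i assms by (subst ip_mult_left[OF assms(1,2)]) (auto simp: L2_family_def)
  finally show "cross_gram I r b (\<lambda>\<tau>. A *\<^sub>v u \<tau>) v $$ (i, l) = (A * cross_gram I a b u v) $$ (i, l)"
    using i by (simp add: cross_gram_index)
qed (use assms in \<open>auto simp: cross_gram_def\<close>)

lemma cross_gram_mult_right:
  assumes "L2_family I a u" "A \<in> carrier_mat r a" "L2_family I b v"
  shows "cross_gram I b r v (\<lambda>\<tau>. A *\<^sub>v u \<tau>) = cross_gram I b a v u * A\<^sup>T"
proof -
  have "cross_gram I b r v (\<lambda>\<tau>. A *\<^sub>v u \<tau>) = (A * cross_gram I a b u v)\<^sup>T"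
    using cross_gram_mult_left[OF assms] by (metis cross_gram_transpose)
  also have "\<dots> = cross_gram I b a v u * A\<^sup>T"
    using transpose_mult[OF assms(2) cross_gram_carrier] by (simp add: cross_gram_transpose)
  finally show ?thesis .
qed

text \<open>Multiplying by the inverse Cholesky factor orthonormalises the family: the new Gram
  matrix is \<open>Li L L^T Li^T\<close>.\<close>

lemma normalized_gram:
  assumes F: "L2_family I k F" and G: "cross_gram I k k F F = L * L\<^sup>T" and L: "L \<in> carrier_mat k k"
    and Li: "Li \<in> carrier_mat k k" "Li * L = 1\<^sub>m k"
  shows "cross_gram I k k (\<lambda>\<tau>. Li *\<^sub>v F \<tau>) (\<lambda>\<tau>. Li *\<^sub>v F \<tau>) = 1\<^sub>m k"
proof -
  have Lt: "L\<^sup>T \<in> carrier_mat k k" "Li\<^sup>T \<in> carrier_mat k k" using L Li by auto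
  have "cross_gram I k k (\<lambda>\<tau>. Li *\<^sub>v F \<tau>) (\<lambda>\<tau>. Li *\<^sub>v F \<tau>) = Li * (cross_gram I k k F F * Li\<^sup>T)"
    using cross_gram_mult_left[OF F Li(1) L2_family_mult[OF F Li(1)]] cross_gram_mult_right[OF F Li(1) F] by simp
  also have "\<dots> = Li * (L * (L\<^sup>T * Li\<^sup>T))" unfolding G using L Lt by (simp add: assoc_mult_mat[of _ k k _ k _ k])
  also have "L\<^sup>T * Li\<^sup>T = (Li * L)\<^sup>T" using transpose_mult[OF Li(1) L] by simp
  finally show ?thesis using Li L by simp
qed

section \<open>The orthonormal system formed from the kernel functions\<close>

context delay_kernels
begin

abbreviation "II i \<equiv> delay_interval S i"

lemma II_eq: "II i = {- delay S i .. - delay S (i - 1)}"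
  by (simp add: delay_interval_def)

lemma families:
  assumes i: "i \<in> {1..num_delays S}"
  shows "L2_family (II i) (dimf G i) (funf G i)" "L2_family (II i) (dimphi G i) (funphi G i)"
    "L2_family (II i) (dimh G i) (funh G i)" "L2_family (II i) (dimg G i) (fung G i)"
proof -
  note d = decomposition_facts[OF i]
  show F: "L2_family (II i) (dimf G i) (funf G i)"
    using d(1) d(4) by (auto simp: L2_family_def W12_on_def delay_interval_def)
  show phi: "L2_family (II i) (dimphi G i) (funphi G i)" using d(3,6) by (simp add: L2_family_def)
  show h: "L2_family (II i) (dimh G i) (funh G i)"
    unfolding L2_family_def
  proof (intro conjI ballI allI impI)
    fix j assume j: "j < dimh G i"
    show "L2_on (II i) (\<lambda>\<tau>. funh G i \<tau> $ j)"
    proof (cases "j < dimvphi G i")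
      case True
      have "L2_on (II i) (\<lambda>\<tau>. funvphi G i \<tau> $ j)" by (rule d(5)[OF True])
      then show ?thesis by (rule L2_on_cong) (use d(1,2) True j in \<open>auto simp: funh_def dimh_def\<close>)
    next
      case False
      then have "L2_on (II i) (\<lambda>\<tau>. funf G i \<tau> $ (j - dimvphi G i))" using F j by (auto simp: L2_family_def dimh_def)
      then show ?thesis by (rule L2_on_cong) (use d(1,2) False j in \<open>auto simp: funh_def dimh_def\<close>)
    qed
  qed (use d(1,2) in \<open>auto simp: funh_def dimh_def\<close>)
  have gh: "dimg G i = dimphi G i + dimh G i" by (simp add: dimg_def dimh_def)
  have dh: "\<tau> \<in> II i \<Longrightarrow> dim_vec (funh G i \<tau>) = dimh G i" for \<tau> using h by (simp add: L2_family_def)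
  show "L2_family (II i) (dimg G i) (fung G i)"
    unfolding L2_family_def
  proof (intro conjI ballI allI impI)
    fix j assume j: "j < dimg G i"
    show "L2_on (II i) (\<lambda>\<tau>. fung G i \<tau> $ j)"
    proof (cases "j < dimphi G i")
      case True
      have "L2_on (II i) (\<lambda>\<tau>. funphi G i \<tau> $ j)" by (rule d(6)[OF True])
      then show ?thesis by (rule L2_on_cong) (use d(3) dh True j in \<open>auto simp: fung_def gh\<close>)
    next
      case False
      then have "L2_on (II i) (\<lambda>\<tau>. funh G i \<tau> $ (j - dimphi G i))" using h j by (auto simp: L2_family_def gh)
      then show ?thesis by (rule L2_on_cong) (use d(3) dh False j in \<open>auto simp: fung_def gh\<close>)
    qed
  qed (use d(3) dh in \<open>auto simp: fung_def gh\<close>)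
qed

text \<open>The determinant of the Gram matrix is the square of that of its Cholesky factor, which
  is nonzero.\<close>

lemma gramH_inverse:
  assumes i: "i \<in> {1..num_delays S}"
  shows "minv (gramH S G i) \<in> carrier_mat (dimh G i) (dimh G i)" "minv (gramH S G i) * gramH S G i = 1\<^sub>m (dimh G i)"
proof -
  note c = cholesky_facts[OF i]
  have "Determinant.det (minv (cholH G i)) * Determinant.det (cholH G i) = 1"
    using det_mult[OF c(3,4)] c(9) by simp
  then have "Determinant.det (cholH G i) \<noteq> 0" by auto
  moreover have "Determinant.det (gramH S G i) = Determinant.det (cholH G i) * Determinant.det (cholH G i)"
    unfolding c(14) using det_mult[OF c(4), of "(cholH G i)\<^sup>T"] det_transpose[OF c(4)] c(4) by simp
  ultimately have "Determinant.det (gramH S G i) \<noteq> 0" by simp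
  moreover have g: "gramH S G i \<in> carrier_mat (dimh G i) (dimh G i)" by (simp add: gramH_def cross_gram_carrier)
  ultimately have "invertible_mat (gramH S G i)" by (intro invertible_mat_of_det)
  then show "minv (gramH S G i) \<in> carrier_mat (dimh G i) (dimh G i)" "minv (gramH S G i) * gramH S G i = 1\<^sub>m (dimh G i)"
    using minv_works[OF g] by auto
qed

text \<open>The matrix of the orthogonal projection of the straight \<open>\<phi>_i\<close> onto the
  span of \<open>h_i\<close>, as given by the normal equations.\<close>

definition proj :: "nat \<Rightarrow> real mat" where
  "proj i = Gam S G i * minv (gramH S G i)"

lemma proj_carrier: "i \<in> {1..num_delays S} \<Longrightarrow> proj i \<in> carrier_mat (dimphi G i) (dimh G i)"
  unfolding proj_def Gam_def by (rule mult_carrier_mat[OF cross_gram_carrier gramH_inverse(1)])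

lemma epsf_eq: "epsf S G i \<tau> = funphi G i \<tau> - proj i *\<^sub>v funh G i \<tau>"
  by (simp add: epsf_def proj_def)

lemma family_eps:
  assumes i: "i \<in> {1..num_delays S}"
  shows "L2_family (II i) (dimphi G i) (epsf S G i)"
    and "L2_on (II i) y \<Longrightarrow> cvec (II i) (dimphi G i) (epsf S G i) y = cvec (II i) (dimphi G i) (funphi G i) y - proj i *\<^sub>v cvec (II i) (dimh G i) (funh G i) y"
proof -
  note P = proj_carrier[OF i] and f = families[OF i]
  note Ph = L2_family_mult[OF f(3) P]
  have idx: "epsf S G i \<tau> $ j = funphi G i \<tau> $ j - (proj i *\<^sub>v funh G i \<tau>) $ j" if "j < dimphi G i" "\<tau> \<in> II i" for j \<tau>
    using that f(2) P by (simp add: epsf_eq L2_family_def)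
  show "L2_family (II i) (dimphi G i) (epsf S G i)"
    unfolding L2_family_def
  proof (intro conjI ballI allI impI)
    fix j assume j: "j < dimphi G i"
    have "L2_on (II i) (\<lambda>\<tau>. funphi G i \<tau> $ j - (proj i *\<^sub>v funh G i \<tau>) $ j)"
      using j f(2) Ph by (intro L2_on_diff) (auto simp: L2_family_def)
    then show "L2_on (II i) (\<lambda>\<tau>. epsf S G i \<tau> $ j)" by (rule L2_on_cong) (simp add: idx j)
  qed (use P in \<open>simp add: epsf_eq\<close>)
  assume y: "L2_on (II i) y"
  show "cvec (II i) (dimphi G i) (epsf S G i) y = cvec (II i) (dimphi G i) (funphi G i) y - proj i *\<^sub>v cvec (II i) (dimh G i) (funh G i) y"
    unfolding cvec_mult[OF f(3) P y, symmetric]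
  proof (rule eq_vecI)
    fix j assume "j < dim_vec (cvec (II i) (dimphi G i) (funphi G i) y - cvec (II i) (dimphi G i) (\<lambda>\<tau>. proj i *\<^sub>v funh G i \<tau>) y)"
    then have j: "j < dimphi G i" by simp
    have "ip (II i) (\<lambda>\<tau>. epsf S G i \<tau> $ j) y = ip (II i) (\<lambda>\<tau>. funphi G i \<tau> $ j - (proj i *\<^sub>v funh G i \<tau>) $ j) y"
      by (rule ip_cong') (simp_all add: idx j)
    also have "\<dots> = ip (II i) (\<lambda>\<tau>. funphi G i \<tau> $ j) y - ip (II i) (\<lambda>\<tau>. (proj i *\<^sub>v funh G i \<tau>) $ j) y"
      using j f(2) Ph y by (intro ip_diff_left) (auto simp: L2_family_def)
    finally show "cvec (II i) (dimphi G i) (epsf S G i) y $ j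
      = (cvec (II i) (dimphi G i) (funphi G i) y - cvec (II i) (dimphi G i) (\<lambda>\<tau>. proj i *\<^sub>v funh G i \<tau>) y) $ j"
      using j by (simp add: cvec_def)
  qed simp
qed

text \<open>The normal equations \<open>proj i * gramH S G i = Gam S G i\<close>, read column by
  column: pairing with the \<open>l\<close>-th entry of \<open>h_i\<close> gives the
  \<open>l\<close>-th column of both sides.\<close>

lemma eps_orthogonal:
  assumes i: "i \<in> {1..num_delays S}"
  shows "cross_gram (II i) (dimphi G i) (dimh G i) (epsf S G i) (funh G i) = 0\<^sub>m (dimphi G i) (dimh G i)"
proof (rule eq_matI)
  note P = proj_carrier[OF i] and f = families[OF i]
  fix k l assume "k < dim_row (0\<^sub>m (dimphi G i) (dimh G i))" "l < dim_col (0\<^sub>m (dimphi G i) (dimh G i))"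
  then have k: "k < dimphi G i" and l: "l < dimh G i" by auto
  have y: "L2_on (II i) (\<lambda>\<tau>. funh G i \<tau> $ l)" using f(3) l by (simp add: L2_family_def)
  have col: "cvec (II i) (dimh G i) (funh G i) (\<lambda>\<tau>. funh G i \<tau> $ l) = col (gramH S G i) l"
    "cvec (II i) (dimphi G i) (funphi G i) (\<lambda>\<tau>. funh G i \<tau> $ l) = col (Gam S G i) l"
    using l by (auto intro!: eq_vecI simp: cvec_def gramH_def Gam_def cross_gram_index cross_gram_def ip_def)
  have PH: "proj i * gramH S G i = Gam S G i"
    unfolding proj_def using gramH_inverse[OF i]
    by (subst assoc_mult_mat[of _ "dimphi G i" "dimh G i" _ "dimh G i" _ "dimh G i"]) (auto simp: Gam_def gramH_def cross_gram_def)
  have "proj i *\<^sub>v col (gramH S G i) l = col (proj i * gramH S G i) l"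
    using P l by (subst col_mult2[of _ "dimphi G i" "dimh G i" _ "dimh G i"]) (auto simp: gramH_def cross_gram_def)
  then have "cvec (II i) (dimphi G i) (epsf S G i) (\<lambda>\<tau>. funh G i \<tau> $ l) = col (Gam S G i) l - col (Gam S G i) l"
    unfolding family_eps(2)[OF i y] col PH by simp
  then have "cvec (II i) (dimphi G i) (epsf S G i) (\<lambda>\<tau>. funh G i \<tau> $ l) $ k = 0"
    using k by (simp add: Gam_def cross_gram_def)
  then show "cross_gram (II i) (dimphi G i) (dimh G i) (epsf S G i) (funh G i) $$ (k, l) = 0\<^sub>m (dimphi G i) (dimh G i) $$ (k, l)"
    using k l by (simp add: cvec_def cross_gram_index)
qed (auto simp: cross_gram_def)

text \<open>Coefficients of a scalar function in the orthonormalised \<open>h_i\<close>,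
  \<open>\<epsilon>_i\<close> and \<open>f_i\<close>. The first two are the distributed entries of
  the vector in the closed-loop equations; the third enters the quadratic part of the
  functional.\<close>

definition Hc where "Hc i y = minv (cholH G i) *\<^sub>v cvec (II i) (dimh G i) (funh G i) y"
definition Ec where "Ec i y = minv (cholE G i) *\<^sub>v cvec (II i) (dimphi G i) (epsf S G i) y"
definition Fc where "Fc i y = minv (cholF G i) *\<^sub>v cvec (II i) (dimf G i) (funf G i) y"

lemma cvec_dims:
  assumes "i \<in> {1..num_delays S}"
  shows "dim_vec (Hc i y) = dimh G i" "dim_vec (Ec i y) = dimphi G i" "dim_vec (Fc i y) = dimf G i"
  using cholesky_facts(1,3,5)[OF assms] by (simp_all add: Hc_def Ec_def Fc_def)

text \<open>Since \<open>\<epsilon>_i\<close> is orthogonal to \<open>h_i\<close>, the two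
  normalised families form one orthonormal system. The joint inequality is used with
  \<open>R_i\<close> for the derivative of the functional, the one for \<open>f_i\<close> alone with
  \<open>Q_i\<close> for its positivity.\<close>

lemma bessel_HE:
  assumes i: "i \<in> {1..num_delays S}" and R: "R \<in> carrier_mat n n" "\<And>v. v \<in> carrier_vec n \<Longrightarrow> 0 \<le> v \<bullet> (R *\<^sub>v v)"
    and y: "\<And>l. l < n \<Longrightarrow> L2_on (II i) (y l)"
  shows "(\<Sum>k<dimh G i. Matrix.vec n (\<lambda>l. Hc i (y l) $ k) \<bullet> (R *\<^sub>v Matrix.vec n (\<lambda>l. Hc i (y l) $ k)))
       + (\<Sum>k<dimphi G i. Matrix.vec n (\<lambda>l. Ec i (y l) $ k) \<bullet> (R *\<^sub>v Matrix.vec n (\<lambda>l. Ec i (y l) $ k)))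
       \<le> (\<Sum>l<n. \<Sum>m<n. R $$ (l, m) * ip (II i) (y l) (y m))" (is ?HE)
    and "(\<Sum>k<dimf G i. Matrix.vec n (\<lambda>l. Fc i (y l) $ k) \<bullet> (R *\<^sub>v Matrix.vec n (\<lambda>l. Fc i (y l) $ k)))
       \<le> (\<Sum>l<n. \<Sum>m<n. R $$ (l, m) * ip (II i) (y l) (y m))" (is ?F)
proof -
  note c = cholesky_facts[OF i] and f = families[OF i] family_eps(1)[OF i]
  define eh where "eh \<tau> = minv (cholH G i) *\<^sub>v funh G i \<tau>" for \<tau>
  define ee where "ee \<tau> = minv (cholE G i) *\<^sub>v epsf S G i \<tau>" for \<tau>
  define ef where "ef \<tau> = minv (cholF G i) *\<^sub>v funf G i \<tau>" for \<tau>
  have fe: "L2_family (II i) (dimh G i) eh" "L2_family (II i) (dimphi G i) ee" "L2_family (II i) (dimf G i) ef"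
    unfolding eh_def ee_def ef_def
    by (rule L2_family_mult[OF f(3) c(3)], rule L2_family_mult[OF f(5) c(5)], rule L2_family_mult[OF f(1) c(1)])
  have hh: "cross_gram (II i) (dimh G i) (dimh G i) eh eh = 1\<^sub>m (dimh G i)"
    unfolding eh_def using c(14) by (intro normalized_gram[OF f(3) _ c(4) c(3) c(9)]) (simp add: gramH_def)
  have eee: "cross_gram (II i) (dimphi G i) (dimphi G i) ee ee = 1\<^sub>m (dimphi G i)"
    unfolding ee_def using c(15) by (intro normalized_gram[OF f(5) _ c(6) c(5) c(11)]) (simp add: gramE_def)
  have ff: "cross_gram (II i) (dimf G i) (dimf G i) ef ef = 1\<^sub>m (dimf G i)"
    unfolding ef_def using c(13) by (intro normalized_gram[OF f(1) _ c(2) c(1) c(7)]) (simp add: gramF_def)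
  have eh0: "cross_gram (II i) (dimphi G i) (dimh G i) ee eh = 0\<^sub>m (dimphi G i) (dimh G i)"
    unfolding ee_def eh_def
    using cross_gram_mult_left[OF f(5) c(5) L2_family_mult[OF f(3) c(3)]] cross_gram_mult_right[OF f(3) c(3) f(5)]
      eps_orthogonal[OF i] c(3,5) by simp
  have quad: "Matrix.vec n u \<bullet> (R *\<^sub>v Matrix.vec n u) = (\<Sum>l<n. \<Sum>m<n. R $$ (l, m) * u l * u m)" for u
    using R(1) by (auto simp: scalar_prod_def atLeast0LessThan sum_distrib_left mult_ac intro!: sum.cong)
  have psd: "0 \<le> (\<Sum>l<n. \<Sum>m<n. R $$ (l, m) * u l * u m)" for u
    using R(2)[of "Matrix.vec n u"] unfolding quad by simp
  have HcI: "Hc i (y l) $ k = ip (II i) (\<lambda>\<tau>. eh \<tau> $ k) (y l)" if "k < dimh G i" "l < n" for k l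
    unfolding Hc_def eh_def using cvec_mult[OF f(3) c(3) y[OF that(2)], symmetric] that by (simp add: cvec_def)
  have EcI: "Ec i (y l) $ k = ip (II i) (\<lambda>\<tau>. ee \<tau> $ k) (y l)" if "k < dimphi G i" "l < n" for k l
    unfolding Ec_def ee_def using cvec_mult[OF f(5) c(5) y[OF that(2)], symmetric] that by (simp add: cvec_def)
  have FcI: "Fc i (y l) $ k = ip (II i) (\<lambda>\<tau>. ef \<tau> $ k) (y l)" if "k < dimf G i" "l < n" for k l
    unfolding Fc_def ef_def using cvec_mult[OF f(1) c(1) y[OF that(2)], symmetric] that by (simp add: cvec_def)
  \<comment> \<open>The joint system, with the entries of \<open>h_i\<close> numbered first.\<close>
  define e where "e k = (if k < dimh G i then (\<lambda>\<tau>. eh \<tau> $ k) else (\<lambda>\<tau>. ee \<tau> $ (k - dimh G i)))" for k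
  have "(\<Sum>k<dimh G i + dimphi G i. \<Sum>l<n. \<Sum>m<n. R $$ (l, m) * ip (II i) (e k) (y l) * ip (II i) (e k) (y m))
       \<le> (\<Sum>l<n. \<Sum>m<n. R $$ (l, m) * ip (II i) (y l) (y m))"
  proof (rule bessel[OF _ y _ psd])
    show "L2_on (II i) (e k)" if "k < dimh G i + dimphi G i" for k
      using that fe by (auto simp: e_def L2_family_def)
    fix j k assume jk: "j < dimh G i + dimphi G i" "k < dimh G i + dimphi G i"
    have 1: "ip (II i) (\<lambda>\<tau>. eh \<tau> $ j) (\<lambda>\<tau>. eh \<tau> $ k) = (if j = k then 1 else 0)" if "j < dimh G i" "k < dimh G i" for j k
      using arg_cong[OF hh, of "\<lambda>A. A $$ (j, k)"] that by (simp add: cross_gram_index)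
    have 2: "ip (II i) (\<lambda>\<tau>. ee \<tau> $ j) (\<lambda>\<tau>. ee \<tau> $ k) = (if j = k then 1 else 0)" if "j < dimphi G i" "k < dimphi G i" for j k
      using arg_cong[OF eee, of "\<lambda>A. A $$ (j, k)"] that by (simp add: cross_gram_index)
    have 3: "ip (II i) (\<lambda>\<tau>. ee \<tau> $ j) (\<lambda>\<tau>. eh \<tau> $ k) = 0" if "j < dimphi G i" "k < dimh G i" for j k
      using arg_cong[OF eh0, of "\<lambda>A. A $$ (j, k)"] that by (simp add: cross_gram_index)
    show "ip (II i) (e j) (e k) = (if j = k then 1 else 0)"
      using jk 1[of j k] 2[of "j - dimh G i" "k - dimh G i"] 3[of "j - dimh G i" k] 3[of "k - dimh G i" j]
      by (auto simp: e_def ip_commute[of _ "\<lambda>\<tau>. eh \<tau> $ j"])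
  qed
  moreover have "(\<Sum>k<dimh G i + dimphi G i. \<Sum>l<n. \<Sum>m<n. R $$ (l, m) * ip (II i) (e k) (y l) * ip (II i) (e k) (y m))
     = (\<Sum>k<dimh G i. Matrix.vec n (\<lambda>l. Hc i (y l) $ k) \<bullet> (R *\<^sub>v Matrix.vec n (\<lambda>l. Hc i (y l) $ k)))
       + (\<Sum>k<dimphi G i. Matrix.vec n (\<lambda>l. Ec i (y l) $ k) \<bullet> (R *\<^sub>v Matrix.vec n (\<lambda>l. Ec i (y l) $ k)))"
  proof -
    let ?s = "\<lambda>k. \<Sum>l<n. \<Sum>m<n. R $$ (l, m) * ip (II i) (e k) (y l) * ip (II i) (e k) (y m)"
    have "(\<Sum>k<dimh G i + dimphi G i. ?s k) = (\<Sum>k<dimh G i. ?s k) + (\<Sum>k<dimphi G i. ?s (dimh G i + k))"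
      by (rule sum_lessThan_add)
    then show ?thesis unfolding quad by (auto simp: e_def HcI EcI intro!: sum.cong arg_cong2[where f = "(+)"])
  qed
  ultimately show ?HE by simp
  have "(\<Sum>k<dimf G i. \<Sum>l<n. \<Sum>m<n. R $$ (l, m) * ip (II i) (\<lambda>\<tau>. ef \<tau> $ k) (y l) * ip (II i) (\<lambda>\<tau>. ef \<tau> $ k) (y m))
       \<le> (\<Sum>l<n. \<Sum>m<n. R $$ (l, m) * ip (II i) (y l) (y m))"
  proof (rule bessel[OF _ y _ psd])
    show "L2_on (II i) (\<lambda>\<tau>. ef \<tau> $ k)" if "k < dimf G i" for k using that fe by (auto simp: L2_family_def)
    show "ip (II i) (\<lambda>\<tau>. ef \<tau> $ j) (\<lambda>\<tau>. ef \<tau> $ k) = (if j = k then 1 else 0)" if "j < dimf G i" "k < dimf G i" for j k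
      using arg_cong[OF ff, of "\<lambda>A. A $$ (j, k)"] that by (simp add: cross_gram_index)
  qed
  then show ?F unfolding quad by (simp add: FcI)
qed

text \<open>Because the straight \<open>\<phi>_i\<close> is \<open>\<epsilon>_i\<close> plus
  \<open>proj i\<close> times \<open>h_i\<close>, the matrices \<open>T\<close> and
  \<open>Ttilde\<close> are what recovers the coefficients of \<open>g_i\<close> from those in the
  normalised systems.\<close>

lemma kernel_coefficients:
  assumes i: "i \<in> {1..num_delays S}" and y: "L2_on (II i) y"
  shows "matT S G i *\<^sub>v Hc i y + matTtilde G i *\<^sub>v Ec i y = cvec (II i) (dimg G i) (fung G i) y"
proof -
  note c = cholesky_facts[OF i] and f = families[OF i]
  let ?h = "cvec (II i) (dimh G i) (funh G i) y" and ?e = "cvec (II i) (dimphi G i) (epsf S G i) y" and ?p = "cvec (II i) (dimphi G i) (funphi G i) y"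
  note P = proj_carrier[OF i]
  have hc: "?h \<in> carrier_vec (dimh G i)" and ec: "?e \<in> carrier_vec (dimphi G i)" by (rule cvec_carrier)+
  have LH: "cholH G i *\<^sub>v Hc i y = ?h" "cholE G i *\<^sub>v Ec i y = ?e"
    unfolding Hc_def Ec_def
    using assoc_mult_mat_vec[OF c(4,3) hc] assoc_mult_mat_vec[OF c(6,5) ec] c(10,12) hc ec by simp_all
  have Hcc: "Hc i y \<in> carrier_vec (dimh G i)" "Ec i y \<in> carrier_vec (dimphi G i)"
    unfolding Hc_def Ec_def by (rule mult_mat_vec_carrier[OF c(3) hc], rule mult_mat_vec_carrier[OF c(5) ec])
  have "vcat [proj i, 1\<^sub>m (dimh G i)] \<in> carrier_mat (dimphi G i + dimh G i) (dimh G i)"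
    using P by (intro carrier_matI) (auto simp: dim_vcat)
  from assoc_mult_mat_vec[OF this c(4) Hcc(1)]
  have "matT S G i *\<^sub>v Hc i y = vcat [proj i, 1\<^sub>m (dimh G i)] *\<^sub>v ?h" by (simp add: matT_def proj_def[symmetric] LH)
  also have "\<dots> = vconcat (map (\<lambda>A. A *\<^sub>v ?h) [proj i, 1\<^sub>m (dimh G i)])"
    using P by (intro vcat_mult_vec) auto
  also have "\<dots> = proj i *\<^sub>v ?h @\<^sub>v ?h" using hc by (simp only: list.map vconcat_simps append_zero_vec one_mult_mat_vec)
  finally have 1: "matT S G i *\<^sub>v Hc i y = proj i *\<^sub>v ?h @\<^sub>v ?h" .
  have "vcat [1\<^sub>m (dimphi G i), 0\<^sub>m (dimh G i) (dimphi G i)] \<in> carrier_mat (dimphi G i + dimh G i) (dimphi G i)"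
    by (intro carrier_matI) (auto simp: dim_vcat)
  from assoc_mult_mat_vec[OF this c(6) Hcc(2)]
  have "matTtilde G i *\<^sub>v Ec i y = vcat [1\<^sub>m (dimphi G i), 0\<^sub>m (dimh G i) (dimphi G i)] *\<^sub>v ?e" by (simp add: matTtilde_def LH)
  also have "\<dots> = vconcat (map (\<lambda>A. A *\<^sub>v ?e) [1\<^sub>m (dimphi G i), 0\<^sub>m (dimh G i) (dimphi G i)])"
    by (intro vcat_mult_vec) auto
  also have "\<dots> = ?e @\<^sub>v 0\<^sub>v (dimh G i)" using ec by (simp only: list.map vconcat_simps append_zero_vec one_mult_mat_vec zero_mat_mult_vec dim_cvec)
  finally have 2: "matTtilde G i *\<^sub>v Ec i y = ?e @\<^sub>v 0\<^sub>v (dimh G i)" .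
  have "matT S G i *\<^sub>v Hc i y + matTtilde G i *\<^sub>v Ec i y = (proj i *\<^sub>v ?h + ?e) @\<^sub>v (?h + 0\<^sub>v (dimh G i))"
    unfolding 1 2 using P by (intro append_vec_add') auto
  also have "?h + 0\<^sub>v (dimh G i) = ?h" by (intro add_zero_right_vec) simp
  also have "proj i *\<^sub>v ?h + ?e = ?p"
    unfolding family_eps(2)[OF i y] using P by (intro eq_vecI) auto
  also have "?p @\<^sub>v ?h = cvec (II i) (dimg G i) (fung G i) y"
  proof (rule eq_vecI)
    fix j assume "j < dim_vec (cvec (II i) (dimg G i) (fung G i) y)"
    then have j: "j < dimphi G i + dimh G i" by (simp add: dimg_def dimh_def)
    have d: "\<tau> \<in> II i \<Longrightarrow> dim_vec (funphi G i \<tau>) = dimphi G i \<and> dim_vec (funh G i \<tau>) = dimh G i" for \<tau>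
      using f(2,3) by (simp add: L2_family_def)
    have "ip (II i) (\<lambda>\<tau>. fung G i \<tau> $ j) y = (if j < dimphi G i then ip (II i) (\<lambda>\<tau>. funphi G i \<tau> $ j) y
       else ip (II i) (\<lambda>\<tau>. funh G i \<tau> $ (j - dimphi G i)) y)"
      using j by (auto intro!: ip_cong' simp: fung_def d)
    then show "(?p @\<^sub>v ?h) $ j = cvec (II i) (dimg G i) (fung G i) y $ j"
      using j by (auto simp: cvec_def dimg_def dimh_def)
  qed (simp add: dimg_def dimh_def)
  finally show ?thesis .
qed

end

text \<open>Lebesgue measure is complete, so agreement almost everywhere carries measurability
  along.\<close>

lemma set_integrable_AE:
  fixes f g :: "real \<Rightarrow> real"
  assumes f: "set_integrable lebesgue I f" and ae: "AE \<tau> in lebesgue. \<tau> \<in> I \<longrightarrow> f \<tau> = g \<tau>"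
  shows "set_integrable lebesgue I g" "(LINT \<tau>:I|lebesgue. g \<tau>) = (LINT \<tau>:I|lebesgue. f \<tau>)"
proof -
  let ?f = "\<lambda>\<tau>. indicat_real I \<tau> *\<^sub>R f \<tau>" and ?g = "\<lambda>\<tau>. indicat_real I \<tau> *\<^sub>R g \<tau>"
  have m: "?f \<in> borel_measurable lebesgue" using f unfolding set_integrable_def by (rule borel_measurable_integrable)
  have e: "AE \<tau> in lebesgue. ?f \<tau> = ?g \<tau>" using ae by eventually_elim (auto simp: indicator_def)
  have m': "?g \<in> borel_measurable lebesgue" by (rule borel_measurable_AE[OF m e])
  show "set_integrable lebesgue I g"
    using integrable_cong_AE[OF m m' e] f by (simp add: set_integrable_def)
  show "(LINT \<tau>:I|lebesgue. g \<tau>) = (LINT \<tau>:I|lebesgue. f \<tau>)"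
    using integral_cong_AE[OF m m' e] by (simp add: set_lebesgue_integral_def)
qed

lemma neg_form:
  assumes "(A :: real mat) \<in> carrier_mat k k" "v \<in> carrier_vec k"
  shows "v \<bullet> ((- A) *\<^sub>v v) = - (v \<bullet> (A *\<^sub>v v))"
proof -
  have "(- A) *\<^sub>v v = - (A *\<^sub>v v)" using assms by simp
  then show ?thesis using assms by simp
qed

lemma vconcat_zero: "(\<And>i. i \<in> set is \<Longrightarrow> v i = 0\<^sub>v (k i)) \<Longrightarrow> vconcat (map v is) = 0\<^sub>v (\<Sum>i\<leftarrow>is. k i)"
proof (induction "is")
  case (Cons i "is")
  then show ?case by (intro eq_vecI) auto
qed simp

lemma stack_zero: "(\<And>i l. i \<in> set is \<Longrightarrow> c i l = 0\<^sub>v (k i)) \<Longrightarrow> stack n k c is = 0\<^sub>v ((\<Sum>i\<leftarrow>is. k i) * n)"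
proof -
  assume "\<And>i l. i \<in> set is \<Longrightarrow> c i l = 0\<^sub>v (k i)"
  then have "blk (k i) n (\<lambda>j l. c i l $ j) = 0\<^sub>v (k i * n)" if "i \<in> set is" for i
    using that by (intro eq_vecI) (auto simp: blk_def div_mod_less)
  then show ?thesis unfolding stack_def
    by (subst vconcat_zero[where k = "\<lambda>i. k i * n"]) (auto simp: sum_list_mult_const)
qed

lemma scalar_prod_zero_left: "0\<^sub>v k \<bullet> v = (0 :: real)" if "dim_vec v = k"
  using that by (simp add: scalar_prod_def)

section \<open>Distributed delay terms expressed through coefficients\<close>

context delay_kernels
begin

text \<open>Needed because the kernels act on \<open>X y\<close> and on \<open>V y\<close>, whose
  components are linear combinations of those of \<open>y\<close>.\<close>

lemma cvec_linear:
  assumes i: "i \<in> {1..num_delays S}" and y: "\<And>l. l < n \<Longrightarrow> L2_on (II i) (y l)"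
    and v: "\<And>\<tau>. \<tau> \<in> II i \<Longrightarrow> v \<tau> = (\<Sum>l<n. b l * y l \<tau>)"
  shows "j < dimh G i \<Longrightarrow> Hc i v $ j = (\<Sum>l<n. b l * Hc i (y l) $ j)"
    and "j < dimphi G i \<Longrightarrow> Ec i v $ j = (\<Sum>l<n. b l * Ec i (y l) $ j)"
    and "L2_on (II i) v"
proof -
  note c = cholesky_facts[OF i] and f = families[OF i] family_eps(1)[OF i]
  have s: "L2_on (II i) (\<lambda>\<tau>. \<Sum>l<n. b l * y l \<tau>)" using y by (intro L2_on_sum L2_on_cmult) auto
  show L2: "L2_on (II i) v" by (rule L2_on_cong[OF s]) (simp add: v)
  have eq: "cvec (II i) k F v = cvec (II i) k F (\<lambda>\<tau>. \<Sum>l<n. b l * y l \<tau>)" for k F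
    unfolding cvec_def by (intro eq_vecI) (auto intro!: ip_cong' simp: v)
  have H: "Hc i u = cvec (II i) (dimh G i) (\<lambda>\<tau>. minv (cholH G i) *\<^sub>v funh G i \<tau>) u" if "L2_on (II i) u" for u
    unfolding Hc_def by (rule cvec_mult[OF f(3) c(3) that, symmetric])
  have E: "Ec i u = cvec (II i) (dimphi G i) (\<lambda>\<tau>. minv (cholE G i) *\<^sub>v epsf S G i \<tau>) u" if "L2_on (II i) u" for u
    unfolding Ec_def by (rule cvec_mult[OF f(5) c(5) that, symmetric])
  show "Hc i v $ j = (\<Sum>l<n. b l * Hc i (y l) $ j)" if "j < dimh G i"
    using cvec_sum_right[OF L2_family_mult[OF f(3) c(3)], of "{..<n}" y j b] y that by (simp add: H[OF L2] eq H[OF y])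
  show "Ec i v $ j = (\<Sum>l<n. b l * Ec i (y l) $ j)" if "j < dimphi G i"
    using cvec_sum_right[OF L2_family_mult[OF f(5) c(5)], of "{..<n}" y j b] y that by (simp add: E[OF L2] eq E[OF y])
qed

text \<open>The kernel is \<open>hat (g_i \<otimes> I)\<close>, so its integral against
  \<open>v = B y\<close> is \<open>hat\<close> applied to the coefficients of the components of
  \<open>v\<close> in \<open>g_i\<close>. These are assembled from the normalised coefficients of
  \<open>y\<close>, with \<open>B\<close> moved through by linearity.\<close>

lemma kernel_integral:
  fixes Ker :: "real \<Rightarrow> real^'c^'r" and v :: "real \<Rightarrow> real^'c"
  assumes i: "i \<in> {1..num_delays S}" and dec: "decomposes (II i) CARD('c) (dimg G i) (fung G i) hat Ker"
    and y: "\<And>l. l < n \<Longrightarrow> L2_on (II i) (y l)" and B: "B \<in> carrier_mat CARD('c) n"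
    and v: "\<And>\<tau>. \<tau> \<in> II i \<Longrightarrow> vec_of (v \<tau>) = B *\<^sub>v Matrix.vec n (\<lambda>l. y l \<tau>)"
  shows "set_integrable lebesgue (II i) (\<lambda>\<tau>. Ker \<tau> *v v \<tau>)"
    and "l < CARD('r) \<Longrightarrow> vec_of (LINT \<tau>:II i|lebesgue. Ker \<tau> *v v \<tau>) $ l = (hat *\<^sub>v
        (kron (matT S G i) (1\<^sub>m CARD('c)) *\<^sub>v blk (dimh G i) CARD('c) (\<lambda>j s. (B *\<^sub>v Matrix.vec n (\<lambda>l. Hc i (y l) $ j)) $ s)
       + kron (matTtilde G i) (1\<^sub>m CARD('c)) *\<^sub>v blk (dimphi G i) CARD('c) (\<lambda>j s. (B *\<^sub>v Matrix.vec n (\<lambda>l. Ec i (y l) $ j)) $ s))) $ l"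
proof -
  let ?c = "CARD('c)" and ?g = "dimg G i"
  note f = families[OF i]
  define vs where "vs s \<tau> = (\<Sum>l<n. B $$ (s, l) * y l \<tau>)" for s \<tau>
  have hat: "hat \<in> carrier_mat CARD('r) (?g * ?c)"
    and ae: "AE \<tau> in lebesgue. \<tau> \<in> II i \<longrightarrow> mat_of (Ker \<tau>) = hat * kron (mat_of_cols ?g [fung G i \<tau>]) (1\<^sub>m ?c)"
    using dec by (auto simp: decomposes_def)
  have vs: "vec_of (v \<tau>) $ s = vs s \<tau>" if "\<tau> \<in> II i" "s < ?c" for \<tau> s
    unfolding v[OF that(1)] vs_def using B that by (subst mult_mat_vec_index) auto
  have L2v: "L2_on (II i) (vs s)" for s
    by (rule cvec_linear(3)[OF i y, of n "\<lambda>l. l"]) (simp_all add: vs_def)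
  \<comment> \<open>Entry \<open>l\<close> of \<open>hat (g_i \<otimes> v)\<close>. The kernel
    factorises only almost everywhere, so this function is integrated and exchanged for the true
    integrand afterwards.\<close>
  define \<Psi> where "\<Psi> l \<tau> = (\<Sum>a<?g * ?c. hat $$ (l, a) * (fung G i \<tau> $ (a div ?c) * vs (a mod ?c) \<tau>))" for l \<tau>
  have ig: "set_integrable lebesgue (II i) (\<lambda>\<tau>. hat $$ (l, a) * (fung G i \<tau> $ (a div ?c) * vs (a mod ?c) \<tau>))"
    if "a < ?g * ?c" for a l
  proof -
    have "set_integrable lebesgue (II i) (\<lambda>\<tau>. fung G i \<tau> $ (a div ?c) * vs (a mod ?c) \<tau>)"
      using f(4) L2v div_mod_less[OF that] by (intro L2_on_mult) (auto simp: L2_family_def)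
    then show ?thesis by simp
  qed
  have i\<Psi>: "set_integrable lebesgue (II i) (\<Psi> l)" for l
    unfolding \<Psi>_def by (rule set_integrable_sum_real) (use ig in auto)
  have eq: "AE \<tau> in lebesgue. \<tau> \<in> II i \<longrightarrow> \<Psi> l \<tau> = vec_of (Ker \<tau> *v v \<tau>) $ l" if l: "l < CARD('r)" for l
    using ae
  proof eventually_elim
    case (elim \<tau>)
    show ?case
    proof
      assume t: "\<tau> \<in> II i"
      have dg: "dim_vec (fung G i \<tau>) = ?g" using f(4) t by (simp add: L2_family_def)
      let ?C = "mat_of_cols ?g [fung G i \<tau>]"
      have vb: "vec_of (v \<tau>) = blk 1 ?c (\<lambda>_ s. vs s \<tau>)"
        by (intro eq_vecI) (auto simp: blk_def vs[OF t])
      have Ck: "kron ?C (1\<^sub>m ?c) *\<^sub>v vec_of (v \<tau>) = blk ?g ?c (\<lambda>r s. fung G i \<tau> $ r * vs s \<tau>)"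
      proof -
        have "kron ?C (1\<^sub>m ?c) *\<^sub>v vec_of (v \<tau>) = blk ?g ?c (\<lambda>r s. (?C *\<^sub>v Matrix.vec 1 (\<lambda>_. vs s \<tau>)) $ r)"
          unfolding vb using kron_one_right[of ?C 1 ?c "\<lambda>_ s. vs s \<tau>"] by simp
        also have "\<dots> = blk ?g ?c (\<lambda>r s. fung G i \<tau> $ r * vs s \<tau>)"
          by (rule blk_cong) (simp add: mult_mat_vec_index mat_of_cols_def del: index_mult_mat_vec)
        finally show ?thesis .
      qed
      have kc: "kron ?C (1\<^sub>m ?c) \<in> carrier_mat (?g * ?c) ?c" by (intro carrier_matI) simp_all
      have "vec_of (Ker \<tau> *v v \<tau>) = hat *\<^sub>v blk ?g ?c (\<lambda>r s. fung G i \<tau> $ r * vs s \<tau>)"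
        using elim t assoc_mult_mat_vec[OF hat kc vec_of_carrier, of "v \<tau>"] by (simp add: vec_of_mult Ck)
      also have "\<dots> $ l = \<Psi> l \<tau>"
        using hat l by (subst mult_mat_vec_index) (auto simp: \<Psi>_def blk_def)
      finally show "\<Psi> l \<tau> = vec_of (Ker \<tau> *v v \<tau>) $ l" by simp
    qed
  qed
  have comp: "set_integrable lebesgue (II i) (\<lambda>\<tau>. vec_of (Ker \<tau> *v v \<tau>) $ l)" if "l < CARD('r)" for l
    by (rule set_integrable_AE(1)[OF i\<Psi> eq[OF that]])
  show "set_integrable lebesgue (II i) (\<lambda>\<tau>. Ker \<tau> *v v \<tau>)" by (rule set_integrable_vec(1)[OF comp])
  assume l: "l < CARD('r)"
  have col: "Matrix.vec (dimh G i) (\<lambda>j. (B *\<^sub>v Matrix.vec n (\<lambda>l. Hc i (y l) $ j)) $ s) = Hc i (vs s)"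
    "Matrix.vec (dimphi G i) (\<lambda>j. (B *\<^sub>v Matrix.vec n (\<lambda>l. Ec i (y l) $ j)) $ s) = Ec i (vs s)" if s: "s < ?c" for s
  proof -
    note lin = cvec_linear[OF i y, where b = "\<lambda>l. B $$ (s, l)" and v = "vs s"]
    show "Matrix.vec (dimh G i) (\<lambda>j. (B *\<^sub>v Matrix.vec n (\<lambda>l. Hc i (y l) $ j)) $ s) = Hc i (vs s)"
    proof (rule eq_vecI)
      fix j assume "j < dim_vec (Hc i (vs s))"
      then have j: "j < dimh G i" by (simp add: cvec_dims[OF i])
      have "Hc i (vs s) $ j = (\<Sum>l<n. B $$ (s, l) * Hc i (y l) $ j)" by (rule lin(1)) (simp_all add: j vs_def)
      then show "Matrix.vec (dimh G i) (\<lambda>j. (B *\<^sub>v Matrix.vec n (\<lambda>l. Hc i (y l) $ j)) $ s) $ j = Hc i (vs s) $ j"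
        using B s j by (simp add: mult_mat_vec_index del: index_mult_mat_vec)
    qed (simp add: cvec_dims[OF i])
    show "Matrix.vec (dimphi G i) (\<lambda>j. (B *\<^sub>v Matrix.vec n (\<lambda>l. Ec i (y l) $ j)) $ s) = Ec i (vs s)"
    proof (rule eq_vecI)
      fix j assume "j < dim_vec (Ec i (vs s))"
      then have j: "j < dimphi G i" by (simp add: cvec_dims[OF i])
      have "Ec i (vs s) $ j = (\<Sum>l<n. B $$ (s, l) * Ec i (y l) $ j)" by (rule lin(2)) (simp_all add: j vs_def)
      then show "Matrix.vec (dimphi G i) (\<lambda>j. (B *\<^sub>v Matrix.vec n (\<lambda>l. Ec i (y l) $ j)) $ s) $ j = Ec i (vs s) $ j"
        using B s j by (simp add: mult_mat_vec_index del: index_mult_mat_vec)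
    qed (simp add: cvec_dims[OF i])
  qed
  have T: "dim_col (matT S G i) = dimh G i" "dim_col (matTtilde G i) = dimphi G i"
    "dim_row (matT S G i) = ?g" "dim_row (matTtilde G i) = ?g"
    using cholesky_facts(4,6)[OF i] by (simp_all add: matT_def matTtilde_def dim_vcat dimg_def dimh_def Gam_def cross_gram_def)
  have "kron (matT S G i) (1\<^sub>m ?c) *\<^sub>v blk (dimh G i) ?c (\<lambda>j s. (B *\<^sub>v Matrix.vec n (\<lambda>l. Hc i (y l) $ j)) $ s)
       + kron (matTtilde G i) (1\<^sub>m ?c) *\<^sub>v blk (dimphi G i) ?c (\<lambda>j s. (B *\<^sub>v Matrix.vec n (\<lambda>l. Ec i (y l) $ j)) $ s)
      = blk ?g ?c (\<lambda>r s. (matT S G i *\<^sub>v Matrix.vec (dimh G i) (\<lambda>j. (B *\<^sub>v Matrix.vec n (\<lambda>l. Hc i (y l) $ j)) $ s)) $ r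
          + (matTtilde G i *\<^sub>v Matrix.vec (dimphi G i) (\<lambda>j. (B *\<^sub>v Matrix.vec n (\<lambda>l. Ec i (y l) $ j)) $ s)) $ r)"
    unfolding kron_one_right[OF T(1)] kron_one_right[OF T(2)] T(3,4) by (rule blk_add)
  also have "\<dots> = blk ?g ?c (\<lambda>r s. ip (II i) (\<lambda>\<tau>. fung G i \<tau> $ r) (vs s))"
  proof (rule blk_cong)
    fix r s assume r: "r < ?g" and s: "s < ?c"
    show "(matT S G i *\<^sub>v Matrix.vec (dimh G i) (\<lambda>j. (B *\<^sub>v Matrix.vec n (\<lambda>l. Hc i (y l) $ j)) $ s)) $ r
          + (matTtilde G i *\<^sub>v Matrix.vec (dimphi G i) (\<lambda>j. (B *\<^sub>v Matrix.vec n (\<lambda>l. Ec i (y l) $ j)) $ s)) $ r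
        = ip (II i) (\<lambda>\<tau>. fung G i \<tau> $ r) (vs s)"
      unfolding col[OF s]
      using arg_cong[OF kernel_coefficients[OF i L2v[of s]], of "\<lambda>v. v $ r"] r T
      by (simp add: cvec_def del: index_mult_mat_vec)
  qed
  finally have K: "kron (matT S G i) (1\<^sub>m ?c) *\<^sub>v blk (dimh G i) ?c (\<lambda>j s. (B *\<^sub>v Matrix.vec n (\<lambda>l. Hc i (y l) $ j)) $ s)
       + kron (matTtilde G i) (1\<^sub>m ?c) *\<^sub>v blk (dimphi G i) ?c (\<lambda>j s. (B *\<^sub>v Matrix.vec n (\<lambda>l. Ec i (y l) $ j)) $ s)
      = blk ?g ?c (\<lambda>r s. ip (II i) (\<lambda>\<tau>. fung G i \<tau> $ r) (vs s))" .
  have "vec_of (LINT \<tau>:II i|lebesgue. Ker \<tau> *v v \<tau>) $ l = (LINT \<tau>:II i|lebesgue. vec_of (Ker \<tau> *v v \<tau>) $ l)"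
    by (rule set_integrable_vec(2)[OF comp l])
  also have "\<dots> = (LINT \<tau>:II i|lebesgue. \<Psi> l \<tau>)" by (rule set_integrable_AE(2)[OF i\<Psi> eq[OF l]])
  also have "\<dots> = (\<Sum>a<?g * ?c. LINT \<tau>:II i|lebesgue. hat $$ (l, a) * (fung G i \<tau> $ (a div ?c) * vs (a mod ?c) \<tau>))"
    unfolding \<Psi>_def by (rule set_integral_sum_real) (use ig in auto)
  also have "\<dots> = (\<Sum>a<?g * ?c. hat $$ (l, a) * ip (II i) (\<lambda>\<tau>. fung G i \<tau> $ (a div ?c)) (vs (a mod ?c)))"
    by (simp add: ip_def)
  also have "\<dots> = (hat *\<^sub>v blk ?g ?c (\<lambda>r s. ip (II i) (\<lambda>\<tau>. fung G i \<tau> $ r) (vs s))) $ l"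
    using hat l by (subst mult_mat_vec_index) (auto simp: blk_def)
  finally show "vec_of (LINT \<tau>:II i|lebesgue. Ker \<tau> *v v \<tau>) $ l = (hat *\<^sub>v
        (kron (matT S G i) (1\<^sub>m CARD('c)) *\<^sub>v blk (dimh G i) CARD('c) (\<lambda>j s. (B *\<^sub>v Matrix.vec n (\<lambda>l. Hc i (y l) $ j)) $ s)
       + kron (matTtilde G i) (1\<^sub>m CARD('c)) *\<^sub>v blk (dimphi G i) CARD('c) (\<lambda>j s. (B *\<^sub>v Matrix.vec n (\<lambda>l. Ec i (y l) $ j)) $ s))) $ l"
    unfolding K .
qed

end

section \<open>Nonsingularity of X\<close>

context synthesis
begin

lemma invertible_X: "invertible_mat (varX U)"
proof (rule invertible_mat_of_det[OF decision_carriers(1)])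
  show "Determinant.det (varX U) \<noteq> 0"
  proof
    assume "Determinant.det (varX U) = 0"
    then obtain u where u: "u \<in> carrier_vec CARD('n)" "u \<noteq> 0\<^sub>v CARD('n)" "varX U *\<^sub>v u = 0\<^sub>v CARD('n)"
      using det_0_iff_vec_prod_zero_field[OF decision_carriers(1)] by blast
    let ?yd = "\<lambda>(_::nat) (_::nat). 0::real" and ?ch = "\<lambda>i (_::nat). 0\<^sub>v (dimh G i) :: real Matrix.vec"
      and ?ce = "\<lambda>i (_::nat). 0\<^sub>v (dimphi G i) :: real Matrix.vec" and ?w = "0\<^sub>v CARD('q) :: real Matrix.vec" and ?s = "0\<^sub>v CARD('m) :: real Matrix.vec"
    let ?D = "beta S G * CARD('n) + CARD('q) + CARD('m)"
    let ?t = "theta ?yd ?ch ?ce ?w"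
    have vz: "Matrix.vec CARD('n) (\<lambda>_. 0) = (0\<^sub>v CARD('n) :: real Matrix.vec)" by (intro eq_vecI) auto
    have zz: "zeta ?ch = 0\<^sub>v (total_dim S (dimf G) * CARD('n))"
      unfolding zeta_def total_dim_idx1 using local_dims
      by (intro stack_zero) (auto simp: set_idx1 mult_mat_vec_zero[of _ _ "dimh G _"] intro!: mult_mat_vec_zero carrier_matI)
    have t0: "?t @\<^sub>v ?s = 0\<^sub>v ?D"
    proof -
      have "vconcat (map (\<lambda>i. Matrix.vec CARD('n) (?yd i)) (idx0 S)) = 0\<^sub>v (\<Sum>i\<leftarrow>idx0 S. CARD('n))"
        by (rule vconcat_zero) (simp add: vz)
      moreover have "stack CARD('n) (dimh G) ?ch (idx1 S) = 0\<^sub>v ((\<Sum>i\<leftarrow>idx1 S. dimh G i) * CARD('n))" by (rule stack_zero) simp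
      moreover have "stack CARD('n) (dimphi G) ?ce (idx1 S) = 0\<^sub>v ((\<Sum>i\<leftarrow>idx1 S. dimphi G i) * CARD('n))" by (rule stack_zero) simp
      moreover have "(0\<^sub>v a @\<^sub>v 0\<^sub>v b :: real Matrix.vec) = 0\<^sub>v (a + b)" for a b by (intro eq_vecI) auto
      ultimately show ?thesis
        by (simp add: theta_def append_vec_assoc sum_list_idx0 sum_list_idx1 beta_def total_dim_def dimg_def dimh_def sum.distrib algebra_simps)
    qed
    let ?chi = "u @\<^sub>v (?t @\<^sub>v ?s)"
    have du: "dim_vec u = CARD('n)" using u(1) by simp
    have Pi: "boldPi S G U *\<^sub>v (?t @\<^sub>v ?s) = varX U *\<^sub>v u"
      unfolding t0 u(3) by (rule mult_mat_vec_zero[OF boldPi_carrier])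
    note q = lmi_quadratic[of ?ch u ?w ?s _ ?yd ?ce, OF _ du _ _ refl Pi]
    have P0: "varP1 U *\<^sub>v 0\<^sub>v CARD('n) = 0\<^sub>v CARD('n)" "varP2 U *\<^sub>v 0\<^sub>v (total_dim S (dimf G) * CARD('n)) = 0\<^sub>v CARD('n)"
      by (rule mult_mat_vec_zero[OF decision_carriers(2)], rule mult_mat_vec_zero[OF decision_facts(3)])
    have d: "dim_vec (varP2 U *\<^sub>v v) = CARD('n)" "dim_vec (varP3 U *\<^sub>v v) = total_dim S (dimf G) * CARD('n)"
      "dim_vec ((- (J2 J)\<^sup>T) *\<^sub>v v) = CARD('q)" "dim_vec (Jtilde J *\<^sub>v v) = CARD('m)" "dim_vec (J1 J *\<^sub>v v) = CARD('m)" "dim_vec (J3 J *\<^sub>v v) = CARD('q)" for v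
      using decision_facts(3) decision_carriers(3) supply_facts by auto
    have Xi0: "Xi_form ?yd ?ch ?ce ?w = 0"
      unfolding Xi_form_def
      by (simp add: sum_list_idx1 vz scalar_prod_zero_left d QR_dims sum.neutral)
        (auto intro!: sum.neutral simp: scalar_prod_def vz)
    have "?chi \<bullet> (synthesis_lmi S G J \<alpha> U *\<^sub>v ?chi) = 0"
      by (subst q(1)) (simp_all add: vz zz P0 scalar_prod_zero_left scalar_prod_zero_right Xi0
        carrier_matD[OF decision_facts(3)] carrier_matD[OF decision_carriers(3)] carrier_matD[OF supply_facts(1)]
        carrier_matD[OF supply_facts(3)] carrier_matD[OF supply_facts(4)] del: vconcat_simps)
    moreover have "pos_def (- synthesis_lmi S G J \<alpha> U)" using feas by (simp add: feasible_def neg_def_def)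
    moreover have "?chi \<noteq> 0\<^sub>v (CARD('n) + ?D)"
    proof
      assume e: "?chi = 0\<^sub>v (CARD('n) + ?D)"
      have "u = 0\<^sub>v CARD('n)"
      proof (rule eq_vecI)
        fix j assume "j < dim_vec (0\<^sub>v CARD('n) :: real Matrix.vec)"
        then show "u $ j = 0\<^sub>v CARD('n) $ j" using arg_cong[OF e, of "\<lambda>v. v $ j"] du by simp
      qed (use du in simp)
      then show False using u(2) by simp
    qed
    moreover have c: "synthesis_lmi S G J \<alpha> U \<in> carrier_mat (CARD('n) + ?D) (CARD('n) + ?D)" "?chi \<in> carrier_vec (CARD('n) + ?D)"
      by (rule q(2), simp_all, rule q(3), simp_all)
    ultimately have "0 < ?chi \<bullet> ((- synthesis_lmi S G J \<alpha> U) *\<^sub>v ?chi)"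
      by (intro pos_def_pos[of _ "CARD('n) + ?D"]) auto
    also have "\<dots> = - (?chi \<bullet> (synthesis_lmi S G J \<alpha> U *\<^sub>v ?chi))"
      by (rule neg_form[OF c])
    finally show False using \<open>?chi \<bullet> (synthesis_lmi S G J \<alpha> U *\<^sub>v ?chi) = 0\<close> by simp
  qed
qed

subsection \<open>The closed loop in the transformed state\<close>

text \<open>Components of \<open>y\<close> are indexed by naturals, matching the coordinates of the
  block vectors and giving real-valued functions to integrate.\<close>

definition ycomp :: "real^'n \<Rightarrow> nat \<Rightarrow> real" where
  "ycomp \<xi> l = (minv (varX U) *\<^sub>v vec_of \<xi>) $ l"

definition gain :: "real^'n^'p" where
  "gain = cart_of_mat (varV U * minv (varX U))"

lemma minv_X: "minv (varX U) \<in> carrier_mat CARD('n) CARD('n)" "varX U * minv (varX U) = 1\<^sub>m CARD('n)" "minv (varX U) * varX U = 1\<^sub>m CARD('n)"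
  using minv_works[OF decision_carriers(1) invertible_X] by auto

lemma vec_ycomp: "Matrix.vec CARD('n) (ycomp \<xi>) = minv (varX U) *\<^sub>v vec_of \<xi>"
  using minv_X(1) by (intro eq_vecI) (auto simp: ycomp_def)

lemma X_ycomp: "varX U *\<^sub>v Matrix.vec CARD('n) (ycomp \<xi>) = vec_of \<xi>"
  unfolding vec_ycomp
  using assoc_mult_mat_vec[OF decision_carriers(1) minv_X(1) vec_of_carrier, of \<xi>] minv_X(2) vec_of_carrier[of \<xi>] by simp

lemma V_ycomp: "varV U *\<^sub>v Matrix.vec CARD('n) (ycomp \<xi>) = vec_of (gain *v \<xi>)"
proof -
  have "varV U * minv (varX U) \<in> carrier_mat CARD('p) CARD('n)"
    by (rule mult_carrier_mat[OF decision_facts(5) minv_X(1)])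
  then have "vec_of (gain *v \<xi>) = (varV U * minv (varX U)) *\<^sub>v vec_of \<xi>"
    by (simp add: vec_of_mult gain_def mat_of_cart_of_mat)
  also have "\<dots> = varV U *\<^sub>v (minv (varX U) *\<^sub>v vec_of \<xi>)"
    by (rule assoc_mult_mat_vec[OF decision_facts(5) minv_X(1) vec_of_carrier])
  finally show ?thesis by (simp add: vec_ycomp)
qed

lemma ycomp_sum: "l < CARD('n) \<Longrightarrow> ycomp \<xi> l = (\<Sum>j<CARD('n). minv (varX U) $$ (l, j) * vec_of \<xi> $ j)"
  unfolding ycomp_def using minv_X(1) by (subst mult_mat_vec_index) auto

lemma bounded_linear_ycomp: "l < CARD('n) \<Longrightarrow> bounded_linear (\<lambda>\<xi>. ycomp \<xi> l)"
  unfolding ycomp_sum by (intro bounded_linear_sum bounded_linear_const_mult bounded_linear_vec_of) auto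

definition yh :: "(real \<Rightarrow> real^'n) \<Rightarrow> nat \<Rightarrow> real \<Rightarrow> real" where
  "yh u l \<tau> = ycomp (u \<tau>) l"

abbreviation "yd u \<equiv> \<lambda>i. ycomp (u (- delay S i))"
abbreviation "ch u \<equiv> \<lambda>i l. Hc i (yh u l)"
abbreviation "ce u \<equiv> \<lambda>i l. Ec i (yh u l)"

lemma II_subset: "i \<in> {1..num_delays S} \<Longrightarrow> II i \<subseteq> {- max_delay S..0}"
  using delay_bounds[of i] by (auto simp: delay_interval_def)

lemma yh_continuous:
  "continuous_on A u \<Longrightarrow> l < CARD('n) \<Longrightarrow> continuous_on A (yh u l)"
  unfolding yh_def by (rule bounded_linear.continuous_on[OF bounded_linear_ycomp])

lemma yh_L2:
  assumes "continuous_on {- max_delay S..0} u" "i \<in> {1..num_delays S}" "l < CARD('n)"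
  shows "L2_on (II i) (yh u l)"
  unfolding II_eq
  by (rule L2_on_continuous, rule yh_continuous[OF continuous_on_subset[OF assms(1)]])
    (use II_subset[OF assms(2)] assms(3) in \<open>auto simp: II_eq\<close>)

text \<open>With \<open>x = X y\<close> and \<open>gain *v x = V y\<close>, the two block rows
  applied to the vector formed from \<open>y\<close> add up to the right-hand side written in
  \<open>x\<close>. The coefficient families are arbitrary, so the state and the output equation are
  both instances.\<close>

lemma closed_loop_row:
  fixes co1 :: "nat \<Rightarrow> real^'n^'r" and co2 :: "nat \<Rightarrow> real^'p^'r" and ker1 :: "nat \<Rightarrow> real \<Rightarrow> real^'n^'r"
    and ker2 :: "nat \<Rightarrow> real \<Rightarrow> real^'p^'r" and D :: "real^'q^'r"
  assumes dec1: "\<And>i. i \<in> {1..num_delays S} \<Longrightarrow> decomposes (II i) CARD('n) (dimg G i) (fung G i) (hat1 i) (ker1 i)"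
    and dec2: "\<And>i. i \<in> {1..num_delays S} \<Longrightarrow> decomposes (II i) CARD('p) (dimg G i) (fung G i) (hat2 i) (ker2 i)"
    and u: "continuous_on {- max_delay S..0} u"
  shows "(block_row S G co1 hat1 (mat_of D) * diag_block_mat [kron (1\<^sub>m (beta S G)) (varX U), 1\<^sub>m CARD('q)]
       + block_row S G co2 hat2 (0\<^sub>m CARD('r) CARD('q)) * diag_block_mat [kron (1\<^sub>m (beta S G)) (varV U), 0\<^sub>m CARD('q) CARD('q)])
      *\<^sub>v theta (yd u) (ch u) (ce u) (vec_of w)
    = vec_of (D *v w + (\<Sum>i=0..num_delays S. (co1 i + co2 i ** gain) *v u (- delay S i))
        + (\<Sum>i=1..num_delays S. LINT \<tau>:II i|lebesgue. (ker1 i \<tau> + ker2 i \<tau> ** gain) *v u \<tau>))"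
    (is "(?B1 * ?D1 + ?B2 * ?D2) *\<^sub>v ?t = vec_of ?rhs")
proof (rule eq_vecI)
  let ?n = "CARD('n)" and ?b = "beta S G * CARD('n) + CARD('q)"
  have c1: "?B1 * ?D1 \<in> carrier_mat CARD('r) ?b"
    by (intro carrier_matI) (simp_all add: block_row_dims dim_diag_block_mat' carrier_matD[OF decision_carriers(1)])
  have c2: "?B2 * ?D2 \<in> carrier_mat CARD('r) ?b"
    by (intro carrier_matI) (simp_all add: block_row_dims dim_diag_block_mat' carrier_matD[OF decision_facts(5)])
  show "dim_vec ((?B1 * ?D1 + ?B2 * ?D2) *\<^sub>v ?t) = dim_vec (vec_of ?rhs)"
    by (simp only: dim_mult_mat_vec index_add_mat index_mult_mat block_row_dims dim_vec_of)
  fix l assume "l < dim_vec (vec_of ?rhs)"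
  then have l: "l < CARD('r)" by simp
  have tc: "?t \<in> carrier_vec ?b" by (rule carrier_vecI) (rule dim_theta, simp)
  have hat1: "i \<in> {1..num_delays S} \<Longrightarrow> hat1 i \<in> carrier_mat CARD('r) (dimg G i * CARD('n))"
    and hat2: "i \<in> {1..num_delays S} \<Longrightarrow> hat2 i \<in> carrier_mat CARD('r) (dimg G i * CARD('p))" for i
    using dec1[of i] dec2[of i] by (simp_all add: decomposes_def)
  note y = yh_L2[OF u]
  have k1: "set_integrable lebesgue (II i) (\<lambda>\<tau>. ker1 i \<tau> *v u \<tau>)"
    "vec_of (LINT \<tau>:II i|lebesgue. ker1 i \<tau> *v u \<tau>) $ l = (hat1 i *\<^sub>v
        (kron (matT S G i) (1\<^sub>m CARD('n)) *\<^sub>v blk (dimh G i) CARD('n) (\<lambda>j s. (varX U *\<^sub>v Matrix.vec ?n (\<lambda>l. Hc i (yh u l) $ j)) $ s)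
       + kron (matTtilde G i) (1\<^sub>m CARD('n)) *\<^sub>v blk (dimphi G i) CARD('n) (\<lambda>j s. (varX U *\<^sub>v Matrix.vec ?n (\<lambda>l. Ec i (yh u l) $ j)) $ s))) $ l"
    if i: "i \<in> {1..num_delays S}" for i
    by (rule kernel_integral(1)[OF i dec1[OF i] y[OF i] decision_carriers(1)], assumption, simp add: yh_def X_ycomp,
        rule kernel_integral(2)[OF i dec1[OF i] y[OF i] decision_carriers(1) _ l], assumption, simp add: yh_def X_ycomp)
  have k2: "set_integrable lebesgue (II i) (\<lambda>\<tau>. ker2 i \<tau> *v (gain *v u \<tau>))"
    "vec_of (LINT \<tau>:II i|lebesgue. ker2 i \<tau> *v (gain *v u \<tau>)) $ l = (hat2 i *\<^sub>v
        (kron (matT S G i) (1\<^sub>m CARD('p)) *\<^sub>v blk (dimh G i) CARD('p) (\<lambda>j s. (varV U *\<^sub>v Matrix.vec ?n (\<lambda>l. Hc i (yh u l) $ j)) $ s)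
       + kron (matTtilde G i) (1\<^sub>m CARD('p)) *\<^sub>v blk (dimphi G i) CARD('p) (\<lambda>j s. (varV U *\<^sub>v Matrix.vec ?n (\<lambda>l. Ec i (yh u l) $ j)) $ s))) $ l"
    if i: "i \<in> {1..num_delays S}" for i
    by (rule kernel_integral(1)[OF i dec2[OF i] y[OF i] decision_facts(5)], assumption, simp add: yh_def V_ycomp,
        rule kernel_integral(2)[OF i dec2[OF i] y[OF i] decision_facts(5) _ l], assumption, simp add: yh_def V_ycomp)
  have r1: "((?B1 * ?D1) *\<^sub>v ?t) $ l = (\<Sum>i=0..num_delays S. vec_of (co1 i *v u (- delay S i)) $ l)
      + (\<Sum>i=1..num_delays S. vec_of (LINT \<tau>:II i|lebesgue. ker1 i \<tau> *v u \<tau>) $ l) + vec_of (D *v w) $ l"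
    using block_row_mult[where co = co1 and yd = "yd u" and ch = "ch u" and ce = "ce u",
        OF hat1 decision_carriers(1) one_carrier_mat mat_of_carrier[of D] dim_vec_of[of w] l]
    by (simp only: k1(2) X_ycomp vec_of_mult[symmetric] one_mult_mat_vec vec_of_carrier cong: sum.cong)
  have r2: "((?B2 * ?D2) *\<^sub>v ?t) $ l = (\<Sum>i=0..num_delays S. vec_of (co2 i *v (gain *v u (- delay S i))) $ l)
      + (\<Sum>i=1..num_delays S. vec_of (LINT \<tau>:II i|lebesgue. ker2 i \<tau> *v (gain *v u \<tau>)) $ l)"
    using block_row_mult[where co = co2 and yd = "yd u" and ch = "ch u" and ce = "ce u",
        OF hat2 decision_facts(5) zero_carrier_mat zero_carrier_mat dim_vec_of[of w] l] l
    by (simp only: k2(2) V_ycomp vec_of_mult[symmetric] cong: sum.cong)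
      (simp add: zero_mat_mult_vec del: index_mult_mat_vec)
  have i: "(LINT \<tau>:II i|lebesgue. (ker1 i \<tau> + ker2 i \<tau> ** gain) *v u \<tau>)
     = (LINT \<tau>:II i|lebesgue. ker1 i \<tau> *v u \<tau>) + (LINT \<tau>:II i|lebesgue. ker2 i \<tau> *v (gain *v u \<tau>))"
    if "i \<in> {1..num_delays S}" for i
    using set_integral_add(2)[OF k1(1)[OF that] k2(1)[OF that]]
    by (simp add: matrix_vector_mult_add_rdistrib matrix_vector_mul_assoc)
  have "((?B1 * ?D1 + ?B2 * ?D2) *\<^sub>v ?t) $ l = ((?B1 * ?D1) *\<^sub>v ?t) $ l + ((?B2 * ?D2) *\<^sub>v ?t) $ l"
    unfolding add_mult_distrib_mat_vec[OF c1 c2 tc]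
    by (rule index_add_vec(1)) (simp only: dim_mult_mat_vec index_mult_mat block_row_dims l)
  also have "\<dots> = vec_of ?rhs $ l"
    unfolding r1 r2 using l
    by (simp only: vec_of_add vec_of_sum_index index_add_vec dim_vec_of i matrix_vector_mult_add_rdistrib[of "co1 _"]
        matrix_vector_mul_assoc sum.distrib cong: sum.cong)
  finally show "((?B1 * ?D1 + ?B2 * ?D2) *\<^sub>v ?t) $ l = vec_of ?rhs $ l" .
qed

definition state_rhs where
  "state_rhs u w = distD1 S *v w + (\<Sum>i=0..num_delays S. (coA S i + coB S i ** gain) *v u (- delay S i))
        + (\<Sum>i=1..num_delays S. LINT \<tau>:II i|lebesgue. (kerA S i \<tau> + kerB S i \<tau> ** gain) *v u \<tau>)"

definition output_rhs where
  "output_rhs u w = distD2 S *v w + (\<Sum>i=0..num_delays S. (coC S i + coE S i ** gain) *v u (- delay S i))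
        + (\<Sum>i=1..num_delays S. LINT \<tau>:II i|lebesgue. (kerC S i \<tau> + kerE S i \<tau> ** gain) *v u \<tau>)"

lemma boldPi_closed_loop:
  assumes u: "continuous_on {- max_delay S..0} u" and s: "dim_vec s = CARD('m)"
  shows "boldPi S G U *\<^sub>v (theta (yd u) (ch u) (ce u) (vec_of w) @\<^sub>v s) = varX U *\<^sub>v Matrix.vec CARD('n) (ycomp (state_rhs u w))"
proof -
  let ?M = "boldA S G * diag_block_mat [kron (1\<^sub>m (beta S G)) (varX U), 1\<^sub>m CARD('q)]
           + boldB1 S G * diag_block_mat [kron (1\<^sub>m (beta S G)) (varV U), 0\<^sub>m CARD('q) CARD('q)]"
  let ?t = "theta (yd u) (ch u) (ce u) (vec_of w)"
  have Md: "dim_row ?M = CARD('n)" "dim_col ?M = beta S G * CARD('n) + CARD('q)"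
    using decision_facts(5) by (simp_all add: boldB1_def block_row_dims dim_diag_block_mat')
  have dt: "dim_vec ?t = beta S G * CARD('n) + CARD('q)" by (rule dim_theta) simp
  have "boldPi S G U *\<^sub>v (?t @\<^sub>v s) = ?M *\<^sub>v ?t + 0\<^sub>m CARD('n) CARD('m) *\<^sub>v s"
    unfolding boldPi_def by (rule hcat_mult_vec_2) (simp_all only: Md dt s index_zero_mat)
  also have "\<dots> = ?M *\<^sub>v ?t" by (rule zero_mult_add) (simp_all only: s Md dim_mult_mat_vec)
  also have "\<dots> = vec_of (state_rhs u w)"
    unfolding boldA_def boldB1_def state_rhs_def
    by (rule closed_loop_row[OF _ _ u]) (rule decomposition_facts(9,10), assumption)+
  finally show ?thesis by (simp only: X_ycomp)
qed

lemma boldSigma_closed_loop: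
  assumes u: "continuous_on {- max_delay S..0} u"
  shows "boldSigma S G U *\<^sub>v theta (yd u) (ch u) (ce u) (vec_of w) = vec_of (output_rhs u w)"
  unfolding boldSigma_def boldC_def boldB2_def output_rhs_def
  by (rule closed_loop_row[OF _ _ u]) (rule decomposition_facts(11,12), assumption)+

text \<open>\<open>s\<close> is the stationary point of
  \<open>2 s \<bullet> g + s \<bullet> (J1 s)\<close> with \<open>g\<close> the image of
  \<open>z\<close> under \<open>Jtilde J\<close>. There \<open>J1 s = - g\<close>, and the value is
  \<open>- g \<bullet> (minv J1 g)\<close>, which undoes the Schur complement that put
  \<open>J1\<close> into the inequality.\<close>

lemma supply_rate_completion:
  fixes z :: "real^'m" and w :: "real^'q"
  defines "s \<equiv> - (minv (J1 J) *\<^sub>v (Jtilde J *\<^sub>v vec_of z))"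
  shows "2 * (vec_of w \<bullet> ((- (J2 J)\<^sup>T) *\<^sub>v vec_of z) + s \<bullet> (Jtilde J *\<^sub>v vec_of z)) - vec_of w \<bullet> (J3 J *\<^sub>v vec_of w) + s \<bullet> (J1 J *\<^sub>v s)
    = - supply_rate J z w"
proof -
  let ?z = "vec_of z" and ?w = "vec_of w" and ?m = "CARD('m)" and ?q = "CARD('q)"
  note Jc = supply_facts
  note Ji = minv_works[OF Jc(3,7)]
  have zc: "?z \<in> carrier_vec ?m" and wc: "?w \<in> carrier_vec ?q" by (rule vec_of_carrier)+
  let ?g = "Jtilde J *\<^sub>v ?z"
  have gc: "?g \<in> carrier_vec ?m" by (rule mult_mat_vec_carrier[OF Jc(1) zc])
  have ic: "minv (J1 J) *\<^sub>v ?g \<in> carrier_vec ?m" by (rule mult_mat_vec_carrier[OF Ji(1) gc])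
  have Js: "J1 J *\<^sub>v s = - ?g"
  proof -
    have "J1 J *\<^sub>v s = - (J1 J *\<^sub>v (minv (J1 J) *\<^sub>v ?g))"
      unfolding s_def
    proof (rule eq_vecI)
      fix i assume "i < dim_vec (- (J1 J *\<^sub>v (minv (J1 J) *\<^sub>v ?g)))"
      then have "i < ?m" using Jc(3) by simp
      moreover have "dim_vec (minv (J1 J) *\<^sub>v ?g) = dim_vec (Matrix.row (J1 J) i)"
        using carrier_vecD[OF ic] carrier_matD[OF Jc(3)] by simp
      ultimately show "(J1 J *\<^sub>v - (minv (J1 J) *\<^sub>v ?g)) $ i = (- (J1 J *\<^sub>v (minv (J1 J) *\<^sub>v ?g))) $ i"
        using carrier_matD[OF Jc(3)] by (simp del: scalar_prod_uminus_right add: scalar_prod_uminus_right)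
    qed simp
    also have "J1 J *\<^sub>v (minv (J1 J) *\<^sub>v ?g) = ?g"
      using assoc_mult_mat_vec[OF Jc(3) Ji(1) gc] Ji(2) gc by simp
    finally show ?thesis .
  qed
  have sc: "s \<in> carrier_vec ?m" unfolding s_def using ic by simp
  have sg: "s \<bullet> ?g = - (?g \<bullet> (minv (J1 J) *\<^sub>v ?g))"
    unfolding s_def using comm_scalar_prod[OF ic gc] carrier_vecD[OF ic] carrier_vecD[OF gc]
    by (subst scalar_prod_uminus_left) (simp_all only:)
  have sJs: "s \<bullet> (J1 J *\<^sub>v s) = - (s \<bullet> ?g)" unfolding Js
    by (rule scalar_prod_uminus_right) (simp only: carrier_vecD[OF sc] carrier_vecD[OF gc])
  let ?T = "(Jtilde J)\<^sup>T * minv (J1 J) * Jtilde J"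
  have Tc: "?T \<in> carrier_mat ?m ?m" using Jc(1) Ji(1) by (intro mult_carrier_mat) auto
  have "?T *\<^sub>v ?z = (Jtilde J)\<^sup>T *\<^sub>v (minv (J1 J) *\<^sub>v ?g)"
    using Jc(1) Ji(1) zc by (simp add: assoc_mult_mat_vec[of _ ?m ?m _ ?m] mult_carrier_mat[of _ ?m ?m])
  then have Tz: "?z \<bullet> (?T *\<^sub>v ?z) = ?g \<bullet> (minv (J1 J) *\<^sub>v ?g)"
    using transpose_form_left[OF Jc(1) zc ic] by simp
  have J2T: "(J2 J)\<^sup>T \<in> carrier_mat ?q ?m" using Jc(4) by simp
  have wz: "?w \<bullet> ((J2 J)\<^sup>T *\<^sub>v ?z) = ?z \<bullet> (J2 J *\<^sub>v ?w)" by (rule transpose_form[OF Jc(4) wc zc])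
  have c: "?T *\<^sub>v ?z \<in> carrier_vec ?m" "J2 J *\<^sub>v ?w \<in> carrier_vec ?m" "(J2 J)\<^sup>T *\<^sub>v ?z \<in> carrier_vec ?q" "J3 J *\<^sub>v ?w \<in> carrier_vec ?q"
    by (rule mult_mat_vec_carrier[OF Tc zc] mult_mat_vec_carrier[OF Jc(4) wc] mult_mat_vec_carrier[OF J2T zc] mult_mat_vec_carrier[OF Jc(6) wc])+
  have "supply_rate J z w = (?z @\<^sub>v ?w) \<bullet> ((?T *\<^sub>v ?z + J2 J *\<^sub>v ?w) @\<^sub>v ((J2 J)\<^sup>T *\<^sub>v ?z + J3 J *\<^sub>v ?w))"
    unfolding supply_rate_def Let_def four_block_mat_mult_vec[OF Tc Jc(4) J2T Jc(6) zc wc] ..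
  also have "\<dots> = ?z \<bullet> (?T *\<^sub>v ?z + J2 J *\<^sub>v ?w) + ?w \<bullet> ((J2 J)\<^sup>T *\<^sub>v ?z + J3 J *\<^sub>v ?w)"
    by (rule scalar_prod_append[OF zc wc add_carrier_vec[OF c(1,2)] add_carrier_vec[OF c(3,4)]])
  also have "\<dots> = ?g \<bullet> (minv (J1 J) *\<^sub>v ?g) + 2 * (?w \<bullet> ((J2 J)\<^sup>T *\<^sub>v ?z)) + ?w \<bullet> (J3 J *\<^sub>v ?w)"
    unfolding scalar_prod_add_distrib[OF zc c(1,2)] scalar_prod_add_distrib[OF wc c(3,4)] Tz by (simp add: wz)
  finally have sr: "supply_rate J z w = ?g \<bullet> (minv (J1 J) *\<^sub>v ?g) + 2 * (?w \<bullet> ((J2 J)\<^sup>T *\<^sub>v ?z)) + ?w \<bullet> (J3 J *\<^sub>v ?w)" .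
  have "?w \<bullet> ((- (J2 J)\<^sup>T) *\<^sub>v ?z) = - (?w \<bullet> ((J2 J)\<^sup>T *\<^sub>v ?z))"
    using c(3) wc zc J2T by simp
  then show ?thesis unfolding sr sJs sg by simp
qed

text \<open>Without disturbance only the negative semidefinite block in \<open>z\<close> survives.
  This sign is what turns the dissipation inequality into decay of the functional.\<close>

lemma supply_rate_zero:
  fixes z :: "real^'m"
  shows "supply_rate J z (0 :: real^'q) \<le> 0"
proof -
  let ?z = "vec_of z" and ?w = "vec_of (0 :: real^'q)" and ?m = "CARD('m)" and ?q = "CARD('q)"
  let ?T = "(Jtilde J)\<^sup>T * minv (J1 J) * Jtilde J"
  note Jc = supply_facts
  note Ji = minv_works[OF Jc(3,7)]
  have w0: "?w = 0\<^sub>v ?q" by (intro eq_vecI) (auto simp: vec_of_def)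
  have zc: "?z \<in> carrier_vec ?m" by (rule vec_of_carrier)
  have Tc: "?T \<in> carrier_mat ?m ?m" using Jc(1) Ji(1) by (intro mult_carrier_mat) auto
  have J2T: "(J2 J)\<^sup>T \<in> carrier_mat ?q ?m" using Jc(4) by simp
  have c: "?T *\<^sub>v ?z \<in> carrier_vec ?m" "(J2 J)\<^sup>T *\<^sub>v ?z \<in> carrier_vec ?q"
    by (rule mult_mat_vec_carrier[OF Tc zc], rule mult_mat_vec_carrier[OF J2T zc])
  have "supply_rate J z (0 :: real^'q) = (?z @\<^sub>v 0\<^sub>v ?q) \<bullet> ((?T *\<^sub>v ?z + J2 J *\<^sub>v 0\<^sub>v ?q) @\<^sub>v ((J2 J)\<^sup>T *\<^sub>v ?z + J3 J *\<^sub>v 0\<^sub>v ?q))"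
    unfolding supply_rate_def Let_def w0 four_block_mat_mult_vec[OF Tc Jc(4) J2T Jc(6) zc zero_carrier_vec[of ?q]] ..
  also have "\<dots> = ?z \<bullet> (?T *\<^sub>v ?z)"
    unfolding mult_mat_vec_zero[OF Jc(4)] mult_mat_vec_zero[OF Jc(6)] right_zero_vec[OF c(1)] right_zero_vec[OF c(2)]
      scalar_prod_append[OF zc zero_carrier_vec c] scalar_prod_zero_left[OF carrier_vecD[OF c(2)]] by simp
  also have "\<dots> \<le> 0" using Jc(8) Tc zc by (auto simp: neg_semidef_def)
  finally show ?thesis .
qed

end

subsection \<open>The functional along moving segments\<close>

text \<open>The quantifier over \<open>c\<close> stands inside: one triple \<open>i\<close>,
  \<open>l\<close>, \<open>j\<close> locates the same entry in every stacked vector, so an entry of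
  \<open>zeta\<close> can be differentiated and matched with the entry of
  \<open>zeta_dot\<close>.\<close>

lemma stack_index_ex:
  assumes "a < (\<Sum>i\<leftarrow>is. k i) * n"
  shows "\<exists>i\<in>set is. \<exists>l<n. \<exists>j<k i. \<forall>c. stack n k c is $ a = c i l $ j"
  using assms
proof (induction "is" arbitrary: a)
  case (Cons i "is")
  have s: "stack n k c (i # is) = blk (k i) n (\<lambda>j l. c i l $ j) @\<^sub>v stack n k c is" for c
    by (simp add: stack_def)
  show ?case
  proof (cases "a < k i * n")
    case True
    then have "a div n < k i" "a mod n < n" by (auto simp: div_mod_less)
    moreover have "stack n k c (i # is) $ a = c i (a mod n) $ (a div n)" for c
      unfolding s using True by (simp add: blk_def)
    ultimately show ?thesis by auto
  next
    case False
    then have "a - k i * n < (\<Sum>i\<leftarrow>is. k i) * n" using Cons.prems by (simp add: distrib_right)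
    from Cons.IH[OF this] obtain i' l j where "i' \<in> set is" "l < n" "j < k i'"
      "\<And>c. stack n k c is $ (a - k i * n) = c i' l $ j" by blast
    moreover have "stack n k c (i # is) $ a = stack n k c is $ (a - k i * n)" for c
      unfolding s using False Cons.prems by (simp add: distrib_right)
    ultimately show ?thesis by (metis list.set_intros(2))
  qed
qed simp

lemma abs_ip_le:
  fixes g y :: "real \<Rightarrow> real"
  assumes g: "set_integrable lebesgue {a..b} g" and y: "continuous_on {a..b} y" "\<And>\<tau>. \<tau> \<in> {a..b} \<Longrightarrow> \<bar>y \<tau>\<bar> \<le> B"
  shows "\<bar>ip {a..b} g y\<bar> \<le> (LINT \<tau>:{a..b}|lebesgue. \<bar>g \<tau>\<bar>) * B"
proof -
  have gy: "set_integrable lebesgue {a..b} (\<lambda>\<tau>. g \<tau> * y \<tau>)" by (rule set_integrable_mult_continuous[OF y(1) g])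
  have ag: "set_integrable lebesgue {a..b} (\<lambda>\<tau>. \<bar>g \<tau>\<bar>)" by (rule set_integrable_abs[OF g])
  have "\<bar>ip {a..b} g y\<bar> \<le> (LINT \<tau>:{a..b}|lebesgue. \<bar>g \<tau> * y \<tau>\<bar>)"
    unfolding ip_def set_lebesgue_integral_def
    using integral_norm_bound[of lebesgue "\<lambda>\<tau>. indicat_real {a..b} \<tau> *\<^sub>R (g \<tau> * y \<tau>)"]
    by (simp add: abs_mult)
  also have "\<dots> \<le> (LINT \<tau>:{a..b}|lebesgue. \<bar>g \<tau>\<bar> * B)"
    by (rule set_integral_mono[OF set_integrable_abs[OF gy]]) (use ag y(2) in \<open>auto simp: abs_mult intro!: mult_left_mono\<close>)
  also have "\<dots> = (LINT \<tau>:{a..b}|lebesgue. \<bar>g \<tau>\<bar>) * B" by simp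
  finally show ?thesis .
qed

text \<open>As \<open>y\<close> is bounded on the whole line, the derivative formula is bounded
  uniformly in time, and the integral is even Lipschitz.\<close>

lemma abs_cont_on_moving_integral:
  fixes y :: "real \<Rightarrow> real"
  assumes ab: "a < b" and f: "continuous_on {a..b} f" and g: "set_integrable lebesgue {a..b} g"
    and weak: "weak_derivative_on a b f g"
    and y: "continuous_on UNIV y" "\<And>t. \<bar>y t\<bar> \<le> B"
  shows "abs_cont_on p q (\<lambda>t. LINT \<tau>:{a..b}|lebesgue. f \<tau> * y (t + \<tau>))" (is "abs_cont_on p q ?F")
proof (rule abs_cont_on_lipschitz)
  let ?D = "\<lambda>t. f b * y (t + b) - f a * y (t + a) - ip {a..b} g (\<lambda>\<tau>. y (t + \<tau>))"
  let ?C = "\<bar>f b\<bar> * B + \<bar>f a\<bar> * B + (LINT \<tau>:{a..b}|lebesgue. \<bar>g \<tau>\<bar>) * B"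
  have D: "(?F has_real_derivative ?D t) (at t)" for t
    using DERIV_moving_integral[OF assms] by (simp add: ip_def)
  have C: "\<bar>?D t\<bar> \<le> ?C" for t
  proof -
    have "continuous_on {a..b} (\<lambda>\<tau>. y (t + \<tau>))"
      by (rule continuous_on_compose2[OF y(1)]) (auto intro!: continuous_intros)
    from abs_ip_le[OF g this y(2)] have "\<bar>ip {a..b} g (\<lambda>\<tau>. y (t + \<tau>))\<bar> \<le> (LINT \<tau>:{a..b}|lebesgue. \<bar>g \<tau>\<bar>) * B" .
    moreover have "\<bar>f b * y (t + b)\<bar> \<le> \<bar>f b\<bar> * B" "\<bar>f a * y (t + a)\<bar> \<le> \<bar>f a\<bar> * B"
      unfolding abs_mult by (intro mult_left_mono y(2); simp)+
    ultimately show ?thesis by linarith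
  qed
  fix s t :: real assume "s \<le> t"
  then show "norm (?F t - ?F s) \<le> ?C * (t - s)"
    using field_differentiable_bound[of UNIV ?F ?D ?C s t] D C by simp
qed

section \<open>The Lyapunov-Krasovskii functional and its derivative\<close>

context synthesis
begin

text \<open>\<open>h_i\<close> ends with \<open>f_i\<close>: undoing the normalisation of
  \<open>h_i\<close> and selecting the last entries leaves the raw coefficients in
  \<open>f_i\<close>, which are then normalised.\<close>

lemma embed_Hc:
  assumes i: "i \<in> {1..num_delays S}"
  shows "embed_f i *\<^sub>v Hc i y = Fc i y"
proof -
  note c = cholesky_facts[OF i]
  let ?c = "\<lambda>k F. cvec (II i) k F y" and ?I = "hcat [0\<^sub>m (dimf G i) (dimvphi G i), 1\<^sub>m (dimf G i)]"
  have Ic: "?I \<in> carrier_mat (dimf G i) (dimh G i)"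
    by (intro carrier_matI) (simp_all add: dim_hcat dimh_def)
  have hc: "?c (dimh G i) (funh G i) \<in> carrier_vec (dimh G i)" by (rule cvec_carrier)
  have fc: "?c (dimf G i) (funf G i) \<in> carrier_vec (dimf G i)" by (rule cvec_carrier)
  have d: "dim_vec (funvphi G i \<tau>) = dimvphi G i" "dim_vec (funf G i \<tau>) = dimf G i" if "\<tau> \<in> II i" for \<tau>
    using decomposition_facts(1,2)[OF i that] by auto
  have "?c (dimh G i) (funh G i) = ?c (dimvphi G i) (funvphi G i) @\<^sub>v ?c (dimf G i) (funf G i)"
    unfolding cvec_def
    by (intro eq_vecI) (auto simp: dimh_def funh_def d intro!: ip_cong')
  then have 1: "?I *\<^sub>v ?c (dimh G i) (funh G i) = ?c (dimf G i) (funf G i)"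
    using hcat_mult_vec_2[of "?c (dimvphi G i) (funvphi G i)" "0\<^sub>m (dimf G i) (dimvphi G i)" "?c (dimf G i) (funf G i)" "1\<^sub>m (dimf G i)"]
      zero_mult_add(1)[of "?c (dimvphi G i) (funvphi G i)" "dimvphi G i" "?c (dimf G i) (funf G i)" "dimf G i"]
      one_mult_mat_vec[OF fc] by simp
  have "cholH G i *\<^sub>v Hc i y = ?c (dimh G i) (funh G i)"
    unfolding Hc_def using assoc_mult_mat_vec[OF c(4,3) hc] c(10) hc by simp
  then show ?thesis
    unfolding embed_f_def Fc_def
    using assoc_mult_mat_vec[OF mult_carrier_mat[OF c(1) Ic] c(4), of "Hc i y"] assoc_mult_mat_vec[OF c(1) Ic hc] 1
      mult_mat_vec_carrier[OF c(3) hc] by (simp add: Hc_def)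
qed

text \<open>Reduces both vectors to scalar integrals and boundary values at one common position, the
  form in which the result on moving integrals applies.\<close>

lemma zeta_entries:
  assumes "a < total_dim S (dimf G) * CARD('n)"
  obtains i l j where "i \<in> {1..num_delays S}" "l < CARD('n)" "j < dimf G i"
    "\<And>u. continuous_on {- max_delay S..0} u \<Longrightarrow>
      zeta (ch u) $ a = (\<Sum>k<dimf G i. minv (cholF G i) $$ (j, k) * ip (II i) (\<lambda>\<tau>. funf G i \<tau> $ k) (yh u l))"
    "\<And>u. continuous_on {- max_delay S..0} u \<Longrightarrow>
      zeta_dot (yd u) (ch u) $ a = (\<Sum>k<dimf G i. minv (cholF G i) $$ (j, k) *
        (funf G i (- delay S (i - 1)) $ k * yh u l (- delay S (i - 1)) - funf G i (- delay S i) $ k * yh u l (- delay S i)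
         - ip (II i) (\<lambda>\<tau>. (matM G i *\<^sub>v funh G i \<tau>) $ k) (yh u l)))"
proof -
  obtain i l j where ij: "i \<in> {1..num_delays S}" "l < CARD('n)" "j < dimf G i"
    and s: "\<And>c. stack CARD('n) (dimf G) c (idx1 S) $ a = c i l $ j"
    using stack_index_ex[of a "dimf G" "idx1 S" "CARD('n)"] assms by (auto simp: total_dim_idx1 set_idx1)
  note i = ij(1)
  note c = cholesky_facts[OF i] and b = delay_bounds[OF i] and f = families[OF i]
  have M: "matM G i \<in> carrier_mat (dimf G i) (dimh G i)" by (rule decomposition_facts(7)[OF i])
  have fdim: "dim_vec (funf G i (- delay S (i - 1))) = dimf G i" "dim_vec (funf G i (- delay S i)) = dimf G i"
    using b by (auto intro!: decomposition_facts(1)[OF i] simp: delay_interval_def)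
  show ?thesis
  proof (rule that[OF ij])
    fix u :: "real \<Rightarrow> real^'n" assume u: "continuous_on {- max_delay S..0} u"
    show "zeta (ch u) $ a = (\<Sum>k<dimf G i. minv (cholF G i) $$ (j, k) * ip (II i) (\<lambda>\<tau>. funf G i \<tau> $ k) (yh u l))"
      unfolding zeta_def s embed_Hc[OF i] Fc_def using c(1) ij(3)
      by (subst mult_mat_vec_index) (auto simp: cvec_def)
    let ?m = "minv (cholF G i)"
    have F: "F_col i \<tau> *\<^sub>v Matrix.vec 1 (\<lambda>_. y) = ?m *\<^sub>v (y \<cdot>\<^sub>v funf G i \<tau>)" if "dim_vec (funf G i \<tau>) = dimf G i" for \<tau> y
    proof -
      have 1: "mat_of_cols (dimf G i) [funf G i \<tau>] *\<^sub>v Matrix.vec 1 (\<lambda>_. y) = y \<cdot>\<^sub>v funf G i \<tau>"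
        using that by (intro eq_vecI) (auto simp: scalar_prod_def mat_of_cols_def)
      show ?thesis unfolding F_col_def
        using assoc_mult_mat_vec[OF c(1), of "mat_of_cols (dimf G i) [funf G i \<tau>]" 1 "Matrix.vec 1 (\<lambda>_. y)"] 1
        mat_of_cols_carrier(1)[of "dimf G i" "[funf G i \<tau>]"] vec_carrier[of 1 "\<lambda>_. y"] by simp
    qed
    have hc: "cvec (II i) (dimh G i) (funh G i) (yh u l) \<in> carrier_vec (dimh G i)" by (rule cvec_carrier)
    have y: "L2_on (II i) (yh u l)" by (rule yh_L2[OF u i ij(2)])
    have LH: "cholH G i *\<^sub>v Hc i (yh u l) = cvec (II i) (dimh G i) (funh G i) (yh u l)"
      unfolding Hc_def using assoc_mult_mat_vec[OF c(4,3) hc] c(10) hc by simp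
    have Mc: "M_col i *\<^sub>v Hc i (yh u l) = ?m *\<^sub>v cvec (II i) (dimf G i) (\<lambda>\<tau>. matM G i *\<^sub>v funh G i \<tau>) (yh u l)"
      unfolding M_col_def cvec_mult[OF f(3) M y]
      using assoc_mult_mat_vec[OF mult_carrier_mat[OF c(1) M] c(4), of "Hc i (yh u l)"] assoc_mult_mat_vec[OF c(1) M hc]
        mult_mat_vec_carrier[OF c(3) hc] LH by (simp add: Hc_def)
    show "zeta_dot (yd u) (ch u) $ a = (\<Sum>k<dimf G i. ?m $$ (j, k) *
        (funf G i (- delay S (i - 1)) $ k * yh u l (- delay S (i - 1)) - funf G i (- delay S i) $ k * yh u l (- delay S i)
         - ip (II i) (\<lambda>\<tau>. (matM G i *\<^sub>v funh G i \<tau>) $ k) (yh u l)))"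
    proof -
      let ?v1 = "yd u (i - 1) l \<cdot>\<^sub>v funf G i (- delay S (i - 1))" and ?v2 = "yd u i l \<cdot>\<^sub>v funf G i (- delay S i)"
      let ?v3 = "cvec (II i) (dimf G i) (\<lambda>\<tau>. matM G i *\<^sub>v funh G i \<tau>) (yh u l)"
      have d: "dim_row ?m = dimf G i" "dim_col ?m = dimf G i" using c(1) by auto
      have dv: "dim_vec ?v1 = dimf G i" "dim_vec ?v2 = dimf G i" "dim_vec ?v3 = dimf G i" using fdim by simp_all
      have m: "(?m *\<^sub>v v) $ j = (\<Sum>k<dimf G i. ?m $$ (j, k) * v $ k)" if "dim_vec v = dimf G i" for v
        using mult_mat_vec_index[of j ?m v] that d ij(3) by (simp only:)
      have "zeta_dot (yd u) (ch u) $ a = (?m *\<^sub>v ?v1) $ j - ((?m *\<^sub>v ?v2) $ j + (?m *\<^sub>v ?v3) $ j)"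
        unfolding zeta_dot_def s Mc F[OF fdim(1)] F[OF fdim(2)]
        using d ij(3) by (simp del: index_mult_mat_vec)
      also have "\<dots> = (\<Sum>k<dimf G i. ?m $$ (j, k) * (?v1 $ k - ?v2 $ k - ?v3 $ k))"
        unfolding m[OF dv(1)] m[OF dv(2)] m[OF dv(3)] by (simp only: sum.distrib[symmetric] sum_subtractf[symmetric] algebra_simps)
      also have "\<dots> = (\<Sum>k<dimf G i. ?m $$ (j, k) *
        (funf G i (- delay S (i - 1)) $ k * yh u l (- delay S (i - 1)) - funf G i (- delay S i) $ k * yh u l (- delay S i)
         - ip (II i) (\<lambda>\<tau>. (matM G i *\<^sub>v funh G i \<tau>) $ k) (yh u l)))"
        by (rule sum.cong[OF refl]) (simp add: fdim yh_def cvec_def mult.commute del: index_mult_mat_vec One_nat_def)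
      finally show ?thesis .
    qed
  qed
qed

definition eta :: "(real \<Rightarrow> real^'n) \<Rightarrow> real Matrix.vec" where
  "eta u = Matrix.vec CARD('n) (ycomp (u 0)) @\<^sub>v zeta (ch u)"

definition Pfull :: "real mat" where
  "Pfull = four_block_mat (varP1 U) (varP2 U) ((varP2 U)\<^sup>T) (varP3 U)"

text \<open>Kept bilinear in two functions, so that continuous differentiability can be obtained
  from bounded bilinearity; the functional itself takes the same function twice.\<close>

definition Vint :: "nat \<Rightarrow> nat \<Rightarrow> nat \<Rightarrow> (real \<Rightarrow> real^'n) \<Rightarrow> (real \<Rightarrow> real^'n) \<Rightarrow> real" where
  "Vint i l m u v = (LINT \<tau>:II i|lebesgue. (varQ U i $$ (l, m) + (\<tau> + delay S i) * varR U i $$ (l, m)) * (yh u l \<tau> * yh v m \<tau>))"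

abbreviation "Neta \<equiv> CARD('n) + total_dim S (dimf G) * CARD('n)"

text \<open>The functional of the overview, written out in scalar entries so that it can be
  differentiated and bounded term by term.\<close>

definition Vfun :: "(real \<Rightarrow> real^'n) \<Rightarrow> real" where
  "Vfun u = (\<Sum>a<Neta. \<Sum>b<Neta. Pfull $$ (a, b) * (eta u $ a * eta u $ b))
     + (\<Sum>i=1..num_delays S. \<Sum>l<CARD('n). \<Sum>m<CARD('n). Vint i l m u u)"

lemma bounded_ycomp:
  assumes "\<And>t. norm (\<xi> t) \<le> B" "l < CARD('n)"
  shows "\<exists>C. \<forall>t. \<bar>ycomp (\<xi> t) l\<bar> \<le> C"
proof -
  obtain K where K: "0 \<le> K" "\<And>x. norm (ycomp x l) \<le> norm x * K"
    using bounded_linear.nonneg_bounded[OF bounded_linear_ycomp[OF assms(2)]] by blast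
  have "\<bar>ycomp (\<xi> t) l\<bar> \<le> B * K" for t
    using K(2)[of "\<xi> t"] mult_right_mono[OF assms(1)[of t] K(1)] by simp
  then show ?thesis by blast
qed

lemma moving_coefficient:
  fixes \<xi> :: "real \<Rightarrow> real^'n"
  assumes \<xi>: "continuous_on UNIV \<xi>" "\<And>t. norm (\<xi> t) \<le> B"
    and i: "i \<in> {1..num_delays S}" and k: "k < dimf G i" and l: "l < CARD('n)"
  defines "u \<equiv> \<lambda>t \<tau>. \<xi> (t + \<tau>)"
  shows "((\<lambda>t. ip (II i) (\<lambda>\<tau>. funf G i \<tau> $ k) (yh (u t) l)) has_real_derivative
     funf G i (- delay S (i - 1)) $ k * yh (u t) l (- delay S (i - 1)) - funf G i (- delay S i) $ k * yh (u t) l (- delay S i)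
         - ip (II i) (\<lambda>\<tau>. (matM G i *\<^sub>v funh G i \<tau>) $ k) (yh (u t) l)) (at t)"
    and "abs_cont_on p q (\<lambda>t. ip (II i) (\<lambda>\<tau>. funf G i \<tau> $ k) (yh (u t) l))"
proof -
  note b = delay_bounds[OF i] and f = families[OF i]
  have M: "matM G i \<in> carrier_mat (dimf G i) (dimh G i)" by (rule decomposition_facts(7)[OF i])
  obtain C where C: "\<And>t. \<bar>ycomp (\<xi> t) l\<bar> \<le> C" using bounded_ycomp[of \<xi> B l, OF \<xi>(2) l] by auto
  have y: "continuous_on UNIV (\<lambda>t. ycomp (\<xi> t) l)" by (rule bounded_linear.continuous_on[OF bounded_linear_ycomp[OF l] \<xi>(1)])
  have g: "L2_on (II i) (\<lambda>\<tau>. (matM G i *\<^sub>v funh G i \<tau>) $ k)"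
    using L2_family_mult[OF f(3) M] k by (simp add: L2_family_def)
  have g': "set_integrable lebesgue {- delay S i..- delay S (i - 1)} (\<lambda>\<tau>. (matM G i *\<^sub>v funh G i \<tau>) $ k)"
    using L2_on_mult[OF g, of "\<lambda>_. 1"] L2_on_continuous[of "- delay S i" "- delay S (i - 1)" "\<lambda>_. 1"] by (simp add: II_eq)
  have fk: "continuous_on {- delay S i..- delay S (i - 1)} (\<lambda>\<tau>. funf G i \<tau> $ k)"
    using decomposition_facts(4)[OF i k] by (simp add: W12_on_def)
  have ab: "- delay S i < - delay S (i - 1)" using b by simp
  note m = ab fk g' decomposition_facts(8)[OF i k] y C
  show "((\<lambda>t. ip (II i) (\<lambda>\<tau>. funf G i \<tau> $ k) (yh (u t) l)) has_real_derivative
     funf G i (- delay S (i - 1)) $ k * yh (u t) l (- delay S (i - 1)) - funf G i (- delay S i) $ k * yh (u t) l (- delay S i)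
         - ip (II i) (\<lambda>\<tau>. (matM G i *\<^sub>v funh G i \<tau>) $ k) (yh (u t) l)) (at t)"
    unfolding ip_def yh_def u_def II_eq by (rule DERIV_moving_integral[OF m])
  show "abs_cont_on p q (\<lambda>t. ip (II i) (\<lambda>\<tau>. funf G i \<tau> $ k) (yh (u t) l))"
    unfolding ip_def yh_def u_def II_eq by (rule abs_cont_on_moving_integral[OF m])
qed

text \<open>The weight has derivative \<open>R_i\<close>, value \<open>Q_i\<close> at the older end
  of the interval and \<open>Q_i\<close> plus the interval length times \<open>R_i\<close> at the
  newer end.\<close>

lemma moving_Vint:
  fixes \<xi> :: "real \<Rightarrow> real^'n"
  assumes \<xi>: "continuous_on UNIV \<xi>" "\<And>t. norm (\<xi> t) \<le> B"
    and i: "i \<in> {1..num_delays S}" and l: "l < CARD('n)" and m: "m < CARD('n)"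
  defines "u \<equiv> \<lambda>t \<tau>. \<xi> (t + \<tau>)"
  shows "((\<lambda>t. Vint i l m (u t) (u t)) has_real_derivative
     (varQ U i $$ (l, m) + (delay S i - delay S (i - 1)) * varR U i $$ (l, m)) * (yh (u t) l (- delay S (i - 1)) * yh (u t) m (- delay S (i - 1)))
     - varQ U i $$ (l, m) * (yh (u t) l (- delay S i) * yh (u t) m (- delay S i))
     - varR U i $$ (l, m) * ip (II i) (yh (u t) l) (yh (u t) m)) (at t)"
    and "abs_cont_on p q (\<lambda>t. Vint i l m (u t) (u t))"
proof -
  note b = delay_bounds[OF i]
  obtain C where C: "\<And>t. \<bar>ycomp (\<xi> t) l\<bar> \<le> C" using bounded_ycomp[of \<xi> B l, OF \<xi>(2) l] by auto
  obtain D where D: "\<And>t. \<bar>ycomp (\<xi> t) m\<bar> \<le> D" using bounded_ycomp[of \<xi> B m, OF \<xi>(2) m] by auto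
  have y: "continuous_on UNIV (\<lambda>t. ycomp (\<xi> t) l * ycomp (\<xi> t) m)"
    by (intro continuous_intros bounded_linear.continuous_on[OF bounded_linear_ycomp \<xi>(1)] l m)
  have CD: "\<bar>ycomp (\<xi> t) l * ycomp (\<xi> t) m\<bar> \<le> C * D" for t
    unfolding abs_mult by (rule mult_mono[OF C D]) (use C[of t] in auto)
  let ?f = "\<lambda>\<tau>. varQ U i $$ (l, m) + (\<tau> + delay S i) * varR U i $$ (l, m)" and ?R = "varR U i $$ (l, m)"
  have ab: "- delay S i < - delay S (i - 1)" using b by simp
  have w: "weak_derivative_on (- delay S i) (- delay S (i - 1)) ?f (\<lambda>_. ?R)"
    by (rule weak_derivative_C1[OF ab]) (auto intro!: derivative_eq_intros)
  have f: "continuous_on {- delay S i..- delay S (i - 1)} ?f" by (intro continuous_intros)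
  have g: "set_integrable lebesgue {- delay S i..- delay S (i - 1)} (\<lambda>_. ?R)"
    by (rule absolutely_integrable_continuous_real) (rule continuous_on_const)
  note mv = ab f g w y CD
  show "((\<lambda>t. Vint i l m (u t) (u t)) has_real_derivative
     (varQ U i $$ (l, m) + (delay S i - delay S (i - 1)) * ?R) * (yh (u t) l (- delay S (i - 1)) * yh (u t) m (- delay S (i - 1)))
     - varQ U i $$ (l, m) * (yh (u t) l (- delay S i) * yh (u t) m (- delay S i))
     - ?R * ip (II i) (yh (u t) l) (yh (u t) m)) (at t)"
    unfolding Vint_def yh_def u_def II_eq
    by (rule DERIV_cong[OF DERIV_moving_integral[OF mv, of t]]) (simp add: ip_def add.commute del: One_nat_def)
  show "abs_cont_on p q (\<lambda>t. Vint i l m (u t) (u t))"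
    unfolding Vint_def yh_def u_def II_eq by (rule abs_cont_on_moving_integral[OF mv])
qed

definition eta_dot :: "(real \<Rightarrow> real^'n) \<Rightarrow> real^'n \<Rightarrow> real Matrix.vec" where
  "eta_dot u x' = Matrix.vec CARD('n) (ycomp x') @\<^sub>v zeta_dot (yd u) (ch u)"

lemma moving_eta:
  fixes \<xi> :: "real \<Rightarrow> real^'n"
  assumes \<xi>: "continuous_on UNIV \<xi>" "\<And>t. norm (\<xi> t) \<le> B" and a: "a < Neta"
  shows "(\<xi> has_vector_derivative x') (at t) \<Longrightarrow>
      ((\<lambda>t. eta (\<lambda>\<tau>. \<xi> (t + \<tau>)) $ a) has_real_derivative eta_dot (\<lambda>\<tau>. \<xi> (t + \<tau>)) x' $ a) (at t)"
    and "abs_cont_on p q \<xi> \<Longrightarrow> abs_cont_on p q (\<lambda>t. eta (\<lambda>\<tau>. \<xi> (t + \<tau>)) $ a)"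
proof -
  have c: "continuous_on A (\<lambda>\<tau>. \<xi> (t + \<tau>))" for A t
    by (rule continuous_on_compose2[OF \<xi>(1)]) (auto intro!: continuous_intros)
  have "((\<xi> has_vector_derivative x') (at t) \<longrightarrow>
      ((\<lambda>t. eta (\<lambda>\<tau>. \<xi> (t + \<tau>)) $ a) has_real_derivative eta_dot (\<lambda>\<tau>. \<xi> (t + \<tau>)) x' $ a) (at t)) \<and>
     (abs_cont_on p q \<xi> \<longrightarrow> abs_cont_on p q (\<lambda>t. eta (\<lambda>\<tau>. \<xi> (t + \<tau>)) $ a))"
  proof (cases "a < CARD('n)")
    case True
    then have "eta u $ a = ycomp (u 0) a" "eta_dot u x' $ a = ycomp x' a" for u
      by (simp_all add: eta_def eta_dot_def zeta_dims)
    then show ?thesis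
      using bounded_linear.has_vector_derivative[OF bounded_linear_ycomp[OF True], of \<xi> x'] abs_cont_on_bounded_linear[OF _ bounded_linear_ycomp[OF True], of p q \<xi>]
      by (simp add: has_real_derivative_iff_has_vector_derivative)
  next
    case False
    then have "a - CARD('n) < total_dim S (dimf G) * CARD('n)" using a by simp
    then obtain i l j where ij: "i \<in> {1..num_delays S}" "l < CARD('n)" "j < dimf G i"
      and z: "\<And>u. continuous_on {- max_delay S..0} u \<Longrightarrow>
      zeta (ch u) $ (a - CARD('n)) = (\<Sum>k<dimf G i. minv (cholF G i) $$ (j, k) * ip (II i) (\<lambda>\<tau>. funf G i \<tau> $ k) (yh u l))"
      and zd: "\<And>u. continuous_on {- max_delay S..0} u \<Longrightarrow>
      zeta_dot (yd u) (ch u) $ (a - CARD('n)) = (\<Sum>k<dimf G i. minv (cholF G i) $$ (j, k) *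
        (funf G i (- delay S (i - 1)) $ k * yh u l (- delay S (i - 1)) - funf G i (- delay S i) $ k * yh u l (- delay S i)
         - ip (II i) (\<lambda>\<tau>. (matM G i *\<^sub>v funh G i \<tau>) $ k) (yh u l)))"
      by (rule zeta_entries) blast
    have e: "eta (\<lambda>\<tau>. \<xi> (t + \<tau>)) $ a = (\<Sum>k<dimf G i. minv (cholF G i) $$ (j, k) * ip (II i) (\<lambda>\<tau>. funf G i \<tau> $ k) (yh (\<lambda>\<tau>. \<xi> (t + \<tau>)) l))" for t
      using False a z[OF c] by (simp add: eta_def zeta_dims)
    have ed: "eta_dot (\<lambda>\<tau>. \<xi> (t + \<tau>)) x' $ a = zeta_dot (yd (\<lambda>\<tau>. \<xi> (t + \<tau>))) (ch (\<lambda>\<tau>. \<xi> (t + \<tau>))) $ (a - CARD('n))"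
      using False a by (simp add: eta_dot_def zeta_dims)
    show ?thesis unfolding e ed zd[OF c]
      using moving_coefficient[OF \<xi> ij(1) _ ij(2)]
      by (intro conjI impI DERIV_sum DERIV_cmult abs_cont_on_sum abs_cont_on_cmult) auto
  qed
  then show "(\<xi> has_vector_derivative x') (at t) \<Longrightarrow>
      ((\<lambda>t. eta (\<lambda>\<tau>. \<xi> (t + \<tau>)) $ a) has_real_derivative eta_dot (\<lambda>\<tau>. \<xi> (t + \<tau>)) x' $ a) (at t)"
    and "abs_cont_on p q \<xi> \<Longrightarrow> abs_cont_on p q (\<lambda>t. eta (\<lambda>\<tau>. \<xi> (t + \<tau>)) $ a)" by auto
qed

text \<open>An explicit expression in the segment and a candidate derivative \<open>x'\<close>, so
  that the dissipation inequality can be proved for every continuous segment before any trajectory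
  is considered.\<close>

definition Vdot :: "(real \<Rightarrow> real^'n) \<Rightarrow> real^'n \<Rightarrow> real" where
  "Vdot u x' = (\<Sum>a<Neta. \<Sum>b<Neta. Pfull $$ (a, b) * (eta_dot u x' $ a * eta u $ b + eta_dot u x' $ b * eta u $ a))
     + (\<Sum>i=1..num_delays S. \<Sum>l<CARD('n). \<Sum>m<CARD('n).
         (varQ U i $$ (l, m) + (delay S i - delay S (i - 1)) * varR U i $$ (l, m)) * (yh u l (- delay S (i - 1)) * yh u m (- delay S (i - 1)))
     - varQ U i $$ (l, m) * (yh u l (- delay S i) * yh u m (- delay S i))
     - varR U i $$ (l, m) * ip (II i) (yh u l) (yh u m))"

lemma moving_Vfun:
  fixes \<xi> :: "real \<Rightarrow> real^'n"
  assumes \<xi>: "continuous_on UNIV \<xi>" "\<And>t. norm (\<xi> t) \<le> B"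
  shows "(\<xi> has_vector_derivative x') (at t) \<Longrightarrow>
      ((\<lambda>t. Vfun (\<lambda>\<tau>. \<xi> (t + \<tau>))) has_real_derivative Vdot (\<lambda>\<tau>. \<xi> (t + \<tau>)) x') (at t)"
    and "abs_cont_on p q \<xi> \<Longrightarrow> abs_cont_on p q (\<lambda>t. Vfun (\<lambda>\<tau>. \<xi> (t + \<tau>)))"
  unfolding Vfun_def Vdot_def
  by (intro DERIV_add DERIV_sum DERIV_cmult DERIV_mult moving_eta[OF \<xi>] moving_Vint[OF \<xi>]; simp)
    (intro abs_cont_on_add abs_cont_on_sum abs_cont_on_cmult abs_cont_on_mult moving_eta[OF \<xi>] moving_Vint[OF \<xi>]; simp)

end

subsection \<open>The dissipation inequality\<close>

lemma quad_sum:
  fixes A :: "real mat"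
  assumes "A \<in> carrier_mat N N" "dim_vec v = N" "dim_vec u = N"
  shows "v \<bullet> (A *\<^sub>v u) = (\<Sum>a<N. \<Sum>b<N. A $$ (a, b) * (v $ a * u $ b))"
proof -
  have d: "dim_row A = N" "dim_col A = N" using assms(1) by auto
  have i: "(A *\<^sub>v u) $ a = (\<Sum>b<N. A $$ (a, b) * u $ b)" if "a < N" for a
    using mult_mat_vec_index[of a A u] that assms(3) d by (simp only:)
  have "v \<bullet> (A *\<^sub>v u) = (\<Sum>a<N. v $ a * (A *\<^sub>v u) $ a)"
    unfolding scalar_prod_def dim_mult_mat_vec d atLeast0LessThan ..
  also have "\<dots> = (\<Sum>a<N. \<Sum>b<N. A $$ (a, b) * (v $ a * u $ b))"
    by (intro sum.cong refl) (simp add: i sum_distrib_left algebra_simps del: index_mult_mat_vec)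
  finally show ?thesis .
qed

context synthesis
begin

lemma delay_0: "delay S 0 = 0"
  using valid_S by (simp add: valid_system_def)

lemma eta_dims: "dim_vec (eta u) = Neta" "dim_vec (eta_dot u x') = Neta"
  by (simp_all add: eta_def eta_dot_def zeta_dims)

lemma Pfull_carrier: "Pfull \<in> carrier_mat Neta Neta"
  unfolding Pfull_def using decision_carriers(2,3) by simp

lemma P2_transpose_carrier: "(varP2 U)\<^sup>T \<in> carrier_mat (total_dim S (dimf G) * CARD('n)) CARD('n)"
  using decision_facts(3) by simp

lemma Pfull_symmetric: "Pfull\<^sup>T = Pfull"
  unfolding Pfull_def using transpose_four_block_mat[OF decision_carriers(2) decision_facts(3) P2_transpose_carrier decision_carriers(3)]
    decision_facts(2,4) by (simp add: symmetric_mats_def)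

lemma Pfull_forms:
  "(\<Sum>a<Neta. \<Sum>b<Neta. Pfull $$ (a, b) * (eta_dot u x' $ a * eta u $ b + eta_dot u x' $ b * eta u $ a))
    = 2 * (Matrix.vec CARD('n) (ycomp x') \<bullet> (varP1 U *\<^sub>v Matrix.vec CARD('n) (ycomp (u 0)) + varP2 U *\<^sub>v zeta (ch u)))
    + 2 * (Matrix.vec CARD('n) (ycomp (u 0)) \<bullet> (varP2 U *\<^sub>v zeta_dot (yd u) (ch u)) + zeta (ch u) \<bullet> (varP3 U *\<^sub>v zeta_dot (yd u) (ch u)))"
proof -
  let ?x = "Matrix.vec CARD('n) (ycomp x')" and ?y = "Matrix.vec CARD('n) (ycomp (u 0))" and ?z = "zeta (ch u)" and ?d = "zeta_dot (yd u) (ch u)"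
  let ?D = "total_dim S (dimf G) * CARD('n)"
  have c: "?x \<in> carrier_vec CARD('n)" "?y \<in> carrier_vec CARD('n)" by (rule vec_carrier)+
  have cz: "?z \<in> carrier_vec ?D" "?d \<in> carrier_vec ?D" by (rule carrier_vecI, rule zeta_dims)+
  have ec: "eta u \<in> carrier_vec Neta" "eta_dot u x' \<in> carrier_vec Neta" by (rule carrier_vecI, rule eta_dims)+
  note P = decision_carriers(2) decision_facts(3) P2_transpose_carrier decision_carriers(3)
  have "(\<Sum>a<Neta. \<Sum>b<Neta. Pfull $$ (a, b) * (eta_dot u x' $ a * eta u $ b + eta_dot u x' $ b * eta u $ a))
     = eta_dot u x' \<bullet> (Pfull *\<^sub>v eta u) + eta u \<bullet> (Pfull *\<^sub>v eta_dot u x')"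
    unfolding quad_sum[OF Pfull_carrier eta_dims(2,1)] quad_sum[OF Pfull_carrier eta_dims(1,2)]
    by (simp only: distrib_left sum.distrib mult.commute[of "eta u $ _" "eta_dot u x' $ _"])
  also have "eta u \<bullet> (Pfull *\<^sub>v eta_dot u x') = eta_dot u x' \<bullet> (Pfull *\<^sub>v eta u)"
    by (rule symmetric_form[OF Pfull_symmetric Pfull_carrier ec])
  also have "eta_dot u x' \<bullet> (Pfull *\<^sub>v eta u) = (?x @\<^sub>v ?d) \<bullet> ((varP1 U *\<^sub>v ?y + varP2 U *\<^sub>v ?z) @\<^sub>v ((varP2 U)\<^sup>T *\<^sub>v ?y + varP3 U *\<^sub>v ?z))"
    unfolding eta_def eta_dot_def Pfull_def four_block_mat_mult_vec[OF P c(2) cz(1)] ..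
  also have "\<dots> = ?x \<bullet> (varP1 U *\<^sub>v ?y + varP2 U *\<^sub>v ?z) + ?d \<bullet> ((varP2 U)\<^sup>T *\<^sub>v ?y + varP3 U *\<^sub>v ?z)"
    by (rule scalar_prod_append[OF c(1) cz(2)
        add_carrier_vec[OF mult_mat_vec_carrier[OF P(1) c(2)] mult_mat_vec_carrier[OF P(2) cz(1)]]
        add_carrier_vec[OF mult_mat_vec_carrier[OF P(3) c(2)] mult_mat_vec_carrier[OF P(4) cz(1)]]])
  also have "?d \<bullet> ((varP2 U)\<^sup>T *\<^sub>v ?y + varP3 U *\<^sub>v ?z) = ?y \<bullet> (varP2 U *\<^sub>v ?d) + ?z \<bullet> (varP3 U *\<^sub>v ?d)"
    using scalar_prod_add_distrib[OF cz(2) mult_mat_vec_carrier[OF P(3) c(2)] mult_mat_vec_carrier[OF P(4) cz(1)]]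
      transpose_form[OF decision_facts(3) cz(2) c(2)] symmetric_form[OF _ P(4) cz(2,1)] decision_facts(4)
    by (simp add: symmetric_mats_def)
  finally show ?thesis by simp
qed

lemma QR_nonneg:
  assumes "i \<in> {1..num_delays S}" "v \<in> carrier_vec CARD('n)"
  shows "0 \<le> v \<bullet> (varQ U i *\<^sub>v v)" "0 \<le> v \<bullet> (varR U i *\<^sub>v v)"
proof -
  have "pos_def (diag_block_mat (map (varQ U) (idx1 S)))" "pos_def (diag_block_mat (map (varR U) (idx1 S)))"
    using feas by (auto simp: feasible_def)
  moreover have "i \<in> set (idx1 S)" "distinct (idx1 S)" "\<And>i. i \<in> set (idx1 S) \<Longrightarrow> i \<in> {1..num_delays S}"
    using assms(1) unfolding set_idx1 by (simp_all add: idx1_def del: upt_Suc)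
  moreover have "(varQ U i)\<^sup>T = varQ U i" "(varR U i)\<^sup>T = varR U i"
    using decision_facts(6,7)[OF assms(1)] by (simp_all add: symmetric_mats_def)
  ultimately have "pos_def (varQ U i)" "pos_def (varR U i)"
    using pos_def_diag_block[of "varQ U" "idx1 S" "CARD('n)" i] pos_def_diag_block[of "varR U" "idx1 S" "CARD('n)" i] decision_carriers(4,5)
    by blast+
  then show "0 \<le> v \<bullet> (varQ U i *\<^sub>v v)" "0 \<le> v \<bullet> (varR U i *\<^sub>v v)"
    using pos_def_nonneg[of "varQ U i" "CARD('n)" v] pos_def_nonneg[of "varR U i" "CARD('n)" v] decision_carriers(4,5)[OF assms(1)] assms(2) by auto
qed

lemma yh_eq_yd: "yh u l (- delay S i) = yd u i l"
  by (simp add: yh_def)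

text \<open>The only loss is Bessel's inequality for the integrals of \<open>y^T R_i y\<close>. The
  form of \<open>J3\<close> is added back because \<open>Xi_form\<close> subtracts it.\<close>

lemma Vdot_le:
  assumes u: "continuous_on {- max_delay S..0} u" and w: "dim_vec w = CARD('q)"
  shows "Vdot u x' \<le> 2 * (Matrix.vec CARD('n) (ycomp x') \<bullet> (varP1 U *\<^sub>v Matrix.vec CARD('n) (yd u 0) + varP2 U *\<^sub>v zeta (ch u)))
    + 2 * (Matrix.vec CARD('n) (yd u 0) \<bullet> (varP2 U *\<^sub>v zeta_dot (yd u) (ch u)) + zeta (ch u) \<bullet> (varP3 U *\<^sub>v zeta_dot (yd u) (ch u)))
    + Xi_form (yd u) (ch u) (ce u) w + w \<bullet> (J3 J *\<^sub>v w)"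
proof -
  let ?n = "CARD('n)" and ?Y = "\<lambda>i. Matrix.vec CARD('n) (yd u i)"
  have i: "(\<Sum>l<?n. \<Sum>m<?n.
         (varQ U i $$ (l, m) + (delay S i - delay S (i - 1)) * varR U i $$ (l, m)) * (yh u l (- delay S (i - 1)) * yh u m (- delay S (i - 1)))
     - varQ U i $$ (l, m) * (yh u l (- delay S i) * yh u m (- delay S i))
     - varR U i $$ (l, m) * ip (II i) (yh u l) (yh u m))
    \<le> ?Y (i - 1) \<bullet> (varQ U i *\<^sub>v ?Y (i - 1)) + (delay S i - delay S (i - 1)) * (?Y (i - 1) \<bullet> (varR U i *\<^sub>v ?Y (i - 1)))
      - ?Y i \<bullet> (varQ U i *\<^sub>v ?Y i)
        - (\<Sum>k<dimh G i. Matrix.vec CARD('n) (\<lambda>l. ch u i l $ k) \<bullet> (varR U i *\<^sub>v Matrix.vec CARD('n) (\<lambda>l. ch u i l $ k)))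
        - (\<Sum>k<dimphi G i. Matrix.vec CARD('n) (\<lambda>l. ce u i l $ k) \<bullet> (varR U i *\<^sub>v Matrix.vec CARD('n) (\<lambda>l. ce u i l $ k)))"
    if i: "i \<in> {1..num_delays S}" for i
  proof -
    note Q = decision_carriers(4)[OF i] and R = decision_carriers(5)[OF i]
    have q: "?Y j \<bullet> (A *\<^sub>v ?Y j) = (\<Sum>l<?n. \<Sum>m<?n. A $$ (l, m) * (yh u l (- delay S j) * yh u m (- delay S j)))"
      if "A \<in> carrier_mat ?n ?n" for A j
      unfolding yh_eq_yd using quad_sum[OF that, of "?Y j" "?Y j"] by simp
    have "(\<Sum>k<dimh G i. Matrix.vec CARD('n) (\<lambda>l. ch u i l $ k) \<bullet> (varR U i *\<^sub>v Matrix.vec CARD('n) (\<lambda>l. ch u i l $ k)))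
        + (\<Sum>k<dimphi G i. Matrix.vec CARD('n) (\<lambda>l. ce u i l $ k) \<bullet> (varR U i *\<^sub>v Matrix.vec CARD('n) (\<lambda>l. ce u i l $ k)))
       \<le> (\<Sum>l<?n. \<Sum>m<?n. varR U i $$ (l, m) * ip (II i) (yh u l) (yh u m))"
      by (rule bessel_HE(1)[OF i R]) (rule QR_nonneg(2)[OF i] yh_L2[OF u i], assumption)+
    then show ?thesis
      unfolding q[OF Q] q[OF R] sum_distrib_left
      unfolding sum_subtractf sum.distrib distrib_right mult.assoc by linarith
  qed
  have "Vdot u x' \<le> 2 * (Matrix.vec CARD('n) (ycomp x') \<bullet> (varP1 U *\<^sub>v Matrix.vec CARD('n) (ycomp (u 0)) + varP2 U *\<^sub>v zeta (ch u)))
    + 2 * (Matrix.vec CARD('n) (ycomp (u 0)) \<bullet> (varP2 U *\<^sub>v zeta_dot (yd u) (ch u)) + zeta (ch u) \<bullet> (varP3 U *\<^sub>v zeta_dot (yd u) (ch u)))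
    + (Xi_form (yd u) (ch u) (ce u) w + w \<bullet> (J3 J *\<^sub>v w))"
    unfolding Vdot_def Pfull_forms Xi_form_def sum_list_idx1 diff_add_cancel
    by (rule add_left_mono) (rule sum_mono, rule i)
  then show ?thesis by (simp add: delay_0)
qed

definition Nsq :: "real^'n \<Rightarrow> real" where
  "Nsq \<xi> = (\<Sum>l<CARD('n). (ycomp \<xi> l)\<^sup>2)"

text \<open>The entries at \<open>CARD('n) + l\<close> are recorded because they hold the undelayed
  \<open>y\<close>, right after the part for its derivative, and the decay margin is to be measured
  there.\<close>

lemma Vdot_le_lmi:
  assumes u: "continuous_on {- max_delay S..0} u"
  defines "N \<equiv> CARD('n) + (beta S G * CARD('n) + CARD('q) + CARD('m))"
  obtains \<chi> where "synthesis_lmi S G J \<alpha> U \<in> carrier_mat N N" "\<chi> \<in> carrier_vec N" "\<And>l. l < CARD('n) \<Longrightarrow> \<chi> $ (CARD('n) + l) = ycomp (u 0) l"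
    "Vdot u (state_rhs u w) - supply_rate J (output_rhs u w) w \<le> \<chi> \<bullet> (synthesis_lmi S G J \<alpha> U *\<^sub>v \<chi>)"
proof -
  let ?z = "output_rhs u w" and ?x = "Matrix.vec CARD('n) (ycomp (state_rhs u w))"
  let ?s = "- (minv (J1 J) *\<^sub>v (Jtilde J *\<^sub>v vec_of ?z))"
  let ?t = "theta (yd u) (ch u) (ce u) (vec_of w)"
  have ds: "dim_vec ?s = CARD('m)" using minv_works(1)[OF supply_facts(3,7)] by auto
  have z: "vec_of ?z = boldSigma S G U *\<^sub>v ?t" by (rule boldSigma_closed_loop[OF u, symmetric])
  note l = lmi_quadratic[where ch = "ch u" and yd = "yd u" and ce = "ce u" and w = "vec_of w" and s = ?s and u = ?x and z = "vec_of ?z", OF cvec_dims(1) dim_vec[of "CARD('n)" "ycomp (state_rhs u w)"] dim_vec_of[of w] ds z boldPi_closed_loop[OF u ds]]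
  let ?c = "?x @\<^sub>v (?t @\<^sub>v ?s)"
  show ?thesis
  proof (rule that)
    show "synthesis_lmi S G J \<alpha> U \<in> carrier_mat N N" unfolding N_def by (rule l(2))
    show "?c \<in> carrier_vec N" unfolding N_def by (rule l(3))
    show "?c $ (CARD('n) + l) = ycomp (u 0) l" if "l < CARD('n)" for l
      using that by (simp add: theta_splits(1) delay_0 dim_parts del: dim_stack dim_vconcat)
    show "Vdot u (state_rhs u w) - supply_rate J ?z w \<le> ?c \<bullet> (synthesis_lmi S G J \<alpha> U *\<^sub>v ?c)"
      using l(1) Vdot_le[OF u dim_vec_of[of w], of "state_rhs u w"] supply_rate_completion[of w ?z] by linarith
  qed
qed

text \<open>Strictness of the matrix inequality bounds the square of each entry of the test vector
  by a multiple of minus the form. Adding the bounds for the entries of \<open>y(t)\<close> gives a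
  margin independent of segment and disturbance.\<close>

lemma dissipation_rate:
  obtains \<epsilon> where "0 < \<epsilon>" "\<And>u w. continuous_on {- max_delay S..0} u \<Longrightarrow>
    Vdot u (state_rhs u w) - supply_rate J (output_rhs u w) w \<le> - \<epsilon> * Nsq (u 0)"
proof -
  let ?L = "synthesis_lmi S G J \<alpha> U" and ?N = "CARD('n) + (beta S G * CARD('n) + CARD('q) + CARD('m))"
  \<comment> \<open>Only the size of the matrix is extracted here; the zero segment and an arbitrary
    disturbance value serve as instances.\<close>
  have L: "?L \<in> carrier_mat ?N ?N" by (rule Vdot_le_lmi[of "\<lambda>_. 0" undefined, OF continuous_on_const])
  have nd: "pos_def (- ?L)" using feas by (simp add: feasible_def neg_def_def)
  have "\<exists>C>0. \<forall>v\<in>carrier_vec ?N. (v $ (CARD('n) + l))\<^sup>2 \<le> C * (v \<bullet> (- ?L *\<^sub>v v))" if "l < CARD('n)" for l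
  proof (rule pos_def_coord_bound[OF nd])
    show "- ?L \<in> carrier_mat ?N ?N" using L by simp
    show "CARD('n) + l < ?N" using that by (simp add: beta_def)
  qed
  then obtain C where C: "\<And>l. l < CARD('n) \<Longrightarrow> 0 < C l"
    "\<And>l v. l < CARD('n) \<Longrightarrow> v \<in> carrier_vec ?N \<Longrightarrow> (v $ (CARD('n) + l))\<^sup>2 \<le> C l * (v \<bullet> (- ?L *\<^sub>v v))"
    by metis
  let ?S = "\<Sum>l<CARD('n). C l"
  have S: "0 < ?S" using C(1) by (intro sum_pos) (auto simp: lessThan_empty_iff)
  show ?thesis
  proof (rule that[of "1 / ?S"])
    show "0 < 1 / ?S" using S by simp
    fix u :: "real \<Rightarrow> real^'n" and w :: "real^'q" assume u: "continuous_on {- max_delay S..0} u"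
    obtain \<chi> where x: "\<chi> \<in> carrier_vec ?N" "\<And>l. l < CARD('n) \<Longrightarrow> \<chi> $ (CARD('n) + l) = ycomp (u 0) l"
      "Vdot u (state_rhs u w) - supply_rate J (output_rhs u w) w \<le> \<chi> \<bullet> (?L *\<^sub>v \<chi>)"
      using Vdot_le_lmi[OF u, of w] by metis
    have "Nsq (u 0) \<le> (\<Sum>l<CARD('n). C l * - (\<chi> \<bullet> (?L *\<^sub>v \<chi>)))"
      unfolding Nsq_def using C(2)[OF _ x(1)] x(2) by (intro sum_mono) (simp add: neg_form[OF L x(1)])
    also have "\<dots> = - (\<chi> \<bullet> (?L *\<^sub>v \<chi>)) * ?S" by (simp only: sum_distrib_right mult.commute)
    finally have "Nsq (u 0) / ?S \<le> - (\<chi> \<bullet> (?L *\<^sub>v \<chi>))" by (simp only: pos_divide_le_eq[OF S])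
    then show "Vdot u (state_rhs u w) - supply_rate J (output_rhs u w) w \<le> - (1 / ?S) * Nsq (u 0)"
      using x(3) by simp
  qed
qed

end

lemma set_integral_nonneg_real:
  fixes f :: "real \<Rightarrow> real"
  assumes "\<And>t. t \<in> I \<Longrightarrow> 0 \<le> f t"
  shows "0 \<le> (LINT t:I|lebesgue. f t)"
  unfolding set_lebesgue_integral_def
  by (rule Bochner_Integration.integral_nonneg) (use assms in \<open>auto simp: indicator_def\<close>)

lemma set_integral_mono_subset:
  fixes f :: "real \<Rightarrow> real"
  assumes "set_integrable lebesgue I f" "set_integrable lebesgue I' f" "I \<subseteq> I'" "\<And>t. t \<in> I' \<Longrightarrow> 0 \<le> f t"
  shows "(LINT t:I|lebesgue. f t) \<le> (LINT t:I'|lebesgue. f t)"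
  unfolding set_lebesgue_integral_def
  by (rule integral_mono) (use assms in \<open>auto simp: set_integrable_def indicator_def\<close>)

lemma abs_mult_le_sum_squares:
  fixes f :: "nat \<Rightarrow> real"
  assumes "l < n" "m < n"
  shows "\<bar>f l * f m\<bar> \<le> (\<Sum>k<n. (f k)\<^sup>2)"
proof -
  have "(f l)\<^sup>2 \<le> (\<Sum>k<n. (f k)\<^sup>2)" "(f m)\<^sup>2 \<le> (\<Sum>k<n. (f k)\<^sup>2)"
    using assms by (auto intro!: member_le_sum)
  moreover have "2 * \<bar>f l * f m\<bar> \<le> (f l)\<^sup>2 + (f m)\<^sup>2"
    using sum_squares_bound[of "\<bar>f l\<bar>" "\<bar>f m\<bar>"] by (simp add: abs_mult)
  ultimately show ?thesis by linarith
qed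

section \<open>Lower and upper bounds of the functional\<close>

context synthesis
begin

lemma yh_product_integrable:
  assumes "continuous_on {- max_delay S..0} u" "i \<in> {1..num_delays S}" "l < CARD('n)" "m < CARD('n)" "continuous_on UNIV h"
  shows "set_integrable lebesgue (II i) (\<lambda>\<tau>. h \<tau> * (yh u l \<tau> * yh u m \<tau>))"
  unfolding II_eq
  by (rule absolutely_integrable_continuous_real, intro continuous_intros yh_continuous continuous_on_subset[OF assms(1)] continuous_on_subset[OF assms(5)])
    (use II_subset[OF assms(2)] assms(3,4) in \<open>auto simp: II_eq\<close>)

lemma Vint_split:
  assumes "continuous_on {- max_delay S..0} u" "i \<in> {1..num_delays S}" "l < CARD('n)" "m < CARD('n)"
  shows "Vint i l m u u = varQ U i $$ (l, m) * ip (II i) (yh u l) (yh u m)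
     + (LINT \<tau>:II i|lebesgue. varR U i $$ (l, m) * ((\<tau> + delay S i) * (yh u l \<tau> * yh u m \<tau>)))"
proof -
  have "Vint i l m u u = (LINT \<tau>:II i|lebesgue. varQ U i $$ (l, m) * (yh u l \<tau> * yh u m \<tau>)
      + (varR U i $$ (l, m) * (\<tau> + delay S i)) * (yh u l \<tau> * yh u m \<tau>))"
    unfolding Vint_def by (simp add: algebra_simps)
  also have "\<dots> = (LINT \<tau>:II i|lebesgue. varQ U i $$ (l, m) * (yh u l \<tau> * yh u m \<tau>))
      + (LINT \<tau>:II i|lebesgue. (varR U i $$ (l, m) * (\<tau> + delay S i)) * (yh u l \<tau> * yh u m \<tau>))"
    by (rule set_integral_add(2)) (rule yh_product_integrable[OF assms], intro continuous_intros)+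
  finally show ?thesis by (simp add: ip_def mult.assoc)
qed

lemma Vint_sum_lower:
  assumes u: "continuous_on {- max_delay S..0} u" and i: "i \<in> {1..num_delays S}"
  shows "(\<Sum>l<CARD('n). \<Sum>m<CARD('n). varQ U i $$ (l, m) * ip (II i) (yh u l) (yh u m)) \<le> (\<Sum>l<CARD('n). \<Sum>m<CARD('n). Vint i l m u u)"
proof -
  let ?n = "CARD('n)"
  let ?g = "\<lambda>l m \<tau>. varR U i $$ (l, m) * ((\<tau> + delay S i) * (yh u l \<tau> * yh u m \<tau>))"
  have g: "set_integrable lebesgue (II i) (?g l m)" if "l < ?n" "m < ?n" for l m
    using yh_product_integrable[OF u i that, of "\<lambda>\<tau>. varR U i $$ (l, m) * (\<tau> + delay S i)"]
    by (simp add: mult.assoc continuous_intros)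
  have "0 \<le> (LINT \<tau>:II i|lebesgue. \<Sum>l<?n. \<Sum>m<?n. ?g l m \<tau>)"
  proof (rule set_integral_nonneg_real)
    fix \<tau> assume \<tau>: "\<tau> \<in> II i"
    let ?v = "Matrix.vec ?n (\<lambda>l. yh u l \<tau>)"
    have "(\<Sum>l<?n. \<Sum>m<?n. ?g l m \<tau>) = (\<tau> + delay S i) * (?v \<bullet> (varR U i *\<^sub>v ?v))"
      using quad_sum[OF decision_carriers(5)[OF i], of ?v ?v]
      by (simp add: sum_distrib_left mult.left_commute)
    also have "\<dots> \<ge> 0"
      using \<tau> QR_nonneg(2)[OF i vec_carrier] by (simp add: II_eq)
    finally show "0 \<le> (\<Sum>l<?n. \<Sum>m<?n. ?g l m \<tau>)" .
  qed
  also have "\<dots> = (\<Sum>l<?n. \<Sum>m<?n. LINT \<tau>:II i|lebesgue. ?g l m \<tau>)"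
    by (subst set_integral_sum_real, (rule set_integrable_sum_real, rule g; simp),
        rule sum.cong[OF refl], rule set_integral_sum_real, rule g) simp_all
  finally show ?thesis using Vint_split[OF u i] by (simp add: sum.distrib)
qed

lemma eta_index: "l < CARD('n) \<Longrightarrow> eta u $ l = ycomp (u 0) l"
  by (simp add: eta_def zeta_dims)

lemma zeta_eq_stack: "zeta (ch u) = stack CARD('n) (dimf G) (\<lambda>i l. Fc i (yh u l)) (idx1 S)"
  unfolding zeta_def by (rule stack_cong) (simp_all add: embed_Hc set_idx1)

lemma Vfun_eq: "Vfun u = eta u \<bullet> (Pfull *\<^sub>v eta u) + (\<Sum>i=1..num_delays S. \<Sum>l<CARD('n). \<Sum>m<CARD('n). Vint i l m u u)"
  unfolding Vfun_def quad_sum[OF Pfull_carrier eta_dims(1,1)] ..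

text \<open>The block matrix \<open>E\<close> is what makes \<open>Pfull + E\<close> positive
  definite. Its form at \<open>eta u\<close> is at most the integral part of the functional, by
  Bessel's inequality for the \<open>f_i\<close> with weight \<open>Q_i\<close>.\<close>

lemma Vfun_lower:
  obtains C where "0 < C" "\<And>u. continuous_on {- max_delay S..0} u \<Longrightarrow> Nsq (u 0) \<le> C * Vfun u"
proof -
  let ?n = "CARD('n)" and ?D = "total_dim S (dimf G) * CARD('n)"
  let ?B = "diag_block_mat (map (\<lambda>i. kron (1\<^sub>m (dimf G i)) (varQ U i)) (idx1 S))"
  define E where "E = diag_block_mat [0\<^sub>m ?n ?n, ?B]"
  have B: "dim_row ?B = ?D" "dim_col ?B = ?D"
    using QR_dims by (simp_all add: dim_diag_block_mat' comp_def sum_list_idx1 total_dim_def sum_distrib_right)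
  have Ec: "E \<in> carrier_mat Neta Neta"
  proof -
    have "diag_block_mat [0\<^sub>m ?n ?n, B'] \<in> carrier_mat Neta Neta" if "dim_row B' = ?D" "dim_col B' = ?D" for B' :: "real mat"
      using that by (intro carrier_matI) (simp_all only: dim_diag_block_mat' list.map sum_list.Cons sum_list.Nil index_zero_mat add_0_right)
    then show ?thesis unfolding E_def using B by blast
  qed
  have PE: "Pfull + E \<in> carrier_mat Neta Neta" by (rule add_carrier_mat[OF Ec])
  have pd: "pos_def (Pfull + E)" using feas unfolding feasible_def Pfull_def E_def by blast
  have "\<exists>C>0. \<forall>v\<in>carrier_vec Neta. (v $ l)\<^sup>2 \<le> C * (v \<bullet> ((Pfull + E) *\<^sub>v v))" if "l < ?n" for l
    by (rule pos_def_coord_bound[OF pd PE]) (use that in simp)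
  then obtain C where C: "\<And>l. l < ?n \<Longrightarrow> 0 < C l"
    "\<And>l v. l < ?n \<Longrightarrow> v \<in> carrier_vec Neta \<Longrightarrow> (v $ l)\<^sup>2 \<le> C l * (v \<bullet> ((Pfull + E) *\<^sub>v v))"
    by metis
  let ?S = "\<Sum>l<?n. C l"
  have S: "0 < ?S" using C(1) by (intro sum_pos) (auto simp: lessThan_empty_iff)
  show ?thesis
  proof (rule that[OF S])
    fix u :: "real \<Rightarrow> real^'n" assume u: "continuous_on {- max_delay S..0} u"
    have e: "eta u \<in> carrier_vec Neta" by (rule carrier_vecI, rule eta_dims)
    have "zeta (ch u) \<bullet> (?B *\<^sub>v zeta (ch u)) = (\<Sum>i=1..num_delays S. \<Sum>j<dimf G i. Matrix.vec ?n (\<lambda>l. Fc i (yh u l) $ j) \<bullet> (varQ U i *\<^sub>v Matrix.vec ?n (\<lambda>l. Fc i (yh u l) $ j)))"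
      unfolding zeta_eq_stack sum_list_idx1[symmetric] by (rule scalar_prod_stack_kron) (rule decision_carriers(4))
    also have "\<dots> \<le> (\<Sum>i=1..num_delays S. \<Sum>l<?n. \<Sum>m<?n. Vint i l m u u)"
    proof (rule sum_mono)
      fix i assume i: "i \<in> {1..num_delays S}"
      have "(\<Sum>j<dimf G i. Matrix.vec ?n (\<lambda>l. Fc i (yh u l) $ j) \<bullet> (varQ U i *\<^sub>v Matrix.vec ?n (\<lambda>l. Fc i (yh u l) $ j)))
        \<le> (\<Sum>l<?n. \<Sum>m<?n. varQ U i $$ (l, m) * ip (II i) (yh u l) (yh u m))"
        by (rule bessel_HE(2)[OF i decision_carriers(4)[OF i]]) (rule QR_nonneg(1)[OF i] yh_L2[OF u i], assumption)+
      also note Vint_sum_lower[OF u i]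
      finally show "(\<Sum>j<dimf G i. Matrix.vec ?n (\<lambda>l. Fc i (yh u l) $ j) \<bullet> (varQ U i *\<^sub>v Matrix.vec ?n (\<lambda>l. Fc i (yh u l) $ j)))
        \<le> (\<Sum>l<?n. \<Sum>m<?n. Vint i l m u u)" .
    qed
    finally have z: "zeta (ch u) \<bullet> (?B *\<^sub>v zeta (ch u)) \<le> (\<Sum>i=1..num_delays S. \<Sum>l<?n. \<Sum>m<?n. Vint i l m u u)" .
    have "eta u \<bullet> (E *\<^sub>v eta u) = Matrix.vec ?n (ycomp (u 0)) \<bullet> (0\<^sub>m ?n ?n *\<^sub>v Matrix.vec ?n (ycomp (u 0)))
       + zeta (ch u) \<bullet> (diag_block_mat [?B] *\<^sub>v zeta (ch u))"
      unfolding eta_def E_def by (rule diag_cons_quad) (simp_all only: diag_single B zeta_dims dim_vec index_zero_mat)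
    also have "\<dots> = zeta (ch u) \<bullet> (?B *\<^sub>v zeta (ch u))"
      unfolding diag_single quad_zero_mat[OF dim_vec] by simp
    finally have eE: "eta u \<bullet> (E *\<^sub>v eta u) = zeta (ch u) \<bullet> (?B *\<^sub>v zeta (ch u))" .
    have "eta u \<bullet> ((Pfull + E) *\<^sub>v eta u) = eta u \<bullet> (Pfull *\<^sub>v eta u) + eta u \<bullet> (E *\<^sub>v eta u)"
      unfolding add_mult_distrib_mat_vec[OF Pfull_carrier Ec e]
      by (rule scalar_prod_add_distrib[OF e mult_mat_vec_carrier[OF Pfull_carrier e] mult_mat_vec_carrier[OF Ec e]])
    then have V: "eta u \<bullet> ((Pfull + E) *\<^sub>v eta u) \<le> Vfun u" unfolding Vfun_eq using z eE by linarith
    have "Nsq (u 0) \<le> (\<Sum>l<?n. C l * Vfun u)"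
      unfolding Nsq_def
    proof (rule sum_mono)
      fix l assume "l \<in> {..<?n}"
      then have l: "l < ?n" by simp
      have "(ycomp (u 0) l)\<^sup>2 \<le> C l * (eta u \<bullet> ((Pfull + E) *\<^sub>v eta u))"
        using C(2)[OF l e] unfolding eta_index[OF l] .
      also have "\<dots> \<le> C l * Vfun u" by (rule mult_left_mono[OF V]) (use C(1)[OF l] in simp)
      finally show "(ycomp (u 0) l)\<^sup>2 \<le> C l * Vfun u" .
    qed
    then show "Nsq (u 0) \<le> ?S * Vfun u" by (simp only: sum_distrib_right)
  qed
qed

lemma Nsq_nonneg: "0 \<le> Nsq \<xi>"
  unfolding Nsq_def by (rule sum_nonneg) simp

lemma Nsq_continuous: "continuous_on A u \<Longrightarrow> continuous_on A (\<lambda>\<tau>. Nsq (u \<tau>))"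
  unfolding Nsq_def by (intro continuous_intros bounded_linear.continuous_on[OF bounded_linear_ycomp]) auto

lemma Nsq_integrable: "continuous_on {a..b::real} u \<Longrightarrow> set_integrable lebesgue {a..b} (\<lambda>\<tau>. Nsq (u \<tau>))"
  by (rule absolutely_integrable_continuous_real) (rule Nsq_continuous)

lemma integral_II_Nsq_le:
  assumes u: "continuous_on {- max_delay S..0} u" and i: "i \<in> {1..num_delays S}"
  shows "(LINT \<tau>:II i|lebesgue. Nsq (u \<tau>)) \<le> (LINT \<tau>:{- max_delay S..0}|lebesgue. Nsq (u \<tau>))"
    "set_integrable lebesgue (II i) (\<lambda>\<tau>. Nsq (u \<tau>))"
proof -
  show I: "set_integrable lebesgue (II i) (\<lambda>\<tau>. Nsq (u \<tau>))"
    unfolding II_eq by (rule Nsq_integrable, rule continuous_on_subset[OF u]) (use II_subset[OF i] in \<open>simp add: II_eq\<close>)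
  show "(LINT \<tau>:II i|lebesgue. Nsq (u \<tau>)) \<le> (LINT \<tau>:{- max_delay S..0}|lebesgue. Nsq (u \<tau>))"
    by (rule set_integral_mono_subset[OF I Nsq_integrable[OF u] II_subset[OF i] Nsq_nonneg])
qed

lemma yh_product_le: "l < CARD('n) \<Longrightarrow> m < CARD('n) \<Longrightarrow> \<bar>yh u l \<tau> * yh u m \<tau>\<bar> \<le> Nsq (u \<tau>)"
  unfolding Nsq_def yh_def by (rule abs_mult_le_sum_squares)

text \<open>An entry beyond the first \<open>CARD('n)\<close> is a coefficient in the normalised
  \<open>f_i\<close>; its square is one term of Bessel's inequality with the identity as
  weight.\<close>

lemma eta_square_le:
  assumes u: "continuous_on {- max_delay S..0} u" and a: "a < Neta"
  shows "(eta u $ a)\<^sup>2 \<le> Nsq (u 0) + (LINT \<tau>:{- max_delay S..0}|lebesgue. Nsq (u \<tau>))"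
proof (cases "a < CARD('n)")
  case True
  have "(ycomp (u 0) a)\<^sup>2 \<le> Nsq (u 0)" unfolding Nsq_def by (rule member_le_sum) (use True in auto)
  then show ?thesis using set_integral_nonneg_real[of "{- max_delay S..0}" "\<lambda>\<tau>. Nsq (u \<tau>)", OF Nsq_nonneg]
    by (simp add: eta_index[OF True])
next
  case False
  let ?n = "CARD('n)"
  have "a - ?n < total_dim S (dimf G) * ?n" using False a by simp
  then obtain i l j where i: "i \<in> {1..num_delays S}" and l: "l < ?n" and j: "j < dimf G i"
    and s: "\<And>c. stack CARD('n) (dimf G) c (idx1 S) $ (a - ?n) = c i l $ j"
    using stack_index_ex[of "a - ?n" "dimf G" "idx1 S" "CARD('n)"] by (auto simp: total_dim_idx1 set_idx1)
  have e: "eta u $ a = Fc i (yh u l) $ j"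
    using False a by (simp add: eta_def zeta_dims) (simp add: zeta_eq_stack s)
  have one: "Matrix.vec ?n g \<bullet> (1\<^sub>m ?n *\<^sub>v Matrix.vec ?n g) = (\<Sum>l<?n. (g l)\<^sup>2)" for g :: "nat \<Rightarrow> real"
    unfolding one_mult_mat_vec[OF vec_carrier] by (simp add: scalar_prod_def atLeast0LessThan power2_eq_square)
  have "(Fc i (yh u l) $ j)\<^sup>2 \<le> (\<Sum>l<?n. (Fc i (yh u l) $ j)\<^sup>2)"
    by (rule member_le_sum[where f = "\<lambda>l. (Fc i (yh u l) $ j)\<^sup>2"]) (use l in auto)
  also have "\<dots> \<le> (\<Sum>j<dimf G i. \<Sum>l<?n. (Fc i (yh u l) $ j)\<^sup>2)"
    by (rule member_le_sum[where f = "\<lambda>j. \<Sum>l<?n. (Fc i (yh u l) $ j)\<^sup>2"]) (use j in \<open>auto intro: sum_nonneg\<close>)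
  also have "\<dots> = (\<Sum>j<dimf G i. Matrix.vec ?n (\<lambda>l. Fc i (yh u l) $ j) \<bullet> (1\<^sub>m ?n *\<^sub>v Matrix.vec ?n (\<lambda>l. Fc i (yh u l) $ j)))"
    by (simp only: one)
  also have "\<dots> \<le> (\<Sum>l<?n. \<Sum>m<?n. 1\<^sub>m ?n $$ (l, m) * ip (II i) (yh u l) (yh u m))"
  proof (rule bessel_HE(2)[OF i one_carrier_mat])
    show "0 \<le> v \<bullet> (1\<^sub>m ?n *\<^sub>v v)" if "v \<in> carrier_vec ?n" for v :: "real Matrix.vec"
      using that by (simp add: scalar_prod_def sum_nonneg)
  qed (rule yh_L2[OF u i])
  also have "\<dots> = (\<Sum>l<?n. ip (II i) (yh u l) (yh u l))"
  proof (rule sum.cong[OF refl])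
    fix l assume "l \<in> {..<?n}"
    then have "(\<Sum>m<?n. 1\<^sub>m ?n $$ (l, m) * ip (II i) (yh u l) (yh u m)) = (\<Sum>m<?n. if l = m then ip (II i) (yh u l) (yh u m) else 0)"
      by (intro sum.cong) auto
    then show "(\<Sum>m<?n. 1\<^sub>m ?n $$ (l, m) * ip (II i) (yh u l) (yh u m)) = ip (II i) (yh u l) (yh u l)"
      using \<open>l \<in> {..<?n}\<close> by simp
  qed
  also have "\<dots> = (LINT \<tau>:II i|lebesgue. Nsq (u \<tau>))"
    unfolding ip_def Nsq_def
    using yh_product_integrable[OF u i, of _ _ "\<lambda>_. 1"] by (subst set_integral_sum_real) (auto simp: yh_def power2_eq_square)
  also note integral_II_Nsq_le(1)[OF u i]
  finally show ?thesis unfolding e using Nsq_nonneg[of "u 0"] by linarith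
qed

lemma Vfun_upper:
  obtains C where "0 < C" "\<And>u. continuous_on {- max_delay S..0} u \<Longrightarrow>
    Vfun u \<le> C * (Nsq (u 0) + (LINT \<tau>:{- max_delay S..0}|lebesgue. Nsq (u \<tau>)))"
proof -
  let ?n = "CARD('n)"
  let ?C1 = "\<Sum>a<Neta. \<Sum>b<Neta. \<bar>Pfull $$ (a, b)\<bar>"
  let ?C2 = "\<Sum>i=1..num_delays S. \<Sum>l<?n. \<Sum>m<?n. \<bar>varQ U i $$ (l, m)\<bar> + max_delay S * \<bar>varR U i $$ (l, m)\<bar>"
  have mp: "0 \<le> max_delay S" using delay_mono[of 0 "num_delays S"] delay_0 by (simp add: max_delay_def)
  have C: "0 \<le> ?C1" "0 \<le> ?C2" by ((intro sum_nonneg)?, use mp in simp)+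
  show ?thesis
  \<comment> \<open>The summand 1 guarantees a strictly positive constant.\<close>
  proof (rule that[of "?C1 + ?C2 + 1"])
    show "0 < ?C1 + ?C2 + 1" using C by linarith
    fix u :: "real \<Rightarrow> real^'n" assume u: "continuous_on {- max_delay S..0} u"
    let ?I = "LINT \<tau>:{- max_delay S..0}|lebesgue. Nsq (u \<tau>)"
    let ?E = "Nsq (u 0) + ?I"
    have I0: "0 \<le> ?I" by (rule set_integral_nonneg_real) (rule Nsq_nonneg)
    have "(\<Sum>a<Neta. \<Sum>b<Neta. Pfull $$ (a, b) * (eta u $ a * eta u $ b)) \<le> (\<Sum>a<Neta. \<Sum>b<Neta. \<bar>Pfull $$ (a, b)\<bar> * ?E)"
    proof (intro sum_mono)
      fix a b assume "a \<in> {..<Neta}" "b \<in> {..<Neta}"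
      then have "(eta u $ a)\<^sup>2 \<le> ?E" "(eta u $ b)\<^sup>2 \<le> ?E" using eta_square_le[OF u] by auto
      moreover have "2 * \<bar>eta u $ a * eta u $ b\<bar> \<le> (eta u $ a)\<^sup>2 + (eta u $ b)\<^sup>2"
        using sum_squares_bound[of "\<bar>eta u $ a\<bar>" "\<bar>eta u $ b\<bar>"] by (simp add: abs_mult)
      ultimately have "\<bar>eta u $ a * eta u $ b\<bar> \<le> ?E" by linarith
      then have "\<bar>Pfull $$ (a, b) * (eta u $ a * eta u $ b)\<bar> \<le> \<bar>Pfull $$ (a, b)\<bar> * ?E"
        unfolding abs_mult[of "Pfull $$ (a, b)"] by (rule mult_left_mono) simp
      then show "Pfull $$ (a, b) * (eta u $ a * eta u $ b) \<le> \<bar>Pfull $$ (a, b)\<bar> * ?E" by linarith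
    qed
    then have 1: "(\<Sum>a<Neta. \<Sum>b<Neta. Pfull $$ (a, b) * (eta u $ a * eta u $ b)) \<le> ?C1 * ?E"
      by (simp only: sum_distrib_right)
    have "(\<Sum>i=1..num_delays S. \<Sum>l<?n. \<Sum>m<?n. Vint i l m u u)
       \<le> (\<Sum>i=1..num_delays S. \<Sum>l<?n. \<Sum>m<?n. (\<bar>varQ U i $$ (l, m)\<bar> + max_delay S * \<bar>varR U i $$ (l, m)\<bar>) * ?I)"
    proof (intro sum_mono)
      fix i l m assume i: "i \<in> {1..num_delays S}" and "l \<in> {..<?n}" "m \<in> {..<?n}"
      then have l: "l < ?n" and m: "m < ?n" by auto
      let ?q = "varQ U i $$ (l, m)" and ?r = "varR U i $$ (l, m)"
      let ?K = "\<bar>?q\<bar> + max_delay S * \<bar>?r\<bar>"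
      have "Vint i l m u u \<le> (LINT \<tau>:II i|lebesgue. ?K * Nsq (u \<tau>))"
        unfolding Vint_def
      proof (rule set_integral_mono)
        show "set_integrable lebesgue (II i) (\<lambda>\<tau>. (?q + (\<tau> + delay S i) * ?r) * (yh u l \<tau> * yh u m \<tau>))"
          by (rule yh_product_integrable[OF u i l m]) (intro continuous_intros)
        show "set_integrable lebesgue (II i) (\<lambda>\<tau>. ?K * Nsq (u \<tau>))"
          by (intro set_integrable_mult_right integral_II_Nsq_le[OF u i])
        fix \<tau> assume "\<tau> \<in> II i"
        then have "0 \<le> \<tau> + delay S i" "\<tau> + delay S i \<le> max_delay S" using delay_bounds[OF i] by (auto simp: II_eq)
        then have "\<bar>(\<tau> + delay S i) * ?r\<bar> \<le> max_delay S * \<bar>?r\<bar>" unfolding abs_mult by (intro mult_right_mono) auto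
        then have k: "\<bar>?q + (\<tau> + delay S i) * ?r\<bar> \<le> ?K" by linarith
        have "\<bar>(?q + (\<tau> + delay S i) * ?r) * (yh u l \<tau> * yh u m \<tau>)\<bar> \<le> ?K * Nsq (u \<tau>)"
          unfolding abs_mult[of "?q + (\<tau> + delay S i) * ?r"]
          by (rule mult_mono[OF k yh_product_le[OF l m]]) (use k in auto)
        then show "(?q + (\<tau> + delay S i) * ?r) * (yh u l \<tau> * yh u m \<tau>) \<le> ?K * Nsq (u \<tau>)" by linarith
      qed
      also have "\<dots> = ?K * (LINT \<tau>:II i|lebesgue. Nsq (u \<tau>))" by simp
      also have "\<dots> \<le> ?K * ?I" by (rule mult_left_mono[OF integral_II_Nsq_le(1)[OF u i]]) (use mp in simp)
      finally show "Vint i l m u u \<le> ?K * ?I" .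
    qed
    also have "\<dots> = ?C2 * ?I" by (simp only: sum_distrib_right)
    also have "\<dots> \<le> ?C2 * ?E" by (rule mult_left_mono[OF _ C(2)]) (use Nsq_nonneg[of "u 0"] in simp)
    finally have "Vfun u \<le> ?C1 * ?E + ?C2 * ?E" unfolding Vfun_def using 1 by linarith
    also have "\<dots> \<le> (?C1 + ?C2 + 1) * ?E"
      using Nsq_nonneg[of "u 0"] I0 by (simp add: distrib_right)
    finally show "Vfun u \<le> (?C1 + ?C2 + 1) * ?E" .
  qed
qed

end

subsection \<open>Continuously differentiable functionals\<close>

text \<open>The derivative at \<open>\<phi>\<close> is the sum of the two partial maps of
  \<open>b\<close> at \<open>\<phi>\<close>, which depends on \<open>\<phi>\<close> linearly and
  boundedly, hence continuously in operator norm.\<close>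

lemma C1_functional_bilinear:
  fixes b :: "(real \<Rightarrow>\<^sub>C 'a::real_normed_vector) \<Rightarrow> (real \<Rightarrow>\<^sub>C 'a) \<Rightarrow> real"
  assumes "bounded_bilinear b"
  shows "C1_functional r (\<lambda>\<phi>. b \<phi> \<phi>)"
proof -
  interpret bounded_bilinear b by fact
  have "((\<lambda>\<phi>. b \<phi> \<phi>) has_derivative blinfun_apply (prod_right \<phi> + prod_left \<phi>)) (at \<phi> within C_space r)" for \<phi>
    by (rule has_derivative_eq_rhs[OF FDERIV[OF has_derivative_ident has_derivative_ident]]) (auto simp: blinfun.add_left)
  moreover have "continuous_on (C_space r) (\<lambda>\<phi>. prod_right \<phi> + prod_left \<phi>)"
    by (intro continuous_on_add bounded_linear.continuous_on[OF bounded_linear_prod_right]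
        bounded_linear.continuous_on[OF bounded_linear_prod_left] continuous_on_id)
  ultimately show ?thesis unfolding C1_functional_def
    by (intro exI[of _ "\<lambda>\<phi>. prod_right \<phi> + prod_left \<phi>"]) blast
qed

lemma C1_functional_add:
  fixes v w :: "(real \<Rightarrow>\<^sub>C 'a::real_normed_vector) \<Rightarrow> real"
  assumes "C1_functional r v" "C1_functional r w"
  shows "C1_functional r (\<lambda>\<phi>. v \<phi> + w \<phi>)"
proof -
  obtain v' w' where d: "\<And>\<phi>. \<phi> \<in> C_space r \<Longrightarrow> (v has_derivative blinfun_apply (v' \<phi>)) (at \<phi> within C_space r)"
    "\<And>\<phi>. \<phi> \<in> C_space r \<Longrightarrow> (w has_derivative blinfun_apply (w' \<phi>)) (at \<phi> within C_space r)"
    "continuous_on (C_space r) v'" "continuous_on (C_space r) w'"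
    using assms unfolding C1_functional_def by metis
  have "((\<lambda>\<phi>. v \<phi> + w \<phi>) has_derivative blinfun_apply (v' \<phi> + w' \<phi>)) (at \<phi> within C_space r)" if "\<phi> \<in> C_space r" for \<phi>
    by (rule has_derivative_eq_rhs[OF has_derivative_add[OF d(1,2)[OF that]]]) (auto simp: blinfun.add_left)
  moreover have "continuous_on (C_space r) (\<lambda>\<phi>. v' \<phi> + w' \<phi>)" by (intro continuous_on_add d)
  ultimately show ?thesis unfolding C1_functional_def by (intro exI[of _ "\<lambda>\<phi>. v' \<phi> + w' \<phi>"]) blast
qed

lemma C1_functional_sum:
  fixes v :: "'i \<Rightarrow> (real \<Rightarrow>\<^sub>C 'a::real_normed_vector) \<Rightarrow> real"
  shows "(\<And>i. i \<in> A \<Longrightarrow> C1_functional r (v i)) \<Longrightarrow> C1_functional r (\<lambda>\<phi>. \<Sum>i\<in>A. v i \<phi>)"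
proof (induction A rule: infinite_finite_induct)
  have z: "C1_functional r (\<lambda>\<phi> :: real \<Rightarrow>\<^sub>C 'a. 0)"
    unfolding C1_functional_def by (intro exI[of _ "\<lambda>_. 0"]) (auto simp: zero_blinfun.rep_eq)
  show "C1_functional r (\<lambda>\<phi> :: real \<Rightarrow>\<^sub>C 'a. \<Sum>i\<in>A. v i \<phi>)" if "infinite A" for A using that z by simp
  show "C1_functional r (\<lambda>\<phi> :: real \<Rightarrow>\<^sub>C 'a. \<Sum>i\<in>{}. v i \<phi>)" using z by simp
qed (simp add: C1_functional_add)

lemma bounded_linear_eval: "bounded_linear (\<lambda>\<phi> :: real \<Rightarrow>\<^sub>C 'a::real_normed_vector. apply_bcontfun \<phi> x)"
  by (rule bounded_linear_intro[of _ 1]) (auto simp: plus_bcontfun.rep_eq scaleR_bcontfun.rep_eq norm_bounded)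

lemma bounded_bilinear_mult_functionals:
  fixes f :: "'a::real_normed_vector \<Rightarrow> real" and g :: "'b::real_normed_vector \<Rightarrow> real"
  assumes "bounded_linear f" "bounded_linear g"
  shows "bounded_bilinear (\<lambda>x y. c * (f x * g y))"
proof -
  have "bounded_bilinear (\<lambda>x y. (c * f x) * g y)"
    by (rule bounded_bilinear.comp[OF bounded_bilinear_mult bounded_linear_const_mult[OF assms(1)] assms(2)])
  then show ?thesis by (simp add: mult.assoc)
qed

lemma abs_cont_on_cong:
  assumes "abs_cont_on a b f" "\<And>t. t \<in> {a..b} \<Longrightarrow> g t = f t"
  shows "abs_cont_on a b g"
  by (rule abs_cont_on_dominated[OF assms(1), of 1]) (use assms(2) in auto)

context synthesis
begin

lemma yh_add: "l < CARD('n) \<Longrightarrow> yh (\<lambda>\<tau>. u \<tau> + v \<tau>) l = (\<lambda>\<tau>. yh u l \<tau> + yh v l \<tau>)"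
  unfolding yh_def by (rule ext) (rule linear_simps(1)[OF bounded_linear_ycomp])

lemma yh_scaleR: "l < CARD('n) \<Longrightarrow> yh (\<lambda>\<tau>. c *\<^sub>R u \<tau>) l = (\<lambda>\<tau>. c * yh u l \<tau>)"
  unfolding yh_def using linear_simps(5)[OF bounded_linear_ycomp] by (intro ext) (metis real_scaleR_def)

lemma yh_bound: 
  assumes "l < CARD('n)"
  obtains K where "0 \<le> K" "\<And>(\<phi> :: real \<Rightarrow>\<^sub>C (real^'n)) \<tau>. \<bar>yh (apply_bcontfun \<phi>) l \<tau>\<bar> \<le> K * norm \<phi>"
proof -
  obtain K where K: "0 \<le> K" "\<And>x. norm (ycomp x l) \<le> norm x * K"
    using bounded_linear.nonneg_bounded[OF bounded_linear_ycomp[OF assms]] by blast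
  have "\<bar>yh (apply_bcontfun \<phi>) l \<tau>\<bar> \<le> K * norm \<phi>" for \<phi> :: "real \<Rightarrow>\<^sub>C (real^'n)" and \<tau>
    using order_trans[OF K(2) mult_right_mono[OF norm_bounded[of \<phi> \<tau>] K(1)]] by (simp add: yh_def mult.commute)
  with K(1) show ?thesis by (rule that)
qed

lemma bounded_linear_ip_yh:
  assumes g: "L2_on (II i) g" and i: "i \<in> {1..num_delays S}" and l: "l < CARD('n)"
  shows "bounded_linear (\<lambda>\<phi> :: real \<Rightarrow>\<^sub>C (real^'n). ip (II i) g (yh (apply_bcontfun \<phi>) l))"
proof -
  have y: "L2_on (II i) (yh (apply_bcontfun \<phi>) l)" for \<phi> :: "real \<Rightarrow>\<^sub>C (real^'n)"
    by (rule yh_L2[OF _ i l]) simp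
  have g': "set_integrable lebesgue {- delay S i..- delay S (i - 1)} g"
    using L2_on_mult[OF g, of "\<lambda>_. 1"] L2_on_continuous[of "- delay S i" "- delay S (i - 1)" "\<lambda>_. 1"] by (simp add: II_eq)
  obtain K where K: "0 \<le> K" "\<And>(\<phi> :: real \<Rightarrow>\<^sub>C (real^'n)) \<tau>. \<bar>yh (apply_bcontfun \<phi>) l \<tau>\<bar> \<le> K * norm \<phi>"
    using yh_bound[OF l] by metis
  show ?thesis
  proof (rule bounded_linear_intro)
    fix \<phi> \<psi> :: "real \<Rightarrow>\<^sub>C (real^'n)" and c :: real
    show "ip (II i) g (yh (apply_bcontfun (\<phi> + \<psi>)) l) = ip (II i) g (yh (apply_bcontfun \<phi>) l) + ip (II i) g (yh (apply_bcontfun \<psi>) l)"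
      using ip_add_left[OF y y g] by (simp add: plus_bcontfun.rep_eq yh_add[OF l] ip_commute[of _ g])
    show "ip (II i) g (yh (apply_bcontfun (c *\<^sub>R \<phi>)) l) = c *\<^sub>R ip (II i) g (yh (apply_bcontfun \<phi>) l)"
      using ip_cmult_left[of "II i" c "yh (apply_bcontfun \<phi>) l" g] by (simp add: scaleR_bcontfun.rep_eq yh_scaleR[OF l] ip_commute[of _ g])
    have "\<bar>ip {- delay S i..- delay S (i - 1)} g (yh (apply_bcontfun \<phi>) l)\<bar> \<le> (LINT \<tau>:{- delay S i..- delay S (i - 1)}|lebesgue. \<bar>g \<tau>\<bar>) * (K * norm \<phi>)"
      by (rule abs_ip_le[OF g' yh_continuous[OF _ l] K(2)]) simp
    then show "norm (ip (II i) g (yh (apply_bcontfun \<phi>) l)) \<le> norm \<phi> * (K * (LINT \<tau>:II i|lebesgue. \<bar>g \<tau>\<bar>))"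
      by (simp add: II_eq mult_ac)
  qed
qed

lemma bounded_linear_eta:
  assumes a: "a < Neta"
  shows "bounded_linear (\<lambda>\<phi> :: real \<Rightarrow>\<^sub>C (real^'n). eta (apply_bcontfun \<phi>) $ a)"
proof (cases "a < CARD('n)")
  case True
  show ?thesis unfolding eta_index[OF True]
    by (rule bounded_linear_compose[OF bounded_linear_ycomp[OF True] bounded_linear_eval])
next
  case False
  then have "a - CARD('n) < total_dim S (dimf G) * CARD('n)" using a by simp
  then obtain i l j where ij: "i \<in> {1..num_delays S}" "l < CARD('n)" "j < dimf G i"
    and z: "\<And>u. continuous_on {- max_delay S..0} u \<Longrightarrow>
      zeta (ch u) $ (a - CARD('n)) = (\<Sum>k<dimf G i. minv (cholF G i) $$ (j, k) * ip (II i) (\<lambda>\<tau>. funf G i \<tau> $ k) (yh u l))"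
    by (rule zeta_entries) blast
  have e: "eta (apply_bcontfun \<phi>) $ a = (\<Sum>k<dimf G i. minv (cholF G i) $$ (j, k) * ip (II i) (\<lambda>\<tau>. funf G i \<tau> $ k) (yh (apply_bcontfun \<phi>) l))"
    for \<phi> :: "real \<Rightarrow>\<^sub>C (real^'n)"
    using False a z[of "apply_bcontfun \<phi>"] by (simp add: eta_def zeta_dims)
  show ?thesis unfolding e
    using families(1)[OF ij(1)]
    by (intro bounded_linear_sum bounded_linear_const_mult bounded_linear_ip_yh ij) (auto simp: L2_family_def)
qed

lemma bounded_bilinear_Vint:
  assumes i: "i \<in> {1..num_delays S}" and l: "l < CARD('n)" and m: "m < CARD('n)"
  shows "bounded_bilinear (\<lambda>(\<phi> :: real \<Rightarrow>\<^sub>C (real^'n)) (\<psi> :: real \<Rightarrow>\<^sub>C (real^'n)). Vint i l m (apply_bcontfun \<phi>) (apply_bcontfun \<psi>))"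
proof -
  define q where "q = (\<lambda>\<tau>. varQ U i $$ (l, m) + (\<tau> + delay S i) * varR U i $$ (l, m))"
  let ?y = "\<lambda>l (\<phi> :: real \<Rightarrow>\<^sub>C (real^'n)). yh (apply_bcontfun \<phi>) l"
  have cy: "continuous_on A (?y k \<phi>)" if "k < CARD('n)" for A k \<phi>
    by (rule yh_continuous[OF _ that]) simp
  have V: "Vint i l m (apply_bcontfun \<phi>) (apply_bcontfun \<psi>) = ip (II i) q (\<lambda>\<tau>. ?y l \<phi> \<tau> * ?y m \<psi> \<tau>)" for \<phi> \<psi>
    by (simp add: Vint_def ip_def q_def)
  have q2: "L2_on (II i) q" unfolding II_eq q_def by (rule L2_on_continuous) (intro continuous_intros)
  have q': "set_integrable lebesgue {- delay S i..- delay S (i - 1)} q"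
    unfolding q_def by (rule absolutely_integrable_continuous_real) (intro continuous_intros)
  have p: "L2_on (II i) (\<lambda>\<tau>. ?y l \<phi> \<tau> * ?y m \<psi> \<tau>)" for \<phi> \<psi>
    unfolding II_eq by (rule L2_on_continuous) (intro continuous_intros cy l m)
  obtain K where K: "0 \<le> K" "\<And>\<phi> \<tau>. \<bar>?y l \<phi> \<tau>\<bar> \<le> K * norm \<phi>" using yh_bound[OF l] by metis
  obtain M where M: "0 \<le> M" "\<And>\<phi> \<tau>. \<bar>?y m \<phi> \<tau>\<bar> \<le> M * norm \<phi>" using yh_bound[OF m] by metis
  show ?thesis unfolding V
  proof (unfold_locales, goal_cases)
    case (1 a a' b)
    show ?case using ip_add_left[OF p p q2]
      by (simp add: plus_bcontfun.rep_eq yh_add[OF l] ip_commute[of _ q] distrib_right)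
  next
    case (2 a b b')
    show ?case using ip_add_left[OF p p q2]
      by (simp add: plus_bcontfun.rep_eq yh_add[OF m] ip_commute[of _ q] distrib_left)
  next
    case (3 r a b)
    show ?case using ip_cmult_left[of "II i" r "\<lambda>\<tau>. ?y l a \<tau> * ?y m b \<tau>" q]
      by (simp add: scaleR_bcontfun.rep_eq yh_scaleR[OF l] ip_commute[of _ q] mult.assoc)
  next
    case (4 a r b)
    show ?case using ip_cmult_left[of "II i" r "\<lambda>\<tau>. ?y l a \<tau> * ?y m b \<tau>" q]
      by (simp add: scaleR_bcontfun.rep_eq yh_scaleR[OF m] ip_commute[of _ q] mult.left_commute)
  next
    case 5
    have "\<bar>ip {- delay S i..- delay S (i - 1)} q (\<lambda>\<tau>. ?y l a \<tau> * ?y m b \<tau>)\<bar>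
        \<le> (LINT \<tau>:{- delay S i..- delay S (i - 1)}|lebesgue. \<bar>q \<tau>\<bar>) * ((K * norm a) * (M * norm b))" for a b
      by (rule abs_ip_le[OF q']; (intro continuous_intros cy l m)?)
        (unfold abs_mult, rule mult_mono[OF K(2) M(2)], use K(1) in simp_all)
    then have "\<forall>a b. norm (ip (II i) q (\<lambda>\<tau>. ?y l a \<tau> * ?y m b \<tau>))
        \<le> norm a * norm b * (K * M * (LINT \<tau>:{- delay S i..- delay S (i - 1)}|lebesgue. \<bar>q \<tau>\<bar>))"
      by (simp add: II_eq mult_ac)
    then show ?case by blast
  qed
qed

lemma C1_functional_Vfun: "C1_functional r (\<lambda>\<phi>. Vfun (apply_bcontfun \<phi>))"
  unfolding Vfun_def
  by (intro C1_functional_add C1_functional_sum C1_functional_bilinear bounded_bilinear_mult_functionals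
      bounded_linear_eta bounded_bilinear_Vint) auto

lemma ch_cong:
  assumes "\<And>\<tau>. \<tau> \<in> {- max_delay S..0} \<Longrightarrow> u \<tau> = v \<tau>" "i \<in> {1..num_delays S}"
  shows "ch u i l = ch v i l"
proof -
  have "cvec (II i) (dimh G i) (funh G i) (yh u l) = cvec (II i) (dimh G i) (funh G i) (yh v l)"
    unfolding cvec_def
    by (intro eq_vecI) (use assms(1) II_subset[OF assms(2)] in \<open>auto intro!: ip_cong' simp: yh_def subset_eq\<close>)
  then show ?thesis by (simp add: Hc_def)
qed

lemma eta_cong:
  assumes "\<And>\<tau>. \<tau> \<in> {- max_delay S..0} \<Longrightarrow> u \<tau> = v \<tau>"
  shows "eta u = eta v" "eta_dot u x' = eta_dot v x'"
proof -
  have m: "0 \<le> max_delay S" using delay_mono[of 0 "num_delays S"] delay_0 by (simp add: max_delay_def)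
  have y: "yd u i = yd v i" if "i \<le> num_delays S" for i
    using assms[of "- delay S i"] delay_mono[of 0 i] delay_mono[of i "num_delays S"] that delay_0 by (simp add: max_delay_def)
  have c: "ch u i l = ch v i l" if "i \<in> {1..num_delays S}" for i l
    by (rule ch_cong[OF _ that]) (rule assms)
  show "eta u = eta v"
    unfolding eta_def zeta_def
  proof (rule arg_cong2[where f = "(@\<^sub>v)"])
    show "Matrix.vec CARD('n) (ycomp (u 0)) = Matrix.vec CARD('n) (ycomp (v 0))" using assms[of 0] m by simp
    show "stack CARD('n) (dimf G) (\<lambda>i l. embed_f i *\<^sub>v ch u i l) (idx1 S) = stack CARD('n) (dimf G) (\<lambda>i l. embed_f i *\<^sub>v ch v i l) (idx1 S)"
      by (rule stack_cong[OF refl]) (simp only: set_idx1 c)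
  qed
  show "eta_dot u x' = eta_dot v x'"
    unfolding eta_dot_def zeta_dot_def
    by (rule arg_cong2[where f = "(@\<^sub>v)", OF refl], rule stack_cong[OF refl])
      (simp only: set_idx1 c y[OF le_trans[OF diff_le_self]] y atLeastAtMost_iff)
qed

text \<open>Segments in the function space and bounded extensions of a trajectory agree with it only
  on the delay window, so the functional must be seen to depend on nothing else.\<close>

lemma Vfun_cong:
  assumes "\<And>\<tau>. \<tau> \<in> {- max_delay S..0} \<Longrightarrow> u \<tau> = v \<tau>"
  shows "Vfun u = Vfun v" "Vdot u x' = Vdot v x'"
proof -
  have e: "eta u = eta v" "eta_dot u x' = eta_dot v x'" by (rule eta_cong(1), rule assms, assumption) (rule eta_cong(2), rule assms, assumption)
  have I: "u \<tau> = v \<tau>" if "i \<in> {1..num_delays S}" "\<tau> \<in> II i" for i \<tau> using assms II_subset that by blast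
  have "Vint i l m u u = Vint i l m v v" if "i \<in> {1..num_delays S}" for i l m
    unfolding Vint_def by (rule set_lebesgue_integral_cong) (use I[OF that] in \<open>auto simp: yh_def II_eq\<close>)
  then show "Vfun u = Vfun v" unfolding Vfun_def e(1) by simp
  have y: "yh u l (- delay S i) = yh v l (- delay S i)" if "i \<le> num_delays S" for i l
    using assms[of "- delay S i"] delay_mono[of 0 i] delay_mono[of i "num_delays S"] that delay_0 by (simp add: max_delay_def yh_def)
  have "ip (II i) (yh u l) (yh u m) = ip (II i) (yh v l) (yh v m)" if "i \<in> {1..num_delays S}" for i l m
    by (rule ip_cong') (use I[OF that] in \<open>simp_all add: yh_def\<close>)
  then show "Vdot u x' = Vdot v x'"
    unfolding Vdot_def e
    by (intro arg_cong2[where f = "(+)"] refl sum.cong)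
      (simp only: y[OF le_trans[OF diff_le_self]] y atLeastAtMost_iff)
qed

end

subsection \<open>Trajectories\<close>

lemma segment_apply:
  fixes x :: "real \<Rightarrow> 'a::real_normed_vector"
  assumes "continuous_on {t - r..t} x" "\<tau> \<in> {- r..0}"
  shows "apply_bcontfun (segment r x t) \<tau> = x (t + \<tau>)"
proof -
  have c: "continuous_on (cbox (- r) 0) (\<lambda>\<theta>. x (t + \<theta>))"
    by (rule continuous_on_compose2[OF assms(1)]) (auto intro!: continuous_intros)
  have "ext_cont (\<lambda>\<theta>. x (t + \<theta>)) (- r) 0 \<in> bcontfun"
    unfolding bcontfun_def using continuous_on_ext_cont[OF c, of UNIV] clamp_bounded[OF compact_imp_bounded[OF compact_continuous_image[OF c compact_cbox]]]
    by (simp add: ext_cont_def)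
  then show ?thesis using assms(2) by (simp add: segment_def Bcontfun_inverse)
qed

context synthesis
begin

lemma max_delay_pos: "0 < max_delay S"
proof -
  have "1 \<in> {1..num_delays S}" using valid_S by (simp add: valid_system_def)
  from delay_bounds[OF this] show ?thesis by linarith
qed

text \<open>The initial function and the absolutely continuous part are glued at \<open>t0\<close>;
  continuity on the half-line is local and follows from all compact pieces.\<close>

lemma trajectory_continuous:
  assumes "state_trajectory S gain t0 \<psi> w x"
  shows "continuous_on {t0 - max_delay S..} x"
proof -
  let ?r = "max_delay S"
  have psi: "continuous_on {- ?r..0} \<psi>" "\<And>\<theta>. \<theta> \<in> {- ?r..0} \<Longrightarrow> x (t0 + \<theta>) = \<psi> \<theta>"
    and ac: "\<And>t1. t0 < t1 \<Longrightarrow> abs_cont_on t0 t1 x"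
    using assms by (auto simp: state_trajectory_def)
  have "continuous_on {t0 - ?r..t0} (\<lambda>t. \<psi> (t - t0))"
    by (rule continuous_on_compose2[OF psi(1)]) (auto intro!: continuous_intros)
  then have 1: "continuous_on {t0 - ?r..t0} x"
    by (rule continuous_on_eq) (use psi(2)[of "_ - t0"] in auto)
  have 2: "continuous_on {t0 - ?r..t1} x" if "t0 < t1" for t1
  proof -
    have "continuous_on ({t0 - ?r..t0} \<union> {t0..t1}) x"
      by (rule continuous_on_closed_Un[OF _ _ 1 abs_cont_on_continuous[OF ac[OF that]]]) auto
    moreover have "{t0 - ?r..t0} \<union> {t0..t1} = {t0 - ?r..t1}" using that max_delay_pos by auto
    ultimately show ?thesis by simp
  qed
  show ?thesis
  proof (rule continuous_on_eq_continuous_within[THEN iffD2], rule ballI)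
    fix t assume t: "t \<in> {t0 - ?r..}"
    define t1 where "t1 = max t t0 + 1"
    have "continuous (at t within {t0 - ?r..t1}) x"
      using 2[of t1] t unfolding t1_def by (auto simp: continuous_on_eq_continuous_within)
    moreover have "at t within {t0 - ?r..t1} = at t within {t0 - ?r..}"
      by (rule at_within_nhd[of _ "{..<t1}"]) (auto simp: t1_def)
    ultimately show "continuous (at t within {t0 - ?r..}) x" by simp
  qed
qed

text \<open>The differentiation results assume functions that are continuous and bounded on the
  whole line. Freezing the trajectory outside a compact interval provides one that agrees with it
  where it matters.\<close>

lemma trajectory_extension:
  assumes x: "continuous_on {t0 - max_delay S..} x" and T: "t0 < T"
  obtains \<xi> B where "continuous_on UNIV \<xi>" "\<And>t. norm (\<xi> t :: real^'n) \<le> B" "\<And>t. t \<in> {t0 - max_delay S..T} \<Longrightarrow> \<xi> t = x t"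
proof
  let ?a = "t0 - max_delay S"
  have c: "continuous_on (cbox ?a T) x" by (rule continuous_on_subset[OF x]) auto
  show "continuous_on UNIV (ext_cont x ?a T)" by (rule continuous_on_ext_cont[OF c])
  have b: "bounded (range (ext_cont x ?a T))"
    using clamp_bounded[OF compact_imp_bounded[OF compact_continuous_image[OF c compact_cbox]]] by (simp add: ext_cont_def)
  show "norm (ext_cont x ?a T t) \<le> (SOME B. \<forall>t. norm (ext_cont x ?a T t) \<le> B)" for t
    using someI_ex[of "\<lambda>B. \<forall>t. norm (ext_cont x ?a T t) \<le> B"] b unfolding bounded_iff by auto
  show "ext_cont x ?a T t = x t" if "t \<in> {?a..T}" for t using that by simp
qed

lemma Vfun_trajectory:
  assumes x: "continuous_on {t0 - max_delay S..} x"
  shows "t0 < t \<Longrightarrow> (x has_vector_derivative x') (at t) \<Longrightarrow>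
      ((\<lambda>\<sigma>. Vfun (\<lambda>\<tau>. x (\<sigma> + \<tau>))) has_real_derivative Vdot (\<lambda>\<tau>. x (t + \<tau>)) x') (at t)"
    and "t0 < T \<Longrightarrow> abs_cont_on t0 T x \<Longrightarrow> abs_cont_on t0 T (\<lambda>\<sigma>. Vfun (\<lambda>\<tau>. x (\<sigma> + \<tau>)))"
proof -
  assume t: "t0 < t" and d: "(x has_vector_derivative x') (at t)"
  obtain \<xi> B where xi: "continuous_on UNIV \<xi>" "\<And>t. norm (\<xi> t) \<le> B" "\<And>s. s \<in> {t0 - max_delay S..t + 1} \<Longrightarrow> \<xi> s = x s"
    using trajectory_extension[OF x, of "t + 1"] t by (metis add_strict_increasing zero_less_one less_add_one less_trans)
  have d': "(\<xi> has_vector_derivative x') (at t)"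
    by (rule has_vector_derivative_transform_within_open[OF d, of "{t0<..<t + 1}"]) (use t xi(3) max_delay_pos in auto)
  have e: "Vfun (\<lambda>\<tau>. x (\<sigma> + \<tau>)) = Vfun (\<lambda>\<tau>. \<xi> (\<sigma> + \<tau>))" "Vdot (\<lambda>\<tau>. x (\<sigma> + \<tau>)) x' = Vdot (\<lambda>\<tau>. \<xi> (\<sigma> + \<tau>)) x'"
    if "\<sigma> \<in> {t0<..<t + 1}" for \<sigma>
    by (rule Vfun_cong(1), use that xi(3) in simp) (rule Vfun_cong(2), use that xi(3) in simp)
  have "((\<lambda>\<sigma>. Vfun (\<lambda>\<tau>. x (\<sigma> + \<tau>))) has_real_derivative Vdot (\<lambda>\<tau>. \<xi> (t + \<tau>)) x') (at t)"
    by (rule has_field_derivative_transform_within_open[OF moving_Vfun(1)[OF xi(1,2) d'], of "{t0<..<t + 1}"])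
      (use t e in auto)
  then show "((\<lambda>\<sigma>. Vfun (\<lambda>\<tau>. x (\<sigma> + \<tau>))) has_real_derivative Vdot (\<lambda>\<tau>. x (t + \<tau>)) x') (at t)"
    using e(2)[of t] t by simp
next
  assume T: "t0 < T" and ac: "abs_cont_on t0 T x"
  obtain \<xi> B where xi: "continuous_on UNIV \<xi>" "\<And>t. norm (\<xi> t) \<le> B" "\<And>s. s \<in> {t0 - max_delay S..T} \<Longrightarrow> \<xi> s = x s"
    using trajectory_extension[OF x T] by metis
  have "abs_cont_on t0 T \<xi>" by (rule abs_cont_on_cong[OF ac]) (use xi(3) max_delay_pos in auto)
  from moving_Vfun(2)[OF xi(1,2) this]
  show "abs_cont_on t0 T (\<lambda>\<sigma>. Vfun (\<lambda>\<tau>. x (\<sigma> + \<tau>)))"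
    by (rule abs_cont_on_cong) (rule Vfun_cong(1), use xi(3) in simp)
qed

lemma trajectory_segment_continuous:
  assumes "continuous_on {t0 - max_delay S..} x" "t0 \<le> t"
  shows "continuous_on {- max_delay S..0} (\<lambda>\<tau>. x (t + \<tau>))"
  by (rule continuous_on_compose2[OF assms(1)]) (use assms(2) in \<open>auto intro!: continuous_intros\<close>)

lemma trajectory_derivative:
  assumes "state_trajectory S gain t0 \<psi> w x"
  shows "AE t in lebesgue. t0 < t \<longrightarrow> (x has_vector_derivative state_rhs (\<lambda>\<tau>. x (t + \<tau>)) (w t)) (at t)"
proof -
  have "AE t in lebesgue. t \<ge> t0 \<longrightarrow> (x has_vector_derivative state_rhs (\<lambda>\<tau>. x (t + \<tau>)) (w t)) (at t)"
    using assms unfolding state_trajectory_def state_rhs_def by simp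
  then show ?thesis by eventually_elim simp
qed

lemma dissipative_closed_loop: "dissipative S gain t0 (supply_rate J)"
  unfolding dissipative_def
proof (intro exI[of _ "\<lambda>\<phi>. Vfun (apply_bcontfun \<phi>)"] conjI allI impI C1_functional_Vfun, elim conjE)
  fix \<psi> w x z
  assume st: "state_trajectory S gain t0 \<psi> w x" and out: "output_trajectory S gain t0 w x z"
  note xc = trajectory_continuous[OF st]
  obtain \<epsilon> where eps: "0 < \<epsilon>" "\<And>u w. continuous_on {- max_delay S..0} u \<Longrightarrow>
    Vdot u (state_rhs u w) - supply_rate J (output_rhs u w) w \<le> - \<epsilon> * Nsq (u 0)" using dissipation_rate by metis
  have "AE t in lebesgue. t \<ge> t0 \<longrightarrow> z t = output_rhs (\<lambda>\<tau>. x (t + \<tau>)) (w t)"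
    using out unfolding output_trajectory_def output_rhs_def by simp
  \<comment> \<open>The time \<open>t0\<close> is discarded because a two-sided derivative there
    would involve values before the start of the initial function.\<close>
  moreover have "AE t in lebesgue. t \<noteq> t0"
    using AE_not_in[of "{t0}" lebesgue] by (simp add: negligible_iff_null_sets[symmetric])
  moreover note trajectory_derivative[OF st]
  ultimately show "AE t in lebesgue. t \<ge> t0 \<longrightarrow>
    (\<exists>D. ((\<lambda>\<sigma>. Vfun (apply_bcontfun (segment (max_delay S) x \<sigma>))) has_real_derivative D) (at t) \<and> D - supply_rate J (z t) (w t) \<le> 0)"
  proof eventually_elim
    case (elim t)
    show ?case
    proof
      assume "t0 \<le> t"
      with elim have t: "t0 < t" and z: "z t = output_rhs (\<lambda>\<tau>. x (t + \<tau>)) (w t)"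
        and d: "(x has_vector_derivative state_rhs (\<lambda>\<tau>. x (t + \<tau>)) (w t)) (at t)" by auto
      let ?D = "Vdot (\<lambda>\<tau>. x (t + \<tau>)) (state_rhs (\<lambda>\<tau>. x (t + \<tau>)) (w t))"
      have s: "Vfun (\<lambda>\<tau>. x (\<sigma> + \<tau>)) = Vfun (apply_bcontfun (segment (max_delay S) x \<sigma>))" if "\<sigma> \<in> {t0<..}" for \<sigma>
        by (rule Vfun_cong(1), rule segment_apply[symmetric], rule continuous_on_subset[OF xc]) (use that in auto)
      have "((\<lambda>\<sigma>. Vfun (apply_bcontfun (segment (max_delay S) x \<sigma>))) has_real_derivative ?D) (at t)"
        by (rule has_field_derivative_transform_within_open[OF Vfun_trajectory(1)[OF xc t d], of "{t0<..}"]) (use t s in auto)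
      moreover have "?D - supply_rate J (z t) (w t) \<le> 0"
      proof -
        have "0 \<le> \<epsilon> * Nsq (x t)" using eps(1) Nsq_nonneg by simp
        then show ?thesis
          using eps(2)[OF trajectory_segment_continuous[OF xc, of t], of "w t"] t unfolding z by simp
      qed
      ultimately show "\<exists>D. ((\<lambda>\<sigma>. Vfun (apply_bcontfun (segment (max_delay S) x \<sigma>))) has_real_derivative D) (at t) \<and> D - supply_rate J (z t) (w t) \<le> 0"
        by blast
    qed
  qed
qed

end

subsection \<open>Exponential stability\<close>

lemma abs_cont_on_exp: "abs_cont_on a b (\<lambda>t::real. exp (c * (t - d)))"
proof (rule abs_cont_on_lipschitz)
  fix u v :: real assume uv: "a \<le> u" "u \<le> v" "v \<le> b"
  let ?B = "\<bar>c\<bar> * exp (\<bar>c\<bar> * (\<bar>a\<bar> + \<bar>b\<bar> + \<bar>d\<bar>))"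
  have "norm (exp (c * (v - d)) - exp (c * (u - d))) \<le> ?B * norm (v - u)"
  proof (rule field_differentiable_bound[of "{a..b}" _ "\<lambda>t. c * exp (c * (t - d))"])
    show "((\<lambda>t. exp (c * (t - d))) has_field_derivative c * exp (c * (t - d))) (at t within {a..b})" for t
      by (auto intro!: derivative_eq_intros)
    fix t assume t: "t \<in> {a..b}"
    have "c * (t - d) \<le> \<bar>c\<bar> * \<bar>t - d\<bar>" by (metis abs_ge_self abs_mult)
    also have "\<dots> \<le> \<bar>c\<bar> * (\<bar>a\<bar> + \<bar>b\<bar> + \<bar>d\<bar>)" by (rule mult_left_mono) (use t in auto)
    finally show "norm (c * exp (c * (t - d))) \<le> ?B" by (simp add: abs_mult mult_left_mono)
  qed (use uv in auto)
  then show "norm (exp (c * (v - d)) - exp (c * (u - d))) \<le> ?B * (v - u)" using uv by simp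
qed

context synthesis
begin

text \<open>From \<open>x = X y\<close> entrywise. Together with \<open>Nsq_le_norm\<close> this
  makes the norms of \<open>x\<close> and of \<open>y\<close> equivalent, so that decay can be
  transferred back to \<open>x\<close>.\<close>

lemma norm_le_sqrt_Nsq: "\<exists>A\<ge>0. \<forall>\<xi>. norm \<xi> \<le> A * sqrt (Nsq \<xi>)"
proof -
  let ?n = "CARD('n)"
  let ?A = "\<Sum>j<?n. \<Sum>l<?n. \<bar>varX U $$ (j, l)\<bar>"
  have "norm \<xi> \<le> ?A * sqrt (Nsq \<xi>)" for \<xi> :: "real^'n"
  proof -
    have d: "dim_row (varX U) = ?n" "dim_col (varX U) = ?n" using decision_carriers(1) by auto
    have y: "\<bar>ycomp \<xi> l\<bar> \<le> sqrt (Nsq \<xi>)" if "l < ?n" for l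
    proof (rule real_le_rsqrt)
      show "\<bar>ycomp \<xi> l\<bar>\<^sup>2 \<le> Nsq \<xi>"
        unfolding Nsq_def power2_abs by (rule member_le_sum[where f = "\<lambda>l. (ycomp \<xi> l)\<^sup>2"]) (use that in auto)
    qed
    have "norm \<xi> \<le> (\<Sum>k\<in>UNIV. \<bar>vec_nth \<xi> k\<bar>)" by (rule norm_le_l1_cart)
    also have "\<dots> = (\<Sum>j<?n. \<bar>vec_of \<xi> $ j\<bar>)"
      unfolding sum_UNIV_from_nat_into by (rule sum.cong) (auto simp: vec_of_index)
    also have "\<dots> \<le> (\<Sum>j<?n. \<Sum>l<?n. \<bar>varX U $$ (j, l)\<bar> * sqrt (Nsq \<xi>))"
    proof (rule sum_mono)
      fix j assume "j \<in> {..<?n}"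
      then have j: "j < ?n" by simp
      have "vec_of \<xi> $ j = (\<Sum>l<?n. varX U $$ (j, l) * Matrix.vec ?n (ycomp \<xi>) $ l)"
        unfolding X_ycomp[symmetric] using mult_mat_vec_index[of j "varX U" "Matrix.vec ?n (ycomp \<xi>)"] j d by (simp only: dim_vec)
      also have "\<dots> = (\<Sum>l<?n. varX U $$ (j, l) * ycomp \<xi> l)" by (rule sum.cong) auto
      finally have "\<bar>vec_of \<xi> $ j\<bar> \<le> (\<Sum>l<?n. \<bar>varX U $$ (j, l) * ycomp \<xi> l\<bar>)" by (simp only: sum_abs)
      also have "\<dots> \<le> (\<Sum>l<?n. \<bar>varX U $$ (j, l)\<bar> * sqrt (Nsq \<xi>))"
        unfolding abs_mult by (intro sum_mono mult_left_mono y) auto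
      finally show "\<bar>vec_of \<xi> $ j\<bar> \<le> (\<Sum>l<?n. \<bar>varX U $$ (j, l)\<bar> * sqrt (Nsq \<xi>))" .
    qed
    also have "\<dots> = ?A * sqrt (Nsq \<xi>)" by (simp only: sum_distrib_right)
    finally show ?thesis .
  qed
  moreover have "0 \<le> ?A" by (intro sum_nonneg) simp
  ultimately show ?thesis by blast
qed

lemma Nsq_le_norm: "\<exists>K\<ge>0. \<forall>\<xi>. Nsq \<xi> \<le> K * (norm \<xi>)\<^sup>2"
proof -
  have "\<exists>K\<ge>0. \<forall>\<xi>. norm (ycomp \<xi> l) \<le> norm \<xi> * K" if "l < CARD('n)" for l
    using bounded_linear.nonneg_bounded[OF bounded_linear_ycomp[OF that]] by blast
  then obtain K where K: "\<And>l \<xi>. l < CARD('n) \<Longrightarrow> norm (ycomp \<xi> l) \<le> norm \<xi> * K l" by metis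
  have "Nsq \<xi> \<le> (\<Sum>l<CARD('n). (K l)\<^sup>2) * (norm \<xi>)\<^sup>2" for \<xi>
    unfolding Nsq_def sum_distrib_right
  proof (rule sum_mono)
    fix l assume "l \<in> {..<CARD('n)}"
    then have "(norm (ycomp \<xi> l))\<^sup>2 \<le> (norm \<xi> * K l)\<^sup>2" using K by (intro power_mono) auto
    then show "(ycomp \<xi> l)\<^sup>2 \<le> (K l)\<^sup>2 * (norm \<xi>)\<^sup>2" by (simp add: power_mult_distrib mult.commute)
  qed
  moreover have "0 \<le> (\<Sum>l<CARD('n). (K l)\<^sup>2)" by (simp add: sum_nonneg)
  ultimately show ?thesis by blast
qed

definition history :: "(real \<Rightarrow> real^'n) \<Rightarrow> real" where
  "history u = (LINT \<tau>:{- max_delay S..0}|lebesgue. Nsq (u \<tau>))"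

text \<open>The weight vanishes at the oldest time and grows with slope 1, so the derivative along a
  trajectory is \<open>max_delay S * Nsq (x t)\<close> minus \<open>history\<close>: a little
  pointwise decay buys decay in the history.\<close>

definition Zfun :: "(real \<Rightarrow> real^'n) \<Rightarrow> real" where
  "Zfun u = (LINT \<tau>:{- max_delay S..0}|lebesgue. (\<tau> + max_delay S) * Nsq (u \<tau>))"

lemma history_nonneg: "0 \<le> history u"
  unfolding history_def by (rule set_integral_nonneg_real) (rule Nsq_nonneg)

lemma Zfun_bounds:
  assumes u: "continuous_on {- max_delay S..0} u"
  shows "0 \<le> Zfun u" "Zfun u \<le> max_delay S * history u"
proof -
  show "0 \<le> Zfun u" unfolding Zfun_def by (rule set_integral_nonneg_real) (simp add: Nsq_nonneg)
  have "Zfun u \<le> (LINT \<tau>:{- max_delay S..0}|lebesgue. max_delay S * Nsq (u \<tau>))"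
    unfolding Zfun_def
  proof (rule set_integral_mono)
    show "set_integrable lebesgue {- max_delay S..0} (\<lambda>\<tau>. (\<tau> + max_delay S) * Nsq (u \<tau>))"
      by (rule absolutely_integrable_continuous_real) (intro continuous_intros Nsq_continuous u)
    show "set_integrable lebesgue {- max_delay S..0} (\<lambda>\<tau>. max_delay S * Nsq (u \<tau>))"
      by (intro set_integrable_mult_right Nsq_integrable u)
    show "(\<tau> + max_delay S) * Nsq (u \<tau>) \<le> max_delay S * Nsq (u \<tau>)" if "\<tau> \<in> {- max_delay S..0}" for \<tau>
      by (rule mult_right_mono[OF _ Nsq_nonneg]) (use that in simp)
  qed
  then show "Zfun u \<le> max_delay S * history u" by (simp add: history_def)
qed

lemma integral_Nsq_cong:
  assumes "\<And>\<tau>. \<tau> \<in> {- max_delay S..0} \<Longrightarrow> u \<tau> = v \<tau>"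
  shows "history u = history v" "Zfun u = Zfun v"
  unfolding history_def Zfun_def using assms by (auto intro!: set_lebesgue_integral_cong)

lemma Zfun_trajectory:
  assumes x: "continuous_on {t0 - max_delay S..} x" and T: "t0 < T"
  shows "t0 < t \<Longrightarrow> t < T \<Longrightarrow> ((\<lambda>\<sigma>. Zfun (\<lambda>\<tau>. x (\<sigma> + \<tau>))) has_real_derivative
       max_delay S * Nsq (x t) - history (\<lambda>\<tau>. x (t + \<tau>))) (at t)"
    and "abs_cont_on t0 T (\<lambda>\<sigma>. Zfun (\<lambda>\<tau>. x (\<sigma> + \<tau>)))"
proof -
  let ?r = "max_delay S"
  obtain \<xi> B where xi: "continuous_on UNIV \<xi>" "\<And>t. norm (\<xi> t) \<le> B" "\<And>s. s \<in> {t0 - ?r..T} \<Longrightarrow> \<xi> s = x s"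
    using trajectory_extension[OF x T] by metis
  obtain K where K: "0 \<le> K" "\<And>\<xi>. Nsq \<xi> \<le> K * (norm \<xi>)\<^sup>2" using Nsq_le_norm by blast
  have b: "\<bar>Nsq (\<xi> t)\<bar> \<le> K * B\<^sup>2" for t
    using order_trans[OF K(2) mult_left_mono[OF power_mono[OF xi(2) norm_ge_zero] K(1)]] Nsq_nonneg by simp
  have ab: "- ?r < 0" using max_delay_pos by simp
  have w: "weak_derivative_on (- ?r) 0 (\<lambda>\<tau>. \<tau> + ?r) (\<lambda>_. 1)"
    by (rule weak_derivative_C1[OF ab]) (auto intro!: derivative_eq_intros)
  have f: "continuous_on {- ?r..0} (\<lambda>\<tau>. \<tau> + ?r)" by (intro continuous_intros)
  have g: "set_integrable lebesgue {- ?r..0} (\<lambda>_. 1 :: real)"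
    by (rule absolutely_integrable_continuous_real) (rule continuous_on_const)
  note m = ab f g w Nsq_continuous[OF xi(1)] b
  have e: "Zfun (\<lambda>\<tau>. x (\<sigma> + \<tau>)) = Zfun (\<lambda>\<tau>. \<xi> (\<sigma> + \<tau>))" "history (\<lambda>\<tau>. x (\<sigma> + \<tau>)) = history (\<lambda>\<tau>. \<xi> (\<sigma> + \<tau>))"
    if "\<sigma> \<in> {t0..T}" for \<sigma>
    by (rule integral_Nsq_cong(2), use that xi(3) in simp) (rule integral_Nsq_cong(1), use that xi(3) in simp)
  show "((\<lambda>\<sigma>. Zfun (\<lambda>\<tau>. x (\<sigma> + \<tau>))) has_real_derivative ?r * Nsq (x t) - history (\<lambda>\<tau>. x (t + \<tau>))) (at t)"
    if t: "t0 < t" "t < T"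
  proof -
    have tT: "t \<in> {t0..T}" using t by simp
    have "((\<lambda>\<sigma>. Zfun (\<lambda>\<tau>. \<xi> (\<sigma> + \<tau>))) has_real_derivative ?r * Nsq (x t) - history (\<lambda>\<tau>. x (t + \<tau>))) (at t)"
      unfolding Zfun_def e(2)[OF tT]
      by (rule DERIV_cong[OF DERIV_moving_integral[OF m]]) (use xi(3)[of t] t max_delay_pos in \<open>simp add: history_def\<close>)
    then show ?thesis
      by (rule has_field_derivative_transform_within_open[of _ _ _ "{t0<..<T}"]) (use t e in auto)
  qed
  have "abs_cont_on t0 T (\<lambda>\<sigma>. Zfun (\<lambda>\<tau>. \<xi> (\<sigma> + \<tau>)))"
    unfolding Zfun_def by (rule abs_cont_on_moving_integral[OF m])
  then show "abs_cont_on t0 T (\<lambda>\<sigma>. Zfun (\<lambda>\<tau>. x (\<sigma> + \<tau>)))"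
    by (rule abs_cont_on_cong) (rule e(1))
qed

text \<open>\<open>W\<close> lies between multiples of \<open>|y(t)|^2\<close> and of
  \<open>|y(t)|^2\<close> plus the history, and its derivative is at most a negative multiple of the
  latter; hence \<open>W\<close> times a slowly growing exponential is nonincreasing.\<close>

lemma exponential_decay:
  obtains C \<gamma> where "0 < C" "0 < \<gamma>" "\<And>\<psi> x T. state_trajectory S gain t0 \<psi> (\<lambda>_. 0) x \<Longrightarrow> t0 \<le> T \<Longrightarrow>
    Nsq (x T) \<le> C * (Nsq (x t0) + history (\<lambda>\<tau>. x (t0 + \<tau>))) * exp (- \<gamma> * (T - t0))"
proof -
  let ?r = "max_delay S"
  obtain \<epsilon> where eps: "0 < \<epsilon>" "\<And>u w. continuous_on {- ?r..0} u \<Longrightarrow>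
    Vdot u (state_rhs u w) - supply_rate J (output_rhs u w) w \<le> - \<epsilon> * Nsq (u 0)" using dissipation_rate by metis
  obtain C1 where C1: "0 < C1" "\<And>u. continuous_on {- ?r..0} u \<Longrightarrow> Nsq (u 0) \<le> C1 * Vfun u" using Vfun_lower by metis
  obtain C2 where C2: "0 < C2" "\<And>u. continuous_on {- ?r..0} u \<Longrightarrow> Vfun u \<le> C2 * (Nsq (u 0) + history u)"
    using Vfun_upper unfolding history_def by metis
  note rp = max_delay_pos
  \<comment> \<open>Half of the margin \<open>\<epsilon>\<close> pays for the term
    \<open>max_delay S * Nsq (x t)\<close> in the derivative of \<open>Zfun\<close>.\<close>
  define \<rho> where "\<rho> = \<epsilon> / (2 * ?r)"
  have rho: "0 < \<rho>" "\<rho> * ?r = \<epsilon> / 2" using rp eps(1) by (simp_all add: \<rho>_def)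
  define m where "m = min (\<epsilon> / 2) \<rho>"
  have m: "0 < m" "m \<le> \<epsilon> / 2" "m \<le> \<rho>" using eps(1) rho(1) by (auto simp: m_def)
  \<comment> \<open>\<open>\<epsilon> / 2\<close> is \<open>\<rho>\<close> times the maximal delay,
    the price of \<open>\<rho> * Zfun u\<close> in the upper bound.\<close>
  define C3 where "C3 = C2 + \<epsilon> / 2"
  have C3: "0 < C3" using C2(1) eps(1) by (simp add: C3_def)
  \<comment> \<open>The largest rate for which \<open>\<gamma> * W\<close> is still covered, through
    the upper bound, by the guaranteed decrease with factor \<open>m\<close>.\<close>
  define \<gamma> where "\<gamma> = m / C3"
  have gam: "0 < \<gamma>" "\<gamma> * C3 = m" using m C3 by (simp_all add: \<gamma>_def)
  define W where "W u = Vfun u + \<rho> * Zfun u" for u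
  have W_upper: "W u \<le> C3 * (Nsq (u 0) + history u)" if u: "continuous_on {- ?r..0} u" for u
  proof -
    have "\<rho> * Zfun u \<le> \<rho> * (?r * history u)" by (rule mult_left_mono[OF Zfun_bounds(2)[OF u]]) (use rho in simp)
    also have "\<dots> = \<epsilon> / 2 * history u" using rho(2) by (simp only: mult.assoc[symmetric])
    also have "\<dots> \<le> \<epsilon> / 2 * (Nsq (u 0) + history u)" using Nsq_nonneg eps(1) by simp
    finally show ?thesis using C2(2)[OF u] by (simp add: W_def C3_def distrib_right)
  qed
  have W_lower: "Nsq (u 0) \<le> C1 * W u" if u: "continuous_on {- ?r..0} u" for u
  proof -
    have "C1 * Vfun u \<le> C1 * W u" using Zfun_bounds(1)[OF u] rho C1(1) by (simp add: W_def)
    then show ?thesis using C1(2)[OF u] by linarith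
  qed
  show ?thesis
  proof (rule that[of "C1 * C3" \<gamma>])
    show "0 < C1 * C3" "0 < \<gamma>" using C1 C3 gam by auto
    fix \<psi> x T assume st: "state_trajectory S gain t0 \<psi> (\<lambda>_. 0) x" and T: "t0 \<le> T"
    note xc = trajectory_continuous[OF st]
    let ?u = "\<lambda>t \<tau>. x (t + \<tau>)"
    let ?F = "\<lambda>t. exp (\<gamma> * (t - t0)) * W (?u t)"
    have uc: "continuous_on {- ?r..0} (?u t)" if "t0 \<le> t" for t by (rule trajectory_segment_continuous[OF xc that])
    have "?F T \<le> ?F t0"
    proof (cases "t0 = T")
      case False
      with T have T': "t0 < T" by simp
      have ac: "abs_cont_on t0 T x" using st T' by (simp add: state_trajectory_def)
      show ?thesis
      proof (rule abs_cont_on_nonincreasing[OF _ T])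
        show "abs_cont_on t0 T ?F"
          unfolding W_def
          by (intro abs_cont_on_mult abs_cont_on_exp abs_cont_on_add abs_cont_on_cmult Vfun_trajectory(2)[OF xc T' ac] Zfun_trajectory(2)[OF xc T'])
        show "AE t in lebesgue. t0 < t \<and> t < T \<longrightarrow> (\<exists>D\<le>0. (?F has_real_derivative D) (at t))"
          using trajectory_derivative[OF st]
        proof eventually_elim
          case (elim t)
          show ?case
          proof
            assume t: "t0 < t \<and> t < T"
            then have d: "(x has_vector_derivative state_rhs (?u t) 0) (at t)" using elim by simp
            let ?DV = "Vdot (?u t) (state_rhs (?u t) 0)" and ?h = "history (?u t)"
            let ?DW = "?DV + \<rho> * (?r * Nsq (x t) - ?h)"
            have dW: "((\<lambda>t. W (?u t)) has_real_derivative ?DW) (at t)"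
              unfolding W_def using Vfun_trajectory(1)[OF xc _ d] Zfun_trajectory(1)[OF xc T', of t] t
              by (intro DERIV_add DERIV_cmult) auto
            have "((\<lambda>t. exp (\<gamma> * (t - t0))) has_real_derivative \<gamma> * exp (\<gamma> * (t - t0))) (at t)"
              by (auto intro!: derivative_eq_intros)
            from DERIV_mult[OF this dW]
            have "(?F has_real_derivative \<gamma> * exp (\<gamma> * (t - t0)) * W (?u t) + ?DW * exp (\<gamma> * (t - t0))) (at t)" .
            moreover have "\<gamma> * exp (\<gamma> * (t - t0)) * W (?u t) + ?DW * exp (\<gamma> * (t - t0)) \<le> 0"
            proof -
              have u: "continuous_on {- ?r..0} (?u t)" using uc t by simp
              have "?DV \<le> - \<epsilon> * Nsq (x t)"
                using eps(2)[OF u, of 0] supply_rate_zero[of "output_rhs (?u t) 0"] by simp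
              moreover have "\<rho> * (?r * Nsq (x t) - ?h) = \<epsilon> / 2 * Nsq (x t) - \<rho> * ?h"
                unfolding right_diff_distrib using rho(2) by (simp only: mult.assoc[symmetric])
              moreover have "m * Nsq (x t) \<le> \<epsilon> / 2 * Nsq (x t)" "m * ?h \<le> \<rho> * ?h"
                by (rule mult_right_mono[OF m(2) Nsq_nonneg], rule mult_right_mono[OF m(3) history_nonneg])
              ultimately have "?DW \<le> - (m * (Nsq (x t) + ?h))" by (simp add: distrib_left)
              moreover have "\<gamma> * W (?u t) \<le> m * (Nsq (x t) + ?h)"
                using mult_left_mono[OF W_upper[OF u] less_imp_le[OF gam(1)]] unfolding mult.assoc[symmetric] gam(2) by simp
              ultimately have "\<gamma> * W (?u t) + ?DW \<le> 0" by linarith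
              then have "exp (\<gamma> * (t - t0)) * (\<gamma> * W (?u t) + ?DW) \<le> 0" by (simp add: mult_nonneg_nonpos)
              then show ?thesis by (simp add: algebra_simps)
            qed
            ultimately show "\<exists>D\<le>0. (?F has_real_derivative D) (at t)" by blast
          qed
        qed
      qed
    qed simp
    then have "exp (\<gamma> * (T - t0)) * W (?u T) \<le> W (?u t0)" by simp
    then have "exp (- \<gamma> * (T - t0)) * (exp (\<gamma> * (T - t0)) * W (?u T)) \<le> exp (- \<gamma> * (T - t0)) * W (?u t0)"
      by (rule mult_left_mono) simp
    moreover have "exp (- \<gamma> * (T - t0)) * (exp (\<gamma> * (T - t0)) * W (?u T)) = W (?u T)"
      by (simp add: exp_minus mult.assoc[symmetric])
    ultimately have "W (?u T) \<le> W (?u t0) * exp (- \<gamma> * (T - t0))" by (simp only: mult.commute)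
    also have "\<dots> \<le> C3 * (Nsq (x t0) + history (?u t0)) * exp (- \<gamma> * (T - t0))"
      using W_upper[OF uc[OF order_refl]] by (intro mult_right_mono) auto
    finally have "C1 * W (?u T) \<le> C1 * (C3 * (Nsq (x t0) + history (?u t0)) * exp (- \<gamma> * (T - t0)))"
      using C1(1) by simp
    then show "Nsq (x T) \<le> C1 * C3 * (Nsq (x t0) + history (?u t0)) * exp (- \<gamma> * (T - t0))"
      using W_lower[OF uc[OF T]] by (simp add: mult.assoc)
  qed
qed

lemma exponentially_stable_closed_loop: "globally_exponentially_stable S gain t0"
proof -
  let ?r = "max_delay S"
  obtain C \<gamma> where C: "0 < C" "0 < \<gamma>" and decay: "\<And>\<psi> x T. state_trajectory S gain t0 \<psi> (\<lambda>_. 0) x \<Longrightarrow> t0 \<le> T \<Longrightarrow>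
    Nsq (x T) \<le> C * (Nsq (x t0) + history (\<lambda>\<tau>. x (t0 + \<tau>))) * exp (- \<gamma> * (T - t0))"
    using exponential_decay by metis
  obtain A where A: "0 \<le> A" "\<And>\<xi>. norm \<xi> \<le> A * sqrt (Nsq \<xi>)" using norm_le_sqrt_Nsq by blast
  obtain K where K: "0 \<le> K" "\<And>\<xi>. Nsq \<xi> \<le> K * (norm \<xi>)\<^sup>2" using Nsq_le_norm by blast
  \<comment> \<open>The summand 1 makes \<open>c\<close> positive even when \<open>A\<close> or
    \<open>K\<close> is zero.\<close>
  define c where "c = A * sqrt (C * (K * (1 + ?r))) + 1"
  have K': "0 \<le> C * (K * (1 + ?r))" using C K max_delay_pos by simp
  have c: "0 < c" "A * sqrt (C * (K * (1 + ?r))) \<le> c" using A K' by (auto simp: c_def intro: add_nonneg_pos)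
  show ?thesis unfolding globally_exponentially_stable_def
  \<comment> \<open>The rate is halved because \<open>\<gamma>\<close> is the rate for the squared
    norm.\<close>
  proof (rule exI[of _ c], rule conjI, rule c(1), rule exI[of _ "\<gamma> / 2"], intro conjI allI impI)
    show "0 < \<gamma> / 2" using C by simp
    fix \<psi> x T assume st: "state_trajectory S gain t0 \<psi> (\<lambda>_. 0) x" and T: "t0 \<le> T"
    let ?M = "SUP \<theta>\<in>{- ?r..0}. norm (\<psi> \<theta>)"
    have psi: "continuous_on {- ?r..0} \<psi>" "\<And>\<theta>. \<theta> \<in> {- ?r..0} \<Longrightarrow> x (t0 + \<theta>) = \<psi> \<theta>"
      using st by (auto simp: state_trajectory_def)
    have bdd: "bdd_above ((\<lambda>\<theta>. norm (\<psi> \<theta>)) ` {- ?r..0})"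
      by (intro bounded_imp_bdd_above compact_imp_bounded compact_continuous_image continuous_intros psi) simp
    have M: "norm (\<psi> \<theta>) \<le> ?M" if "\<theta> \<in> {- ?r..0}" for \<theta> by (rule cSUP_upper[OF that bdd])
    have M0: "0 \<le> ?M" using order_trans[OF norm_ge_zero M[of 0]] max_delay_pos by simp
    have N: "Nsq (x (t0 + \<theta>)) \<le> K * ?M\<^sup>2" if "\<theta> \<in> {- ?r..0}" for \<theta>
      using order_trans[OF K(2) mult_left_mono[OF power_mono[OF M[OF that] norm_ge_zero] K(1)]] psi(2)[OF that] by simp
    \<comment> \<open>At the initial time the whole window belongs to the initial function, so its
      sup norm controls the integral.\<close>
    have "history (\<lambda>\<tau>. x (t0 + \<tau>)) \<le> (LINT \<tau>:{- ?r..0}|lebesgue. K * ?M\<^sup>2)"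
      unfolding history_def
    proof (rule set_integral_mono)
      show "set_integrable lebesgue {- ?r..0} (\<lambda>\<tau>. Nsq (x (t0 + \<tau>)))"
        by (rule Nsq_integrable[OF trajectory_segment_continuous[OF trajectory_continuous[OF st] order_refl]])
      show "set_integrable lebesgue {- ?r..0} (\<lambda>\<tau>. K * ?M\<^sup>2)"
        by (rule absolutely_integrable_continuous_real) (rule continuous_on_const)
    qed (rule N)
    also have "\<dots> = ?r * (K * ?M\<^sup>2)" using max_delay_pos by (simp add: set_lebesgue_integral_def)
    finally have "Nsq (x t0) + history (\<lambda>\<tau>. x (t0 + \<tau>)) \<le> (K * (1 + ?r)) * ?M\<^sup>2"
      using N[of 0] max_delay_pos by (simp add: algebra_simps)
    then have "C * (Nsq (x t0) + history (\<lambda>\<tau>. x (t0 + \<tau>))) * exp (- \<gamma> * (T - t0)) \<le> C * ((K * (1 + ?r)) * ?M\<^sup>2) * exp (- \<gamma> * (T - t0))"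
      using C(1) by (intro mult_right_mono mult_left_mono) auto
    moreover have e: "exp (- \<gamma> * (T - t0)) = (exp (- (\<gamma> / 2) * (T - t0)))\<^sup>2"
      by (simp add: exp_double[symmetric])
    ultimately have "Nsq (x T) \<le> C * ((K * (1 + ?r)) * ?M\<^sup>2) * (exp (- (\<gamma> / 2) * (T - t0)))\<^sup>2"
      using decay[OF st T] unfolding e by linarith
    then have "Nsq (x T) \<le> (C * (K * (1 + ?r))) * (?M * exp (- (\<gamma> / 2) * (T - t0)))\<^sup>2"
      by (simp add: power_mult_distrib mult.assoc)
    from real_sqrt_le_mono[OF this] have "sqrt (Nsq (x T)) \<le> sqrt (C * (K * (1 + ?r))) * (?M * exp (- (\<gamma> / 2) * (T - t0)))"
      using M0 by (simp add: real_sqrt_mult abs_mult)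
    from mult_left_mono[OF this A(1)] have "norm (x T) \<le> A * sqrt (C * (K * (1 + ?r))) * (?M * exp (- (\<gamma> / 2) * (T - t0)))"
      using A(2)[of "x T"] by (simp add: mult.assoc)
    also have "\<dots> \<le> c * (?M * exp (- (\<gamma> / 2) * (T - t0)))"
      by (rule mult_right_mono[OF c(2)]) (use M0 in simp)
    finally show "norm (x T) \<le> c * ?M * exp (- (\<gamma> / 2) * (T - t0))" by (simp add: mult.assoc)
  qed
qed

end

theorem theorem2:
  fixes S :: "('n::finite, 'm::finite, 'p::finite, 'q::finite) delay_system"
    and G :: kernel_decomposition
    and J :: supply_params
    and \<alpha> :: "nat \<Rightarrow> real"
    and t0 :: real
  assumes "valid_system S"
    and "valid_decomposition S G"
    and "valid_supply CARD('m) CARD('q) J"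
  shows "(\<forall>U. feasible S G J \<alpha> U \<longrightarrow>
            invertible_mat (varX U) \<and>
            (let K = cart_of_mat (varV U * minv (varX U)) :: real^'n^'p
             in dissipative S K t0 (supply_rate J) \<and> globally_exponentially_stable S K t0)) \<and>
         (let n = real CARD('n); p = real CARD('p);
              \<nu> = real (num_delays S); d = real (total_dim S (dimf G))
          in real (num_unknowns CARD('n) CARD('p) (num_delays S) (total_dim S (dimf G)))
               = (0.5 * d\<^sup>2 + d + \<nu> + 1) * n\<^sup>2 + (0.5 * d + 1 + \<nu> + p) * n) \<and>
         (\<lambda>(d', n'). real (num_unknowns n' CARD('p) (num_delays S) d'))
           \<in> O[principal ({1..} \<times> {1..})](\<lambda>(d', n'). (real d')\<^sup>2 * (real n')\<^sup>2)"
proof (intro conjI allI impI)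
  fix U assume feasible: "feasible S G J \<alpha> U"
  interpret synthesis S G J \<alpha> U
    by unfold_locales (use assms feasible in auto)
  show "invertible_mat (varX U)" by (rule invertible_X)
  show "let K = cart_of_mat (varV U * minv (varX U)) :: real^'n^'p
      in dissipative S K t0 (supply_rate J) \<and> globally_exponentially_stable S K t0"
    using dissipative_closed_loop exponentially_stable_closed_loop by (simp add: gain_def)
next
  show "let n = real CARD('n); p = real CARD('p);
              \<nu> = real (num_delays S); d = real (total_dim S (dimf G))
          in real (num_unknowns CARD('n) CARD('p) (num_delays S) (total_dim S (dimf G)))
               = (0.5 * d\<^sup>2 + d + \<nu> + 1) * n\<^sup>2 + (0.5 * d + 1 + \<nu> + p) * n"
    unfolding Let_def num_unknowns_eq by (rule card_coords)
  show "(\<lambda>(d', n'). real (num_unknowns n' CARD('p) (num_delays S) d'))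
           \<in> O[principal ({1..} \<times> {1..})](\<lambda>(d', n'). (real d')\<^sup>2 * (real n')\<^sup>2)"
    by (rule num_unknowns_bigo)
qed

end
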